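(* Let $A$ be a right and left coherent ring. Then there is a duality of triangulated categories $$\phi:\ \mathbb{K}^{\mathrm b}(\mathrm{mod}\text{-}A^{\mathrm{op}})\longrightarrow \mathbb{K}^{\mathrm b}(\mathrm{mod}\text{-}A).$$
   Context: Modules are right modules; $A^{\mathrm{op}}$-modules are left $A$-modules. $\mathrm{mod}\text{-}A$ is the category of finitely presented $A$-modules, and $\mathbb{K}^{\mathrm b}(\mathcal{A})$ is the bounded homotopy category of complexes over an additive category $\mathcal{A}$. A duality is a contravariant functor that is an equivalence; a duality of triangulated categories $\mathcal{T}\to\mathcal{T}'$ is a triangle equivalence $\mathcal{T}\to(\mathcal{T}')^{\mathrm{op}}$. *)

theory Defs
  imports "HOL-Algebra.Module" "HOL-Library.FuncSet"
begin

section \<open>Modules over a not necessarily commutative ring\<close>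

definition op_ring :: "('a, 'r) ring_scheme \<Rightarrow> ('a, 'r) ring_scheme" where
  "op_ring A = A\<lparr>mult := (\<lambda>x y. y \<otimes>\<^bsub>A\<^esub> x)\<rparr>"

text \<open>
  The locale \<^locale>\<open>module\<close> of the library requires a commutative ring. Its record type is
  reused here for right modules over an arbitrary ring: \<open>a \<odot>\<^bsub>M\<^esub> x\<close> stands for \<open>x \<cdot> a\<close>,
  whence the order of the factors in \<open>rsmult_assoc\<close>. The fields \<^const>\<open>mult\<close> and \<^const>\<open>one\<close>
  of \<open>M\<close> play no role. Left \<open>A\<close>-modules are right modules over \<open>op_ring A\<close>.
\<close>

locale right_module = R?: ring R + M?: abelian_group M
  for R :: "('a, 'r) ring_scheme" (structure) and M :: "('a, 'u, 'x) module_scheme" (structure) +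
  assumes rsmult_closed:
      "\<lbrakk>a \<in> carrier R; x \<in> carrier M\<rbrakk> \<Longrightarrow> a \<odot>\<^bsub>M\<^esub> x \<in> carrier M"
    and rsmult_l_distr:
      "\<lbrakk>a \<in> carrier R; b \<in> carrier R; x \<in> carrier M\<rbrakk> \<Longrightarrow>
        (a \<oplus>\<^bsub>R\<^esub> b) \<odot>\<^bsub>M\<^esub> x = a \<odot>\<^bsub>M\<^esub> x \<oplus>\<^bsub>M\<^esub> b \<odot>\<^bsub>M\<^esub> x"
    and rsmult_r_distr:
      "\<lbrakk>a \<in> carrier R; x \<in> carrier M; y \<in> carrier M\<rbrakk> \<Longrightarrow>
        a \<odot>\<^bsub>M\<^esub> (x \<oplus>\<^bsub>M\<^esub> y) = a \<odot>\<^bsub>M\<^esub> x \<oplus>\<^bsub>M\<^esub> a \<odot>\<^bsub>M\<^esub> y"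
    and rsmult_assoc:
      "\<lbrakk>a \<in> carrier R; b \<in> carrier R; x \<in> carrier M\<rbrakk> \<Longrightarrow>
        (a \<otimes>\<^bsub>R\<^esub> b) \<odot>\<^bsub>M\<^esub> x = b \<odot>\<^bsub>M\<^esub> (a \<odot>\<^bsub>M\<^esub> x)"
    and rsmult_one:
      "x \<in> carrier M \<Longrightarrow> \<one>\<^bsub>R\<^esub> \<odot>\<^bsub>M\<^esub> x = x"

text \<open>Maps are extensional, so that equality of homomorphisms is equality on the carrier.\<close>

definition rmod_hom ::
  "('a, 'r) ring_scheme \<Rightarrow> ('a, 'u, 'x) module_scheme \<Rightarrow> ('a, 'v, 'y) module_scheme \<Rightarrow> ('u \<Rightarrow> 'v) set"
  where
  "rmod_hom A M N = {f \<in> carrier M \<rightarrow>\<^sub>E carrier N.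
     (\<forall>x\<in>carrier M. \<forall>y\<in>carrier M. f (x \<oplus>\<^bsub>M\<^esub> y) = f x \<oplus>\<^bsub>N\<^esub> f y) \<and>
     (\<forall>a\<in>carrier A. \<forall>x\<in>carrier M. f (a \<odot>\<^bsub>M\<^esub> x) = a \<odot>\<^bsub>N\<^esub> f x)}"

definition regular_rmod :: "('a, 'r) ring_scheme \<Rightarrow> ('a, 'a) module" where
  "regular_rmod A = \<lparr>carrier = carrier A, mult = mult A, one = one A,
     zero = \<zero>\<^bsub>A\<^esub>, add = add A, smult = (\<lambda>a x. x \<otimes>\<^bsub>A\<^esub> a)\<rparr>"

text \<open>The free right module \<open>A\<^sup>n\<close>.\<close>

definition free_rmod :: "('a, 'r) ring_scheme \<Rightarrow> nat \<Rightarrow> ('a, nat \<Rightarrow> 'a) module" where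
  "free_rmod A n = \<lparr>carrier = {..<n} \<rightarrow>\<^sub>E carrier A,
     mult = undefined, one = undefined,
     zero = (\<lambda>i\<in>{..<n}. \<zero>\<^bsub>A\<^esub>),
     add = (\<lambda>x y. \<lambda>i\<in>{..<n}. x i \<oplus>\<^bsub>A\<^esub> y i),
     smult = (\<lambda>a x. \<lambda>i\<in>{..<n}. x i \<otimes>\<^bsub>A\<^esub> a)\<rparr>"

definition fin_gen_rmod :: "('a, 'r) ring_scheme \<Rightarrow> ('a, 'u, 'x) module_scheme \<Rightarrow> bool" where
  "fin_gen_rmod A M \<longleftrightarrow> right_module A M \<and>
     (\<exists>n. \<exists>g\<in>rmod_hom A (free_rmod A n) M. g ` carrier (free_rmod A n) = carrier M)"

text \<open>Existence of an exact sequence \<open>A\<^sup>m \<rightarrow> A\<^sup>n \<rightarrow> M \<rightarrow> 0\<close>.\<close>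

definition fin_pres_rmod :: "('a, 'r) ring_scheme \<Rightarrow> ('a, 'u, 'x) module_scheme \<Rightarrow> bool" where
  "fin_pres_rmod A M \<longleftrightarrow> right_module A M \<and>
     (\<exists>m n. \<exists>f\<in>rmod_hom A (free_rmod A m) (free_rmod A n). \<exists>g\<in>rmod_hom A (free_rmod A n) M.
        f ` carrier (free_rmod A m) = {x \<in> carrier (free_rmod A n). g x = \<zero>\<^bsub>M\<^esub>} \<and>
        g ` carrier (free_rmod A n) = carrier M)"

text \<open>Every finitely generated right ideal is finitely presented.\<close>

definition right_coherent :: "('a, 'r) ring_scheme \<Rightarrow> bool" where
  "right_coherent A \<longleftrightarrow> ring A \<and>
     (\<forall>I. submodule I A (regular_rmod A) \<and> fin_gen_rmod A ((regular_rmod A)\<lparr>carrier := I\<rparr>)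
        \<longrightarrow> fin_pres_rmod A ((regular_rmod A)\<lparr>carrier := I\<rparr>))"

definition left_coherent :: "('a, 'r) ring_scheme \<Rightarrow> bool" where
  "left_coherent A \<longleftrightarrow> right_coherent (op_ring A)"


section \<open>Preadditive categories, functors and equivalences\<close>

text \<open>
  Arrow sets need not be disjoint, so composition, addition and zero take the objects involved as
  arguments: \<open>Comp C X Y Z g f\<close> is the composite of \<open>f : X \<rightarrow> Y\<close> and \<open>g : Y \<rightarrow> Z\<close>.
\<close>

record ('o, 'm) preadd_cat =
  Obj :: "'o set"
  Arr :: "'o \<Rightarrow> 'o \<Rightarrow> 'm set"
  Ident :: "'o \<Rightarrow> 'm"
  Comp :: "'o \<Rightarrow> 'o \<Rightarrow> 'o \<Rightarrow> 'm \<Rightarrow> 'm \<Rightarrow> 'm"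
  Plus :: "'o \<Rightarrow> 'o \<Rightarrow> 'm \<Rightarrow> 'm \<Rightarrow> 'm"
  Null :: "'o \<Rightarrow> 'o \<Rightarrow> 'm"

definition Neg :: "('o, 'm, 'x) preadd_cat_scheme \<Rightarrow> 'o \<Rightarrow> 'o \<Rightarrow> 'm \<Rightarrow> 'm" where
  "Neg C X Y f = (THE g. g \<in> Arr C X Y \<and> Plus C X Y f g = Null C X Y)"

definition is_iso :: "('o, 'm, 'x) preadd_cat_scheme \<Rightarrow> 'o \<Rightarrow> 'o \<Rightarrow> 'm \<Rightarrow> bool" where
  "is_iso C X Y f \<longleftrightarrow> f \<in> Arr C X Y \<and>
     (\<exists>g\<in>Arr C Y X. Comp C X Y X g f = Ident C X \<and> Comp C Y X Y f g = Ident C Y)"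

definition zero_object :: "('o, 'm, 'x) preadd_cat_scheme \<Rightarrow> 'o \<Rightarrow> bool" where
  "zero_object C X \<longleftrightarrow> X \<in> Obj C \<and> Ident C X = Null C X X"

definition is_biproduct ::
  "('o, 'm, 'x) preadd_cat_scheme \<Rightarrow> 'o \<Rightarrow> 'o \<Rightarrow> 'o \<Rightarrow> 'm \<Rightarrow> 'm \<Rightarrow> 'm \<Rightarrow> 'm \<Rightarrow> bool" where
  "is_biproduct C X Y Z i\<^sub>1 i\<^sub>2 p\<^sub>1 p\<^sub>2 \<longleftrightarrow>
     i\<^sub>1 \<in> Arr C X Z \<and> i\<^sub>2 \<in> Arr C Y Z \<and> p\<^sub>1 \<in> Arr C Z X \<and> p\<^sub>2 \<in> Arr C Z Y \<and>
     Comp C X Z X p\<^sub>1 i\<^sub>1 = Ident C X \<and> Comp C Y Z Y p\<^sub>2 i\<^sub>2 = Ident C Y \<and>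
     Comp C X Z Y p\<^sub>2 i\<^sub>1 = Null C X Y \<and> Comp C Y Z X p\<^sub>1 i\<^sub>2 = Null C Y X \<and>
     Plus C Z Z (Comp C Z X Z i\<^sub>1 p\<^sub>1) (Comp C Z Y Z i\<^sub>2 p\<^sub>2) = Ident C Z"

record ('o, 'm, 'p, 'q) cat_functor =
  FObj :: "'o \<Rightarrow> 'p"
  FArr :: "'o \<Rightarrow> 'o \<Rightarrow> 'm \<Rightarrow> 'q"

definition is_functor ::
  "('o, 'm, 'x) preadd_cat_scheme \<Rightarrow> ('p, 'q, 'y) preadd_cat_scheme \<Rightarrow>
   ('o, 'm, 'p, 'q) cat_functor \<Rightarrow> bool" where
  "is_functor C D F \<longleftrightarrow>
     (\<forall>X\<in>Obj C. FObj F X \<in> Obj D) \<and>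
     (\<forall>X\<in>Obj C. \<forall>Y\<in>Obj C. \<forall>f\<in>Arr C X Y. FArr F X Y f \<in> Arr D (FObj F X) (FObj F Y)) \<and>
     (\<forall>X\<in>Obj C. FArr F X X (Ident C X) = Ident D (FObj F X)) \<and>
     (\<forall>X\<in>Obj C. \<forall>Y\<in>Obj C. \<forall>Z\<in>Obj C. \<forall>f\<in>Arr C X Y. \<forall>g\<in>Arr C Y Z.
        FArr F X Z (Comp C X Y Z g f) =
        Comp D (FObj F X) (FObj F Y) (FObj F Z) (FArr F Y Z g) (FArr F X Y f))"

definition additive_functor ::
  "('o, 'm, 'x) preadd_cat_scheme \<Rightarrow> ('p, 'q, 'y) preadd_cat_scheme \<Rightarrow>
   ('o, 'm, 'p, 'q) cat_functor \<Rightarrow> bool" where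
  "additive_functor C D F \<longleftrightarrow> is_functor C D F \<and>
     (\<forall>X\<in>Obj C. \<forall>Y\<in>Obj C. \<forall>f\<in>Arr C X Y. \<forall>g\<in>Arr C X Y.
        FArr F X Y (Plus C X Y f g) =
        Plus D (FObj F X) (FObj F Y) (FArr F X Y f) (FArr F X Y g))"

definition id_functor :: "('o, 'm, 'o, 'm) cat_functor" where
  "id_functor = \<lparr>FObj = (\<lambda>X. X), FArr = (\<lambda>X Y f. f)\<rparr>"

definition comp_functor ::
  "('p, 'q, 's, 't) cat_functor \<Rightarrow> ('o, 'm, 'p, 'q) cat_functor \<Rightarrow> ('o, 'm, 's, 't) cat_functor" where
  "comp_functor G F = \<lparr>FObj = (\<lambda>X. FObj G (FObj F X)),
     FArr = (\<lambda>X Y f. FArr G (FObj F X) (FObj F Y) (FArr F X Y f))\<rparr>"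

definition natural_iso ::
  "('o, 'm, 'x) preadd_cat_scheme \<Rightarrow> ('p, 'q, 'y) preadd_cat_scheme \<Rightarrow>
   ('o, 'm, 'p, 'q) cat_functor \<Rightarrow> ('o, 'm, 'p, 'q) cat_functor \<Rightarrow> ('o \<Rightarrow> 'q) \<Rightarrow> bool" where
  "natural_iso C D F G \<eta> \<longleftrightarrow>
     (\<forall>X\<in>Obj C. is_iso D (FObj F X) (FObj G X) (\<eta> X)) \<and>
     (\<forall>X\<in>Obj C. \<forall>Y\<in>Obj C. \<forall>f\<in>Arr C X Y.
        Comp D (FObj F X) (FObj F Y) (FObj G Y) (\<eta> Y) (FArr F X Y f) =
        Comp D (FObj F X) (FObj G X) (FObj G Y) (FArr G X Y f) (\<eta> X))"

definition is_equivalence ::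
  "('o, 'm, 'x) preadd_cat_scheme \<Rightarrow> ('p, 'q, 'y) preadd_cat_scheme \<Rightarrow>
   ('o, 'm, 'p, 'q) cat_functor \<Rightarrow> bool" where
  "is_equivalence C D F \<longleftrightarrow> is_functor C D F \<and>
     (\<exists>G. is_functor D C G \<and>
        (\<exists>\<eta>. natural_iso C C id_functor (comp_functor G F) \<eta>) \<and>
        (\<exists>\<epsilon>. natural_iso D D (comp_functor F G) id_functor \<epsilon>))"


section \<open>Triangulated structure and triangle functors\<close>

text \<open>
  The data of a triangulated category: \<open>Shift\<close> and \<open>ShiftArr\<close> form the suspension automorphism,
  and \<open>(X, Y, Z, u, v, w) \<in> Dist T\<close> means that \<open>X \<rightarrow>u Y \<rightarrow>v Z \<rightarrow>w Shift X\<close> is distinguished.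
\<close>

record ('o, 'm) tri_cat = "('o, 'm) preadd_cat" +
  Shift :: "'o \<Rightarrow> 'o"
  ShiftArr :: "'o \<Rightarrow> 'o \<Rightarrow> 'm \<Rightarrow> 'm"
  Dist :: "('o \<times> 'o \<times> 'o \<times> 'm \<times> 'm \<times> 'm) set"

definition shift_functor :: "('o, 'm, 'x) tri_cat_scheme \<Rightarrow> ('o, 'm, 'o, 'm) cat_functor" where
  "shift_functor T = \<lparr>FObj = Shift T, FArr = ShiftArr T\<rparr>"

definition Unshift :: "('o, 'm, 'x) tri_cat_scheme \<Rightarrow> 'o \<Rightarrow> 'o" where
  "Unshift T = the_inv_into (Obj T) (Shift T)"

definition UnshiftArr :: "('o, 'm, 'x) tri_cat_scheme \<Rightarrow> 'o \<Rightarrow> 'o \<Rightarrow> 'm \<Rightarrow> 'm" where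
  "UnshiftArr T X Y =
     the_inv_into (Arr T (Unshift T X) (Unshift T Y)) (ShiftArr T (Unshift T X) (Unshift T Y))"

text \<open>
  The opposite triangulated category, with suspension the inverse of that of \<open>T\<close>. A distinguished
  triangle \<open>Z \<rightarrow>v Y \<rightarrow>u X \<rightarrow>w' Shift Z\<close> of \<open>T\<close> becomes \<open>X \<rightarrow> Y \<rightarrow> Z \<rightarrow> Unshift X\<close>, the last
  arrow being given by the arrow \<open>w\<close> of \<open>T\<close> from \<open>Unshift X\<close> to \<open>Z\<close> whose shift is \<open>w'\<close>. The
  convention with a sign at \<open>w\<close> gives an equivalent triangulated category: take the identity
  functor, with minus the identity as comparison with the suspension.
\<close>

definition op_tri :: "('o, 'm) tri_cat \<Rightarrow> ('o, 'm) tri_cat" where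
  "op_tri T = \<lparr>Obj = Obj T,
     Arr = (\<lambda>X Y. Arr T Y X),
     Ident = Ident T,
     Comp = (\<lambda>X Y Z g f. Comp T Z Y X f g),
     Plus = (\<lambda>X Y. Plus T Y X),
     Null = (\<lambda>X Y. Null T Y X),
     Shift = Unshift T,
     ShiftArr = (\<lambda>X Y. UnshiftArr T Y X),
     Dist = {(X, Y, Z, u, v, w). X \<in> Obj T \<and> Y \<in> Obj T \<and> Z \<in> Obj T \<and>
       w \<in> Arr T (Unshift T X) Z \<and>
       (Z, Y, X, v, u, ShiftArr T (Unshift T X) Z w) \<in> Dist T}\<rparr>"

definition triangle_functor ::
  "('o, 'm) tri_cat \<Rightarrow> ('p, 'q) tri_cat \<Rightarrow> ('o, 'm, 'p, 'q) cat_functor \<Rightarrow> ('o \<Rightarrow> 'q) \<Rightarrow> bool" where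
  "triangle_functor T T' F \<xi> \<longleftrightarrow> additive_functor T T' F \<and>
     natural_iso T T' (comp_functor F (shift_functor T)) (comp_functor (shift_functor T') F) \<xi> \<and>
     (\<forall>X Y Z u v w. (X, Y, Z, u, v, w) \<in> Dist T \<longrightarrow>
        (FObj F X, FObj F Y, FObj F Z, FArr F X Y u, FArr F Y Z v,
         Comp T' (FObj F Z) (FObj F (Shift T X)) (Shift T' (FObj F X)) (\<xi> X) (FArr F Z (Shift T X) w))
        \<in> Dist T')"

definition triangle_equivalence ::
  "('o, 'm) tri_cat \<Rightarrow> ('p, 'q) tri_cat \<Rightarrow> ('o, 'm, 'p, 'q) cat_functor \<Rightarrow> ('o \<Rightarrow> 'q) \<Rightarrow> bool" where
  "triangle_equivalence T T' F \<xi> \<longleftrightarrow> triangle_functor T T' F \<xi> \<and> is_equivalence T T' F"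

definition triangulated_duality ::
  "('o, 'm) tri_cat \<Rightarrow> ('p, 'q) tri_cat \<Rightarrow> ('o, 'm, 'p, 'q) cat_functor \<Rightarrow> bool" where
  "triangulated_duality T T' F \<longleftrightarrow> (\<exists>\<xi>. triangle_equivalence T (op_tri T') F \<xi>)"


section \<open>The bounded homotopy category\<close>

record ('o, 'm) cochain =
  Ob :: "int \<Rightarrow> 'o"
  Df :: "int \<Rightarrow> 'm"

definition bounded_complexes :: "('o, 'm, 'x) preadd_cat_scheme \<Rightarrow> ('o, 'm) cochain set" where
  "bounded_complexes C = {X.
     (\<forall>n. Ob X n \<in> Obj C) \<and>
     (\<forall>n. Df X n \<in> Arr C (Ob X n) (Ob X (n + 1))) \<and>
     (\<forall>n. Comp C (Ob X n) (Ob X (n + 1)) (Ob X (n + 2)) (Df X (n + 1)) (Df X n) =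
        Null C (Ob X n) (Ob X (n + 2))) \<and>
     (\<exists>N. \<forall>n. \<bar>n\<bar> > N \<longrightarrow> zero_object C (Ob X n))}"

definition chain_maps ::
  "('o, 'm, 'x) preadd_cat_scheme \<Rightarrow> ('o, 'm) cochain \<Rightarrow> ('o, 'm) cochain \<Rightarrow> (int \<Rightarrow> 'm) set" where
  "chain_maps C X Y = {f. \<forall>n. f n \<in> Arr C (Ob X n) (Ob Y n) \<and>
     Comp C (Ob X n) (Ob X (n + 1)) (Ob Y (n + 1)) (f (n + 1)) (Df X n) =
     Comp C (Ob X n) (Ob Y n) (Ob Y (n + 1)) (Df Y n) (f n)}"

text \<open>\<open>f\<^sup>n = g\<^sup>n + (d\<^sup>n\<^sup>-\<^sup>1 s\<^sup>n + s\<^sup>n\<^sup>+\<^sup>1 d\<^sup>n)\<close> with \<open>s\<^sup>n : X\<^sup>n \<rightarrow> Y\<^sup>n\<^sup>-\<^sup>1\<close>.\<close>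

definition homotopy_rel ::
  "('o, 'm, 'x) preadd_cat_scheme \<Rightarrow> ('o, 'm) cochain \<Rightarrow> ('o, 'm) cochain \<Rightarrow>
   ((int \<Rightarrow> 'm) \<times> (int \<Rightarrow> 'm)) set" where
  "homotopy_rel C X Y = {(f, g). f \<in> chain_maps C X Y \<and> g \<in> chain_maps C X Y \<and>
     (\<exists>s. (\<forall>n. s n \<in> Arr C (Ob X n) (Ob Y (n - 1))) \<and>
        (\<forall>n. f n = Plus C (Ob X n) (Ob Y n) (g n)
           (Plus C (Ob X n) (Ob Y n)
              (Comp C (Ob X n) (Ob Y (n - 1)) (Ob Y n) (Df Y (n - 1)) (s n))
              (Comp C (Ob X n) (Ob X (n + 1)) (Ob Y n) (s (n + 1)) (Df X n)))))}"

definition hclass ::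
  "('o, 'm, 'x) preadd_cat_scheme \<Rightarrow> ('o, 'm) cochain \<Rightarrow> ('o, 'm) cochain \<Rightarrow>
   (int \<Rightarrow> 'm) \<Rightarrow> (int \<Rightarrow> 'm) set" where
  "hclass C X Y f = homotopy_rel C X Y `` {f}"

definition shift_complex ::
  "('o, 'm, 'x) preadd_cat_scheme \<Rightarrow> ('o, 'm) cochain \<Rightarrow> ('o, 'm) cochain" where
  "shift_complex C X = \<lparr>Ob = (\<lambda>n. Ob X (n + 1)),
     Df = (\<lambda>n. Neg C (Ob X (n + 1)) (Ob X (n + 2)) (Df X (n + 1)))\<rparr>"

text \<open>The homotopy category without its distinguished triangles.\<close>

definition Kb_cat ::
  "('o, 'm, 'x) preadd_cat_scheme \<Rightarrow> (('o, 'm) cochain, (int \<Rightarrow> 'm) set) preadd_cat" where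
  "Kb_cat C = \<lparr>Obj = bounded_complexes C,
     Arr = (\<lambda>X Y. chain_maps C X Y // homotopy_rel C X Y),
     Ident = (\<lambda>X. hclass C X X (\<lambda>n. Ident C (Ob X n))),
     Comp = (\<lambda>X Y Z G F. \<Union>g\<in>G. \<Union>f\<in>F.
       hclass C X Z (\<lambda>n. Comp C (Ob X n) (Ob Y n) (Ob Z n) (g n) (f n))),
     Plus = (\<lambda>X Y F G. \<Union>f\<in>F. \<Union>g\<in>G.
       hclass C X Y (\<lambda>n. Plus C (Ob X n) (Ob Y n) (f n) (g n))),
     Null = (\<lambda>X Y. hclass C X Y (\<lambda>n. Null C (Ob X n) (Ob Y n)))\<rparr>"

definition Kb_shift_arr :: "(int \<Rightarrow> 'm) set \<Rightarrow> (int \<Rightarrow> 'm) set" where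
  "Kb_shift_arr F = (\<lambda>f n. f (n + 1)) ` F"

text \<open>
  \<open>Z\<close> is a mapping cone of \<open>f : X \<rightarrow> Y\<close>: in each degree \<open>Z\<^sup>n\<close> is a biproduct of \<open>X\<^sup>n\<^sup>+\<^sup>1\<close> and \<open>Y\<^sup>n\<close>,
  and its differential is the matrix with rows \<open>(-d, 0)\<close> and \<open>(f\<^sup>n\<^sup>+\<^sup>1, d)\<close>. No choice of
  biproducts is made.
\<close>

definition is_mapping_cone ::
  "('o, 'm, 'x) preadd_cat_scheme \<Rightarrow> ('o, 'm) cochain \<Rightarrow> ('o, 'm) cochain \<Rightarrow> (int \<Rightarrow> 'm) \<Rightarrow>
   ('o, 'm) cochain \<Rightarrow> (int \<Rightarrow> 'm) \<Rightarrow> (int \<Rightarrow> 'm) \<Rightarrow> (int \<Rightarrow> 'm) \<Rightarrow> (int \<Rightarrow> 'm) \<Rightarrow> bool" where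
  "is_mapping_cone C X Y f Z i\<^sub>1 i\<^sub>2 p\<^sub>1 p\<^sub>2 \<longleftrightarrow>
     (\<forall>n. is_biproduct C (Ob X (n + 1)) (Ob Y n) (Ob Z n) (i\<^sub>1 n) (i\<^sub>2 n) (p\<^sub>1 n) (p\<^sub>2 n)) \<and>
     (\<forall>n. Df Z n =
        Plus C (Ob Z n) (Ob Z (n + 1))
          (Comp C (Ob Z n) (Ob X (n + 2)) (Ob Z (n + 1)) (i\<^sub>1 (n + 1))
             (Comp C (Ob Z n) (Ob X (n + 1)) (Ob X (n + 2)) (Df (shift_complex C X) n) (p\<^sub>1 n)))
          (Comp C (Ob Z n) (Ob Y (n + 1)) (Ob Z (n + 1)) (i\<^sub>2 (n + 1))
             (Plus C (Ob Z n) (Ob Y (n + 1))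
                (Comp C (Ob Z n) (Ob X (n + 1)) (Ob Y (n + 1)) (f (n + 1)) (p\<^sub>1 n))
                (Comp C (Ob Z n) (Ob Y n) (Ob Y (n + 1)) (Df Y n) (p\<^sub>2 n)))))"

definition standard_triangles ::
  "('o, 'm, 'x) preadd_cat_scheme \<Rightarrow>
   (('o, 'm) cochain \<times> ('o, 'm) cochain \<times> ('o, 'm) cochain \<times>
    (int \<Rightarrow> 'm) set \<times> (int \<Rightarrow> 'm) set \<times> (int \<Rightarrow> 'm) set) set" where
  "standard_triangles C =
     {(X, Y, Z, hclass C X Y f, hclass C Y Z i\<^sub>2, hclass C Z (shift_complex C X) p\<^sub>1)
      | X Y Z f i\<^sub>1 i\<^sub>2 p\<^sub>1 p\<^sub>2.
        X \<in> bounded_complexes C \<and> Y \<in> bounded_complexes C \<and> Z \<in> bounded_complexes C \<and>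
        f \<in> chain_maps C X Y \<and> is_mapping_cone C X Y f Z i\<^sub>1 i\<^sub>2 p\<^sub>1 p\<^sub>2}"

text \<open>The triangles that are isomorphic to a standard one.\<close>

definition Kb_dist ::
  "('o, 'm, 'x) preadd_cat_scheme \<Rightarrow>
   (('o, 'm) cochain \<times> ('o, 'm) cochain \<times> ('o, 'm) cochain \<times>
    (int \<Rightarrow> 'm) set \<times> (int \<Rightarrow> 'm) set \<times> (int \<Rightarrow> 'm) set) set" where
  "Kb_dist C = (let K = Kb_cat C; S = shift_complex C in
     {(X, Y, Z, u, v, w). X \<in> Obj K \<and> Y \<in> Obj K \<and> Z \<in> Obj K \<and>
        u \<in> Arr K X Y \<and> v \<in> Arr K Y Z \<and> w \<in> Arr K Z (S X) \<and>
        (\<exists>X' Y' Z' u' v' w' a b c.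
           (X', Y', Z', u', v', w') \<in> standard_triangles C \<and>
           is_iso K X X' a \<and> is_iso K Y Y' b \<and> is_iso K Z Z' c \<and>
           Comp K X Y Y' b u = Comp K X X' Y' u' a \<and>
           Comp K Y Z Z' c v = Comp K Y Y' Z' v' b \<and>
           Comp K Z (S X) (S X') (Kb_shift_arr a) w = Comp K Z Z' (S X') w' c)})"

definition Kb ::
  "('o, 'm, 'x) preadd_cat_scheme \<Rightarrow> (('o, 'm) cochain, (int \<Rightarrow> 'm) set) tri_cat" where
  "Kb C = \<lparr>Obj = Obj (Kb_cat C), Arr = Arr (Kb_cat C), Ident = Ident (Kb_cat C),
     Comp = Comp (Kb_cat C), Plus = Plus (Kb_cat C), Null = Null (Kb_cat C),
     Shift = shift_complex C, ShiftArr = (\<lambda>X Y. Kb_shift_arr), Dist = Kb_dist C\<rparr>"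


section \<open>The category of finitely presented modules\<close>

text \<open>
  \<open>mod_cat A\<close> is the category of finitely presented right \<open>A\<close>-modules whose carrier is a set of
  elements of the type \<open>'u\<close>, which plays the role of a universe.
\<close>

definition mod_cat :: "('a, 'r) ring_scheme \<Rightarrow> (('a, 'u) module, 'u \<Rightarrow> 'u) preadd_cat" where
  "mod_cat A = \<lparr>Obj = {M. fin_pres_rmod A M},
     Arr = rmod_hom A,
     Ident = (\<lambda>M. \<lambda>x\<in>carrier M. x),
     Comp = (\<lambda>L M N g f. compose (carrier L) g f),
     Plus = (\<lambda>M N f g. \<lambda>x\<in>carrier M. f x \<oplus>\<^bsub>N\<^esub> g x),
     Null = (\<lambda>M N. \<lambda>x\<in>carrier M. \<zero>\<^bsub>N\<^esub>)\<rparr>"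

text \<open>
  The type \<open>'u\<close> is large enough if it contains a copy of the set of finite sequences of ring
  elements: by the lemma below, every finitely presented module, on whatever type, is then
  isomorphic to an object of \<open>mod_cat A\<close>. The type of lists over \<open>'a\<close> itself qualifies.
\<close>

definition large_universe :: "('a, 'r) ring_scheme \<Rightarrow> 'u itself \<Rightarrow> bool" where
  "large_universe A _ \<longleftrightarrow> (\<exists>\<iota> :: 'a list \<Rightarrow> 'u. inj_on \<iota> (lists (carrier A)))"

lemma fin_pres_rmod_in_large_universe:
  fixes A :: "('a, 'r) ring_scheme" and M :: "('a, 'v, 'x) module_scheme"
  assumes M: "fin_pres_rmod A M" and U: "large_universe A TYPE('u)"
  shows "\<exists>N \<in> Obj (mod_cat A :: (('a, 'u) module, 'u \<Rightarrow> 'u) preadd_cat).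
    \<exists>h \<in> rmod_hom A M N. bij_betw h (carrier M) (carrier N)"
proof -
  obtain \<iota> :: "'a list \<Rightarrow> 'u" where \<iota>: "inj_on \<iota> (lists (carrier A))"
    using U by (auto simp: large_universe_def)
  obtain m n f g where f: "f \<in> rmod_hom A (free_rmod A m) (free_rmod A n)"
    and g: "g \<in> rmod_hom A (free_rmod A n) M"
    and ex: "f ` carrier (free_rmod A m) = {x \<in> carrier (free_rmod A n). g x = \<zero>\<^bsub>M\<^esub>}"
    and sur: "g ` carrier (free_rmod A n) = carrier M"
    using M unfolding fin_pres_rmod_def by (elim conjE exE bexE) (rule that)
  interpret M: right_module A M using M by (simp add: fin_pres_rmod_def)
  have "\<exists>y. y \<in> carrier (free_rmod A n) \<and> g y = x" if "x \<in> carrier M" for x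
    using that sur by (metis imageE)
  then obtain s where s: "\<And>x. x \<in> carrier M \<Longrightarrow> s x \<in> carrier (free_rmod A n) \<and> g (s x) = x"
    by metis
  define j where "j x = \<iota> (map (s x) [0..<n])" for x
  have j: "inj_on j (carrier M)"
  proof (rule inj_onI)
    fix x y assume x: "x \<in> carrier M" and y: "y \<in> carrier M" and eq: "j x = j y"
    have E: "s x \<in> {..<n} \<rightarrow>\<^sub>E carrier A" "s y \<in> {..<n} \<rightarrow>\<^sub>E carrier A"
      using s x y by (auto simp: free_rmod_def)
    then have "map (s x) [0..<n] \<in> lists (carrier A)" "map (s y) [0..<n] \<in> lists (carrier A)"
      by (auto simp: PiE_iff)
    then have "map (s x) [0..<n] = map (s y) [0..<n]"
      using eq inj_onD[OF \<iota>] unfolding j_def by blast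
    then have "s x = s y"
      by (intro PiE_ext[OF E]) auto
    then show "x = y" using s x y by metis
  qed
  define k where "k = the_inv_into (carrier M) j"
  have kj: "k (j x) = x" if "x \<in> carrier M" for x
    using that j by (simp add: k_def the_inv_into_f_f)
  define N :: "('a, 'u) module" where "N = \<lparr>carrier = j ` carrier M, mult = undefined,
    one = undefined, zero = j \<zero>\<^bsub>M\<^esub>, add = (\<lambda>x y. j (k x \<oplus>\<^bsub>M\<^esub> k y)), smult = (\<lambda>a x. j (a \<odot>\<^bsub>M\<^esub> k x))\<rparr>"
  have N: "right_module A N"
  proof (intro right_module.intro right_module_axioms.intro abelian_groupI)
    show "ring A" by (rule M.R.ring_axioms)
    fix x assume "x \<in> carrier N"
    then obtain x' where x': "x' \<in> carrier M" "x = j x'" by (auto simp: N_def)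
    show "\<exists>y\<in>carrier N. y \<oplus>\<^bsub>N\<^esub> x = \<zero>\<^bsub>N\<^esub>"
      by (rule bexI[of _ "j (\<ominus>\<^bsub>M\<^esub> x')"]) (use x' in \<open>simp_all add: N_def kj M.M.l_neg\<close>)
  next
    fix x y assume "x \<in> carrier N" "y \<in> carrier N"
    then show "x \<oplus>\<^bsub>N\<^esub> y = y \<oplus>\<^bsub>N\<^esub> x" by (auto simp: N_def kj M.M.a_comm)
  next
    fix x y z assume "x \<in> carrier N" "y \<in> carrier N" "z \<in> carrier N"
    then show "x \<oplus>\<^bsub>N\<^esub> y \<oplus>\<^bsub>N\<^esub> z = x \<oplus>\<^bsub>N\<^esub> (y \<oplus>\<^bsub>N\<^esub> z)"
      by (auto simp: N_def kj M.M.a_assoc)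
  qed (auto simp: N_def kj M.rsmult_closed M.rsmult_l_distr M.rsmult_r_distr M.rsmult_assoc
      M.rsmult_one)
  define h where "h = (\<lambda>x\<in>carrier M. j x)"
  have h: "h \<in> rmod_hom A M N"
    by (auto simp: rmod_hom_def h_def N_def kj M.rsmult_closed)
  have bij: "bij_betw h (carrier M) (carrier N)"
    using j by (auto simp: bij_betw_def h_def N_def inj_on_def)
  define g' where "g' = compose (carrier (free_rmod A n)) h g"
  have fadd: "x \<oplus>\<^bsub>free_rmod A n\<^esub> y \<in> carrier (free_rmod A n)"
    if "x \<in> carrier (free_rmod A n)" "y \<in> carrier (free_rmod A n)" for x y
    using that by (auto simp: free_rmod_def)
  have fsm: "a \<odot>\<^bsub>free_rmod A n\<^esub> x \<in> carrier (free_rmod A n)"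
    if "a \<in> carrier A" "x \<in> carrier (free_rmod A n)" for x a
    using that by (auto simp: free_rmod_def)
  have gc: "g x \<in> carrier M" if "x \<in> carrier (free_rmod A n)" for x
    using sur that by blast
  have g': "g' \<in> rmod_hom A (free_rmod A n) N"
    using g h fadd fsm gc unfolding rmod_hom_def g'_def
    by (auto simp: compose_def)
  have sur': "g' ` carrier (free_rmod A n) = carrier N"
    using sur bij_betw_imp_surj_on[OF bij] unfolding g'_def
    by (simp add: image_image[symmetric, of h g] compose_def cong: image_cong_simp)
  have "h x = \<zero>\<^bsub>N\<^esub> \<longleftrightarrow> x = \<zero>\<^bsub>M\<^esub>" if "x \<in> carrier M" for x
    using that j by (auto simp: h_def N_def inj_on_def)
  then have ex': "f ` carrier (free_rmod A m) = {x \<in> carrier (free_rmod A n). g' x = \<zero>\<^bsub>N\<^esub>}"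
    using ex gc by (auto simp: g'_def compose_def)
  have "fin_pres_rmod A N"
    unfolding fin_pres_rmod_def
    by (rule conjI[OF N], rule exI[of _ m], rule exI[of _ n], rule bexI[OF _ f], rule bexI[OF _ g'],
        rule conjI[OF ex' sur'])
  then show ?thesis
    using h bij by (auto simp: mod_cat_def)
qed

end

theory Submission
  imports Defs
begin

text \<open>
  In Adelman's free abelian category over the finitely generated free right modules over
  \<open>R = A\<^sup>o\<^sup>p\<close>, the diagrams \<open>R\<^sup>m \<rightarrow> R\<^sup>n \<rightarrow> 0\<close> are injective and form a copy of
  \<open>mod-A\<^sup>o\<^sup>p\<close>, a module being sent to its presentation; by transposition of presentations, the diagrams
  \<open>0 \<rightarrow> R\<^sup>p \<rightarrow> R\<^sup>q\<close> are projective and form a copy of the opposite of \<open>mod-A\<close>. The exact sequence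
  \<open>0 \<rightarrow> (0 \<rightarrow> R\<^sup>m \<rightarrow> R\<^sup>n) \<rightarrow> R\<^sup>m \<rightarrow> R\<^sup>n \<rightarrow> (R\<^sup>m \<rightarrow> R\<^sup>n \<rightarrow> 0) \<rightarrow> 0\<close> resolves the objects of each kind by
  those of the other kind. So every bounded complex \<open>X\<close> of injectives of this kind receives a
  quasi-isomorphism \<open>e : Y \<rightarrow> X\<close> from a bounded complex of projectives and vice versa, and \<open>\<phi> X = Y\<close>
  is the duality. Derived categories are avoided by working with the homotopy commutative squares between such
  maps \<open>e\<close>.
\<close>

section \<open>Preadditive categories\<close>

text \<open>So transposition is no functor between the module categories. In Adelman's category,
  however, the transposed diagram depends contravariantly on the module alone, and the four-term
  sequence bounds the length of the resolutions by two, so that bounded complexes are resolved by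
  bounded ones. Three obstacles shape the proof. A HOL type cannot depend on a category, so hom
  groups are not types and ring arithmetic does not apply to them; all arrows are therefore
  represented in one ring of endomorphisms. Neither the lift of a module map to presentations nor
  the lift of a chain map to resolutions is unique, so functors are obtained from relations that are
  total and single-valued up to null maps. The suspension negates differentials and runs backwards
  on the dual side, which is why it is kept explicit as conjugation by invertible elements of degree
  -1.\<close>

type_synonym 'a gr = "int \<Rightarrow> 'a"

text \<open>Negation is not a field of the record: \<open>Neg\<close> picks it by a definite
  description. Hence \<open>inverse_ex\<close> asks for mere existence, and cancellation supplies
  the uniqueness that the description needs.\<close>

locale precat =
  fixes C :: "('o, 'm) preadd_cat"
  assumes Ident_in: "X \<in> Obj C \<Longrightarrow> Ident C X \<in> Arr C X X"
    and Comp_in: "\<lbrakk>X \<in> Obj C; Y \<in> Obj C; Z \<in> Obj C; f \<in> Arr C X Y; g \<in> Arr C Y Z\<rbrakk>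
      \<Longrightarrow> Comp C X Y Z g f \<in> Arr C X Z"
    and Comp_assoc: "\<lbrakk>W \<in> Obj C; X \<in> Obj C; Y \<in> Obj C; Z \<in> Obj C;
        f \<in> Arr C W X; g \<in> Arr C X Y; h \<in> Arr C Y Z\<rbrakk>
      \<Longrightarrow> Comp C W Y Z h (Comp C W X Y g f) = Comp C W X Z (Comp C X Y Z h g) f"
    and Ident_l: "\<lbrakk>X \<in> Obj C; Y \<in> Obj C; f \<in> Arr C X Y\<rbrakk> \<Longrightarrow> Comp C X Y Y (Ident C Y) f = f"
    and Ident_r: "\<lbrakk>X \<in> Obj C; Y \<in> Obj C; f \<in> Arr C X Y\<rbrakk> \<Longrightarrow> Comp C X X Y f (Ident C X) = f"
    and Plus_in: "\<lbrakk>X \<in> Obj C; Y \<in> Obj C; f \<in> Arr C X Y; g \<in> Arr C X Y\<rbrakk> \<Longrightarrow> Plus C X Y f g \<in> Arr C X Y"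
    and Null_in: "\<lbrakk>X \<in> Obj C; Y \<in> Obj C\<rbrakk> \<Longrightarrow> Null C X Y \<in> Arr C X Y"
    and Plus_assoc: "\<lbrakk>X \<in> Obj C; Y \<in> Obj C; f \<in> Arr C X Y; g \<in> Arr C X Y; h \<in> Arr C X Y\<rbrakk>
      \<Longrightarrow> Plus C X Y (Plus C X Y f g) h = Plus C X Y f (Plus C X Y g h)"
    and Plus_comm: "\<lbrakk>X \<in> Obj C; Y \<in> Obj C; f \<in> Arr C X Y; g \<in> Arr C X Y\<rbrakk>
      \<Longrightarrow> Plus C X Y f g = Plus C X Y g f"
    and Plus_Null: "\<lbrakk>X \<in> Obj C; Y \<in> Obj C; f \<in> Arr C X Y\<rbrakk> \<Longrightarrow> Plus C X Y (Null C X Y) f = f"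
    and inverse_ex: "\<lbrakk>X \<in> Obj C; Y \<in> Obj C; f \<in> Arr C X Y\<rbrakk>
      \<Longrightarrow> \<exists>g \<in> Arr C X Y. Plus C X Y f g = Null C X Y"
    and Comp_Plus_l: "\<lbrakk>X \<in> Obj C; Y \<in> Obj C; Z \<in> Obj C; f \<in> Arr C X Y; g \<in> Arr C Y Z; h \<in> Arr C Y Z\<rbrakk>
      \<Longrightarrow> Comp C X Y Z (Plus C Y Z g h) f = Plus C X Z (Comp C X Y Z g f) (Comp C X Y Z h f)"
    and Comp_Plus_r: "\<lbrakk>X \<in> Obj C; Y \<in> Obj C; Z \<in> Obj C; f \<in> Arr C X Y; h \<in> Arr C X Y; g \<in> Arr C Y Z\<rbrakk>
      \<Longrightarrow> Comp C X Y Z g (Plus C X Y f h) = Plus C X Z (Comp C X Y Z g f) (Comp C X Y Z g h)"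
begin

lemma Plus_cancel:
  assumes "X \<in> Obj C" "Y \<in> Obj C" "f \<in> Arr C X Y" "g \<in> Arr C X Y" "h \<in> Arr C X Y"
    and "Plus C X Y f g = Plus C X Y f h"
  shows "g = h"
proof -
  obtain k where k: "k \<in> Arr C X Y" "Plus C X Y f k = Null C X Y" using inverse_ex assms by blast
  have "Plus C X Y (Plus C X Y k f) g = Plus C X Y (Plus C X Y k f) h"
    using assms k by (simp add: Plus_assoc)
  then show ?thesis using assms k Plus_comm[of X Y f k] by (simp add: Plus_Null)
qed

lemma Neg_in_Plus:
  assumes "X \<in> Obj C" "Y \<in> Obj C" "f \<in> Arr C X Y"
  shows "Neg C X Y f \<in> Arr C X Y \<and> Plus C X Y f (Neg C X Y f) = Null C X Y"
  unfolding Neg_def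
proof (rule theI')
  show "\<exists>!g. g \<in> Arr C X Y \<and> Plus C X Y f g = Null C X Y"
    using inverse_ex[OF assms] Plus_cancel[OF assms] by metis
qed

lemmas Neg_in = Neg_in_Plus[THEN conjunct1]
lemmas Plus_Neg = Neg_in_Plus[THEN conjunct2]

lemma Neg_unique:
  "\<lbrakk>X \<in> Obj C; Y \<in> Obj C; f \<in> Arr C X Y; g \<in> Arr C X Y; Plus C X Y f g = Null C X Y\<rbrakk> \<Longrightarrow> Neg C X Y f = g"
  using Plus_cancel Neg_in Plus_Neg by metis

lemma Neg_Neg: "\<lbrakk>X \<in> Obj C; Y \<in> Obj C; f \<in> Arr C X Y\<rbrakk> \<Longrightarrow> Neg C X Y (Neg C X Y f) = f"
  using Neg_unique Neg_in Plus_Neg Plus_comm by metis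

lemma Comp_Null_l:
  assumes "X \<in> Obj C" "Y \<in> Obj C" "Z \<in> Obj C" "f \<in> Arr C X Y"
  shows "Comp C X Y Z (Null C Y Z) f = Null C X Z"
proof -
  let ?n = "Comp C X Y Z (Null C Y Z) f"
  have n: "?n \<in> Arr C X Z" using assms by (simp add: Comp_in Null_in)
  have "Plus C X Z ?n ?n = ?n"
    using assms Comp_Plus_l[of X Y Z f "Null C Y Z" "Null C Y Z"] by (simp add: Null_in Plus_Null)
  also have "\<dots> = Plus C X Z ?n (Null C X Z)"
    using n assms Plus_comm[of X Z ?n "Null C X Z"] by (simp add: Null_in Plus_Null)
  finally show ?thesis using Plus_cancel[OF assms(1,3) n n] Null_in assms by blast
qed

lemma Comp_Null_r:
  assumes "X \<in> Obj C" "Y \<in> Obj C" "Z \<in> Obj C" "g \<in> Arr C Y Z"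
  shows "Comp C X Y Z g (Null C X Y) = Null C X Z"
proof -
  let ?n = "Comp C X Y Z g (Null C X Y)"
  have n: "?n \<in> Arr C X Z" using assms by (simp add: Comp_in Null_in)
  have "Plus C X Z ?n ?n = ?n"
    using assms Comp_Plus_r[of X Y Z "Null C X Y" "Null C X Y" g] by (simp add: Null_in Plus_Null)
  also have "\<dots> = Plus C X Z ?n (Null C X Z)"
    using n assms Plus_comm[of X Z ?n "Null C X Z"] by (simp add: Null_in Plus_Null)
  finally show ?thesis using Plus_cancel[OF assms(1,3) n n] Null_in assms by blast
qed

end

text \<open>The object set is a parameter because the same axioms serve for the finitely presented
  modules, for the free modules, and for a mere pair of modules.\<close>

definition rmod_cat :: "('a, 'r) ring_scheme \<Rightarrow> ('a, 'u) module set \<Rightarrow> (('a, 'u) module, 'u \<Rightarrow> 'u) preadd_cat" where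
  "rmod_cat A S = (mod_cat A)\<lparr>Obj := S\<rparr>"

lemma mod_cat_eq: "mod_cat A = rmod_cat A {M. fin_pres_rmod A M}"
  by (simp add: rmod_cat_def mod_cat_def)

lemma rmod_cat_simps [simp]:
  "Obj (rmod_cat A S) = S" "Arr (rmod_cat A S) = rmod_hom A"
  "Ident (rmod_cat A S) M = (\<lambda>x\<in>carrier M. x)"
  "Comp (rmod_cat A S) L M N g f = compose (carrier L) g f"
  "Plus (rmod_cat A S) M N f g = (\<lambda>x\<in>carrier M. f x \<oplus>\<^bsub>N\<^esub> g x)"
  "Null (rmod_cat A S) M N = (\<lambda>x\<in>carrier M. \<zero>\<^bsub>N\<^esub>)"
  by (simp_all add: rmod_cat_def mod_cat_def)

lemma rmod_homI:
  assumes "\<And>x. x \<in> carrier M \<Longrightarrow> f x \<in> carrier N" "f \<in> extensional (carrier M)"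
    and "\<And>x y. \<lbrakk>x \<in> carrier M; y \<in> carrier M\<rbrakk> \<Longrightarrow> f (x \<oplus>\<^bsub>M\<^esub> y) = f x \<oplus>\<^bsub>N\<^esub> f y"
    and "\<And>a x. \<lbrakk>a \<in> carrier A; x \<in> carrier M\<rbrakk> \<Longrightarrow> f (a \<odot>\<^bsub>M\<^esub> x) = a \<odot>\<^bsub>N\<^esub> f x"
  shows "f \<in> rmod_hom A M N"
  using assms by (auto simp: rmod_hom_def PiE_def)

lemma rmod_homD:
  assumes "f \<in> rmod_hom A M N"
  shows "x \<in> carrier M \<Longrightarrow> f x \<in> carrier N" "f \<in> extensional (carrier M)"
    and "\<lbrakk>x \<in> carrier M; y \<in> carrier M\<rbrakk> \<Longrightarrow> f (x \<oplus>\<^bsub>M\<^esub> y) = f x \<oplus>\<^bsub>N\<^esub> f y"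
    and "\<lbrakk>a \<in> carrier A; x \<in> carrier M\<rbrakk> \<Longrightarrow> f (a \<odot>\<^bsub>M\<^esub> x) = a \<odot>\<^bsub>N\<^esub> f x"
  using assms by (auto simp: rmod_hom_def PiE_def)

lemma rmod_hom_compose:
  assumes "right_module A L" "f \<in> rmod_hom A L M" "g \<in> rmod_hom A M N"
  shows "compose (carrier L) g f \<in> rmod_hom A L N"
proof -
  interpret L: right_module A L by (rule assms)
  show ?thesis
    by (rule rmod_homI)
      (use rmod_homD[OF assms(2)] rmod_homD[OF assms(3)] L.rsmult_closed in \<open>auto simp: compose_def\<close>)
qed

lemma precat_rmod_cat:
  assumes "\<And>M. M \<in> S \<Longrightarrow> right_module A M"
  shows "precat (rmod_cat A S)"
proof -
  have rm: "right_module A M" "abelian_group M" if "M \<in> S" for M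
    using assms[OF that] by (auto simp: right_module_def)
  show ?thesis
  proof
    fix X assume "X \<in> Obj (rmod_cat A S)"
    then interpret right_module A X using assms by simp
    show "Ident (rmod_cat A S) X \<in> Arr (rmod_cat A S) X X"
      by (auto intro!: rmod_homI simp: rsmult_closed)
  next
    fix X Y Z f g assume "X \<in> Obj (rmod_cat A S)" "f \<in> Arr (rmod_cat A S) X Y" "g \<in> Arr (rmod_cat A S) Y Z"
    then show "Comp (rmod_cat A S) X Y Z g f \<in> Arr (rmod_cat A S) X Z"
      using rmod_hom_compose[of A X] rm by simp
  next
    fix W X Y Z f g h assume "f \<in> Arr (rmod_cat A S) W X" "g \<in> Arr (rmod_cat A S) X Y" "h \<in> Arr (rmod_cat A S) Y Z"
    then show "Comp (rmod_cat A S) W Y Z h (Comp (rmod_cat A S) W X Y g f)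
      = Comp (rmod_cat A S) W X Z (Comp (rmod_cat A S) X Y Z h g) f"
      by (auto simp: compose_def fun_eq_iff rmod_homD)
  next
    fix X Y f assume "f \<in> Arr (rmod_cat A S) X Y"
    then show "Comp (rmod_cat A S) X Y Y (Ident (rmod_cat A S) Y) f = f"
      and "Comp (rmod_cat A S) X X Y f (Ident (rmod_cat A S) X) = f"
      using rmod_homD[of f A X Y] by (auto simp: compose_def fun_eq_iff extensional_def)
  next
    fix X Y f g assume "X \<in> Obj (rmod_cat A S)" "Y \<in> Obj (rmod_cat A S)" and
      f: "f \<in> Arr (rmod_cat A S) X Y" "g \<in> Arr (rmod_cat A S) X Y"
    then interpret X: right_module A X + Y: right_module A Y using assms by auto
    show "Plus (rmod_cat A S) X Y f g \<in> Arr (rmod_cat A S) X Y"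
      using f rmod_homD[of f A X Y] rmod_homD[of g A X Y]
      by (auto intro!: rmod_homI simp: X.rsmult_closed Y.rsmult_r_distr Y.M.add.m_ac)
    show "Plus (rmod_cat A S) X Y f g = Plus (rmod_cat A S) X Y g f"
      using f rmod_homD[of f A X Y] rmod_homD[of g A X Y] by (auto simp: fun_eq_iff Y.M.a_comm)
  next
    fix X Y assume "X \<in> Obj (rmod_cat A S)" "Y \<in> Obj (rmod_cat A S)"
    then interpret X: right_module A X + Y: right_module A Y using assms by auto
    have "a \<odot>\<^bsub>Y\<^esub> \<zero>\<^bsub>Y\<^esub> = \<zero>\<^bsub>Y\<^esub>" if "a \<in> carrier A" for a
      using Y.rsmult_r_distr[OF that, of "\<zero>\<^bsub>Y\<^esub>" "\<zero>\<^bsub>Y\<^esub>"] Y.rsmult_closed[OF that, of "\<zero>\<^bsub>Y\<^esub>"] by simp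
    then show "Null (rmod_cat A S) X Y \<in> Arr (rmod_cat A S) X Y"
      by (auto intro!: rmod_homI simp: X.rsmult_closed)
  next
    fix X Y f g h assume "Y \<in> Obj (rmod_cat A S)" and
      "f \<in> Arr (rmod_cat A S) X Y" "g \<in> Arr (rmod_cat A S) X Y" "h \<in> Arr (rmod_cat A S) X Y"
    then show "Plus (rmod_cat A S) X Y (Plus (rmod_cat A S) X Y f g) h
      = Plus (rmod_cat A S) X Y f (Plus (rmod_cat A S) X Y g h)"
      using rm by (auto simp: fun_eq_iff rmod_homD abelian_monoid.a_assoc[OF abelian_group.axioms(1)])
  next
    fix X Y f assume Y: "Y \<in> Obj (rmod_cat A S)" and f: "f \<in> Arr (rmod_cat A S) X Y"
    then show "Plus (rmod_cat A S) X Y (Null (rmod_cat A S) X Y) f = f"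
      using rm rmod_homD[of f A X Y] by (auto simp: fun_eq_iff abelian_monoid.l_zero[OF abelian_group.axioms(1)] extensional_def)
  next
    fix X Y f assume XY: "X \<in> Obj (rmod_cat A S)" "Y \<in> Obj (rmod_cat A S)" and f: "f \<in> Arr (rmod_cat A S) X Y"
    interpret X: right_module A X + Y: right_module A Y using XY assms by auto
    have sm: "a \<odot>\<^bsub>Y\<^esub> (\<ominus>\<^bsub>Y\<^esub> x) = \<ominus>\<^bsub>Y\<^esub> (a \<odot>\<^bsub>Y\<^esub> x)" if "a \<in> carrier A" "x \<in> carrier Y" for a x
    proof (rule sym, rule Y.M.minus_equality)
      have "a \<odot>\<^bsub>Y\<^esub> \<zero>\<^bsub>Y\<^esub> = \<zero>\<^bsub>Y\<^esub>"
        using Y.rsmult_r_distr[OF that(1), of "\<zero>\<^bsub>Y\<^esub>" "\<zero>\<^bsub>Y\<^esub>"] Y.rsmult_closed[OF that(1), of "\<zero>\<^bsub>Y\<^esub>"] by simp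
      then show "a \<odot>\<^bsub>Y\<^esub> (\<ominus>\<^bsub>Y\<^esub> x) \<oplus>\<^bsub>Y\<^esub> a \<odot>\<^bsub>Y\<^esub> x = \<zero>\<^bsub>Y\<^esub>"
        using that by (simp add: Y.rsmult_r_distr[symmetric] Y.M.l_neg)
    qed (use that in \<open>auto simp: Y.rsmult_closed\<close>)
    show "\<exists>g \<in> Arr (rmod_cat A S) X Y. Plus (rmod_cat A S) X Y f g = Null (rmod_cat A S) X Y"
    proof (rule bexI)
      show "Plus (rmod_cat A S) X Y f (\<lambda>x\<in>carrier X. \<ominus>\<^bsub>Y\<^esub> f x) = Null (rmod_cat A S) X Y"
        using f by (auto simp: fun_eq_iff Y.M.r_neg rmod_homD)
      show "(\<lambda>x\<in>carrier X. \<ominus>\<^bsub>Y\<^esub> f x) \<in> Arr (rmod_cat A S) X Y"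
        using f rmod_homD[of f A X Y] sm
        by (auto intro!: rmod_homI simp: X.rsmult_closed Y.M.minus_add Y.M.a_comm)
    qed
  next
    fix X Y Z f g h assume "Y \<in> Obj (rmod_cat A S)" "Z \<in> Obj (rmod_cat A S)" and
      "f \<in> Arr (rmod_cat A S) X Y" "g \<in> Arr (rmod_cat A S) Y Z" "h \<in> Arr (rmod_cat A S) Y Z"
    then show "Comp (rmod_cat A S) X Y Z (Plus (rmod_cat A S) Y Z g h) f
      = Plus (rmod_cat A S) X Z (Comp (rmod_cat A S) X Y Z g f) (Comp (rmod_cat A S) X Y Z h f)"
      by (auto simp: compose_def fun_eq_iff rmod_homD)
  next
    fix X Y Z f g h assume "Y \<in> Obj (rmod_cat A S)" and
      "f \<in> Arr (rmod_cat A S) X Y" "h \<in> Arr (rmod_cat A S) X Y" "g \<in> Arr (rmod_cat A S) Y Z"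
    then show "Comp (rmod_cat A S) X Y Z g (Plus (rmod_cat A S) X Y f h)
      = Plus (rmod_cat A S) X Z (Comp (rmod_cat A S) X Y Z g f) (Comp (rmod_cat A S) X Y Z g h)"
      by (auto simp: compose_def fun_eq_iff rmod_homD)
  qed
qed

section \<open>A ring containing all graded families of arrows\<close>

text \<open>
  The product of all arrow sets of all preadditive categories on the given types. Other than a
  single arrow set, it is a type of class \<open>ab_group_add\<close>; so its additive endomorphisms form a
  type of class \<open>ring\<close>, in which the families of arrows of a given degree are represented
  faithfully. Identities between such families are thus proved by ring arithmetic.
\<close>

definition fam_valid :: "('o, 'm) preadd_cat \<Rightarrow> 'o \<Rightarrow> 'o gr \<Rightarrow> int \<Rightarrow> bool" where
  "fam_valid C W X n \<longleftrightarrow> precat C \<and> W \<in> Obj C \<and> X n \<in> Obj C"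

text \<open>An element gives, for every \<open>C\<close>, every test object \<open>W\<close> and
  every graded object \<open>X\<close>, a family of arrows from \<open>W\<close> to the components
  of \<open>X\<close>. Graded maps act by postcomposition, and the test object allows
  \<open>gop_inject\<close> to recover a map from its action, as in Yoneda's lemma. The fixed value
  at invalid arguments keeps the neutral element unique.\<close>

typedef ('o, 'm) fam =
  "{h :: ('o, 'm) preadd_cat \<Rightarrow> 'o \<Rightarrow> 'o gr \<Rightarrow> int \<Rightarrow> 'm.
     \<forall>C W X n. if fam_valid C W X n then h C W X n \<in> Arr C W (X n) else h C W X n = undefined}"
  by (rule exI[of _ "\<lambda>C W X n. if fam_valid C W X n then Null C W (X n) else undefined"])
    (auto simp: fam_valid_def precat.Null_in)

setup_lifting type_definition_fam

instantiation fam :: (type, type) ab_group_add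
begin

lift_definition zero_fam :: "('a, 'b) fam" is
  "\<lambda>C W X n. if fam_valid C W X n then Null C W (X n) else undefined"
  by (auto simp: fam_valid_def precat.Null_in)

lift_definition plus_fam :: "('a, 'b) fam \<Rightarrow> ('a, 'b) fam \<Rightarrow> ('a, 'b) fam" is
  "\<lambda>f g C W X n. if fam_valid C W X n then Plus C W (X n) (f C W X n) (g C W X n) else undefined"
  by (auto simp: fam_valid_def precat.Plus_in)

lift_definition uminus_fam :: "('a, 'b) fam \<Rightarrow> ('a, 'b) fam" is
  "\<lambda>f C W X n. if fam_valid C W X n then Neg C W (X n) (f C W X n) else undefined"
  by (auto simp: fam_valid_def precat.Neg_in)

definition minus_fam :: "('a, 'b) fam \<Rightarrow> ('a, 'b) fam \<Rightarrow> ('a, 'b) fam" where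
  "minus_fam f g = f + - g"

instance
proof
  fix a b c :: "('a, 'b) fam"
  show "a + b + c = a + (b + c)"
    by transfer (auto simp: fun_eq_iff fam_valid_def precat.Plus_assoc)
  show "a + b = b + a"
    by transfer (simp add: fun_eq_iff fam_valid_def precat.Plus_comm)
  show "0 + a = a"
    by transfer (auto simp: fun_eq_iff fam_valid_def precat.Plus_Null)
  show "- a + a = 0"
    by transfer (simp add: fun_eq_iff fam_valid_def precat.Plus_Neg precat.Plus_comm precat.Neg_in)
  show "a - b = a + - b" by (simp add: minus_fam_def)
qed

end

typedef (overloaded) 'h endo = "{f :: 'h :: ab_group_add \<Rightarrow> 'h. \<forall>x y. f (x + y) = f x + f y}"
  by (rule exI[of _ id]) simp

setup_lifting type_definition_endo

text \<open>The class \<open>ring\<close> has no unit. Identities of graded objects will enter as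
  local idempotents \<open>gone X\<close>.\<close>

instantiation endo :: (ab_group_add) ring
begin

lift_definition zero_endo :: "'a endo" is "\<lambda>x. 0" by simp
lift_definition plus_endo :: "'a endo \<Rightarrow> 'a endo \<Rightarrow> 'a endo" is "\<lambda>f g x. f x + g x"
  by (simp add: algebra_simps)
lift_definition uminus_endo :: "'a endo \<Rightarrow> 'a endo" is "\<lambda>f x. - f x"
  by (simp add: algebra_simps)
lift_definition minus_endo :: "'a endo \<Rightarrow> 'a endo \<Rightarrow> 'a endo" is "\<lambda>f g x. f x - g x"
  by (simp add: algebra_simps)
lift_definition times_endo :: "'a endo \<Rightarrow> 'a endo \<Rightarrow> 'a endo" is "\<lambda>f g x. f (g x)"
  by simp

instance
  by standard (transfer, simp add: algebra_simps fun_eq_iff)+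

end

section \<open>Graded maps and their action on families\<close>

definition gmap :: "('o, 'm) preadd_cat \<Rightarrow> int \<Rightarrow> 'o gr \<Rightarrow> 'o gr \<Rightarrow> 'm gr set" where
  "gmap C k X Y = {f. \<forall>n. f n \<in> Arr C (X n) (Y (n + k))}"

definition gobj :: "('o, 'm) preadd_cat \<Rightarrow> 'o gr set" where
  "gobj C = {X. \<forall>n. X n \<in> Obj C}"

definition gcomp ::
  "('o, 'm) preadd_cat \<Rightarrow> int \<Rightarrow> int \<Rightarrow> 'o gr \<Rightarrow> 'o gr \<Rightarrow> 'o gr \<Rightarrow>
   'm gr \<Rightarrow> 'm gr \<Rightarrow> int \<Rightarrow> 'm" where
  "gcomp C k l X Y Z g f = (\<lambda>n. Comp C (X n) (Y (n + k)) (Z (n + k + l)) (g (n + k)) (f n))"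

definition gplus ::
  "('o, 'm) preadd_cat \<Rightarrow> int \<Rightarrow> 'o gr \<Rightarrow> 'o gr \<Rightarrow> 'm gr \<Rightarrow> 'm gr \<Rightarrow> int \<Rightarrow> 'm" where
  "gplus C k X Y f g = (\<lambda>n. Plus C (X n) (Y (n + k)) (f n) (g n))"

definition gnull ::
  "('o, 'm) preadd_cat \<Rightarrow> int \<Rightarrow> 'o gr \<Rightarrow> 'o gr \<Rightarrow> int \<Rightarrow> 'm" where
  "gnull C k X Y = (\<lambda>n. Null C (X n) (Y (n + k)))"

definition gneg ::
  "('o, 'm) preadd_cat \<Rightarrow> int \<Rightarrow> 'o gr \<Rightarrow> 'o gr \<Rightarrow> 'm gr \<Rightarrow> int \<Rightarrow> 'm" where
  "gneg C k X Y f = (\<lambda>n. Neg C (X n) (Y (n + k)) (f n))"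

definition gid :: "('o, 'm) preadd_cat \<Rightarrow> 'o gr \<Rightarrow> int \<Rightarrow> 'm" where
  "gid C X = (\<lambda>n. Ident C (X n))"

definition gproj :: "('o, 'm) preadd_cat \<Rightarrow> int \<Rightarrow> 'o gr \<Rightarrow> int \<Rightarrow> 'm" where
  "gproj C m X = (\<lambda>n. if n = m then Ident C (X n) else Null C (X n) (X n))"

text \<open>Modelled on matrix units: the result is supported on the category \<open>C\<close> and
  the graded object \<open>Y\<close>, and it depends only on the component of \<open>h\<close> at
  \<open>X\<close>. The product of two such operators is therefore the composite if the objects in
  the middle agree.\<close>

definition gact ::
  "('o, 'm) preadd_cat \<Rightarrow> int \<Rightarrow> 'o gr \<Rightarrow> 'o gr \<Rightarrow> 'm gr \<Rightarrow>
   (('o, 'm) preadd_cat \<Rightarrow> 'o \<Rightarrow> 'o gr \<Rightarrow> int \<Rightarrow> 'm) \<Rightarrow>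
   ('o, 'm) preadd_cat \<Rightarrow> 'o \<Rightarrow> 'o gr \<Rightarrow> int \<Rightarrow> 'm" where
  "gact C k X Y f h C' W Z n =
     (if fam_valid C' W Z n then
        if C' = C \<and> Z = Y then Comp C W (X (n - k)) (Y n) (f (n - k)) (h C W X (n - k))
        else Null C' W (Z n)
      else undefined)"

definition gop ::
  "('o, 'm) preadd_cat \<Rightarrow> int \<Rightarrow> 'o gr \<Rightarrow> 'o gr \<Rightarrow> 'm gr \<Rightarrow> ('o, 'm) fam endo" where
  "gop C k X Y f = Abs_endo (\<lambda>h. Abs_fam (gact C k X Y f (Rep_fam h)))"

context precat
begin

lemma gobjD: "X \<in> gobj C \<Longrightarrow> X n \<in> Obj C"
  by (simp add: gobj_def)

lemma gmapD: "f \<in> gmap C k X Y \<Longrightarrow> f n \<in> Arr C (X n) (Y (n + k))"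
  by (simp add: gmap_def)

lemma gmapD': "f \<in> gmap C k X Y \<Longrightarrow> f (n - k) \<in> Arr C (X (n - k)) (Y n)"
  using gmapD[of f k X Y "n - k"] by simp

lemma gmap_closed:
  assumes "X \<in> gobj C" "Y \<in> gobj C"
  shows "gnull C k X Y \<in> gmap C k X Y" "gid C X \<in> gmap C 0 X X" "gproj C m X \<in> gmap C 0 X X"
    and "f \<in> gmap C k X Y \<Longrightarrow> gneg C k X Y f \<in> gmap C k X Y"
    and "\<lbrakk>f \<in> gmap C k X Y; g \<in> gmap C k X Y\<rbrakk> \<Longrightarrow> gplus C k X Y f g \<in> gmap C k X Y"
  using assms by (auto simp: gmap_def gobj_def gnull_def gneg_def gplus_def gid_def gproj_def
      Null_in Neg_in Plus_in Ident_in)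

lemma gcomp_closed:
  assumes "X \<in> gobj C" "Y \<in> gobj C" "Z \<in> gobj C" "f \<in> gmap C k X Y" "g \<in> gmap C l Y Z"
  shows "gcomp C k l X Y Z g f \<in> gmap C (k + l) X Z"
proof -
  have "g (n + k) \<in> Arr C (Y (n + k)) (Z (n + (k + l)))" for n
    using assms(5) by (simp add: gmap_def add.assoc[symmetric])
  then show ?thesis
    using assms Comp_in by (simp add: gmap_def gcomp_def gobj_def add.assoc)
qed

lemma fam_in:
  assumes "W \<in> Obj C" "X n \<in> Obj C"
  shows "Rep_fam h C W X n \<in> Arr C W (X n)"
  using Rep_fam[of h] assms precat_axioms by (auto simp: fam_valid_def split: if_splits)

lemma fam_in':
  assumes "W \<in> Obj C" "X \<in> gobj C"
  shows "Rep_fam h C W X n \<in> Arr C W (X n)"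
  using fam_in assms gobjD by blast

lemma gact_in:
  assumes "X \<in> gobj C" "Y \<in> gobj C" "f \<in> gmap C k X Y"
  shows "Rep_fam (Abs_fam (gact C k X Y f (Rep_fam h))) = gact C k X Y f (Rep_fam h)"
proof (rule Abs_fam_inverse, safe)
  fix C' W Z n
  show "if fam_valid C' W Z n then gact C k X Y f (Rep_fam h) C' W Z n \<in> Arr C' W (Z n)
    else gact C k X Y f (Rep_fam h) C' W Z n = undefined"
    using assms gobjD[OF assms(1)] gobjD[OF assms(2)] gmapD'[OF assms(3)] fam_in'[OF _ assms(1)]
    by (auto simp: gact_def fam_valid_def precat.Null_in Comp_in)
qed

lemma gact_add:
  assumes "X \<in> gobj C" "Y \<in> gobj C" "f \<in> gmap C k X Y"
  shows "Abs_fam (gact C k X Y f (Rep_fam (g + h)))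
    = Abs_fam (gact C k X Y f (Rep_fam g)) + Abs_fam (gact C k X Y f (Rep_fam h))"
proof (rule iffD1[OF Rep_fam_inject], rule ext, rule ext, rule ext, rule ext)
  fix C' W Z n
  show "Rep_fam (Abs_fam (gact C k X Y f (Rep_fam (g + h)))) C' W Z n
    = Rep_fam (Abs_fam (gact C k X Y f (Rep_fam g)) + Abs_fam (gact C k X Y f (Rep_fam h))) C' W Z n"
    using assms gobjD[OF assms(1)] gobjD[OF assms(2)] gmapD'[OF assms(3)] fam_in'[OF _ assms(1)]
    unfolding gact_in[OF assms]
    by (simp only: plus_fam.rep_eq gact_in[OF assms])
      (auto simp: gact_def fam_valid_def precat.Plus_Null precat.Null_in
        Comp_Plus_r precat_axioms)
qed

lemma gop_apply:
  assumes "X \<in> gobj C" "Y \<in> gobj C" "f \<in> gmap C k X Y"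
  shows "Rep_fam (Rep_endo (gop C k X Y f) h) = gact C k X Y f (Rep_fam h)"
  unfolding gop_def by (subst Abs_endo_inverse) (simp_all add: gact_add assms gact_in)

lemma endo_eqI:
  fixes a b :: "('o, 'm) fam endo"
  assumes "\<And>h C' W Z n. Rep_fam (Rep_endo a h) C' W Z n = Rep_fam (Rep_endo b h) C' W Z n"
  shows "a = b"
  by (metis Rep_endo_inject Rep_fam_inject assms ext)

text \<open>Yoneda's lemma: on the family that is the identity at the test object \<open>X n\<close>
  in degree \<open>n\<close> of \<open>X\<close> and zero elsewhere, the operator returns
  \<open>f n\<close>.\<close>

lemma gop_inject:
  assumes X: "X \<in> gobj C" and Y: "Y \<in> gobj C" and f: "f \<in> gmap C k X Y" and g: "g \<in> gmap C k X Y"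
    and eq: "gop C k X Y f = gop C k X Y g"
  shows "f = g"
proof
  fix n
  define h where "h = (\<lambda>C' W Z m. if fam_valid C' W Z m then
      if C' = C \<and> W = X n \<and> Z = X \<and> m = n then Ident C (X n) else Null C' W (Z m) else undefined)"
  have h: "Rep_fam (Abs_fam h) = h"
    by (rule Abs_fam_inverse)
      (auto simp: h_def fam_valid_def precat.Null_in Ident_in gobjD X)
  have "Rep_fam (Rep_endo (gop C k X Y f) (Abs_fam h)) C (X n) Y (n + k) = f n"
    using gmapD[OF f] by (simp add: gop_apply X Y f h gact_def fam_valid_def precat_axioms gobjD)
      (simp add: h_def fam_valid_def precat_axioms gobjD X Y Ident_r)
  moreover have "Rep_fam (Rep_endo (gop C k X Y g) (Abs_fam h)) C (X n) Y (n + k) = g n"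
    using gmapD[OF g] by (simp add: gop_apply X Y g h gact_def fam_valid_def precat_axioms gobjD)
      (simp add: h_def fam_valid_def precat_axioms gobjD X Y Ident_r)
  ultimately show "f n = g n" using eq by simp
qed

lemma gop_gplus:
  assumes "X \<in> gobj C" "Y \<in> gobj C" "f \<in> gmap C k X Y" "g \<in> gmap C k X Y"
  shows "gop C k X Y (gplus C k X Y f g) = gop C k X Y f + gop C k X Y g"
proof (rule endo_eqI)
  fix h C' W Z n
  show "Rep_fam (Rep_endo (gop C k X Y (gplus C k X Y f g)) h) C' W Z n
    = Rep_fam (Rep_endo (gop C k X Y f + gop C k X Y g) h) C' W Z n"
    using assms gobjD[OF assms(1)] gobjD[OF assms(2)] gmapD'[OF assms(3)] gmapD'[OF assms(4)]
      fam_in'[OF _ assms(1)]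
    by (simp only: gop_apply gmap_closed plus_endo.rep_eq plus_fam.rep_eq)
      (auto simp: gact_def fam_valid_def gplus_def precat.Plus_Null precat.Null_in Comp_Plus_l)
qed

lemma gop_gcomp:
  assumes "X \<in> gobj C" "Y \<in> gobj C" "Z \<in> gobj C" "f \<in> gmap C k X Y" "g \<in> gmap C l Y Z"
  shows "gop C (k + l) X Z (gcomp C k l X Y Z g f) = gop C l Y Z g * gop C k X Y f"
proof (rule endo_eqI)
  fix h C' W Z' n
  have e: "n - (k + l) = n - l - k" by simp
  show "Rep_fam (Rep_endo (gop C (k + l) X Z (gcomp C k l X Y Z g f)) h) C' W Z' n
    = Rep_fam (Rep_endo (gop C l Y Z g * gop C k X Y f) h) C' W Z' n"
    using assms gobjD[OF assms(1)] gobjD[OF assms(2)] gobjD[OF assms(3)] gmapD'[OF assms(4)]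
      gmapD'[OF assms(5)] fam_in'[OF _ assms(1)]
    by (simp only: gop_apply gcomp_closed times_endo.rep_eq)
      (auto simp: gact_def fam_valid_def Comp_assoc precat_axioms gcomp_def e)
qed

lemma gop_gnull:
  assumes "X \<in> gobj C" "Y \<in> gobj C"
  shows "gop C k X Y (gnull C k X Y) = 0"
proof -
  have "gplus C k X Y (gnull C k X Y) (gnull C k X Y) = gnull C k X Y"
    using assms by (simp add: gplus_def gnull_def Plus_Null Null_in gobjD)
  then show ?thesis
    using gop_gplus[OF assms gmap_closed(1)[OF assms] gmap_closed(1)[OF assms], of k] by simp
qed

lemma gop_gneg:
  assumes "X \<in> gobj C" "Y \<in> gobj C" "f \<in> gmap C k X Y"
  shows "gop C k X Y (gneg C k X Y f) = - gop C k X Y f"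
proof -
  have "gplus C k X Y f (gneg C k X Y f) = gnull C k X Y"
    using assms gmapD[OF assms(3)] by (simp add: gplus_def gneg_def gnull_def Plus_Neg gobjD)
  then show ?thesis
    using gop_gplus[OF assms gmap_closed(4)[OF assms]] gop_gnull[OF assms(1,2), of k]
    by (simp add: eq_neg_iff_add_eq_0 add.commute)
qed

end

section \<open>Graded categories and cones\<close>

text \<open>
  \<open>H k a b\<close> are the maps of degree \<open>k\<close> between graded objects, and \<open>pr n a\<close> is the projector to
  degree \<open>n\<close>. The multiplication is a parameter of the locale, because reversing it (and the
  degrees of the objects) yields another model; every statement below thus has a dual.
\<close>

locale grcat =
  fixes mul :: "'r :: ab_group_add \<Rightarrow> 'r \<Rightarrow> 'r" (infixl \<open>**\<close> 70)
    and H :: "int \<Rightarrow> 'x \<Rightarrow> 'x \<Rightarrow> 'r set"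
    and one :: "'x \<Rightarrow> 'r"
    and pr :: "int \<Rightarrow> 'x \<Rightarrow> 'r"
  assumes mul_assoc: "(f ** g) ** h = f ** (g ** h)"
    and add_mul: "(f + g) ** h = f ** h + g ** h"
    and mul_add: "f ** (g + h) = f ** g + f ** h"
    and H_zero [simp]: "0 \<in> H k a b"
    and H_add: "\<lbrakk>f \<in> H k a b; g \<in> H k a b\<rbrakk> \<Longrightarrow> f + g \<in> H k a b"
    and H_uminus: "f \<in> H k a b \<Longrightarrow> - f \<in> H k a b"
    and H_mul: "\<lbrakk>f \<in> H k a b; g \<in> H l b c\<rbrakk> \<Longrightarrow> g ** f \<in> H (k + l) a c"
    and H_one [simp]: "one a \<in> H 0 a a"
    and one_l: "f \<in> H k a b \<Longrightarrow> one b ** f = f"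
    and one_r: "f \<in> H k a b \<Longrightarrow> f ** one a = f"
    and H_pr [simp]: "pr n a \<in> H 0 a a"
    and pr_comm: "f \<in> H k a b \<Longrightarrow> f ** pr n a = pr (n + k) b ** f"
    and pr_pr: "pr m a ** pr n a = (if m = n then pr n a else 0)"
    and pr_sep: "\<lbrakk>f \<in> H k a b; \<And>n. f ** pr n a = 0\<rbrakk> \<Longrightarrow> f = 0"
begin

lemma mul_zero [simp]: "f ** 0 = 0" "0 ** f = 0"
  using mul_add[of f 0 0] add_mul[of 0 0 f] by simp_all

lemma mul_uminus: "f ** (- g) = - (f ** g)" "(- f) ** g = - (f ** g)"
  using mul_add[of f g "- g"] add_mul[of f "- f" g] by (simp_all add: eq_neg_iff_add_eq_0 add.commute)

lemma mul_diff: "f ** (g - h) = f ** g - f ** h" "(f - g) ** h = f ** h - g ** h"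
  using mul_add[of f g "- h"] add_mul[of f "- g" h] by (simp_all add: mul_uminus)

lemmas mul_simps = mul_assoc add_mul mul_add mul_uminus mul_diff

lemma H_diff: "\<lbrakk>f \<in> H k a b; g \<in> H k a b\<rbrakk> \<Longrightarrow> f - g \<in> H k a b"
  using H_add[OF _ H_uminus, of f k a b g] by simp

lemma H_mul': "\<lbrakk>g \<in> H l b c; f \<in> H k a b; m = k + l\<rbrakk> \<Longrightarrow> g ** f \<in> H m a c"
  using H_mul by blast

lemmas H_intros = H_add H_uminus H_diff H_mul'

lemma mul_cong: "f ** g = h \<Longrightarrow> f ** (g ** k) = h ** k"
  by (metis mul_assoc)

lemma dual: "grcat (\<lambda>f g. g ** f) (\<lambda>k a b. H k b a) one (\<lambda>n. pr (- n))"
proof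
  fix f k a b n assume f: "f \<in> H k b a"
  show "pr (- n) a ** f = f ** pr (- (n + k)) b"
    using pr_comm[OF f, of "- (n + k)"] by simp
  assume z: "\<And>n. pr (- n) a ** f = 0"
  show "f = 0"
  proof (rule pr_sep[OF f])
    show "f ** pr n b = 0" for n using z[of "- (n + k)"] pr_comm[OF f, of n] by (simp add: add.commute)
  qed
qed (auto simp: mul_simps one_l one_r pr_pr intro: H_intros)

section \<open>Complexes, and cones tested by graded objects\<close>

definition cx :: "'x \<Rightarrow> 'r \<Rightarrow> bool" where
  "cx a d \<longleftrightarrow> d \<in> H 1 a a \<and> d ** d = 0"

definition bdd :: "'x \<Rightarrow> bool" where
  "bdd a \<longleftrightarrow> finite {n. pr n a \<noteq> 0}"

definition biprod :: "'x \<Rightarrow> 'x \<Rightarrow> 'x \<Rightarrow> 'r \<Rightarrow> 'r \<Rightarrow> 'r \<Rightarrow> 'r \<Rightarrow> bool" where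
  "biprod a b c i\<^sub>1 i\<^sub>2 p\<^sub>1 p\<^sub>2 \<longleftrightarrow>
     i\<^sub>1 \<in> H 0 a c \<and> i\<^sub>2 \<in> H 0 b c \<and> p\<^sub>1 \<in> H 0 c a \<and> p\<^sub>2 \<in> H 0 c b \<and>
     p\<^sub>1 ** i\<^sub>1 = one a \<and> p\<^sub>2 ** i\<^sub>2 = one b \<and> p\<^sub>2 ** i\<^sub>1 = 0 \<and> p\<^sub>1 ** i\<^sub>2 = 0 \<and>
     i\<^sub>1 ** p\<^sub>1 + i\<^sub>2 ** p\<^sub>2 = one c"

text \<open>
  For all \<open>q \<in> Q\<close>, the complex of maps from \<open>q\<close> to the cone of \<open>e\<close> is acyclic.
\<close>

definition hgood :: "'x set \<Rightarrow> 'x \<Rightarrow> 'r \<Rightarrow> 'x \<Rightarrow> 'r \<Rightarrow> 'r \<Rightarrow> bool" where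
  "hgood Q y dy x dx e \<longleftrightarrow> (\<forall>q\<in>Q. \<forall>k. \<forall>a\<in>H (k + 1) q y. \<forall>b\<in>H k q x.
     dy ** a = 0 \<longrightarrow> dx ** b = e ** a \<longrightarrow>
     (\<exists>a'\<in>H k q y. \<exists>b'\<in>H (k - 1) q x. a = dy ** a' \<and> b = e ** a' - dx ** b'))"

lemma hgoodD:
  assumes "hgood Q y dy x dx e" "q \<in> Q" "a \<in> H (k + 1) q y" "b \<in> H k q x" "dy ** a = 0" "dx ** b = e ** a"
  obtains a' b' where "a' \<in> H k q y" "b' \<in> H (k - 1) q x" "a = dy ** a'" "b = e ** a' - dx ** b'"
  using assms unfolding hgood_def by blast

text \<open>\<open>hgood\<close> tests the cone by graded objects without differential; here the
  source is a bounded complex with differential \<open>\<delta>\<close>. As \<open>\<delta>\<close>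
  raises degrees, the part of a cocycle in its top degree is a cocycle for the differential of the
  cone alone. So \<open>hgood\<close> removes it, one degree at a time from above. The signs do not
  depend on the parity of \<open>k\<close>; a caller that needs the other parity passes
  \<open>- \<delta>\<close>.\<close>

lemma hgood_lift:
  assumes g: "hgood Q y dy x dx e" and e: "e \<in> H 0 y x" "dx ** e = e ** dy"
    and dy: "cx y dy" and dx: "cx x dx" and q: "q \<in> Q" "bdd q" "cx q \<delta>"
    and a: "a \<in> H (k + 1) q y" and b: "b \<in> H k q x"
    and da: "dy ** a + a ** \<delta> = 0" and db: "dx ** b - b ** \<delta> = e ** a"
  shows "\<exists>a'\<in>H k q y. \<exists>b'\<in>H (k - 1) q x.
    a = dy ** a' - a' ** \<delta> \<and> b = e ** a' - (dx ** b' + b' ** \<delta>)"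
proof -
  note dyH = dy[unfolded cx_def] and dxH = dx[unfolded cx_def] and dqH = q(3)[unfolded cx_def]
  obtain N where N: "\<And>n. \<bar>n\<bar> > N \<Longrightarrow> pr n q = 0"
  proof -
    obtain N where "\<forall>n\<in>{n. pr n q \<noteq> 0}. \<bar>n\<bar> \<le> N"
      using q(2) unfolding bdd_def by (metis finite_imageI finite_nat_set_iff_bounded_le
        finite_set_choice Max_ge imageI)
    then show ?thesis using that[of N] by (metis leD mem_Collect_eq)
  qed
  \<comment> \<open>After \<open>m\<close> steps nothing is left in degrees from
    \<open>N + 1 - int m\<close> on. Above \<open>N\<close> the source vanishes, which starts the
    induction.\<close>
  have "\<exists>a'\<in>H k q y. \<exists>b'\<in>H (k - 1) q x. \<forall>n \<ge> N + 1 - int m.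
    (a - (dy ** a' - a' ** \<delta>)) ** pr n q = 0 \<and> (b - (e ** a' - (dx ** b' + b' ** \<delta>))) ** pr n q = 0" for m :: nat
  proof (induction m)
    case 0
    have "pr n q = 0" if "n \<ge> N + 1" for n using that N[of n] by simp
    then show ?case by (intro bexI[of _ 0]) auto
  next
    case (Suc m)
    then obtain a' b' where a': "a' \<in> H k q y" and b': "b' \<in> H (k - 1) q x" and
      van: "\<And>n. n \<ge> N + 1 - int m \<Longrightarrow> (a - (dy ** a' - a' ** \<delta>)) ** pr n q = 0"
      "\<And>n. n \<ge> N + 1 - int m \<Longrightarrow> (b - (e ** a' - (dx ** b' + b' ** \<delta>))) ** pr n q = 0" by blast
    define A where "A = a - (dy ** a' - a' ** \<delta>)"
    define B where "B = b - (e ** a' - (dx ** b' + b' ** \<delta>))"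
    define n where "n = N + 1 - int (Suc m)"
    have AH: "A \<in> H (k + 1) q y" unfolding A_def
      by (intro H_diff a H_mul'[OF _ a'] H_mul'[OF a']) (use dyH dqH in auto)
    have BH: "B \<in> H k q x" unfolding B_def
      by (intro H_diff H_add b H_mul'[OF e(1) a'] H_mul'[OF _ b'] H_mul'[OF b']) (use dxH dqH in auto)
    have dA: "dy ** A = - (A ** \<delta>)" and dB: "dx ** B = B ** \<delta> + e ** A"
    proof -
      have "dy ** A + A ** \<delta> = (dy ** a + a ** \<delta>)"
        using dyH dqH unfolding A_def by (simp add: mul_simps mul_cong[of dy dy 0] mul_cong[of \<delta> \<delta> 0])
      then show "dy ** A = - (A ** \<delta>)" using da by (simp add: eq_neg_iff_add_eq_0)
      have "dx ** B - B ** \<delta> - e ** A = (dx ** b - b ** \<delta>) - e ** a"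
        using dyH dqH dxH unfolding A_def B_def
        by (simp add: mul_simps mul_cong[of dx dx 0] mul_cong[of \<delta> \<delta> 0] mul_cong[OF e(2)])
      then show "dx ** B = B ** \<delta> + e ** A" using db by (simp add: algebra_simps)
    qed
    have van': "A ** pr i q = 0" "B ** pr i q = 0" if "i > n" for i
      using van[of i] that unfolding A_def B_def n_def by auto
    have dp: "\<delta> ** pr i q = pr (i + 1) q ** \<delta>" for i using pr_comm dqH by blast
    have 1: "dy ** (A ** pr n q) = 0"
      using van'(1)[of "n + 1"] by (simp add: mul_assoc[symmetric] dA mul_uminus) (simp add: mul_assoc dp mul_cong)
    have 2: "dx ** (B ** pr n q) = e ** (A ** pr n q)"
      using van'(2)[of "n + 1"] by (simp add: mul_assoc[symmetric] dB mul_add add_mul) (simp add: mul_assoc dp mul_cong)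
    have mem: "A ** pr n q \<in> H (k + 1) q y" "B ** pr n q \<in> H k q x"
      using H_mul[OF H_pr AH] H_mul[OF H_pr BH] by simp_all
    obtain \<alpha> \<beta> where \<alpha>: "\<alpha> \<in> H k q y" and \<beta>: "\<beta> \<in> H (k - 1) q x" and
      eqs: "A ** pr n q = dy ** \<alpha>" "B ** pr n q = e ** \<alpha> - dx ** \<beta>"
      by (rule hgoodD[OF g q(1) mem 1 2])
    \<comment> \<open>The correction is supported in degree \<open>n\<close> of the source. Composed
      with \<open>\<delta>\<close> it is supported in degree \<open>n - 1\<close>, so the degrees
      above \<open>n\<close> stay settled and degree \<open>n\<close> is changed only through the
      differential of the cone.\<close>
    let ?a = "a' + \<alpha> ** pr n q" and ?b = "b' + \<beta> ** pr n q"
    have H: "?a \<in> H k q y" "?b \<in> H (k - 1) q x"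
      using H_add[OF a' H_mul[OF H_pr, of \<alpha>, simplified, OF \<alpha>]]
        H_add[OF b' H_mul[OF H_pr, of \<beta>, simplified, OF \<beta>]] by auto
    have "(a - (dy ** ?a - ?a ** \<delta>)) ** pr i q = 0 \<and> (b - (e ** ?a - (dx ** ?b + ?b ** \<delta>))) ** pr i q = 0"
      if i: "i \<ge> n" for i
    proof -
      have pp: "pr n q ** (pr (i + 1) q ** f) = 0" for f
        using i mul_assoc[of "pr n q" "pr (i + 1) q" f] by (simp add: pr_pr)
      have "(a - (dy ** ?a - ?a ** \<delta>)) ** pr i q = A ** pr i q - dy ** (\<alpha> ** (pr n q ** pr i q))"
        unfolding A_def by (simp add: mul_simps dp pp)
      also have "\<dots> = 0"
        using i van'(1)[of i] by (cases "i = n") (auto simp: pr_pr mul_assoc[symmetric] eqs(1)[symmetric],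
            simp add: mul_assoc pr_pr)
      finally have 1: "(a - (dy ** ?a - ?a ** \<delta>)) ** pr i q = 0" .
      have "(b - (e ** ?a - (dx ** ?b + ?b ** \<delta>))) ** pr i q
         = B ** pr i q - (e ** \<alpha> - dx ** \<beta>) ** (pr n q ** pr i q)"
        unfolding B_def by (simp add: mul_simps dp pp)
      also have "\<dots> = 0"
        using i van'(2)[of i] by (cases "i = n") (auto simp: pr_pr eqs(2)[symmetric] mul_assoc)
      finally show ?thesis using 1 by blast
    qed
    then show ?case using H unfolding n_def by blast
  qed
  \<comment> \<open>From \<open>N + 1\<close> down to \<open>- N - 1\<close> there are
    \<open>2 * N + 2\<close> steps. For negative \<open>N\<close> the function \<open>nat\<close>
    returns 0, and then \<open>N + 1\<close> is at most \<open>- N - 1\<close> already.\<close>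
  from this[of "nat (2 * N + 2)"] obtain a' b' where a': "a' \<in> H k q y" and b': "b' \<in> H (k - 1) q x" and
    van: "\<And>n. n \<ge> - N - 1 \<Longrightarrow> (a - (dy ** a' - a' ** \<delta>)) ** pr n q = 0"
      "\<And>n. n \<ge> - N - 1 \<Longrightarrow> (b - (e ** a' - (dx ** b' + b' ** \<delta>))) ** pr n q = 0"
    by (smt (verit, ccfv_threshold) int_nat_eq)
  have "a - (dy ** a' - a' ** \<delta>) = 0"
  proof (rule pr_sep)
    show "a - (dy ** a' - a' ** \<delta>) \<in> H (k + 1) q y"
      by (intro H_diff a H_mul'[OF _ a'] H_mul'[OF a']) (use dyH dqH in auto)
    show "(a - (dy ** a' - a' ** \<delta>)) ** pr n q = 0" for n
      using van(1)[of n] N[of n] by (cases "n \<ge> - N - 1") auto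
  qed
  moreover have "b - (e ** a' - (dx ** b' + b' ** \<delta>)) = 0"
  proof (rule pr_sep)
    show "b - (e ** a' - (dx ** b' + b' ** \<delta>)) \<in> H k q x"
      by (intro H_diff H_add b H_mul'[OF e(1) a'] H_mul'[OF _ b'] H_mul'[OF b']) (use dxH dqH in auto)
    show "(b - (e ** a' - (dx ** b' + b' ** \<delta>))) ** pr n q = 0" for n
      using van(2)[of n] N[of n] by (cases "n \<ge> - N - 1") auto
  qed
  ultimately show ?thesis using a' b' by (intro bexI[of _ a'] bexI[of _ b']) auto
qed

end

context grcat
begin

text \<open>A triangular form of the five lemma. \<open>x2\<close> and \<open>y2\<close> are
  subcomplexes, \<open>x1\<close> and \<open>y1\<close> the quotients, and \<open>s\<close> makes
  the extended map commute with the differentials. The quotient components are solved first; what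
  their solution contributes through \<open>tx\<close>, \<open>ty\<close> and \<open>s\<close> is
  subtracted before the subcomplex is solved.\<close>

lemma hgood_ext:
  assumes g1: "hgood Q y1 dy1 x1 dx1 e1" and g2: "hgood Q y2 dy2 x2 dx2 e2"
    and X: "biprod x1 x2 zx i1 i2 p1 p2" and Y: "biprod y1 y2 zy j1 j2 q1 q2"
    and cx: "cx x1 dx1" "cx x2 dx2" "cx y1 dy1" "cx y2 dy2"
    and e: "e1 \<in> H 0 y1 x1" "dx1 ** e1 = e1 ** dy1" "e2 \<in> H 0 y2 x2" "dx2 ** e2 = e2 ** dy2"
    and tx: "tx \<in> H 1 x1 x2" "dx2 ** tx + tx ** dx1 = 0" and ty: "ty \<in> H 1 y1 y2" "dy2 ** ty + ty ** dy1 = 0"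
    and s: "s \<in> H 0 y1 x2" "tx ** e1 - e2 ** ty = s ** dy1 - dx2 ** s"
  shows "hgood Q zy (j1 ** dy1 ** q1 + j2 ** dy2 ** q2 + j2 ** ty ** q1)
    zx (i1 ** dx1 ** p1 + i2 ** dx2 ** p2 + i2 ** tx ** p1)
    (i1 ** e1 ** q1 + i2 ** e2 ** q2 + i2 ** s ** q1)" (is "hgood Q zy ?dy zx ?dx ?e")
  unfolding hgood_def
proof (intro ballI allI impI)
  note Xs = X[unfolded biprod_def] and Ys = Y[unfolded biprod_def]
  note X0 = Xs[THEN conjunct2, THEN conjunct2, THEN conjunct2, THEN conjunct2]
  fix q k a b
  assume q: "q \<in> Q" and a: "a \<in> H (k + 1) q zy" and b: "b \<in> H k q zx" and da: "?dy ** a = 0"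
    and db: "?dx ** b = ?e ** a"
  have Xeq: "p1 ** i1 = one x1" "p2 ** i2 = one x2" "p2 ** i1 = 0" "p1 ** i2 = 0" "i1 ** p1 + i2 ** p2 = one zx"
    and XH: "i1 \<in> H 0 x1 zx" "i2 \<in> H 0 x2 zx" "p1 \<in> H 0 zx x1" "p2 \<in> H 0 zx x2" using Xs by auto
  have Yeq: "q1 ** j1 = one y1" "q2 ** j2 = one y2" "q2 ** j1 = 0" "q1 ** j2 = 0" "j1 ** q1 + j2 ** q2 = one zy"
    and YH: "j1 \<in> H 0 y1 zy" "j2 \<in> H 0 y2 zy" "q1 \<in> H 0 zy y1" "q2 \<in> H 0 zy y2" using Ys by auto
  have d: "dx1 \<in> H 1 x1 x1" "dx2 \<in> H 1 x2 x2" "dy1 \<in> H 1 y1 y1" "dy2 \<in> H 1 y2 y2" 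
    "dx1 ** dx1 = 0" "dx2 ** dx2 = 0" "dy1 ** dy1 = 0" "dy2 ** dy2 = 0" 
    using cx by (auto simp: cx_def)
  define a1 a2 b1 b2 where ab: "a1 = q1 ** a" "a2 = q2 ** a" "b1 = p1 ** b" "b2 = p2 ** b"
  have abH: "a1 \<in> H (k + 1) q y1" "a2 \<in> H (k + 1) q y2" "b1 \<in> H k q x1" "b2 \<in> H k q x2"
    using H_mul'[OF YH(3) a] H_mul'[OF YH(4) a] H_mul'[OF XH(3) b] H_mul'[OF XH(4) b] by (auto simp: ab)
  note pj = Xeq(1-4) Yeq(1-4) mul_cong[OF Xeq(1)] mul_cong[OF Xeq(2)] mul_cong[OF Xeq(3)] mul_cong[OF Xeq(4)]
    mul_cong[OF Yeq(1)] mul_cong[OF Yeq(2)] mul_cong[OF Yeq(3)] mul_cong[OF Yeq(4)]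
  have ol: "one x1 ** (f ** g) = f ** g" if "f \<in> H l c x1" for f g l c using one_l[OF that] mul_cong by metis
  have ol2: "one x2 ** (f ** g) = f ** g" if "f \<in> H l c x2" for f g l c using one_l[OF that] mul_cong by metis
  have ol3: "one y1 ** (f ** g) = f ** g" if "f \<in> H l c y1" for f g l c using one_l[OF that] mul_cong by metis
  have ol4: "one y2 ** (f ** g) = f ** g" if "f \<in> H l c y2" for f g l c using one_l[OF that] mul_cong by metis
  note ols = ol[OF d(1)] ol[OF e(1)] ol2[OF d(2)] ol2[OF e(3)] ol2[OF tx(1)] ol2[OF s(1)] ol3[OF d(3)] ol4[OF d(4)] ol4[OF ty(1)]
  have A1: "dy1 ** a1 = 0" using arg_cong[OF da, of "\<lambda>f. q1 ** f"] by (simp add: mul_simps pj ols ab)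
  have A2: "dy2 ** a2 + ty ** a1 = 0" using arg_cong[OF da, of "\<lambda>f. q2 ** f"] by (simp add: mul_simps pj ols ab)
  have B1: "dx1 ** b1 = e1 ** a1" using arg_cong[OF db, of "\<lambda>f. p1 ** f"] by (simp add: mul_simps pj ols ab)
  have B2: "dx2 ** b2 + tx ** b1 = e2 ** a2 + s ** a1"
    using arg_cong[OF db, of "\<lambda>f. p2 ** f"] by (simp add: mul_simps pj ols ab)
  obtain \<alpha>1 \<beta>1 where H1: "\<alpha>1 \<in> H k q y1" "\<beta>1 \<in> H (k - 1) q x1" and E1: "a1 = dy1 ** \<alpha>1" "b1 = e1 ** \<alpha>1 - dx1 ** \<beta>1"
    by (rule hgoodD[OF g1 q abH(1,3) A1 B1])
  have tyd: "dy2 ** (ty ** f) = - (ty ** (dy1 ** f))" for f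
    using arg_cong[OF ty(2), of "\<lambda>g. g ** f"] by (simp add: mul_simps eq_neg_iff_add_eq_0)
  have txd: "dx2 ** (tx ** f) = - (tx ** (dx1 ** f))" for f
    using arg_cong[OF tx(2), of "\<lambda>g. g ** f"] by (simp add: mul_simps eq_neg_iff_add_eq_0)
  have sd: "e2 ** (ty ** f) = tx ** (e1 ** f) - s ** (dy1 ** f) + dx2 ** (s ** f)" for f
    using arg_cong[OF s(2), of "\<lambda>g. g ** f"] by (simp add: mul_simps algebra_simps)
  have A2': "dy2 ** (a2 - ty ** \<alpha>1) = 0" using A2 by (simp add: mul_simps tyd E1(1))
  have B2': "dx2 ** (b2 + tx ** \<beta>1 - s ** \<alpha>1) = e2 ** (a2 - ty ** \<alpha>1)"
    using B2 by (simp add: mul_simps txd sd E1 algebra_simps)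
  have m2: "a2 - ty ** \<alpha>1 \<in> H (k + 1) q y2" "b2 + tx ** \<beta>1 - s ** \<alpha>1 \<in> H k q x2"
    using abH H_mul'[OF ty(1) H1(1)] H_mul'[OF tx(1) H1(2)] H_mul'[OF s(1) H1(1)]
    by (auto intro!: H_diff H_add)
  obtain \<alpha>2 \<beta>2 where H2: "\<alpha>2 \<in> H k q y2" "\<beta>2 \<in> H (k - 1) q x2"
    and E2: "a2 - ty ** \<alpha>1 = dy2 ** \<alpha>2" "b2 + tx ** \<beta>1 - s ** \<alpha>1 = e2 ** \<alpha>2 - dx2 ** \<beta>2"
    by (rule hgoodD[OF g2 q m2 A2' B2'])
  note ones = one_l[OF H1(1)] one_l[OF H1(2)] one_l[OF H2(1)] one_l[OF H2(2)]
  have "?dy ** (j1 ** \<alpha>1 + j2 ** \<alpha>2) = j1 ** a1 + j2 ** a2"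
    using E1(1) E2(1) by (simp add: mul_simps pj ones diff_eq_eq)
  also have "\<dots> = a" using one_l[OF a] Yeq(5) by (simp add: ab mul_assoc[symmetric] add_mul[symmetric])
  finally have 1: "a = ?dy ** (j1 ** \<alpha>1 + j2 ** \<alpha>2)" by simp
  have b2: "b2 = e2 ** \<alpha>2 - dx2 ** \<beta>2 - tx ** \<beta>1 + s ** \<alpha>1"
    using E2(2) by (simp add: algebra_simps)
  have "?e ** (j1 ** \<alpha>1 + j2 ** \<alpha>2) - ?dx ** (i1 ** \<beta>1 + i2 ** \<beta>2) = i1 ** b1 + i2 ** b2"
    by (simp add: mul_simps pj ones E1(2) b2)
  also have "\<dots> = b" using one_l[OF b] Xeq(5) by (simp add: ab mul_assoc[symmetric] add_mul[symmetric])
  finally have 2: "b = ?e ** (j1 ** \<alpha>1 + j2 ** \<alpha>2) - ?dx ** (i1 ** \<beta>1 + i2 ** \<beta>2)" by simp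
  have "j1 ** \<alpha>1 + j2 ** \<alpha>2 \<in> H k q zy" "i1 ** \<beta>1 + i2 ** \<beta>2 \<in> H (k - 1) q zx"
    using H_mul'[OF YH(1) H1(1)] H_mul'[OF YH(2) H2(1)] H_mul'[OF XH(1) H1(2)] H_mul'[OF XH(2) H2(2)]
    by (auto intro!: H_add)
  then show "\<exists>a'\<in>H k q zy. \<exists>b'\<in>H (k - 1) q zx. a = ?dy ** a' \<and> b = ?e ** a' - ?dx ** b'"
    using 1 2 by blast
qed

text \<open>Used with \<open>j = 0\<close> for isomorphisms of graded objects and with
  \<open>j = - 1\<close> for the suspension. Both ends move by the same degree, so the transported
  map keeps degree 0.\<close>

lemma hgood_transport:
  assumes g: "hgood Q y dy x dx e" and e: "e \<in> H 0 y x"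
    and \<sigma>: "\<sigma>y \<in> H j y y'" "\<tau>y \<in> H (- j) y' y" "\<tau>y ** \<sigma>y = one y" "\<sigma>y ** \<tau>y = one y'"
      "\<sigma>x \<in> H j x x'" "\<tau>x \<in> H (- j) x' x" "\<tau>x ** \<sigma>x = one x" "\<sigma>x ** \<tau>x = one x'"
    and d: "dy \<in> H 1 y y" "dx \<in> H 1 x x"
  shows "hgood Q y' (\<sigma>y ** dy ** \<tau>y) x' (\<sigma>x ** dx ** \<tau>x) (\<sigma>x ** e ** \<tau>y)"
  unfolding hgood_def
proof (intro ballI allI impI)
  fix q k a b
  assume q: "q \<in> Q" and a: "a \<in> H (k + 1) q y'" and b: "b \<in> H k q x'"
    and da: "\<sigma>y ** dy ** \<tau>y ** a = 0" and db: "\<sigma>x ** dx ** \<tau>x ** b = \<sigma>x ** e ** \<tau>y ** a"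
  have H: "\<tau>y ** a \<in> H ((k - j) + 1) q y" "\<tau>x ** b \<in> H (k - j) q x"
    using H_mul'[OF \<sigma>(2) a] H_mul'[OF \<sigma>(6) b] by (auto simp: algebra_simps)
  have o: "\<tau>y ** (\<sigma>y ** (dy ** f)) = dy ** f" "\<tau>x ** (\<sigma>x ** (dx ** f)) = dx ** f" "\<tau>x ** (\<sigma>x ** (e ** f)) = e ** f" for f
    using mul_cong[OF \<sigma>(3)] mul_cong[OF \<sigma>(7)] mul_cong[OF one_l[OF d(1)]] mul_cong[OF one_l[OF d(2)]]
      mul_cong[OF one_l[OF e]] by auto
  have 1: "dy ** (\<tau>y ** a) = 0" using arg_cong[OF da, of "\<lambda>f. \<tau>y ** f"] by (simp add: mul_assoc o)
  have 2: "dx ** (\<tau>x ** b) = e ** (\<tau>y ** a)" using arg_cong[OF db, of "\<lambda>f. \<tau>x ** f"] by (simp add: mul_assoc o)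
  obtain \<alpha> \<beta> where m: "\<alpha> \<in> H (k - j) q y" "\<beta> \<in> H (k - j - 1) q x"
    and eq: "\<tau>y ** a = dy ** \<alpha>" "\<tau>x ** b = e ** \<alpha> - dx ** \<beta>"
    by (rule hgoodD[OF g q H 1 2])
  have "\<sigma>y ** \<alpha> \<in> H k q y'" "\<sigma>x ** \<beta> \<in> H (k - 1) q x'"
    using H_mul'[OF \<sigma>(1) m(1)] H_mul'[OF \<sigma>(5) m(2)] by auto
  moreover have "a = \<sigma>y ** dy ** \<tau>y ** (\<sigma>y ** \<alpha>)"
    using arg_cong[OF eq(1), of "\<lambda>f. \<sigma>y ** f"] one_l[OF a]
    by (simp add: mul_assoc mul_cong[OF \<sigma>(3)] mul_cong[OF \<sigma>(4)] one_l[OF m(1)])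
  moreover have "b = \<sigma>x ** e ** \<tau>y ** (\<sigma>y ** \<alpha>) - \<sigma>x ** dx ** \<tau>x ** (\<sigma>x ** \<beta>)"
    using arg_cong[OF eq(2), of "\<lambda>f. \<sigma>x ** f"] one_l[OF b]
    by (simp add: mul_simps mul_cong[OF \<sigma>(3)] mul_cong[OF \<sigma>(7)] mul_cong[OF \<sigma>(8)] one_l[OF m(1)] one_l[OF m(2)])
  ultimately show "\<exists>a'\<in>H k q y'. \<exists>b'\<in>H (k - 1) q x'. a = \<sigma>y ** dy ** \<tau>y ** a' \<and>
      b = \<sigma>x ** e ** \<tau>y ** a' - \<sigma>x ** dx ** \<tau>x ** b'" by blast
qed

text \<open>The suspension negates differentials. The sign is absorbed by applying the hypothesis to
  \<open>- b\<close>.\<close>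

lemma hgood_uminus:
  assumes g: "hgood Q y dy x dx e"
  shows "hgood Q y (- dy) x (- dx) e"
  unfolding hgood_def
proof (intro ballI allI impI)
  fix q k a b
  assume q: "q \<in> Q" and a: "a \<in> H (k + 1) q y" and b: "b \<in> H k q x"
    and da: "(- dy) ** a = 0" and db: "(- dx) ** b = e ** a"
  obtain \<alpha> \<beta> where m: "\<alpha> \<in> H k q y" "\<beta> \<in> H (k - 1) q x" and eq: "a = dy ** \<alpha>" "- b = e ** \<alpha> - dx ** \<beta>"
    by (rule hgoodD[OF g q a H_uminus[OF b]]) (use da db in \<open>auto simp: mul_simps\<close>)
  show "\<exists>a'\<in>H k q y. \<exists>b'\<in>H (k - 1) q x. a = (- dy) ** a' \<and> b = e ** a' - (- dx) ** b'"
    by (rule bexI[OF _ H_uminus[OF m(1)]], rule bexI[OF _ H_uminus[OF H_uminus[OF m(2)]]])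
      (use eq in \<open>auto simp: mul_simps minus_equation_iff[of b] eq_commute\<close>)
qed


section \<open>Good maps, and chain maps carried along them\<close>

definition hrel :: "'x \<Rightarrow> 'r \<Rightarrow> 'x \<Rightarrow> 'r \<Rightarrow> 'r \<Rightarrow> bool" where
  "hrel a da b db f \<longleftrightarrow> (\<exists>s\<in>H (- 1) a b. f = db ** s + s ** da)"

text \<open>\<open>e\<close> is a quasi-isomorphism as far as maps out of \<open>P\<close> and maps
  into \<open>I\<close> can see. This form takes the place of cohomology, which a
  \<open>grcat\<close> does not have, and it goes over into itself under duality.\<close>

definition good :: "'x set \<Rightarrow> 'x set \<Rightarrow> 'x \<Rightarrow> 'r \<Rightarrow> 'x \<Rightarrow> 'r \<Rightarrow> 'r \<Rightarrow> bool" where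
  "good P I y dy x dx e \<longleftrightarrow> e \<in> H 0 y x \<and> dx ** e = e ** dy \<and> hgood P y dy x dx e \<and>
     grcat.hgood (\<lambda>f g. g ** f) (\<lambda>k a b. H k b a) I x dx y dy e"

lemma goodD:
  assumes "good P I y dy x dx e"
  shows "e \<in> H 0 y x" "dx ** e = e ** dy" "hgood P y dy x dx e"
    "grcat.hgood (\<lambda>f g. g ** f) (\<lambda>k a b. H k b a) I x dx y dy e"
  using assms by (auto simp: good_def)

interpretation D: grcat "\<lambda>f g. g ** f" "\<lambda>k a b. H k b a" one "\<lambda>n. pr (- n)"
  by (rule dual)

lemma dual_simps:
  "D.cx a d \<longleftrightarrow> cx a d" "D.bdd a \<longleftrightarrow> bdd a"
  "D.biprod b a c p\<^sub>2 p\<^sub>1 i\<^sub>2 i\<^sub>1 \<longleftrightarrow> biprod a b c i\<^sub>1 i\<^sub>2 p\<^sub>1 p\<^sub>2"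
  "D.good I P x dx y dy e \<longleftrightarrow> good P I y dy x dx e"
proof -
  show "D.cx a d \<longleftrightarrow> cx a d" by (simp add: cx_def D.cx_def)
  have "bij_betw uminus {n. pr (- n) a \<noteq> 0} {n. pr n a \<noteq> 0}"
    by (rule bij_betw_byWitness[of _ uminus]) auto
  then show "D.bdd a \<longleftrightarrow> bdd a" by (simp add: bdd_def D.bdd_def bij_betw_finite)
  show "D.biprod b a c p\<^sub>2 p\<^sub>1 i\<^sub>2 i\<^sub>1 \<longleftrightarrow> biprod a b c i\<^sub>1 i\<^sub>2 p\<^sub>1 p\<^sub>2"
    by (auto simp: biprod_def D.biprod_def add.commute)
  show "D.good I P x dx y dy e \<longleftrightarrow> good P I y dy x dx e"
    by (auto simp: good_def D.good_def)
qed

lemma good_ext: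
  assumes g1: "good P I y1 dy1 x1 dx1 e1" and g2: "good P I y2 dy2 x2 dx2 e2"
    and X: "biprod x1 x2 zx i1 i2 p1 p2" and Y: "biprod y1 y2 zy j1 j2 q1 q2"
    and cx: "cx x1 dx1" "cx x2 dx2" "cx y1 dy1" "cx y2 dy2"
    and tx: "tx \<in> H 1 x1 x2" "dx2 ** tx + tx ** dx1 = 0" and ty: "ty \<in> H 1 y1 y2" "dy2 ** ty + ty ** dy1 = 0"
    and s: "s \<in> H 0 y1 x2" "tx ** e1 - e2 ** ty = s ** dy1 - dx2 ** s"
  shows "good P I zy (j1 ** dy1 ** q1 + j2 ** dy2 ** q2 + j2 ** ty ** q1)
    zx (i1 ** dx1 ** p1 + i2 ** dx2 ** p2 + i2 ** tx ** p1)
    (i1 ** e1 ** q1 + i2 ** e2 ** q2 + i2 ** s ** q1)"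
  unfolding good_def
proof (intro conjI)
  note g1' = goodD[OF g1] and g2' = goodD[OF g2]
  have Xeq: "p1 ** i1 = one x1" "p2 ** i2 = one x2" "p2 ** i1 = 0" "p1 ** i2 = 0" "i1 ** p1 + i2 ** p2 = one zx"
    and XH: "i1 \<in> H 0 x1 zx" "i2 \<in> H 0 x2 zx" "p1 \<in> H 0 zx x1" "p2 \<in> H 0 zx x2" using X[unfolded biprod_def] by auto
  have Yeq: "q1 ** j1 = one y1" "q2 ** j2 = one y2" "q2 ** j1 = 0" "q1 ** j2 = 0" "j1 ** q1 + j2 ** q2 = one zy"
    and YH: "j1 \<in> H 0 y1 zy" "j2 \<in> H 0 y2 zy" "q1 \<in> H 0 zy y1" "q2 \<in> H 0 zy y2" using Y[unfolded biprod_def] by auto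
  note pj = mul_cong[OF Xeq(1)] mul_cong[OF Xeq(2)] mul_cong[OF Xeq(3)] mul_cong[OF Xeq(4)]
    mul_cong[OF Yeq(1)] mul_cong[OF Yeq(2)] mul_cong[OF Yeq(3)] mul_cong[OF Yeq(4)]
  show "i1 ** e1 ** q1 + i2 ** e2 ** q2 + i2 ** s ** q1 \<in> H 0 zy zx"
    using H_mul'[OF H_mul'[OF XH(1) g1'(1) refl] YH(3) refl] H_mul'[OF H_mul'[OF XH(2) g2'(1) refl] YH(4) refl]
      H_mul'[OF H_mul'[OF XH(2) s(1) refl] YH(3) refl] by (auto intro!: H_add)
  have ols: "one x1 ** (e1 ** f) = e1 ** f" "one x2 ** (e2 ** f) = e2 ** f" "one x2 ** (s ** f) = s ** f"
    "one y1 ** (dy1 ** f) = dy1 ** f" "one y2 ** (dy2 ** f) = dy2 ** f" "one y2 ** (ty ** f) = ty ** f" for f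
    using mul_cong[OF one_l[OF g1'(1)]] mul_cong[OF one_l[OF g2'(1)]] mul_cong[OF one_l[OF s(1)]]
      mul_cong[OF one_l[of dy1]] mul_cong[OF one_l[of dy2]] mul_cong[OF one_l[OF ty(1)]] cx by (auto simp: cx_def)
  have "tx ** (e1 ** f) = e2 ** (ty ** f) + s ** (dy1 ** f) - dx2 ** (s ** f)" for f
    using arg_cong[OF s(2), of "\<lambda>g. g ** f"] by (simp add: mul_simps algebra_simps)
  then show "(i1 ** dx1 ** p1 + i2 ** dx2 ** p2 + i2 ** tx ** p1) ** (i1 ** e1 ** q1 + i2 ** e2 ** q2 + i2 ** s ** q1)
    = (i1 ** e1 ** q1 + i2 ** e2 ** q2 + i2 ** s ** q1) ** (j1 ** dy1 ** q1 + j2 ** dy2 ** q2 + j2 ** ty ** q1)"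
    by (simp add: mul_simps pj ols mul_cong[OF g1'(2)] mul_cong[OF g2'(2)])
  show "hgood P zy (j1 ** dy1 ** q1 + j2 ** dy2 ** q2 + j2 ** ty ** q1)
    zx (i1 ** dx1 ** p1 + i2 ** dx2 ** p2 + i2 ** tx ** p1) (i1 ** e1 ** q1 + i2 ** e2 ** q2 + i2 ** s ** q1)"
    by (rule hgood_ext[OF g1'(3) g2'(3) X Y cx g1'(1,2) g2'(1,2) tx ty s])
  \<comment> \<open>Reversing arrows makes \<open>x1\<close> and \<open>y1\<close> the subcomplexes,
    so the two given maps enter \<open>hgood_ext\<close> in the opposite order.\<close>
  show "D.hgood I zx (i1 ** dx1 ** p1 + i2 ** dx2 ** p2 + i2 ** tx ** p1)
    zy (j1 ** dy1 ** q1 + j2 ** dy2 ** q2 + j2 ** ty ** q1) (i1 ** e1 ** q1 + i2 ** e2 ** q2 + i2 ** s ** q1)"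
    using D.hgood_ext[OF g2'(4) g1'(4), of zy q2 q1 j2 j1 zx p2 p1 i2 i1 ty tx s]
      X Y cx g1'(1,2) g2'(1,2) tx ty s
    by (simp add: dual_simps mul_assoc add.assoc add.left_commute add.commute algebra_simps)
qed

lemma good_transport:
  assumes g: "good P I y dy x dx e"
    and \<sigma>: "\<sigma>y \<in> H j y y'" "\<tau>y \<in> H (- j) y' y" "\<tau>y ** \<sigma>y = one y" "\<sigma>y ** \<tau>y = one y'"
      "\<sigma>x \<in> H j x x'" "\<tau>x \<in> H (- j) x' x" "\<tau>x ** \<sigma>x = one x" "\<sigma>x ** \<tau>x = one x'"
    and d: "dy \<in> H 1 y y" "dx \<in> H 1 x x"
  shows "good P I y' (\<sigma>y ** dy ** \<tau>y) x' (\<sigma>x ** dx ** \<tau>x) (\<sigma>x ** e ** \<tau>y)"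
  unfolding good_def
proof (intro conjI)
  note g' = goodD[OF g]
  show "\<sigma>x ** e ** \<tau>y \<in> H 0 y' x'" using H_mul'[OF H_mul'[OF \<sigma>(5) g'(1) refl] \<sigma>(2)] by auto
  show "\<sigma>x ** dx ** \<tau>x ** (\<sigma>x ** e ** \<tau>y) = \<sigma>x ** e ** \<tau>y ** (\<sigma>y ** dy ** \<tau>y)"
    using mul_cong[OF one_l[OF g'(1)]] mul_cong[OF one_l[OF d(1)]]
    by (simp add: mul_assoc mul_cong[OF \<sigma>(7)] mul_cong[OF \<sigma>(3)] mul_cong[OF g'(2)])
  show "hgood P y' (\<sigma>y ** dy ** \<tau>y) x' (\<sigma>x ** dx ** \<tau>x) (\<sigma>x ** e ** \<tau>y)"
    by (rule hgood_transport[OF g'(3,1) \<sigma> d])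
  show "D.hgood I x' (\<sigma>x ** dx ** \<tau>x) y' (\<sigma>y ** dy ** \<tau>y) (\<sigma>x ** e ** \<tau>y)"
    using D.hgood_transport[OF g'(4,1), of \<tau>x "- j" x' \<sigma>x \<tau>y y' \<sigma>y] \<sigma> d by (simp add: mul_assoc)
qed

lemma good_uminus: "good P I y dy x dx e \<Longrightarrow> good P I y (- dy) x (- dx) e"
  using hgood_uminus[of P y dy x dx e] D.hgood_uminus[of I x dx y dy e] by (auto simp: good_def mul_simps)

lemma good_lift:
  assumes g: "good P I y dy x dx e"
    and dy: "cx y dy" and dx: "cx x dx" and q: "q \<in> P" "bdd q" "cx q \<delta>"
    and a: "a \<in> H (k + 1) q y" and b: "b \<in> H k q x"
    and da: "dy ** a + a ** \<delta> = 0" and db: "dx ** b - b ** \<delta> = e ** a"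
  shows "\<exists>a'\<in>H k q y. \<exists>b'\<in>H (k - 1) q x.
    a = dy ** a' - a' ** \<delta> \<and> b = e ** a' - (dx ** b' + b' ** \<delta>)"
  using hgood_lift[OF goodD(3,1,2)[OF g] dy dx q a b da db] .

lemma cx_uminus: "cx a (- d) \<longleftrightarrow> cx a d"
  using H_uminus[of d 1 a a] H_uminus[of "- d" 1 a a] by (auto simp: cx_def mul_simps)

text \<open>The relation between \<open>f\<close> and \<open>h\<close> is the graph of the duality on arrows.\<close>

lemma good_forward:
  assumes g: "good P I y dy x dx e" and g': "good P I y' dy' x' dx' e'"
    and cx: "cx y dy" "cx y' dy'" "cx x' dx'" and y: "y \<in> P" "bdd y"
    and f: "f \<in> H 0 x x'" "dx' ** f = f ** dx"
  shows "\<exists>h\<in>H 0 y y'. dy' ** h = h ** dy \<and> hrel y dy x' dx' (f ** e - e' ** h)"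
proof -
  have "f ** e \<in> H 0 y x'" using H_mul'[OF f(1) goodD(1)[OF g]] by simp
  moreover have "dx' ** (f ** e) - (f ** e) ** dy = e' ** 0"
    using goodD(2)[OF g] by (simp add: mul_assoc mul_cong[OF f(2)])
  \<comment> \<open>The pair of 0 and \<open>f ** e\<close> is a cocycle of maps into the cone of
    \<open>e'\<close>. A primitive of it consists of the wanted \<open>h\<close> and, up to sign,
    the homotopy.\<close>
  ultimately obtain h t where h: "h \<in> H 0 y y'" "t \<in> H (- 1) y x'" "0 = dy' ** h - h ** dy"
    "f ** e = e' ** h - (dx' ** t + t ** dy)"
    using good_lift[OF g' cx(2,3) y cx(1), of 0 0 "f ** e"] by auto
  then have "f ** e - e' ** h = dx' ** (- t) + (- t) ** dy" by (simp add: mul_simps)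
  then show ?thesis using h H_uminus[OF h(2)] unfolding hrel_def by (intro bexI[OF _ h(1)]) auto
qed

text \<open>Together with a nullhomotopy \<open>s\<close> of \<open>e' ** h\<close>, the map
  \<open>h\<close> is a cocycle of maps into the cone of \<open>e'\<close>, and a primitive contains
  a nullhomotopy of \<open>h\<close>. Here \<open>k = - 1\<close>, so the parity changes and
  \<open>- dy\<close> is passed as the differential of the source.\<close>

lemma good_forward_null:
  assumes g: "good P I y' dy' x' dx' e'"
    and cx: "cx y dy" "cx y' dy'" "cx x' dx'" and y: "y \<in> P" "bdd y"
    and h: "h \<in> H 0 y y'" "dy' ** h = h ** dy" and 0: "hrel y dy x' dx' (e' ** h)"
  shows "hrel y dy y' dy' h"
proof -
  obtain s where s: "s \<in> H (- 1) y x'" "e' ** h = dx' ** s + s ** dy" using 0 by (auto simp: hrel_def)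
  have "\<exists>a'\<in>H (- 1) y y'. \<exists>b'\<in>H (- 1 - 1) y x'. h = dy' ** a' - a' ** (- dy) \<and> s = e' ** a' - (dx' ** b' + b' ** (- dy))"
    by (rule good_lift[OF g cx(2,3) y])
      (use cx h s in \<open>auto simp: cx_uminus mul_uminus\<close>)
  then show ?thesis by (auto simp: hrel_def mul_uminus)
qed

end

context grcat
begin

interpretation D: grcat "\<lambda>f g. g ** f" "\<lambda>k a b. H k b a" one "\<lambda>n. pr (- n)"
  by (rule dual)

lemma good_backward:
  assumes g: "good P I y dy x dx e" and g': "good P I y' dy' x' dx' e'"
    and cx: "cx y dy" "cx x dx" "cx x' dx'" and x: "x' \<in> I" "bdd x'"
    and h: "h \<in> H 0 y y'" "dy' ** h = h ** dy"
  shows "\<exists>f\<in>H 0 x x'. dx' ** f = f ** dx \<and> hrel y dy x' dx' (f ** e - e' ** h)"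
proof -
  obtain f where f: "f \<in> H 0 x x'" "f ** dx = dx' ** f" "D.hrel x' dx' y dy (e' ** h - f ** e)"
    using D.good_forward[of I P x' dx' y' dy' e' x dx y dy e h] assms by (auto simp: dual_simps)
  then obtain s where s: "s \<in> H (- 1) y x'" "e' ** h - f ** e = s ** dy + dx' ** s" by (auto simp: D.hrel_def)
  have "f ** e - e' ** h = - (e' ** h - f ** e)" by simp
  also have "\<dots> = dx' ** (- s) + (- s) ** dy" by (simp add: s mul_uminus)
  finally have "hrel y dy x' dx' (f ** e - e' ** h)" using H_uminus[OF s(1)] unfolding hrel_def by blast
  then show ?thesis using f(2) by (intro bexI[OF _ f(1)]) simp
qed

lemma good_backward_null:
  assumes g: "good P I y dy x dx e"
    and cx: "cx y dy" "cx x dx" "cx x' dx'" and x: "x' \<in> I" "bdd x'"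
    and f: "f \<in> H 0 x x'" "dx' ** f = f ** dx" and 0: "hrel y dy x' dx' (f ** e)"
  shows "hrel x dx x' dx' f"
proof -
  have "D.hrel x' dx' x dx f"
    using D.good_forward_null[of I P x dx y dy e x' dx' f] assms
    by (auto simp: dual_simps D.hrel_def hrel_def add.commute)
  then show ?thesis by (auto simp: D.hrel_def hrel_def add.commute)
qed

end

text \<open>Resolutions are required only for objects concentrated in a single degree, which is what
  \<open>one x = pr n x\<close> expresses; \<open>split_P\<close> and \<open>split_I\<close> cut an
  object into such a piece and the rest.\<close>

locale grpair = grcat +
  fixes P I :: "'b set"
  assumes biprod_P: "\<lbrakk>a \<in> P; b \<in> P\<rbrakk> \<Longrightarrow> \<exists>c\<in>P. \<exists>i\<^sub>1 i\<^sub>2 p\<^sub>1 p\<^sub>2. biprod a b c i\<^sub>1 i\<^sub>2 p\<^sub>1 p\<^sub>2"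
    and biprod_I: "\<lbrakk>a \<in> I; b \<in> I\<rbrakk> \<Longrightarrow> \<exists>c\<in>I. \<exists>i\<^sub>1 i\<^sub>2 p\<^sub>1 p\<^sub>2. biprod a b c i\<^sub>1 i\<^sub>2 p\<^sub>1 p\<^sub>2"
    and split_P: "a \<in> P \<Longrightarrow> \<exists>b\<in>P. \<exists>c\<in>P. \<exists>i\<^sub>1 i\<^sub>2 p\<^sub>1 p\<^sub>2. biprod b c a i\<^sub>1 i\<^sub>2 p\<^sub>1 p\<^sub>2 \<and> i\<^sub>1 ** p\<^sub>1 = pr n a"
    and split_I: "a \<in> I \<Longrightarrow> \<exists>b\<in>I. \<exists>c\<in>I. \<exists>i\<^sub>1 i\<^sub>2 p\<^sub>1 p\<^sub>2. biprod b c a i\<^sub>1 i\<^sub>2 p\<^sub>1 p\<^sub>2 \<and> i\<^sub>1 ** p\<^sub>1 = pr n a"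
    and zero_P: "\<exists>z\<in>P. one z = 0"
    and zero_I: "\<exists>z\<in>I. one z = 0"
    and res_I: "\<lbrakk>x \<in> I; one x = pr n x\<rbrakk> \<Longrightarrow> \<exists>y\<in>P. \<exists>dy e. bdd y \<and> cx y dy \<and> good P I y dy x 0 e"
    and res_P: "\<lbrakk>y \<in> P; one y = pr n y\<rbrakk> \<Longrightarrow> \<exists>x\<in>I. \<exists>dx e. bdd x \<and> cx x dx \<and> good P I y 0 x dx e"
begin

lemma dual_pair: "grpair (\<lambda>f g. g ** f) (\<lambda>k a b. H k b a) one (\<lambda>n. pr (- n)) I P"
proof -
  interpret D: grcat "\<lambda>f g. g ** f" "\<lambda>k a b. H k b a" one "\<lambda>n. pr (- n)"
    by (rule dual)
  have bi: "D.biprod b a c p1 p2 i1 i2 \<longleftrightarrow> biprod b a c i1 i2 p1 p2" for a b c p1 p2 i1 i2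
    by (auto simp: biprod_def D.biprod_def add.commute)
  show ?thesis
  proof
    show "\<exists>c\<in>I. \<exists>i1 i2 p1 p2. D.biprod a b c i1 i2 p1 p2" if "a \<in> I" "b \<in> I" for a b
      using biprod_I[OF that] unfolding bi by blast
    show "\<exists>c\<in>P. \<exists>i1 i2 p1 p2. D.biprod a b c i1 i2 p1 p2" if "a \<in> P" "b \<in> P" for a b
      using biprod_P[OF that] unfolding bi by blast
    show "\<exists>b\<in>I. \<exists>c\<in>I. \<exists>i1 i2 p1 p2. D.biprod b c a i1 i2 p1 p2 \<and> p1 ** i1 = pr (- n) a" if "a \<in> I" for a n
      using split_I[OF that] unfolding bi by blast
    show "\<exists>b\<in>P. \<exists>c\<in>P. \<exists>i1 i2 p1 p2. D.biprod b c a i1 i2 p1 p2 \<and> p1 ** i1 = pr (- n) a" if "a \<in> P" for a n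
      using split_P[OF that] unfolding bi by blast
    show "\<exists>y\<in>I. \<exists>dy e. D.bdd y \<and> D.cx y dy \<and> D.good I P y dy x 0 e"
      if "x \<in> P" "one x = pr (- n) x" for x n
      using res_P[OF that] by (simp add: dual_simps)
    show "\<exists>x\<in>P. \<exists>dx e. D.bdd x \<and> D.cx x dx \<and> D.good I P y 0 x dx e"
      if "y \<in> I" "one y = pr (- n) y" for y n
      using res_I[OF that] by (simp add: dual_simps)
  qed (auto intro: zero_P zero_I)
qed

lemma biprod_pr_zero:
  assumes B: "biprod a b c i1 i2 p1 p2" and 0: "pr n a = 0" "pr n b = 0"
  shows "pr n c = 0"
proof -
  have B': "i1 \<in> H 0 a c" "i2 \<in> H 0 b c" "i1 ** p1 + i2 ** p2 = one c" using B by (auto simp: biprod_def)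
  have "pr n c ** i1 = 0" "pr n c ** i2 = 0"
    using pr_comm[OF B'(1), of n] pr_comm[OF B'(2), of n] 0 by simp_all
  then show ?thesis
    using one_r[OF H_pr, of n c] by (simp add: B'(3)[symmetric] mul_add mul_assoc[symmetric])
qed

text \<open>Induction on the number of nonzero degrees. The lowest component \<open>x1\<close> is a
  quotient of the complex and the rest \<open>x2\<close> a subcomplex. Their resolutions are joined
  by a lift of the connecting map \<open>t\<close>; it exists because the resolution of
  \<open>x1\<close> is a bounded complex in \<open>P\<close>.\<close>

theorem ex_good_I:
  assumes "x \<in> I" "cx x dx" "bdd x"
  shows "\<exists>y\<in>P. \<exists>dy e. bdd y \<and> cx y dy \<and> good P I y dy x dx e"
  using assms
proof (induction "card {n. pr n x \<noteq> 0}" arbitrary: x dx rule: less_induct)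
  case less
  have fin: "finite {n. pr n x \<noteq> 0}" using less.prems by (simp add: bdd_def)
  show ?case
  proof (cases "{n. pr n x \<noteq> 0} = {}")
    case True
    then have "one x = 0" using pr_sep[OF H_one, of x] one_l[OF H_pr] by auto
    then have x0: "f = 0" if "f \<in> H k a x \<or> f \<in> H k x a" for f k a
      using that one_l[of f k a x] one_r[of f k x a] by auto
    obtain z where z: "z \<in> P" "one z = 0" using zero_P by blast
    then have z0: "f = 0" if "f \<in> H k a z \<or> f \<in> H k z a" for f k a
      using that one_l[of f k a z] one_r[of f k z a] by auto
    interpret D: grcat "\<lambda>f g. g ** f" "\<lambda>k a b. H k b a" one "\<lambda>n. pr (- n)" by (rule dual)
    have "good P I z 0 x dx 0"
      unfolding good_def hgood_def D.hgood_def
    proof (intro conjI ballI allI impI)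
      fix q k a b assume "a \<in> H (k + 1) q z" "b \<in> H k q x"
      then have "a = 0" "b = 0" using z0 x0 by blast+
      then show "\<exists>a'\<in>H k q z. \<exists>b'\<in>H (k - 1) q x. a = 0 ** a' \<and> b = 0 ** a' - dx ** b'"
        by (intro bexI[of _ 0]) auto
    next
      fix q k a b assume "a \<in> H (k + 1) x q" "b \<in> H k z q"
      then have "a = 0" "b = 0" using z0 x0 by blast+
      then show "\<exists>a'\<in>H k x q. \<exists>b'\<in>H (k - 1) z q. a = a' ** dx \<and> b = a' ** 0 - b' ** 0"
        by (intro bexI[of _ 0]) auto
    qed auto
    moreover have "bdd z" using z0[OF disjI1[OF H_pr]] by (simp add: bdd_def)
    moreover have "cx z 0" by (simp add: cx_def)
    ultimately show ?thesis using z(1) by blast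
  next
    case False
    \<comment> \<open>Nothing lies in degree \<open>n - 1\<close>, so no differential ends in degree
      \<open>n\<close>. This makes the lowest component a quotient.\<close>
    define n where "n = Min {n. pr n x \<noteq> 0}"
    have n: "pr n x \<noteq> 0" using Min_in[OF fin False] by (simp add: n_def)
    have "pr (n - 1) x = 0" using Min_le[OF fin, of "n - 1"] by (auto simp: n_def)
    have d: "dx \<in> H 1 x x" "dx ** dx = 0" using less.prems by (auto simp: cx_def)
    have prd: "pr n x ** dx = 0" using pr_comm[OF d(1), of "n - 1"] \<open>pr (n - 1) x = 0\<close> by simp
    obtain x1 x2 i1 i2 p1 p2 where x12: "x1 \<in> I" "x2 \<in> I" and B: "biprod x1 x2 x i1 i2 p1 p2" and ip: "i1 ** p1 = pr n x"
      using split_I[OF less.prems(1), of n] by blast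
    have Beq: "p1 ** i1 = one x1" "p2 ** i2 = one x2" "p2 ** i1 = 0" "p1 ** i2 = 0" "i1 ** p1 + i2 ** p2 = one x"
      and BH: "i1 \<in> H 0 x1 x" "i2 \<in> H 0 x2 x" "p1 \<in> H 0 x x1" "p2 \<in> H 0 x x2" using B by (auto simp: biprod_def)
    have p1d: "p1 ** dx = 0"
    proof -
      have "p1 ** dx = p1 ** (i1 ** (p1 ** dx))"
        using mul_cong[OF Beq(1)] mul_cong[OF one_l[OF BH(3)]] by simp
      also have "\<dots> = 0" using prd by (simp add: mul_assoc[symmetric] ip mul_cong)
      finally show ?thesis .
    qed
    define d2 where "d2 = p2 ** dx ** i2"
    define t where "t = p2 ** dx ** i1"
    have dx: "dx ** f = i2 ** (p2 ** (dx ** f))" for f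
    proof -
      have "dx = (i1 ** p1 + i2 ** p2) ** dx" using Beq(5) one_l[OF d(1)] by simp
      then have "dx = i2 ** (p2 ** dx)" by (simp add: mul_simps p1d)
      then show ?thesis by (metis mul_assoc)
    qed
    have ddx: "dx ** (i2 ** (p2 ** (dx ** f))) = 0" for f
      using dx[of f] mul_cong[OF d(2), of f] by simp
    have d2: "cx x2 d2" and t: "t \<in> H 1 x1 x2" "d2 ** t + t ** 0 = 0"
      unfolding cx_def d2_def t_def
      using H_mul'[OF H_mul'[OF BH(4) d(1) refl] BH(2)] H_mul'[OF H_mul'[OF BH(4) d(1) refl] BH(1)]
      by (auto simp: mul_assoc ddx)
    have dxeq: "dx = i1 ** 0 ** p1 + i2 ** d2 ** p2 + i2 ** t ** p1"
    proof -
      have "dx = dx ** (i1 ** p1 + i2 ** p2)" using Beq(5) one_r[OF d(1)] by simp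
      also have "\<dots> = i2 ** t ** p1 + i2 ** d2 ** p2" 
        by (simp add: mul_simps d2_def t_def dx[symmetric])
      finally show ?thesis by (simp add: add.commute)
    qed
    have prx2: "pr m x2 = p2 ** (pr m x ** i2)" for m
    proof -
      have "pr m x2 = pr m x2 ** (p2 ** i2)" using one_r[OF H_pr] Beq by simp
      then show ?thesis using pr_comm[OF BH(4), of m] by (simp add: mul_assoc[symmetric])
    qed
    have "pr n x2 = 0" by (simp add: prx2 ip[symmetric] mul_assoc Beq)
    then have sub: "{m. pr m x2 \<noteq> 0} \<subset> {m. pr m x \<noteq> 0}" using n by (auto simp: prx2)
    then have "card {m. pr m x2 \<noteq> 0} < card {m. pr m x \<noteq> 0}" by (rule psubset_card_mono[OF fin])
    moreover have "bdd x2" using sub fin by (auto simp: bdd_def intro: finite_subset)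
    ultimately obtain y2 dy2 e2 where y2: "y2 \<in> P" "bdd y2" "cx y2 dy2" "good P I y2 dy2 x2 d2 e2"
      using less.hyps x12 d2 by blast
    have "one x1 = pr n x1"
    proof -
      have "one x1 = p1 ** (i1 ** p1) ** i1" using mul_cong[OF Beq(1)] Beq(1) one_l[OF H_one] by (simp add: mul_assoc)
      also have "\<dots> = pr n x1 ** (p1 ** i1)" unfolding ip using pr_comm[OF BH(3), of n] by (simp add: mul_assoc[symmetric])
      finally show ?thesis using Beq one_r[OF H_pr] by simp
    qed
    from res_I[OF x12(1) this] obtain y1 dy1 e1 where y1: "y1 \<in> P" "bdd y1" "cx y1 dy1" "good P I y1 dy1 x1 0 e1"
      by blast
    note e1 = goodD(1,2)[OF y1(4)]
    \<comment> \<open>\<open>u\<close> and \<open>s\<close> lift \<open>t ** e1\<close> through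
      \<open>e2\<close>. The degree \<open>k = 1\<close> is odd, hence \<open>- dy1\<close>; as a
      result \<open>u\<close> anticommutes with the differentials, which is what makes
      \<open>dy\<close> square to zero.\<close>
    obtain u s where u: "u \<in> H 1 y1 y2" and s: "s \<in> H 0 y1 x2" and
      eqs: "0 = dy2 ** u - u ** (- dy1)" "t ** e1 = e2 ** u - (d2 ** s + s ** (- dy1))"
    proof -
      have "d2 ** (t ** e1) - (t ** e1) ** (- dy1) = e2 ** 0"
        using mul_cong[of d2 t 0] t(2) e1(2) by (simp add: mul_simps)
      then show ?thesis
        using good_lift[OF y2(4,3) d2 y1(1,2), of "- dy1" 0 1 "t ** e1"] y1(3) H_mul'[OF t(1) e1(1)] that
        by (auto simp: cx_uminus)
    qed
    have eqs': "dy2 ** u + u ** dy1 = 0" "t ** e1 - e2 ** u = s ** dy1 - d2 ** s"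
      using eqs by (simp_all add: mul_uminus algebra_simps)
    obtain y j1 j2 q1 q2 where y: "y \<in> P" and Y: "biprod y1 y2 y j1 j2 q1 q2" using biprod_P y1 y2 by blast
    have Yeq: "q1 ** j1 = one y1" "q2 ** j2 = one y2" "q2 ** j1 = 0" "q1 ** j2 = 0"
      and YH: "j1 \<in> H 0 y1 y" "j2 \<in> H 0 y2 y" "q1 \<in> H 0 y y1" "q2 \<in> H 0 y y2" using Y by (auto simp: biprod_def)
    define dy where "dy = j1 ** dy1 ** q1 + j2 ** dy2 ** q2 + j2 ** u ** q1"
    have g: "good P I y dy x dx (i1 ** e1 ** q1 + i2 ** e2 ** q2 + i2 ** s ** q1)"
      unfolding dy_def by (subst dxeq, rule good_ext[OF y1(4) y2(4) B Y _ d2 y1(3) y2(3) t u eqs'(1) s eqs'(2)])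
        (simp add: cx_def)
    have dH: "dy1 \<in> H 1 y1 y1" "dy1 ** dy1 = 0" "dy2 \<in> H 1 y2 y2" "dy2 ** dy2 = 0" using y1 y2 by (auto simp: cx_def)
    have "dy \<in> H 1 y y"
      using H_mul'[OF H_mul'[OF YH(1) dH(1) refl] YH(3)] H_mul'[OF H_mul'[OF YH(2) dH(3) refl] YH(4)]
        H_mul'[OF H_mul'[OF YH(2) u refl] YH(3)] by (auto simp: dy_def intro!: H_add)
    moreover have "dy ** dy = 0"
    proof -
      have "dy2 ** (u ** f) = - (u ** (dy1 ** f))" for f
        using arg_cong[OF eqs'(1), of "\<lambda>g. g ** f"] by (simp add: mul_simps eq_neg_iff_add_eq_0)
      then show ?thesis
        unfolding dy_def
        by (simp add: mul_simps Yeq mul_cong[OF Yeq(1)] mul_cong[OF Yeq(2)] mul_cong[OF Yeq(3)] mul_cong[OF Yeq(4)]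
            mul_cong[OF dH(2)] mul_cong[OF dH(4)] mul_cong[OF one_l[OF dH(1)]] mul_cong[OF one_l[OF dH(3)]]
            mul_cong[OF one_l[OF u]])
    qed
    moreover have "bdd y"
    proof -
      have "{m. pr m y \<noteq> 0} \<subseteq> {m. pr m y1 \<noteq> 0} \<union> {m. pr m y2 \<noteq> 0}" using biprod_pr_zero[OF Y] by auto
      then show ?thesis using y1(2) y2(2) by (auto simp: bdd_def intro: finite_subset)
    qed
    ultimately show ?thesis using y g unfolding cx_def by blast
  qed
qed

end

context grpair
begin

theorem ex_good_P:
  assumes "y \<in> P" "cx y dy" "bdd y"
  shows "\<exists>x\<in>I. \<exists>dx e. bdd x \<and> cx x dx \<and> good P I y dy x dx e"
proof -
  interpret D: grpair "\<lambda>f g. g ** f" "\<lambda>k a b. H k b a" one "\<lambda>n. pr (- n)" I P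
    by (rule dual_pair)
  show ?thesis using D.ex_good_I[of y dy] assms by (simp add: dual_simps)
qed

end

section \<open>Triangles in the bounded homotopy category\<close>

text \<open>
  A faithful representation of the graded objects over a preadditive category \<open>C\<close> inside a
  \<open>grcat\<close>, which turns all statements on complexes over \<open>C\<close> into statements on elements of \<open>'r\<close>.
\<close>

locale krep = precat C + grcat mul H one pr
  for C :: "('o, 'm) preadd_cat"
    and mul :: "'r :: ab_group_add \<Rightarrow> 'r \<Rightarrow> 'r" (infixl \<open>**\<close> 70)
    and H :: "int \<Rightarrow> 'x \<Rightarrow> 'x \<Rightarrow> 'r set"
    and one :: "'x \<Rightarrow> 'r"
    and pr :: "int \<Rightarrow> 'x \<Rightarrow> 'r" +
  fixes ob :: "'o gr \<Rightarrow> 'x"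
    and \<rho> :: "int \<Rightarrow> 'o gr \<Rightarrow> 'o gr \<Rightarrow> 'm gr \<Rightarrow> 'r"
  assumes \<rho>_bij: "\<lbrakk>X \<in> gobj C; Y \<in> gobj C\<rbrakk> \<Longrightarrow> bij_betw (\<rho> k X Y) (gmap C k X Y) (H k (ob X) (ob Y))"
    and \<rho>_plus: "\<lbrakk>X \<in> gobj C; Y \<in> gobj C; f \<in> gmap C k X Y; g \<in> gmap C k X Y\<rbrakk>
      \<Longrightarrow> \<rho> k X Y (gplus C k X Y f g) = \<rho> k X Y f + \<rho> k X Y g"
    and \<rho>_comp: "\<lbrakk>X \<in> gobj C; Y \<in> gobj C; Z \<in> gobj C; f \<in> gmap C k X Y; g \<in> gmap C l Y Z\<rbrakk>
      \<Longrightarrow> \<rho> (k + l) X Z (gcomp C k l X Y Z g f) = \<rho> l Y Z g ** \<rho> k X Y f"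
    and \<rho>_id: "X \<in> gobj C \<Longrightarrow> \<rho> 0 X X (gid C X) = one (ob X)"
    and \<rho>_proj: "X \<in> gobj C \<Longrightarrow> \<rho> 0 X X (gproj C n X) = pr n (ob X)"
begin

lemma \<rho>_in: "\<lbrakk>X \<in> gobj C; Y \<in> gobj C; f \<in> gmap C k X Y\<rbrakk> \<Longrightarrow> \<rho> k X Y f \<in> H k (ob X) (ob Y)"
  using \<rho>_bij bij_betwE by blast

lemma \<rho>_inject: "\<lbrakk>X \<in> gobj C; Y \<in> gobj C; f \<in> gmap C k X Y; g \<in> gmap C k X Y\<rbrakk>
    \<Longrightarrow> \<rho> k X Y f = \<rho> k X Y g \<longleftrightarrow> f = g"
  using \<rho>_bij[THEN bij_betw_imp_inj_on] by (auto dest: inj_onD)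

lemma \<rho>_surj:
  assumes "X \<in> gobj C" "Y \<in> gobj C" "a \<in> H k (ob X) (ob Y)"
  obtains f where "f \<in> gmap C k X Y" "a = \<rho> k X Y f"
  using \<rho>_bij[OF assms(1,2), THEN bij_betw_imp_surj_on] assms(3) by blast

lemma \<rho>_null: "\<lbrakk>X \<in> gobj C; Y \<in> gobj C\<rbrakk> \<Longrightarrow> \<rho> k X Y (gnull C k X Y) = 0"
proof -
  assume X: "X \<in> gobj C" "Y \<in> gobj C"
  have "gplus C k X Y (gnull C k X Y) (gnull C k X Y) = gnull C k X Y"
    using X by (simp add: gplus_def gnull_def Plus_Null Null_in gobjD)
  then show ?thesis
    using \<rho>_plus[OF X gmap_closed(1)[OF X] gmap_closed(1)[OF X], of k] by simp
qed

lemma \<rho>_neg: "\<lbrakk>X \<in> gobj C; Y \<in> gobj C; f \<in> gmap C k X Y\<rbrakk> \<Longrightarrow> \<rho> k X Y (gneg C k X Y f) = - \<rho> k X Y f"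
proof -
  assume X: "X \<in> gobj C" "Y \<in> gobj C" "f \<in> gmap C k X Y"
  have "gplus C k X Y f (gneg C k X Y f) = gnull C k X Y"
    using X gmapD[OF X(3)] by (simp add: gplus_def gneg_def gnull_def Plus_Neg gobjD)
  then show ?thesis
    using \<rho>_plus[OF X gmap_closed(4)[OF X]] \<rho>_null[OF X(1,2), of k]
    by (simp add: eq_neg_iff_add_eq_0 add.commute)
qed

abbreviation bc :: "('o, 'm) cochain set" where "bc \<equiv> bounded_complexes C"
abbreviation oc :: "('o, 'm) cochain \<Rightarrow> 'x" where "oc X \<equiv> ob (Ob X)"

section \<open>Complexes, chain maps and homotopies as ring elements\<close>

definition dl :: "('o, 'm) cochain \<Rightarrow> 'r" where "dl X = \<rho> 1 (Ob X) (Ob X) (Df X)"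

lemma bcI:
  assumes "Ob X \<in> gobj C" "Df X \<in> gmap C 1 (Ob X) (Ob X)" "cx (oc X) (dl X)" "bdd (oc X)"
  shows "X \<in> bc"
proof -
  note X = assms(1,2)
  have "gcomp C 1 1 (Ob X) (Ob X) (Ob X) (Df X) (Df X) = gnull C (1 + 1) (Ob X) (Ob X)"
    using assms(3) \<rho>_inject[OF X(1,1) gcomp_closed[OF X(1,1,1,2,2)] gmap_closed(1)[OF X(1,1)]]
      \<rho>_comp[OF X(1,1,1,2,2)]
    by (simp add: cx_def dl_def X \<rho>_null)
  then have "\<And>n. Comp C (Ob X n) (Ob X (n + 1)) (Ob X (n + 2)) (Df X (n + 1)) (Df X n) = Null C (Ob X n) (Ob X (n + 2))"
    by (simp add: gcomp_def gnull_def fun_eq_iff add.assoc)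
  moreover obtain N where "\<forall>n\<in>{n. pr n (oc X) \<noteq> 0}. \<bar>n\<bar> \<le> N"
    using assms(4) unfolding bdd_def by (metis finite_imageI finite_nat_set_iff_bounded_le
        finite_set_choice Max_ge imageI)
  moreover have "zero_object C (Ob X n)" if "pr n (oc X) = 0" for n
  proof -
    have "gproj C n (Ob X) = gnull C 0 (Ob X) (Ob X)"
      using \<rho>_inject[OF X(1,1) gmap_closed(3)[OF X(1,1)] gmap_closed(1)[OF X(1,1)]] that
      by (simp add: \<rho>_proj X \<rho>_null)
    from fun_cong[OF this, of n] show ?thesis
      using X(1) by (simp add: gproj_def gnull_def zero_object_def gobjD)
  qed
  ultimately show ?thesis using X unfolding bounded_complexes_def
    by (auto simp: gobjD gmap_def) (metis leD linorder_not_le)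
qed

lemma bcD:
  assumes "X \<in> bc"
  shows "Ob X \<in> gobj C" "Df X \<in> gmap C 1 (Ob X) (Ob X)" "cx (oc X) (dl X)" "bdd (oc X)"
    "dl X \<in> H 1 (oc X) (oc X)" "dl X ** dl X = 0"
proof -
  show X: "Ob X \<in> gobj C" "Df X \<in> gmap C 1 (Ob X) (Ob X)"
    using assms by (auto simp: bounded_complexes_def gobj_def gmap_def)
  have "gcomp C 1 1 (Ob X) (Ob X) (Ob X) (Df X) (Df X) = gnull C (1 + 1) (Ob X) (Ob X)"
    using assms by (auto simp: bounded_complexes_def gcomp_def gnull_def fun_eq_iff add.assoc)
  then show cx: "cx (oc X) (dl X)"
    using \<rho>_comp[OF X(1,1,1,2,2)] \<rho>_in[OF X(1,1,2)] by (simp add: cx_def dl_def \<rho>_null X)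
  then show "dl X \<in> H 1 (oc X) (oc X)" "dl X ** dl X = 0" by (auto simp: cx_def)
  obtain N where N: "\<And>n. \<bar>n\<bar> > N \<Longrightarrow> zero_object C (Ob X n)" using assms by (auto simp: bounded_complexes_def)
  have "pr n (oc X) = 0" if "\<bar>n\<bar> > N" for n
  proof -
    have "gproj C n (Ob X) = gnull C 0 (Ob X) (Ob X)"
      using N[OF that] by (auto simp: gproj_def gnull_def fun_eq_iff zero_object_def)
    then show ?thesis using \<rho>_proj[OF X(1), of n] \<rho>_null[OF X(1,1), of 0] by simp
  qed
  then have "{n. pr n (oc X) \<noteq> 0} \<subseteq> {- N..N}" by (auto simp: abs_le_iff not_less[symmetric] minus_le_iff)
  then show "bdd (oc X)" unfolding bdd_def by (rule finite_subset) simp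
qed

definition cyc :: "('o, 'm) cochain \<Rightarrow> ('o, 'm) cochain \<Rightarrow> 'r set" where
  "cyc X Y = {a \<in> H 0 (oc X) (oc Y). dl Y ** a = a ** dl X}"

abbreviation hr :: "('o, 'm) cochain \<Rightarrow> ('o, 'm) cochain \<Rightarrow> 'r \<Rightarrow> bool" where
  "hr X Y \<equiv> hrel (oc X) (dl X) (oc Y) (dl Y)"

abbreviation \<rho>0 :: "('o, 'm) cochain \<Rightarrow> ('o, 'm) cochain \<Rightarrow> 'm gr \<Rightarrow> 'r" where
  "\<rho>0 X Y \<equiv> \<rho> 0 (Ob X) (Ob Y)"

lemma chain_maps_iff:
  assumes "X \<in> bc" "Y \<in> bc"
  shows "f \<in> chain_maps C X Y \<longleftrightarrow> f \<in> gmap C 0 (Ob X) (Ob Y) \<and> \<rho>0 X Y f \<in> cyc X Y"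
proof (cases "f \<in> gmap C 0 (Ob X) (Ob Y)")
  case True
  note X = bcD(1,2)[OF assms(1)] and Y = bcD(1,2)[OF assms(2)]
  have "dl Y ** \<rho>0 X Y f = \<rho>0 X Y f ** dl X \<longleftrightarrow>
    gcomp C 1 0 (Ob X) (Ob X) (Ob Y) f (Df X) = gcomp C 0 1 (Ob X) (Ob Y) (Ob Y) (Df Y) f"
    using \<rho>_comp[OF X(1,1) Y(1) X(2) True] \<rho>_comp[OF X(1) Y(1,1) True Y(2)]
      \<rho>_inject[OF X(1) Y(1) gcomp_closed[OF X(1,1) Y(1) X(2) True]] gcomp_closed[OF X(1) Y(1,1) True Y(2)]
    by (simp add: dl_def) (metis)
  also have "\<dots> \<longleftrightarrow> f \<in> chain_maps C X Y"
    using True by (auto simp: chain_maps_def gcomp_def fun_eq_iff gmap_def)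
  finally show ?thesis using True \<rho>_in[OF X(1) Y(1) True] by (simp add: cyc_def)
qed (auto simp: chain_maps_def gmap_def)

lemma cyc_surj:
  assumes "X \<in> bc" "Y \<in> bc" "a \<in> cyc X Y"
  obtains f where "f \<in> chain_maps C X Y" "a = \<rho>0 X Y f"
proof -
  have "a \<in> H 0 (oc X) (oc Y)" using assms by (simp add: cyc_def)
  then obtain f where "f \<in> gmap C 0 (Ob X) (Ob Y)" "a = \<rho>0 X Y f"
    using \<rho>_surj[OF bcD(1)[OF assms(1)] bcD(1)[OF assms(2)]] by metis
  then show ?thesis using that chain_maps_iff assms by blast
qed

lemma homotopy_rel_iff:
  assumes "X \<in> bc" "Y \<in> bc"
  shows "(f, g) \<in> homotopy_rel C X Y \<longleftrightarrow> f \<in> chain_maps C X Y \<and> g \<in> chain_maps C X Y \<and>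
    hr X Y (\<rho>0 X Y f - \<rho>0 X Y g)"
proof (cases "f \<in> chain_maps C X Y \<and> g \<in> chain_maps C X Y")
  case True
  note X = bcD(1,2)[OF assms(1)] and Y = bcD(1,2)[OF assms(2)]
  have fg: "f \<in> gmap C 0 (Ob X) (Ob Y)" "g \<in> gmap C 0 (Ob X) (Ob Y)" using True chain_maps_iff assms by auto
  let ?u = "\<lambda>s. gcomp C (-1) 1 (Ob X) (Ob Y) (Ob Y) (Df Y) s"
  let ?v = "\<lambda>s. gcomp C 1 (-1) (Ob X) (Ob X) (Ob Y) s (Df X)"
  let ?w = "\<lambda>s. gplus C 0 (Ob X) (Ob Y) g (gplus C 0 (Ob X) (Ob Y) (?u s) (?v s))"
  have uv: "?u s \<in> gmap C 0 (Ob X) (Ob Y)" "?v s \<in> gmap C 0 (Ob X) (Ob Y)"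
    "\<rho>0 X Y (?u s) = dl Y ** \<rho> (-1) (Ob X) (Ob Y) s" "\<rho>0 X Y (?v s) = \<rho> (-1) (Ob X) (Ob Y) s ** dl X"
    if s: "s \<in> gmap C (-1) (Ob X) (Ob Y)" for s
    using \<rho>_comp[OF X(1,1) Y(1) X(2) s] \<rho>_comp[OF X(1) Y(1,1) s Y(2)]
      gcomp_closed[OF X(1,1) Y(1) X(2) s] gcomp_closed[OF X(1) Y(1,1) s Y(2)] by (auto simp: dl_def)
  have w: "?w s \<in> gmap C 0 (Ob X) (Ob Y)" "\<rho>0 X Y (?w s) =
      \<rho>0 X Y g + (dl Y ** \<rho> (-1) (Ob X) (Ob Y) s + \<rho> (-1) (Ob X) (Ob Y) s ** dl X)"
    if s: "s \<in> gmap C (-1) (Ob X) (Ob Y)" for s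
    using uv[OF s] fg X Y by (auto simp: \<rho>_plus gmap_closed)
  have "(f, g) \<in> homotopy_rel C X Y \<longleftrightarrow> (\<exists>s \<in> gmap C (-1) (Ob X) (Ob Y). f = ?w s)"
    using True by (auto simp: homotopy_rel_def gmap_def gplus_def gcomp_def fun_eq_iff)
  also have "\<dots> \<longleftrightarrow> (\<exists>s \<in> gmap C (-1) (Ob X) (Ob Y). \<rho>0 X Y f = \<rho>0 X Y g +
      (dl Y ** \<rho> (-1) (Ob X) (Ob Y) s + \<rho> (-1) (Ob X) (Ob Y) s ** dl X))"
    using w \<rho>_inject[OF X(1) Y(1) fg(1)] by metis
  also have "\<dots> \<longleftrightarrow> (\<exists>s \<in> H (-1) (oc X) (oc Y). \<rho>0 X Y f = \<rho>0 X Y g + (dl Y ** s + s ** dl X))"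
    using \<rho>_surj[OF X(1) Y(1)] \<rho>_in[OF X(1) Y(1)] by metis
  finally show ?thesis using True by (simp add: hrel_def diff_eq_eq add.commute)
qed (auto simp: homotopy_rel_def)

end

context grcat
begin

lemma hrel_zero [simp]: "hrel a da b db 0"
  unfolding hrel_def by (rule bexI[of _ 0]) auto

lemma hrel_add: "\<lbrakk>hrel a da b db f; hrel a da b db g\<rbrakk> \<Longrightarrow> hrel a da b db (f + g)"
  unfolding hrel_def
proof (elim bexE)
  fix s t assume "s \<in> H (- 1) a b" "f = db ** s + s ** da" "t \<in> H (- 1) a b" "g = db ** t + t ** da"
  then show "\<exists>s\<in>H (- 1) a b. f + g = db ** s + s ** da"
    by (intro bexI[of _ "s + t"]) (auto simp: mul_simps algebra_simps H_add)
qed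

lemma hrel_uminus: "hrel a da b db f \<Longrightarrow> hrel a da b db (- f)"
  unfolding hrel_def by (auto simp: mul_simps algebra_simps intro!: bexI[OF _ H_uminus])

lemma hrel_commute: "hrel a da b db (f - g) \<Longrightarrow> hrel a da b db (g - f)"
  using hrel_uminus[of a da b db "f - g"] by simp

lemma hrel_trans: "\<lbrakk>hrel a da b db (f - g); hrel a da b db (g - h)\<rbrakk> \<Longrightarrow> hrel a da b db (f - h)"
  using hrel_add[of a da b db "f - g" "g - h"] by simp

lemma hrel_mul_l:
  assumes "hrel a da b db f" "g \<in> H 0 b c" "dc ** g = g ** db"
  shows "hrel a da c dc (g ** f)"
proof -
  obtain s where s: "s \<in> H (- 1) a b" "f = db ** s + s ** da" using assms(1) by (auto simp: hrel_def)
  have "g ** f = dc ** (g ** s) + (g ** s) ** da" by (simp add: s mul_simps mul_cong[OF assms(3)])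
  then show ?thesis using H_mul'[OF assms(2) s(1)] by (auto simp: hrel_def)
qed

lemma hrel_mul_r:
  assumes "hrel b db c dc f" "g \<in> H 0 a b" "db ** g = g ** da"
  shows "hrel a da c dc (f ** g)"
proof -
  obtain s where s: "s \<in> H (- 1) b c" "f = dc ** s + s ** db" using assms(1) by (auto simp: hrel_def)
  have "f ** g = dc ** (s ** g) + (s ** g) ** da" by (simp add: s mul_simps assms(3))
  then show ?thesis using H_mul'[OF s(1) assms(2)] by (auto simp: hrel_def)
qed

end

section \<open>Arrows of the homotopy category\<close>

context krep
begin

text \<open>The homotopy class named by a ring element instead of by a chain map. Every arrow of
  \<open>Kb C\<close> has this form, and \<open>cls_eq_iff\<close> turns equality of arrows into
  \<open>hr\<close>.\<close>

definition cls :: "('o, 'm) cochain \<Rightarrow> ('o, 'm) cochain \<Rightarrow> 'r \<Rightarrow> 'm gr set" where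
  "cls X Y a = {f \<in> chain_maps C X Y. hr X Y (a - \<rho>0 X Y f)}"

lemma cycD: "a \<in> cyc X Y \<Longrightarrow> a \<in> H 0 (oc X) (oc Y)" "a \<in> cyc X Y \<Longrightarrow> dl Y ** a = a ** dl X"
  by (auto simp: cyc_def)

lemma cyc_mul: "\<lbrakk>b \<in> cyc Y Z; a \<in> cyc X Y\<rbrakk> \<Longrightarrow> b ** a \<in> cyc X Z"
  using H_mul'[of b 0 "oc Y" "oc Z" a 0 "oc X" 0] by (simp add: cyc_def) (metis mul_assoc)

lemma cyc_add: "\<lbrakk>a \<in> cyc X Y; b \<in> cyc X Y\<rbrakk> \<Longrightarrow> a + b \<in> cyc X Y"
  by (auto simp: cyc_def mul_simps intro: H_add)

lemma cyc_one: "X \<in> bc \<Longrightarrow> one (oc X) \<in> cyc X X"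
  using bcD(5)[of X] by (simp add: cyc_def one_l one_r)

lemma cls_eq_iff:
  assumes "X \<in> bc" "Y \<in> bc" "a \<in> cyc X Y" "b \<in> cyc X Y"
  shows "cls X Y a = cls X Y b \<longleftrightarrow> hr X Y (a - b)"
proof
  assume eq: "cls X Y a = cls X Y b"
  obtain f where f: "f \<in> chain_maps C X Y" "a = \<rho>0 X Y f" using cyc_surj[OF assms(1-3)] by metis
  then have "f \<in> cls X Y a" by (simp add: cls_def)
  then have "hr X Y (b - a)" unfolding eq by (simp add: cls_def f)
  then show "hr X Y (a - b)" by (rule hrel_commute)
next
  assume h: "hr X Y (a - b)"
  then show "cls X Y a = cls X Y b"
    unfolding cls_def using hrel_trans[OF h] hrel_trans[OF hrel_commute[OF h]] by (intro Collect_cong) blast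
qed

lemma hclass_eq:
  assumes "X \<in> bc" "Y \<in> bc" "f \<in> chain_maps C X Y"
  shows "hclass C X Y f = cls X Y (\<rho>0 X Y f)"
  using assms by (auto simp: hclass_def cls_def homotopy_rel_iff)

lemma chain_cyc: "\<lbrakk>X \<in> bc; Y \<in> bc; f \<in> chain_maps C X Y\<rbrakk> \<Longrightarrow> \<rho>0 X Y f \<in> cyc X Y"
  using chain_maps_iff by blast

lemma cls_self: "f \<in> chain_maps C X Y \<Longrightarrow> f \<in> cls X Y (\<rho>0 X Y f)"
  by (simp add: cls_def)

lemma cls_mem:
  assumes "X \<in> bc" "Y \<in> bc" "a \<in> cyc X Y" "f \<in> cls X Y a"
  shows "f \<in> chain_maps C X Y" "cls X Y (\<rho>0 X Y f) = cls X Y a"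
proof -
  show 1: "f \<in> chain_maps C X Y" using assms by (simp add: cls_def)
  show "cls X Y (\<rho>0 X Y f) = cls X Y a"
    using assms hrel_commute unfolding cls_eq_iff[OF assms(1,2) chain_cyc[OF assms(1,2) 1] assms(3)]
    by (simp add: cls_def)
qed

lemma Kb_Obj [simp]: "Obj (Kb C) = bc" and Kb_Shift [simp]: "Shift (Kb C) = shift_complex C"
  and Kb_ShiftArr [simp]: "ShiftArr (Kb C) X Y = Kb_shift_arr" and Kb_Dist [simp]: "Dist (Kb C) = Kb_dist C"
  by (simp_all add: Kb_def Kb_cat_def)

lemma Kb_Arr:
  assumes "X \<in> bc" "Y \<in> bc"
  shows "Arr (Kb C) X Y = cls X Y ` cyc X Y"
proof -
  have "chain_maps C X Y // homotopy_rel C X Y = (\<lambda>f. hclass C X Y f) ` chain_maps C X Y"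
    by (auto simp: quotient_def hclass_def)
  also have "\<dots> = cls X Y ` cyc X Y"
    using hclass_eq[OF assms] chain_cyc[OF assms] cyc_surj[OF assms] by (auto simp: image_iff) metis
  finally show ?thesis by (simp add: Kb_def Kb_cat_def)
qed

lemma Kb_Ident:
  assumes "X \<in> bc" shows "Ident (Kb C) X = cls X X (one (oc X))"
proof -
  have "gid C (Ob X) \<in> chain_maps C X X"
    using chain_maps_iff[OF assms assms] gmap_closed(2)[of "Ob X" "Ob X"] \<rho>_id[of "Ob X"] bcD(1)[OF assms]
      cyc_one[OF assms] by simp
  then show ?thesis
    using hclass_eq[OF assms assms] \<rho>_id[of "Ob X"] bcD(1)[OF assms]
    by (simp add: Kb_def Kb_cat_def gid_def)
qed

text \<open>\<open>Comp\<close> is a union over all pairs of representatives. It collapses to one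
  class because every pair contributes the same class and because there is at least one
  pair.\<close>

lemma Kb_Comp:
  assumes X: "X \<in> bc" and Y: "Y \<in> bc" and Z: "Z \<in> bc" and a: "a \<in> cyc X Y" and b: "b \<in> cyc Y Z"
  shows "Comp (Kb C) X Y Z (cls Y Z b) (cls X Y a) = cls X Z (b ** a)"
proof -
  have *: "hclass C X Z (\<lambda>n. Comp C (Ob X n) (Ob Y n) (Ob Z n) (g n) (f n)) = cls X Z (b ** a)"
    if f: "f \<in> cls X Y a" and g: "g \<in> cls Y Z b" for f g
  proof -
    note fc = cls_mem[OF X Y a f] and gc = cls_mem[OF Y Z b g]
    have fg: "f \<in> gmap C 0 (Ob X) (Ob Y)" "g \<in> gmap C 0 (Ob Y) (Ob Z)"
      using fc gc chain_maps_iff X Y Z by auto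
    let ?h = "\<lambda>n. Comp C (Ob X n) (Ob Y n) (Ob Z n) (g n) (f n)"
    have h: "?h = gcomp C 0 0 (Ob X) (Ob Y) (Ob Z) g f" by (simp add: gcomp_def)
    have \<rho>h: "\<rho>0 X Z ?h = \<rho>0 Y Z g ** \<rho>0 X Y f"
      using \<rho>_comp[OF bcD(1)[OF X] bcD(1)[OF Y] bcD(1)[OF Z] fg] by (simp add: h)
    have hc: "\<rho>0 X Z ?h \<in> cyc X Z" unfolding \<rho>h using cyc_mul chain_cyc X Y Z fc gc by blast
    have "?h \<in> chain_maps C X Z"
      using chain_maps_iff[OF X Z] hc gcomp_closed[OF bcD(1)[OF X] bcD(1)[OF Y] bcD(1)[OF Z] fg] h by simp
    then have "hclass C X Z ?h = cls X Z (\<rho>0 Y Z g ** \<rho>0 X Y f)" using hclass_eq[OF X Z] \<rho>h by simp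
    also have "\<dots> = cls X Z (b ** a)"
    proof (subst cls_eq_iff[OF X Z])
      have "hr X Y (\<rho>0 X Y f - a)" "hr Y Z (\<rho>0 Y Z g - b)" using f g hrel_commute by (auto simp: cls_def)
      then have "hr X Z (\<rho>0 Y Z g ** (\<rho>0 X Y f - a))" "hr X Z ((\<rho>0 Y Z g - b) ** a)"
        using hrel_mul_l[OF _ cycD[OF chain_cyc[OF Y Z gc(1)]]] hrel_mul_r[OF _ cycD[OF a]] by auto
      from hrel_add[OF this] show "hr X Z (\<rho>0 Y Z g ** \<rho>0 X Y f - b ** a)"
        by (simp add: mul_simps)
    qed (use cyc_mul[OF chain_cyc[OF Y Z gc(1)] chain_cyc[OF X Y fc(1)]] cyc_mul[OF b a] in auto)
    finally show ?thesis .
  qed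
  obtain f g where "f \<in> cls X Y a" "g \<in> cls Y Z b"
    using cyc_surj[OF X Y a] cyc_surj[OF Y Z b] cls_self by metis
  then show ?thesis unfolding Kb_def Kb_cat_def using * by auto
qed

lemma Kb_Plus:
  assumes X: "X \<in> bc" and Y: "Y \<in> bc" and a: "a \<in> cyc X Y" and b: "b \<in> cyc X Y"
  shows "Plus (Kb C) X Y (cls X Y a) (cls X Y b) = cls X Y (a + b)"
proof -
  have *: "hclass C X Y (\<lambda>n. Plus C (Ob X n) (Ob Y n) (f n) (g n)) = cls X Y (a + b)"
    if f: "f \<in> cls X Y a" and g: "g \<in> cls X Y b" for f g
  proof -
    note fc = cls_mem[OF X Y a f] and gc = cls_mem[OF X Y b g]
    have fg: "f \<in> gmap C 0 (Ob X) (Ob Y)" "g \<in> gmap C 0 (Ob X) (Ob Y)"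
      using fc gc chain_maps_iff X Y by auto
    let ?h = "\<lambda>n. Plus C (Ob X n) (Ob Y n) (f n) (g n)"
    have h: "?h = gplus C 0 (Ob X) (Ob Y) f g" by (simp add: gplus_def)
    have \<rho>h: "\<rho>0 X Y ?h = \<rho>0 X Y f + \<rho>0 X Y g"
      using \<rho>_plus[OF bcD(1)[OF X] bcD(1)[OF Y] fg] by (simp add: h)
    have hc: "\<rho>0 X Y ?h \<in> cyc X Y" unfolding \<rho>h using cyc_add chain_cyc X Y fc gc by blast
    have "?h \<in> chain_maps C X Y"
      using chain_maps_iff[OF X Y] hc gmap_closed(5)[OF bcD(1)[OF X] bcD(1)[OF Y] fg] h by simp
    then have "hclass C X Y ?h = cls X Y (\<rho>0 X Y f + \<rho>0 X Y g)" using hclass_eq[OF X Y] \<rho>h by simp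
    also have "\<dots> = cls X Y (a + b)"
    proof (subst cls_eq_iff[OF X Y])
      have "hr X Y (\<rho>0 X Y f - a)" "hr X Y (\<rho>0 X Y g - b)" using f g hrel_commute by (auto simp: cls_def)
      from hrel_add[OF this] show "hr X Y (\<rho>0 X Y f + \<rho>0 X Y g - (a + b))"
        by (simp add: algebra_simps)
    qed (use cyc_add[OF chain_cyc[OF X Y fc(1)] chain_cyc[OF X Y gc(1)]] cyc_add[OF a b] in auto)
    finally show ?thesis .
  qed
  obtain f g where "f \<in> cls X Y a" "g \<in> cls X Y b"
    using cyc_surj[OF X Y a] cyc_surj[OF X Y b] cls_self by metis
  then show ?thesis unfolding Kb_def Kb_cat_def using * by auto
qed

section \<open>The suspension and its inverse\<close>

definition shf :: "'o gr \<Rightarrow> int \<Rightarrow> 'o" where "shf X = (\<lambda>n. X (n + 1))"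

abbreviation S :: "('o, 'm) cochain \<Rightarrow> ('o, 'm) cochain" where "S \<equiv> shift_complex C"

text \<open>The identity of \<open>Ob X n\<close>, read as an arrow into the component of index
  \<open>n - 1\<close> of the shifted object, is a map of degree -1. With its inverse
  \<open>sg'\<close> of degree 1 it turns the suspension into conjugation in the ring.\<close>

definition sg :: "('o, 'm) cochain \<Rightarrow> 'r" where
  "sg X = \<rho> (-1) (Ob X) (shf (Ob X)) (\<lambda>n. Ident C (Ob X n))"

definition sg' :: "('o, 'm) cochain \<Rightarrow> 'r" where
  "sg' X = \<rho> 1 (shf (Ob X)) (Ob X) (\<lambda>n. Ident C (Ob X (n + 1)))"

lemma Ob_S: "Ob (S X) = shf (Ob X)"
  by (simp add: shift_complex_def shf_def)

lemma shf_gobj: "X \<in> gobj C \<Longrightarrow> shf X \<in> gobj C"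
  by (simp add: gobj_def shf_def)

context
  fixes X :: "('o, 'm) cochain" assumes X: "Ob X \<in> gobj C"
begin

lemma sg_gmap:
  "(\<lambda>n. Ident C (Ob X n)) \<in> gmap C (-1) (Ob X) (shf (Ob X))"
  "(\<lambda>n. Ident C (Ob X (n + 1))) \<in> gmap C 1 (shf (Ob X)) (Ob X)"
  using gobjD[OF X] by (auto simp: gmap_def shf_def Ident_in)

lemma sg_in: "sg X \<in> H (-1) (oc X) (oc (S X))" "sg' X \<in> H 1 (oc (S X)) (oc X)"
  unfolding sg_def sg'_def Ob_S using \<rho>_in X shf_gobj[OF X] sg_gmap by auto

lemma sg_inv: "sg' X ** sg X = one (oc X)" "sg X ** sg' X = one (oc (S X))"
proof -
  note m = \<rho>_comp[OF X shf_gobj[OF X] X sg_gmap] \<rho>_comp[OF shf_gobj[OF X] X shf_gobj[OF X] sg_gmap(2,1)]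
  have "gcomp C (-1) 1 (Ob X) (shf (Ob X)) (Ob X) (\<lambda>n. Ident C (Ob X (n + 1))) (\<lambda>n. Ident C (Ob X n)) = gid C (Ob X)"
    "gcomp C 1 (-1) (shf (Ob X)) (Ob X) (shf (Ob X)) (\<lambda>n. Ident C (Ob X n)) (\<lambda>n. Ident C (Ob X (n + 1))) = gid C (shf (Ob X))"
    using gobjD[OF X] by (auto simp: gcomp_def gid_def shf_def Ident_l Ident_in)
  then show "sg' X ** sg X = one (oc X)" "sg X ** sg' X = one (oc (S X))"
    using m \<rho>_id[OF X] \<rho>_id[OF shf_gobj[OF X]] by (simp_all add: sg_def sg'_def Ob_S)
qed

end

lemma \<rho>_shf:
  assumes X: "Ob X \<in> gobj C" and Y: "Ob Y \<in> gobj C" and f: "f \<in> gmap C k (Ob X) (Ob Y)"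
  shows "(\<lambda>n. f (n + 1)) \<in> gmap C k (shf (Ob X)) (shf (Ob Y))"
    and "\<rho> k (shf (Ob X)) (shf (Ob Y)) (\<lambda>n. f (n + 1)) = sg Y ** \<rho> k (Ob X) (Ob Y) f ** sg' X"
    and "(\<lambda>n. f (n + 1)) \<in> gmap C (k + 1) (shf (Ob X)) (Ob Y)"
    and "\<rho> (k + 1) (shf (Ob X)) (Ob Y) (\<lambda>n. f (n + 1)) = \<rho> k (Ob X) (Ob Y) f ** sg' X"
proof -
  note m = gmapD[OF f]
  show 1: "(\<lambda>n. f (n + 1)) \<in> gmap C k (shf (Ob X)) (shf (Ob Y))" "(\<lambda>n. f (n + 1)) \<in> gmap C (k + 1) (shf (Ob X)) (Ob Y)"
    using m[of "_ + 1"] by (simp_all add: gmap_def shf_def ac_simps)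
  have f1: "gcomp C 1 k (shf (Ob X)) (Ob X) (Ob Y) f (\<lambda>n. Ident C (Ob X (n + 1))) = (\<lambda>n. f (n + 1))"
    using gobjD[OF X] gobjD[OF Y] m by (auto simp: gcomp_def shf_def Ident_r fun_eq_iff)
  show f2: "\<rho> (k + 1) (shf (Ob X)) (Ob Y) (\<lambda>n. f (n + 1)) = \<rho> k (Ob X) (Ob Y) f ** sg' X"
    using \<rho>_comp[OF shf_gobj[OF X] X Y sg_gmap(2)[OF X] f] f1 by (simp add: sg'_def add.commute)
  have "(\<lambda>n. f (n + 1)) n \<in> Arr C (Ob X (n + 1)) (Ob Y (n + (k + 1)))" for n
    using m[of "n + 1"] by (simp add: ac_simps)
  then have "gcomp C (k + 1) (-1) (shf (Ob X)) (Ob Y) (shf (Ob Y)) (\<lambda>n. Ident C (Ob Y n)) (\<lambda>n. f (n + 1)) = (\<lambda>n. f (n + 1))"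
    using gobjD[OF X] gobjD[OF Y] by (auto simp: gcomp_def shf_def Ident_l fun_eq_iff ac_simps)
  then show "\<rho> k (shf (Ob X)) (shf (Ob Y)) (\<lambda>n. f (n + 1)) = sg Y ** \<rho> k (Ob X) (Ob Y) f ** sg' X"
    using \<rho>_comp[OF shf_gobj[OF X] Y shf_gobj[OF Y] 1(2) sg_gmap(1)[OF Y]] f2 by (simp add: sg_def mul_assoc)
qed

lemma shift_dl:
  assumes X: "Ob X \<in> gobj C" "Df X \<in> gmap C 1 (Ob X) (Ob X)"
  shows "Df (S X) \<in> gmap C 1 (Ob (S X)) (Ob (S X))" "dl (S X) = - (sg X ** dl X ** sg' X)"
proof -
  have "Df (S X) = gneg C 1 (shf (Ob X)) (shf (Ob X)) (\<lambda>n. Df X (n + 1))"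
    by (simp add: shift_complex_def gneg_def shf_def fun_eq_iff add.assoc)
  then show "Df (S X) \<in> gmap C 1 (Ob (S X)) (Ob (S X))" "dl (S X) = - (sg X ** dl X ** sg' X)"
    using gmap_closed(4)[OF shf_gobj[OF X(1)] shf_gobj[OF X(1)] \<rho>_shf(1)[OF X(1,1,2)]]
      \<rho>_neg[OF shf_gobj[OF X(1)] shf_gobj[OF X(1)] \<rho>_shf(1)[OF X(1,1,2)]] \<rho>_shf(2)[OF X(1,1,2)]
    by (simp_all add: Ob_S dl_def)
qed

text \<open>The implication from \<open>S X\<close> back to \<open>X\<close> shows that
  \<open>unshift X\<close> is a bounded complex, so that the suspension is bijective on
  objects.\<close>

lemma shift_bc_iff:
  assumes X: "Ob X \<in> gobj C" "Df X \<in> gmap C 1 (Ob X) (Ob X)"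
  shows "S X \<in> bc \<longleftrightarrow> X \<in> bc"
proof -
  have dX: "dl X \<in> H 1 (oc X) (oc X)" using \<rho>_in X by (simp add: dl_def)
  note si = sg_inv[OF X(1)] and sh = sg_in[OF X(1)]
  have dS: "dl (S X) \<in> H 1 (oc (S X)) (oc (S X))" using shift_dl(1)[OF X] \<rho>_in shf_gobj X by (simp add: dl_def Ob_S)
  have o: "sg' X ** (sg X ** (dl X ** f)) = dl X ** f" for f
    using mul_cong[OF si(1)] mul_cong[OF one_l[OF dX]] by simp
  have "dl (S X) ** dl (S X) = sg X ** (dl X ** dl X) ** sg' X"
    by (simp add: shift_dl[OF X] mul_simps o)
  moreover have "dl X ** dl X = sg' X ** (sg X ** (dl X ** dl X) ** sg' X) ** sg X"
    using one_r[OF dX] by (simp add: mul_assoc o si)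
  ultimately have cx: "cx (oc (S X)) (dl (S X)) \<longleftrightarrow> cx (oc X) (dl X)" unfolding cx_def using dX dS by auto
  have p: "pr n (oc (S X)) ** sg X = sg X ** pr (n + 1) (oc X)" for n using pr_comm[OF sh(1), where n = "n + 1"] by simp
  have e1: "pr n (oc (S X)) = sg X ** pr (n + 1) (oc X) ** sg' X" for n
    using p[of n, symmetric] one_r[OF H_pr, of n "oc (S X)"] by (simp add: mul_assoc si)
  have e2: "pr (n + 1) (oc X) = sg' X ** pr n (oc (S X)) ** sg X" for n
    using p[of n] one_l[OF H_pr, of "oc X" "n + 1"] by (simp add: mul_assoc mul_cong[OF si(1)])
  have "pr n (oc (S X)) = 0 \<longleftrightarrow> pr (n + 1) (oc X) = 0" for n
  proof
    show "pr n (oc (S X)) = 0" if "pr (n + 1) (oc X) = 0" by (subst e1) (simp add: that)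
    show "pr (n + 1) (oc X) = 0" if "pr n (oc (S X)) = 0" by (subst e2) (simp add: that)
  qed
  then have "bij_betw (\<lambda>n. n + 1) {n. pr n (oc (S X)) \<noteq> 0} {n. pr n (oc X) \<noteq> 0}"
    by (intro bij_betw_byWitness[of _ "\<lambda>n. n - 1"]) auto
  then have "bdd (oc (S X)) \<longleftrightarrow> bdd (oc X)" unfolding bdd_def by (rule bij_betw_finite)
  moreover have "Ob (S X) \<in> gobj C" using shf_gobj[OF X(1)] by (simp add: Ob_S)
  ultimately show ?thesis
    using cx bcI[OF X] bcI[OF _ shift_dl(1)[OF X]] bcD(3,4)[of X] bcD(3,4)[of "S X"] by blast
qed

lemma S_bc: "X \<in> bc \<Longrightarrow> S X \<in> bc"
  using shift_bc_iff[OF bcD(1,2)] by simp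

text \<open>\<open>op_tri\<close> takes the inverse of the suspension from
  \<open>the_inv_into\<close>; this explicit inverse replaces it.\<close>

definition unshift :: "('o, 'm) cochain \<Rightarrow> ('o, 'm) cochain" where
  "unshift X = \<lparr>Ob = (\<lambda>n. Ob X (n - 1)), Df = (\<lambda>n. Neg C (Ob X (n - 1)) (Ob X n) (Df X (n - 1)))\<rparr>"

lemma S_unshift:
  assumes "X \<in> bc" shows "S (unshift X) = X" "unshift X \<in> bc"
proof -
  note X = bcD(1,2)[OF assms]
  note N = Neg_Neg[OF gobjD[OF X(1)] gobjD[OF X(1)] gmapD[OF X(2)]]
  have e: "n + 1 - 1 = n" "n + 2 - 1 = n + 1" for n :: int by simp_all
  have "Df (S (unshift X)) = Df X" "Ob (S (unshift X)) = Ob X"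
    unfolding shift_complex_def unshift_def cochain.select_convs e N by (rule refl)+
  then show 1: "S (unshift X) = X" by (intro cochain.equality) simp_all
  have "Ob (unshift X) \<in> gobj C" "Df (unshift X) \<in> gmap C 1 (Ob (unshift X)) (Ob (unshift X))"
    unfolding gobj_def gmap_def
    using gobjD[OF X(1)] Neg_in[OF gobjD[OF X(1)] gobjD[OF X(1)] gmapD'[OF X(2)]] by (simp_all add: unshift_def)
  from shift_bc_iff[OF this] show "unshift X \<in> bc" using 1 assms by simp
qed

lemma unshift_S:
  assumes "X \<in> bc" shows "unshift (S X) = X"
proof -
  note X = bcD(1,2)[OF assms]
  note N = Neg_Neg[OF gobjD[OF X(1)] gobjD[OF X(1)] gmapD[OF X(2)]]
  have e: "n - 1 + 1 = n" "n - 1 + 2 = n + 1" for n :: int by simp_all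
  have "Df (unshift (S X)) = Df X" "Ob (unshift (S X)) = Ob X"
    unfolding shift_complex_def unshift_def cochain.select_convs e N by (rule refl)+
  then show ?thesis by (intro cochain.equality) simp_all
qed

lemma Unshift_Kb: "X \<in> bc \<Longrightarrow> Unshift (Kb C) X = unshift X"
proof -
  assume X: "X \<in> bc"
  have "inj_on S bc" by (rule inj_on_inverseI[of _ unshift]) (rule unshift_S)
  then show ?thesis unfolding Unshift_def using S_unshift[OF X] by (simp add: the_inv_into_f_eq)
qed

definition shm :: "('o, 'm) cochain \<Rightarrow> ('o, 'm) cochain \<Rightarrow> 'r \<Rightarrow> 'r" where
  "shm X Y a = sg Y ** a ** sg' X"

lemma shm_cyc:
  assumes X: "X \<in> bc" and Y: "Y \<in> bc" and a: "a \<in> cyc X Y"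
  shows "shm X Y a \<in> cyc (S X) (S Y)"
proof -
  note X' = bcD[OF X] and Y' = bcD[OF Y]
  have 1: "shm X Y a \<in> H 0 (oc (S X)) (oc (S Y))"
    unfolding shm_def using H_mul'[OF H_mul'[OF sg_in(1)[OF Y'(1)] cycD(1)[OF a] refl] sg_in(2)[OF X'(1)]] by simp
  have "sg' X ** (sg X ** (dl X ** f)) = dl X ** f" "sg' Y ** (sg Y ** (a ** f)) = a ** f" for f
    using mul_cong[OF sg_inv(1)[OF X'(1)]] mul_cong[OF one_l[OF X'(5)]] 
      mul_cong[OF sg_inv(1)[OF Y'(1)]] mul_cong[OF one_l[OF cycD(1)[OF a]]] by auto
  then have "dl (S Y) ** shm X Y a = shm X Y a ** dl (S X)"
    by (simp add: shift_dl[OF X'(1,2)] shift_dl[OF Y'(1,2)] shm_def mul_simps mul_cong[OF cycD(2)[OF a]])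
  with 1 show ?thesis by (simp add: cyc_def)
qed

lemma shm_hr:
  assumes X: "X \<in> bc" and Y: "Y \<in> bc" and a: "hr X Y a"
  shows "hr (S X) (S Y) (shm X Y a)"
proof -
  note X' = bcD[OF X] and Y' = bcD[OF Y]
  obtain s where s: "s \<in> H (-1) (oc X) (oc Y)" "a = dl Y ** s + s ** dl X" using a by (auto simp: hrel_def)
  have o: "sg' X ** (sg X ** (dl X ** f)) = dl X ** f" "sg' Y ** (sg Y ** (s ** f)) = s ** f" for f
    using mul_cong[OF sg_inv(1)[OF X'(1)]] mul_cong[OF one_l[OF X'(5)]] 
      mul_cong[OF sg_inv(1)[OF Y'(1)]] mul_cong[OF one_l[OF s(1)]] by auto
  have "- (sg Y ** s ** sg' X) \<in> H (-1) (oc (S X)) (oc (S Y))"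
    using H_uminus[OF H_mul'[OF H_mul'[OF sg_in(1)[OF Y'(1)] s(1) refl] sg_in(2)[OF X'(1)], of "-1"]] by simp
  moreover have "shm X Y a = dl (S Y) ** (- (sg Y ** s ** sg' X)) + (- (sg Y ** s ** sg' X)) ** dl (S X)"
    by (simp add: shift_dl[OF X'(1,2)] shift_dl[OF Y'(1,2)] shm_def s(2) mul_simps o)
  ultimately show ?thesis by (auto simp: hrel_def)
qed
lemma shm_inv:
  assumes X: "X \<in> bc" and Y: "Y \<in> bc" and a: "a \<in> H 0 (oc X) (oc Y)"
  shows "sg' Y ** shm X Y a ** sg X = a"
  using sg_inv[OF bcD(1)[OF X]] sg_inv[OF bcD(1)[OF Y]] one_r[OF a] one_l[OF a]
  by (simp add: shm_def mul_assoc mul_cong[OF sg_inv(1)[OF bcD(1)[OF Y]]])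

lemma shm_surj:
  assumes X: "X \<in> bc" and Y: "Y \<in> bc" and b: "b \<in> cyc (S X) (S Y)"
  obtains a where "a \<in> cyc X Y" "b = shm X Y a"
proof -
  note sX = sg_inv[OF bcD(1)[OF X]] and sY = sg_inv[OF bcD(1)[OF Y]]
    and iX = sg_in[OF bcD(1)[OF X]] and iY = sg_in[OF bcD(1)[OF Y]]
  let ?a = "sg' Y ** b ** sg X"
  have b0: "b \<in> H 0 (oc (S X)) (oc (S Y))" using cycD[OF b] by simp
  have a0: "?a \<in> H 0 (oc X) (oc Y)" using H_mul'[OF H_mul'[OF iY(2) b0 refl] iX(1)] by simp
  have sb: "shm X Y ?a = b"
    using one_r[OF b0] one_l[OF b0] by (simp add: shm_def mul_assoc mul_cong[OF sY(2)] sX)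
  have 1: "sg Y ** (dl Y ** ?a) ** sg' X = sg Y ** (?a ** dl X) ** sg' X"
  proof -
    have "dl Y ** ?a = dl Y ** (sg' Y ** (b ** sg X))" by (simp add: mul_assoc)
    then have "sg Y ** (dl Y ** ?a) ** sg' X = - (dl (S Y) ** b)"
      using one_r[OF b0] by (simp add: shift_dl bcD[OF Y] mul_simps sX)
    also have "\<dots> = - (b ** dl (S X))" using cycD[OF b] by simp
    also have "\<dots> = sg Y ** (?a ** dl X) ** sg' X"
      using one_l[OF b0] by (simp add: shift_dl bcD[OF X] mul_simps mul_cong[OF sY(2)] mul_cong[of "one _" b])
    finally show ?thesis .
  qed
  have "dl Y ** ?a = ?a ** dl X"
  proof -
    have "f = sg' Y ** (sg Y ** f ** sg' X) ** sg X" if "f \<in> H 1 (oc X) (oc Y)" for f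
      using one_r[OF that] one_l[OF that] by (simp add: mul_assoc sX mul_cong[OF sY(1)])
    from this[of "dl Y ** ?a"] this[of "?a ** dl X"] 1 show ?thesis
      using H_mul'[OF bcD(5)[OF Y] a0] H_mul'[OF a0 bcD(5)[OF X]] by simp
  qed
  then show ?thesis using that[of ?a] a0 sb by (simp add: cyc_def)
qed

lemma shm_hr_iff:
  assumes X: "X \<in> bc" and Y: "Y \<in> bc" and a: "a \<in> H 0 (oc X) (oc Y)"
  shows "hr (S X) (S Y) (shm X Y a) \<longleftrightarrow> hr X Y a"
proof
  note sX = sg_inv[OF bcD(1)[OF X]] and sY = sg_inv[OF bcD(1)[OF Y]]
    and iX = sg_in[OF bcD(1)[OF X]] and iY = sg_in[OF bcD(1)[OF Y]]
  assume "hr (S X) (S Y) (shm X Y a)"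
  then obtain s where s: "s \<in> H (-1) (oc (S X)) (oc (S Y))" "shm X Y a = dl (S Y) ** s + s ** dl (S X)"
    by (auto simp: hrel_def)
  have "- (sg' Y ** s ** sg X) \<in> H (-1) (oc X) (oc Y)"
    using H_uminus[OF H_mul'[OF H_mul'[OF iY(2) s(1) refl] iX(1), of "-1"]] by simp
  moreover have "sg' Y ** (dl (S Y) ** s + s ** dl (S X)) ** sg X
      = dl Y ** (- (sg' Y ** s ** sg X)) + (- (sg' Y ** s ** sg X)) ** dl X"
    using one_r[OF bcD(5)[OF X]] one_l[OF bcD(5)[OF Y]]
    by (simp add: shift_dl bcD[OF X] bcD[OF Y] mul_simps sX mul_cong[OF sY(1)]
        mul_cong[OF one_l[OF bcD(5)[OF Y]]])
  ultimately show "hr X Y a" using shm_inv[OF X Y a] unfolding hrel_def s(2) by metis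
qed (rule shm_hr[OF X Y])

lemma Kb_shift_arr_cls:
  assumes X: "X \<in> bc" and Y: "Y \<in> bc" and a: "a \<in> cyc X Y"
  shows "Kb_shift_arr (cls X Y a) = cls (S X) (S Y) (shm X Y a)"
proof -
  have key: "(\<lambda>n. f (n + 1)) \<in> cls (S X) (S Y) (shm X Y a) \<longleftrightarrow> f \<in> cls X Y a" if f: "f \<in> gmap C 0 (Ob X) (Ob Y)" for f
  proof -
    note fs = \<rho>_shf(1,2)[OF bcD(1)[OF X] bcD(1)[OF Y] f]
    have fH: "\<rho>0 X Y f \<in> H 0 (oc X) (oc Y)" using \<rho>_in[OF bcD(1)[OF X] bcD(1)[OF Y] f] .
    have \<rho>: "\<rho>0 (S X) (S Y) (\<lambda>n. f (n + 1)) = shm X Y (\<rho>0 X Y f)"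
      using fs by (simp add: Ob_S shm_def)
    have "\<rho>0 X Y f \<in> cyc X Y" if "shm X Y (\<rho>0 X Y f) \<in> cyc (S X) (S Y)"
      by (rule shm_surj[OF X Y that]) (metis shm_inv[OF X Y] fH cycD(1))
    then have 1: "(\<lambda>n. f (n + 1)) \<in> chain_maps C (S X) (S Y) \<longleftrightarrow> f \<in> chain_maps C X Y"
      using chain_maps_iff[OF X Y] chain_maps_iff[OF S_bc[OF X] S_bc[OF Y]] f fs \<rho> shm_cyc[OF X Y]
      by (auto simp: Ob_S)
    have "shm X Y a - shm X Y (\<rho>0 X Y f) = shm X Y (a - \<rho>0 X Y f)" by (simp add: shm_def mul_simps)
    then show ?thesis
      unfolding cls_def using 1 \<rho> shm_hr_iff[OF X Y H_diff[OF cycD(1)[OF a] fH]] by simp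
  qed
  show ?thesis
  proof
    show "Kb_shift_arr (cls X Y a) \<subseteq> cls (S X) (S Y) (shm X Y a)"
    proof
      fix g assume "g \<in> Kb_shift_arr (cls X Y a)"
      then obtain f where f: "f \<in> cls X Y a" "g = (\<lambda>n. f (n + 1))" by (auto simp: Kb_shift_arr_def)
      then have "f \<in> gmap C 0 (Ob X) (Ob Y)" using chain_maps_iff[OF X Y] by (auto simp: cls_def)
      then show "g \<in> cls (S X) (S Y) (shm X Y a)" using key f by simp
    qed
    \<comment> \<open>The suspension of a class is its image under reindexing, so a representative
      of the shifted class has to be reindexed back, by \<open>n - 1\<close>.\<close>
    show "cls (S X) (S Y) (shm X Y a) \<subseteq> Kb_shift_arr (cls X Y a)"
    proof
      fix g assume g: "g \<in> cls (S X) (S Y) (shm X Y a)"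
      then have "g \<in> gmap C 0 (shf (Ob X)) (shf (Ob Y))"
        using chain_maps_iff[OF S_bc[OF X] S_bc[OF Y]] by (simp add: cls_def Ob_S)
      then have "g (n - 1) \<in> Arr C (Ob X n) (Ob Y n)" for n
        using gmapD[of g 0 "shf (Ob X)" "shf (Ob Y)" "n - 1"] by (simp add: shf_def)
      then have "(\<lambda>n. g (n - 1)) \<in> gmap C 0 (Ob X) (Ob Y)" by (simp add: gmap_def)
      from key[OF this] have "(\<lambda>n. g (n - 1)) \<in> cls X Y a" using g by simp
      then show "g \<in> Kb_shift_arr (cls X Y a)" 
        unfolding Kb_shift_arr_def by (rule rev_image_eqI) simp
    qed
  qed
qed

text \<open>The inverse taken by \<open>the_inv_into\<close> can be evaluated once the suspension is
  injective on homotopy classes, and this is what \<open>shm_hr_iff\<close> gives.\<close>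

lemma Kb_UnshiftArr:
  assumes X: "X \<in> bc" and Y: "Y \<in> bc" and a: "a \<in> cyc (unshift X) (unshift Y)"
  shows "UnshiftArr (Kb C) X Y (cls X Y (shm (unshift X) (unshift Y) a)) = cls (unshift X) (unshift Y) a"
proof -
  note uX = S_unshift[OF X] and uY = S_unshift[OF Y]
  have "inj_on Kb_shift_arr (Arr (Kb C) (unshift X) (unshift Y))"
  proof (rule inj_onI)
    fix F G assume FG: "F \<in> Arr (Kb C) (unshift X) (unshift Y)" "G \<in> Arr (Kb C) (unshift X) (unshift Y)"
      and eq: "Kb_shift_arr F = Kb_shift_arr G"
    obtain b c where bc: "b \<in> cyc (unshift X) (unshift Y)" "c \<in> cyc (unshift X) (unshift Y)"
      "F = cls (unshift X) (unshift Y) b" "G = cls (unshift X) (unshift Y) c"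
      using FG Kb_Arr[OF uX(2) uY(2)] by auto
    have "hr X Y (shm (unshift X) (unshift Y) b - shm (unshift X) (unshift Y) c)"
      using eq Kb_shift_arr_cls[OF uX(2) uY(2)] bc cls_eq_iff[OF S_bc[OF uX(2)] S_bc[OF uY(2)]
        shm_cyc[OF uX(2) uY(2) bc(1)] shm_cyc[OF uX(2) uY(2) bc(2)]] uX uY by simp
    moreover have "shm (unshift X) (unshift Y) b - shm (unshift X) (unshift Y) c = shm (unshift X) (unshift Y) (b - c)"
      by (simp add: shm_def mul_simps)
    ultimately have "hr (unshift X) (unshift Y) (b - c)"
      using shm_hr_iff[OF uX(2) uY(2) H_diff[OF cycD(1)[OF bc(1)] cycD(1)[OF bc(2)]]] uX(1) uY(1) by simp
    then show "F = G" using cls_eq_iff[OF uX(2) uY(2) bc(1,2)] bc by simp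
  qed
  moreover have "Kb_shift_arr (cls (unshift X) (unshift Y) a) = cls X Y (shm (unshift X) (unshift Y) a)"
    using Kb_shift_arr_cls[OF uX(2) uY(2) a] uX uY by simp
  moreover have "cls (unshift X) (unshift Y) a \<in> Arr (Kb C) (unshift X) (unshift Y)"
    using Kb_Arr[OF uX(2) uY(2)] a by simp
  ultimately show ?thesis
    unfolding UnshiftArr_def using Unshift_Kb[OF X] Unshift_Kb[OF Y] by (simp add: the_inv_into_f_eq)
qed

section \<open>Isomorphisms, cones and distinguished triangles\<close>

definition riso :: "('o, 'm) cochain \<Rightarrow> ('o, 'm) cochain \<Rightarrow> 'r \<Rightarrow> bool" where
  "riso X Y a \<longleftrightarrow> a \<in> cyc X Y \<and>
     (\<exists>b\<in>cyc Y X. hr X X (b ** a - one (oc X)) \<and> hr Y Y (a ** b - one (oc Y)))"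

lemma is_iso_iff:
  assumes X: "X \<in> bc" and Y: "Y \<in> bc" and a: "a \<in> cyc X Y"
  shows "is_iso (Kb C) X Y (cls X Y a) \<longleftrightarrow> riso X Y a"
proof -
  have "(Comp (Kb C) X Y X (cls Y X b) (cls X Y a) = Ident (Kb C) X \<and>
      Comp (Kb C) Y X Y (cls X Y a) (cls Y X b) = Ident (Kb C) Y) \<longleftrightarrow>
      hr X X (b ** a - one (oc X)) \<and> hr Y Y (a ** b - one (oc Y))" if b: "b \<in> cyc Y X" for b
    using a b X Y by (simp add: Kb_Comp Kb_Ident cls_eq_iff cyc_mul cyc_one)
  then show ?thesis unfolding is_iso_def riso_def using Kb_Arr[OF X Y] Kb_Arr[OF Y X] a by auto
qed

lemma riso_comp:
  assumes X: "X \<in> bc" "Y \<in> bc" "Z \<in> bc" and a: "riso X Y a" and b: "riso Y Z b"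
  shows "riso X Z (b ** a)"
proof -
  obtain a' where a': "a \<in> cyc X Y" "a' \<in> cyc Y X" "hr X X (a' ** a - one (oc X))" "hr Y Y (a ** a' - one (oc Y))"
    using a by (auto simp: riso_def)
  obtain b' where b': "b \<in> cyc Y Z" "b' \<in> cyc Z Y" "hr Y Y (b' ** b - one (oc Y))" "hr Z Z (b ** b' - one (oc Z))"
    using b by (auto simp: riso_def)
  have "hr X X (a' ** (b' ** b - one (oc Y)) ** a)" "hr Z Z (b ** (a ** a' - one (oc Y)) ** b')"
    using hrel_mul_r[OF hrel_mul_l[OF b'(3) cycD[OF a'(2)]] cycD[OF a'(1)]]
      hrel_mul_r[OF hrel_mul_l[OF a'(4) cycD[OF b'(1)]] cycD[OF b'(2)]] by auto
  from hrel_add[OF this(1) a'(3)] hrel_add[OF this(2) b'(4)]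
  have "hr X X ((a' ** b') ** (b ** a) - one (oc X))" "hr Z Z ((b ** a) ** (a' ** b') - one (oc Z))"
    using one_l[OF cycD(1)[OF a'(1)]] one_l[OF cycD(1)[OF b'(2)]] by (simp_all add: mul_simps)
  then show ?thesis
    unfolding riso_def using cyc_mul[OF b'(1) a'(1)] cyc_mul[OF a'(2) b'(2)] by blast
qed

lemma riso_one: "X \<in> bc \<Longrightarrow> riso X X (one (oc X))"
  unfolding riso_def using cyc_one[of X] one_l[OF H_one, of "oc X"] by (auto intro!: bexI[of _ "one (oc X)"])

lemma biprod_iff:
  assumes X: "X \<in> gobj C" and Y: "Y \<in> gobj C" and Z: "Z \<in> gobj C"
    and i: "i1 \<in> gmap C 0 X Z" "i2 \<in> gmap C 0 Y Z" "p1 \<in> gmap C 0 Z X" "p2 \<in> gmap C 0 Z Y"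
  shows "(\<forall>n. is_biproduct C (X n) (Y n) (Z n) (i1 n) (i2 n) (p1 n) (p2 n)) \<longleftrightarrow>
    biprod (ob X) (ob Y) (ob Z) (\<rho> 0 X Z i1) (\<rho> 0 Y Z i2) (\<rho> 0 Z X p1) (\<rho> 0 Z Y p2)"
proof -
  note c = gcomp_closed[OF X Z X i(1,3), unfolded add_0] gcomp_closed[OF Y Z Y i(2,4), unfolded add_0]
    gcomp_closed[OF X Z Y i(1,4), unfolded add_0] gcomp_closed[OF Y Z X i(2,3), unfolded add_0]
    gcomp_closed[OF Z X Z i(3,1), unfolded add_0] gcomp_closed[OF Z Y Z i(4,2), unfolded add_0]
  note r = \<rho>_comp[OF X Z X i(1,3), unfolded add_0] \<rho>_comp[OF Y Z Y i(2,4), unfolded add_0]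
    \<rho>_comp[OF X Z Y i(1,4), unfolded add_0] \<rho>_comp[OF Y Z X i(2,3), unfolded add_0]
    \<rho>_comp[OF Z X Z i(3,1), unfolded add_0] \<rho>_comp[OF Z Y Z i(4,2), unfolded add_0]
  note h = \<rho>_in[OF X Z i(1)] \<rho>_in[OF Y Z i(2)] \<rho>_in[OF Z X i(3)] \<rho>_in[OF Z Y i(4)]
  have 1: "\<rho> 0 Z X p1 ** \<rho> 0 X Z i1 = one (ob X) \<longleftrightarrow> gcomp C 0 0 X Z X p1 i1 = gid C X"
    using \<rho>_inject[OF X X c(1) gmap_closed(2)[OF X X]] r(1) \<rho>_id[OF X] by simp
  have 2: "\<rho> 0 Z Y p2 ** \<rho> 0 Y Z i2 = one (ob Y) \<longleftrightarrow> gcomp C 0 0 Y Z Y p2 i2 = gid C Y"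
    using \<rho>_inject[OF Y Y c(2) gmap_closed(2)[OF Y Y]] r(2) \<rho>_id[OF Y] by simp
  have 3: "\<rho> 0 Z Y p2 ** \<rho> 0 X Z i1 = 0 \<longleftrightarrow> gcomp C 0 0 X Z Y p2 i1 = gnull C 0 X Y"
    using \<rho>_inject[OF X Y c(3) gmap_closed(1)[OF X Y]] r(3) \<rho>_null[OF X Y, of 0] by simp
  have 4: "\<rho> 0 Z X p1 ** \<rho> 0 Y Z i2 = 0 \<longleftrightarrow> gcomp C 0 0 Y Z X p1 i2 = gnull C 0 Y X"
    using \<rho>_inject[OF Y X c(4) gmap_closed(1)[OF Y X]] r(4) \<rho>_null[OF Y X, of 0] by simp
  have 5: "\<rho> 0 X Z i1 ** \<rho> 0 Z X p1 + \<rho> 0 Y Z i2 ** \<rho> 0 Z Y p2 = one (ob Z) \<longleftrightarrow>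
      gplus C 0 Z Z (gcomp C 0 0 Z X Z i1 p1) (gcomp C 0 0 Z Y Z i2 p2) = gid C Z"
    using \<rho>_inject[OF Z Z gmap_closed(5)[OF Z Z c(5,6)] gmap_closed(2)[OF Z Z]] r(5,6) \<rho>_plus[OF Z Z c(5,6)] \<rho>_id[OF Z] by simp
  have m: "\<forall>n. i1 n \<in> Arr C (X n) (Z n)" "\<forall>n. i2 n \<in> Arr C (Y n) (Z n)" "\<forall>n. p1 n \<in> Arr C (Z n) (X n)"
    "\<forall>n. p2 n \<in> Arr C (Z n) (Y n)" using i by (auto simp: gmap_def)
  show ?thesis
    unfolding biprod_def 1 2 3 4 5
    using h m by (auto simp: is_biproduct_def fun_eq_iff gcomp_def gid_def gnull_def gplus_def)
qed

text \<open>The element \<open>a ** sg' X\<close> is \<open>a\<close> read as a map of degree 1 from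
  \<open>S X\<close> to \<open>Y\<close>. Written with it, the cone is an extension of exactly the
  shape treated in \<open>good_ext\<close>.\<close>

definition scone :: "('o, 'm) cochain \<Rightarrow> ('o, 'm) cochain \<Rightarrow> ('o, 'm) cochain \<Rightarrow> 'r \<Rightarrow> 'r \<Rightarrow> 'r \<Rightarrow> 'r \<Rightarrow> 'r \<Rightarrow> bool" where
  "scone X Y Z a I1 I2 P1 P2 \<longleftrightarrow> X \<in> bc \<and> Y \<in> bc \<and> Z \<in> bc \<and> a \<in> cyc X Y \<and>
     biprod (oc (S X)) (oc Y) (oc Z) I1 I2 P1 P2 \<and>
     dl Z = I1 ** dl (S X) ** P1 + I2 ** dl Y ** P2 + I2 ** (a ** sg' X) ** P1"

lemma cone_df_iff:
  assumes X: "X \<in> bc" and Y: "Y \<in> bc" and Z: "Ob Z \<in> gobj C" "Df Z \<in> gmap C 1 (Ob Z) (Ob Z)"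
    and f: "f \<in> gmap C 0 (Ob X) (Ob Y)"
    and i: "i1 \<in> gmap C 0 (Ob (S X)) (Ob Z)" "i2 \<in> gmap C 0 (Ob Y) (Ob Z)"
      "p1 \<in> gmap C 0 (Ob Z) (Ob (S X))" "p2 \<in> gmap C 0 (Ob Z) (Ob Y)"
  shows "(\<forall>n. Df Z n =
        Plus C (Ob Z n) (Ob Z (n + 1))
          (Comp C (Ob Z n) (Ob X (n + 2)) (Ob Z (n + 1)) (i1 (n + 1))
             (Comp C (Ob Z n) (Ob X (n + 1)) (Ob X (n + 2)) (Df (S X) n) (p1 n)))
          (Comp C (Ob Z n) (Ob Y (n + 1)) (Ob Z (n + 1)) (i2 (n + 1))
             (Plus C (Ob Z n) (Ob Y (n + 1))
                (Comp C (Ob Z n) (Ob X (n + 1)) (Ob Y (n + 1)) (f (n + 1)) (p1 n))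
                (Comp C (Ob Z n) (Ob Y n) (Ob Y (n + 1)) (Df Y n) (p2 n))))) \<longleftrightarrow>
    dl Z = \<rho> 0 (Ob (S X)) (Ob Z) i1 ** dl (S X) ** \<rho> 0 (Ob Z) (Ob (S X)) p1
      + \<rho> 0 (Ob Y) (Ob Z) i2 ** dl Y ** \<rho> 0 (Ob Z) (Ob Y) p2
      + \<rho> 0 (Ob Y) (Ob Z) i2 ** (\<rho>0 X Y f ** sg' X) ** \<rho> 0 (Ob Z) (Ob (S X)) p1"
proof -
  note gX = bcD(1)[OF X] and gY = bcD(1)[OF Y] and gS = bcD(1)[OF S_bc[OF X]]
  have f': "(\<lambda>n. f (n + 1)) \<in> gmap C 1 (Ob (S X)) (Ob Y)" "\<rho> 1 (Ob (S X)) (Ob Y) (\<lambda>n. f (n + 1)) = \<rho>0 X Y f ** sg' X"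
    using \<rho>_shf(3,4)[OF gX gY f] by (auto simp: Ob_S)
  let ?u = "gcomp C 0 1 (Ob Z) (Ob (S X)) (Ob (S X)) (Df (S X)) p1"
  let ?v = "gcomp C 0 1 (Ob Z) (Ob (S X)) (Ob Y) (\<lambda>n. f (n + 1)) p1"
  let ?w = "gcomp C 0 1 (Ob Z) (Ob Y) (Ob Y) (Df Y) p2"
  let ?x = "gplus C 1 (Ob Z) (Ob Y) ?v ?w"
  let ?y = "gcomp C 1 0 (Ob Z) (Ob (S X)) (Ob Z) i1 ?u"
  let ?z = "gcomp C 1 0 (Ob Z) (Ob Y) (Ob Z) i2 ?x"
  have u: "?u \<in> gmap C 1 (Ob Z) (Ob (S X))" "\<rho> 1 (Ob Z) (Ob (S X)) ?u = dl (S X) ** \<rho> 0 (Ob Z) (Ob (S X)) p1"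
    using gcomp_closed[OF Z(1) gS gS i(3) bcD(2)[OF S_bc[OF X]]] \<rho>_comp[OF Z(1) gS gS i(3) bcD(2)[OF S_bc[OF X]]]
    by (auto simp: dl_def)
  have v: "?v \<in> gmap C 1 (Ob Z) (Ob Y)" "\<rho> 1 (Ob Z) (Ob Y) ?v = \<rho>0 X Y f ** sg' X ** \<rho> 0 (Ob Z) (Ob (S X)) p1"
    using gcomp_closed[OF Z(1) gS gY i(3) f'(1)] \<rho>_comp[OF Z(1) gS gY i(3) f'(1)] f'(2) by auto
  have w: "?w \<in> gmap C 1 (Ob Z) (Ob Y)" "\<rho> 1 (Ob Z) (Ob Y) ?w = dl Y ** \<rho> 0 (Ob Z) (Ob Y) p2"
    using gcomp_closed[OF Z(1) gY gY i(4) bcD(2)[OF Y]] \<rho>_comp[OF Z(1) gY gY i(4) bcD(2)[OF Y]] by (auto simp: dl_def)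
  have x: "?x \<in> gmap C 1 (Ob Z) (Ob Y)" using gmap_closed(5)[OF Z(1) gY v(1) w(1)] .
  have y: "?y \<in> gmap C 1 (Ob Z) (Ob Z)" "\<rho> 1 (Ob Z) (Ob Z) ?y = \<rho> 0 (Ob (S X)) (Ob Z) i1 ** \<rho> 1 (Ob Z) (Ob (S X)) ?u"
    using gcomp_closed[OF Z(1) gS Z(1) u(1) i(1)] \<rho>_comp[OF Z(1) gS Z(1) u(1) i(1)] by auto
  have z: "?z \<in> gmap C 1 (Ob Z) (Ob Z)" "\<rho> 1 (Ob Z) (Ob Z) ?z = \<rho> 0 (Ob Y) (Ob Z) i2 ** \<rho> 1 (Ob Z) (Ob Y) ?x"
    using gcomp_closed[OF Z(1) gY Z(1) x i(2)] \<rho>_comp[OF Z(1) gY Z(1) x i(2)] by auto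
  have "dl Z = \<rho> 0 (Ob (S X)) (Ob Z) i1 ** dl (S X) ** \<rho> 0 (Ob Z) (Ob (S X)) p1
      + \<rho> 0 (Ob Y) (Ob Z) i2 ** dl Y ** \<rho> 0 (Ob Z) (Ob Y) p2
      + \<rho> 0 (Ob Y) (Ob Z) i2 ** (\<rho>0 X Y f ** sg' X) ** \<rho> 0 (Ob Z) (Ob (S X)) p1 \<longleftrightarrow>
    \<rho> 1 (Ob Z) (Ob Z) (Df Z) = \<rho> 1 (Ob Z) (Ob Z) (gplus C 1 (Ob Z) (Ob Z) ?y ?z)"
    unfolding \<rho>_plus[OF Z(1,1) y(1) z(1)] y(2) z(2) u(2) \<rho>_plus[OF Z(1) gY v(1) w(1)] v(2) w(2)
    by (simp add: dl_def mul_simps add.assoc add.commute add.left_commute)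
  also have "\<dots> \<longleftrightarrow> Df Z = gplus C 1 (Ob Z) (Ob Z) ?y ?z"
    using \<rho>_inject[OF Z(1,1,2) gmap_closed(5)[OF Z(1,1) y(1) z(1)]] .
  finally show ?thesis
    by (simp add: fun_eq_iff gplus_def gcomp_def Ob_S shf_def add.assoc)
qed

text \<open>\<open>standard_triangles\<close> does not ask that the inclusion
  \<open>i\<^sub>2\<close> and the projection \<open>p\<^sub>1\<close> of the cone be chain maps.
  This follows from the form of the differential, and only then can their classes be named by ring
  elements.\<close>

lemma std_iff:
  "(X, Y, Z, u, v, w) \<in> standard_triangles C \<longleftrightarrow>
    (\<exists>a I1 I2 P1 P2. scone X Y Z a I1 I2 P1 P2 \<and> u = cls X Y a \<and> v = cls Y Z I2 \<and> w = cls Z (S X) P1)"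
  (is "?l \<longleftrightarrow> ?r")
proof -
  have aux: "I2 \<in> cyc Y Z" "P1 \<in> cyc Z (S X)" if s: "scone X Y Z a I1 I2 P1 P2" for a I1 I2 P1 P2
  proof -
    have s': "X \<in> bc" "Y \<in> bc" "Z \<in> bc" "a \<in> cyc X Y" "biprod (oc (S X)) (oc Y) (oc Z) I1 I2 P1 P2"
      "dl Z = I1 ** dl (S X) ** P1 + I2 ** dl Y ** P2 + I2 ** (a ** sg' X) ** P1" using s by (auto simp: scone_def)
    note B = s'(5)[unfolded biprod_def]
    have "P1 ** I1 = one (oc (S X))" "P2 ** I2 = one (oc Y)" "P2 ** I1 = 0" "P1 ** I2 = 0" using B by auto
    then show "I2 \<in> cyc Y Z" "P1 \<in> cyc Z (S X)"
      unfolding cyc_def using B one_r[OF bcD(5)[OF s'(2)]] one_l[OF bcD(5)[OF S_bc[OF s'(1)]]]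
      by (auto simp: s'(6) mul_simps mul_cong[of P1 I1] mul_cong[of P1 I2] mul_cong[of "one _" "dl (S X)"])
  qed
  show ?thesis
  proof
    assume ?l
    then obtain f i1 i2 p1 p2 where X: "X \<in> bc" and Y: "Y \<in> bc" and Z: "Z \<in> bc" and f: "f \<in> chain_maps C X Y"
      and mc: "is_mapping_cone C X Y f Z i1 i2 p1 p2" and eq: "u = hclass C X Y f" "v = hclass C Y Z i2" "w = hclass C Z (S X) p1"
      by (auto simp: standard_triangles_def)
    have i: "i1 \<in> gmap C 0 (Ob (S X)) (Ob Z)" "i2 \<in> gmap C 0 (Ob Y) (Ob Z)"
      "p1 \<in> gmap C 0 (Ob Z) (Ob (S X))" "p2 \<in> gmap C 0 (Ob Z) (Ob Y)"
      using mc by (auto simp: is_mapping_cone_def is_biproduct_def gmap_def Ob_S shf_def)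
    have f0: "f \<in> gmap C 0 (Ob X) (Ob Y)" "\<rho>0 X Y f \<in> cyc X Y" using chain_maps_iff[OF X Y] f by auto
    have s: "scone X Y Z (\<rho>0 X Y f) (\<rho> 0 (Ob (S X)) (Ob Z) i1) (\<rho> 0 (Ob Y) (Ob Z) i2)
        (\<rho> 0 (Ob Z) (Ob (S X)) p1) (\<rho> 0 (Ob Z) (Ob Y) p2)"
      using mc biprod_iff[OF bcD(1)[OF S_bc[OF X]] bcD(1)[OF Y] bcD(1)[OF Z] i] X Y Z f0
        cone_df_iff[OF X Y bcD(1,2)[OF Z] f0(1) i]
      unfolding scone_def is_mapping_cone_def by (simp add: Ob_S shf_def)
    have "i2 \<in> chain_maps C Y Z" "p1 \<in> chain_maps C Z (S X)"
      using aux[OF s] chain_maps_iff[OF Y Z] chain_maps_iff[OF Z S_bc[OF X]] i by auto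
    then show ?r using s eq hclass_eq X Y Z S_bc f by metis
  next
    assume ?r
    then obtain a I1 I2 P1 P2 where s: "scone X Y Z a I1 I2 P1 P2" and eq: "u = cls X Y a" "v = cls Y Z I2" "w = cls Z (S X) P1"
      by blast
    then have X: "X \<in> bc" and Y: "Y \<in> bc" and Z: "Z \<in> bc" and a: "a \<in> cyc X Y"
      and B: "biprod (oc (S X)) (oc Y) (oc Z) I1 I2 P1 P2"
      and d: "dl Z = I1 ** dl (S X) ** P1 + I2 ** dl Y ** P2 + I2 ** (a ** sg' X) ** P1"
      by (auto simp: scone_def)
    note g = bcD(1)[OF S_bc[OF X]] bcD(1)[OF Y] bcD(1)[OF Z]
    obtain f where f: "f \<in> chain_maps C X Y" "a = \<rho>0 X Y f" using cyc_surj[OF X Y a] .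
    then have f0: "f \<in> gmap C 0 (Ob X) (Ob Y)" using chain_maps_iff[OF X Y] by auto
    obtain i2 where i2: "i2 \<in> chain_maps C Y Z" "I2 = \<rho>0 Y Z i2" using cyc_surj[OF Y Z aux(1)[OF s]] .
    obtain p1 where p1: "p1 \<in> chain_maps C Z (S X)" "P1 = \<rho>0 Z (S X) p1" using cyc_surj[OF Z S_bc[OF X] aux(2)[OF s]] .
    obtain i1 where i1: "i1 \<in> gmap C 0 (Ob (S X)) (Ob Z)" "I1 = \<rho>0 (S X) Z i1"
      using \<rho>_surj[OF g(1,3), of I1 0] B by (auto simp: biprod_def)
    obtain p2 where p2: "p2 \<in> gmap C 0 (Ob Z) (Ob Y)" "P2 = \<rho>0 Z Y p2"
      using \<rho>_surj[OF g(3,2), of P2 0] B by (auto simp: biprod_def)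
    have ip: "i2 \<in> gmap C 0 (Ob Y) (Ob Z)" "p1 \<in> gmap C 0 (Ob Z) (Ob (S X))"
      using i2 p1 chain_maps_iff[OF Y Z] chain_maps_iff[OF Z S_bc[OF X]] by auto
    have "is_mapping_cone C X Y f Z i1 i2 p1 p2"
      using biprod_iff[OF g i1(1) ip p2(1)] cone_df_iff[OF X Y bcD(1,2)[OF Z] f0 i1(1) ip p2(1)] B d
        i1(2) i2(2) p1(2) p2(2) f(2)
      unfolding is_mapping_cone_def by (simp add: Ob_S shf_def)
    moreover have "u = hclass C X Y f" "v = hclass C Y Z i2" "w = hclass C Z (S X) p1"
      using eq f i2 p1 hclass_eq X Y Z S_bc by auto
    ultimately show ?l using X Y Z f(1) unfolding standard_triangles_def by blast
  qed
qed
text \<open>Membership in \<open>Kb_dist\<close>, stated for representatives so that squares can be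
  handled up to \<open>hr\<close>. \<open>rdistI\<close> and \<open>rdistD\<close> are the
  translation.\<close>

definition rdist :: "('o, 'm) cochain \<Rightarrow> ('o, 'm) cochain \<Rightarrow> ('o, 'm) cochain \<Rightarrow> 'r \<Rightarrow> 'r \<Rightarrow> 'r \<Rightarrow> bool" where
  "rdist X Y Z a b c \<longleftrightarrow> X \<in> bc \<and> Y \<in> bc \<and> Z \<in> bc \<and> a \<in> cyc X Y \<and> b \<in> cyc Y Z \<and> c \<in> cyc Z (S X) \<and>
     (\<exists>X' Y' Z' a' I1 I2 P1 P2 \<alpha> \<beta> \<gamma>. scone X' Y' Z' a' I1 I2 P1 P2 \<and>
        riso X X' \<alpha> \<and> riso Y Y' \<beta> \<and> riso Z Z' \<gamma> \<and>
        hr X Y' (\<beta> ** a - a' ** \<alpha>) \<and> hr Y Z' (\<gamma> ** b - I2 ** \<beta>) \<and> hr Z (S X') (shm X X' \<alpha> ** c - P1 ** \<gamma>))"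

lemma scone_cyc:
  assumes s: "scone X Y Z a I1 I2 P1 P2"
  shows "X \<in> bc" "Y \<in> bc" "Z \<in> bc" "a \<in> cyc X Y" "I2 \<in> cyc Y Z" "P1 \<in> cyc Z (S X)"
proof -
  show s': "X \<in> bc" "Y \<in> bc" "Z \<in> bc" "a \<in> cyc X Y" using s by (auto simp: scone_def)
  have d: "dl Z = I1 ** dl (S X) ** P1 + I2 ** dl Y ** P2 + I2 ** (a ** sg' X) ** P1" using s by (auto simp: scone_def)
  have B: "P1 ** I1 = one (oc (S X))" "P2 ** I2 = one (oc Y)" "P2 ** I1 = 0" "P1 ** I2 = 0"
    "I2 \<in> H 0 (oc Y) (oc Z)" "P1 \<in> H 0 (oc Z) (oc (S X))"
    using s by (auto simp: scone_def biprod_def)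
  show "I2 \<in> cyc Y Z" "P1 \<in> cyc Z (S X)"
    unfolding cyc_def using B one_r[OF bcD(5)[OF s'(2)]] one_l[OF bcD(5)[OF S_bc[OF s'(1)]]]
    by (auto simp: d mul_simps mul_cong[of P1 I1] mul_cong[of P1 I2] mul_cong[of "one _" "dl (S X)"])
qed

lemma cls_eqI: "\<lbrakk>X \<in> bc; Y \<in> bc; a \<in> cyc X Y; b \<in> cyc X Y; hr X Y (a - b)\<rbrakk> \<Longrightarrow> cls X Y a = cls X Y b"
  using cls_eq_iff by blast

lemma riso_cyc: "riso X Y a \<Longrightarrow> a \<in> cyc X Y"
  by (simp add: riso_def)

lemma rdistI:
  assumes d: "rdist X Y Z a b c"
  shows "(X, Y, Z, cls X Y a, cls Y Z b, cls Z (S X) c) \<in> Kb_dist C"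
proof -
  obtain X' Y' Z' a' I1 I2 P1 P2 \<alpha> \<beta> \<gamma> where s: "scone X' Y' Z' a' I1 I2 P1 P2"
    and i: "riso X X' \<alpha>" "riso Y Y' \<beta>" "riso Z Z' \<gamma>"
    and h: "hr X Y' (\<beta> ** a - a' ** \<alpha>)" "hr Y Z' (\<gamma> ** b - I2 ** \<beta>)" "hr Z (S X') (shm X X' \<alpha> ** c - P1 ** \<gamma>)"
    using d unfolding rdist_def by blast
  have X: "X \<in> bc" "Y \<in> bc" "Z \<in> bc" "a \<in> cyc X Y" "b \<in> cyc Y Z" "c \<in> cyc Z (S X)" using d by (auto simp: rdist_def)
  note s' = scone_cyc[OF s] and ic = riso_cyc[OF i(1)] riso_cyc[OF i(2)] riso_cyc[OF i(3)]
  let ?K = "Kb C"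
  have 1: "(X', Y', Z', cls X' Y' a', cls Y' Z' I2, cls Z' (S X') P1) \<in> standard_triangles C"
    unfolding std_iff using s by blast
  have 2: "is_iso ?K X X' (cls X X' \<alpha>)" "is_iso ?K Y Y' (cls Y Y' \<beta>)" "is_iso ?K Z Z' (cls Z Z' \<gamma>)"
    using is_iso_iff[OF X(1) s'(1) ic(1)] is_iso_iff[OF X(2) s'(2) ic(2)] is_iso_iff[OF X(3) s'(3) ic(3)] i by auto
  have 3: "Comp ?K X Y Y' (cls Y Y' \<beta>) (cls X Y a) = Comp ?K X X' Y' (cls X' Y' a') (cls X X' \<alpha>)"
    using cls_eqI[OF X(1) s'(2) cyc_mul[OF ic(2) X(4)] cyc_mul[OF s'(4) ic(1)] h(1)]
    by (simp add: Kb_Comp[OF X(1,2) s'(2) X(4) ic(2)] Kb_Comp[OF X(1) s'(1,2) ic(1) s'(4)])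
  have 4: "Comp ?K Y Z Z' (cls Z Z' \<gamma>) (cls Y Z b) = Comp ?K Y Y' Z' (cls Y' Z' I2) (cls Y Y' \<beta>)"
    using cls_eqI[OF X(2) s'(3) cyc_mul[OF ic(3) X(5)] cyc_mul[OF s'(5) ic(2)] h(2)]
    by (simp add: Kb_Comp[OF X(2,3) s'(3) X(5) ic(3)] Kb_Comp[OF X(2) s'(2,3) ic(2) s'(5)])
  note S1 = S_bc[OF X(1)] and S2 = S_bc[OF s'(1)] and sc = shm_cyc[OF X(1) s'(1) ic(1)]
  have 5: "Comp ?K Z (S X) (S X') (Kb_shift_arr (cls X X' \<alpha>)) (cls Z (S X) c) = Comp ?K Z Z' (S X') (cls Z' (S X') P1) (cls Z Z' \<gamma>)"
    using cls_eqI[OF X(3) S2 cyc_mul[OF sc X(6)] cyc_mul[OF s'(6) ic(3)] h(3)]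
    by (simp add: Kb_shift_arr_cls[OF X(1) s'(1) ic(1)] Kb_Comp[OF X(3) S1 S2 X(6) sc] Kb_Comp[OF X(3) s'(3) S2 ic(3) s'(6)])
  have 6: "cls X Y a \<in> Arr ?K X Y" "cls Y Z b \<in> Arr ?K Y Z" "cls Z (S X) c \<in> Arr ?K Z (S X)"
    using Kb_Arr[OF X(1,2)] Kb_Arr[OF X(2,3)] Kb_Arr[OF X(3) S1] X(4-6) by auto
  have K: "Obj (Kb_cat C) = bc" "Arr (Kb_cat C) = Arr ?K" "Comp (Kb_cat C) = Comp ?K" "is_iso (Kb_cat C) = is_iso ?K"
    by (simp_all add: Kb_def Kb_cat_def is_iso_def fun_eq_iff)
  show ?thesis
    unfolding Kb_dist_def Let_def K using X(1-3) 1 2 3 4 5 6 by blast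
qed

lemma rdistD:
  assumes d: "(X, Y, Z, u, v, w) \<in> Kb_dist C"
  obtains a b c where "rdist X Y Z a b c" "u = cls X Y a" "v = cls Y Z b" "w = cls Z (S X) c"
proof -
  let ?K = "Kb C"
  have K: "Obj (Kb_cat C) = bc" "Arr (Kb_cat C) = Arr ?K" "Comp (Kb_cat C) = Comp ?K" "is_iso (Kb_cat C) = is_iso ?K"
    by (simp_all add: Kb_def Kb_cat_def is_iso_def fun_eq_iff)
  obtain X' Y' Z' u' v' w' p q r where X: "X \<in> bc" "Y \<in> bc" "Z \<in> bc"
    and uvw: "u \<in> Arr ?K X Y" "v \<in> Arr ?K Y Z" "w \<in> Arr ?K Z (S X)"
    and std: "(X', Y', Z', u', v', w') \<in> standard_triangles C"
    and i: "is_iso ?K X X' p" "is_iso ?K Y Y' q" "is_iso ?K Z Z' r"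
    and e: "Comp ?K X Y Y' q u = Comp ?K X X' Y' u' p" "Comp ?K Y Z Z' r v = Comp ?K Y Y' Z' v' q"
      "Comp ?K Z (S X) (S X') (Kb_shift_arr p) w = Comp ?K Z Z' (S X') w' r"
    using d unfolding Kb_dist_def Let_def K by auto
  obtain a' I1 I2 P1 P2 where s: "scone X' Y' Z' a' I1 I2 P1 P2"
    and u': "u' = cls X' Y' a'" "v' = cls Y' Z' I2" "w' = cls Z' (S X') P1" using std unfolding std_iff by blast
  note s' = scone_cyc[OF s]
  note S1 = S_bc[OF X(1)] and S2 = S_bc[OF s'(1)]
  obtain a b c where abc: "a \<in> cyc X Y" "b \<in> cyc Y Z" "c \<in> cyc Z (S X)"
    and u: "u = cls X Y a" "v = cls Y Z b" "w = cls Z (S X) c"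
    using uvw Kb_Arr[OF X(1,2)] Kb_Arr[OF X(2,3)] Kb_Arr[OF X(3) S1] by auto
  have "p \<in> Arr ?K X X'" "q \<in> Arr ?K Y Y'" "r \<in> Arr ?K Z Z'" using i by (auto simp: is_iso_def)
  then obtain \<alpha> \<beta> \<gamma> where ic: "\<alpha> \<in> cyc X X'" "\<beta> \<in> cyc Y Y'" "\<gamma> \<in> cyc Z Z'"
    and p: "p = cls X X' \<alpha>" "q = cls Y Y' \<beta>" "r = cls Z Z' \<gamma>"
    using Kb_Arr[OF X(1) s'(1)] Kb_Arr[OF X(2) s'(2)] Kb_Arr[OF X(3) s'(3)] by auto
  note sc = shm_cyc[OF X(1) s'(1) ic(1)]
  have "riso X X' \<alpha>" "riso Y Y' \<beta>" "riso Z Z' \<gamma>"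
    using is_iso_iff[OF X(1) s'(1) ic(1)] is_iso_iff[OF X(2) s'(2) ic(2)] is_iso_iff[OF X(3) s'(3) ic(3)] i p by auto
  moreover have "hr X Y' (\<beta> ** a - a' ** \<alpha>)"
    using e(1) unfolding u p u' Kb_Comp[OF X(1,2) s'(2) abc(1) ic(2)] Kb_Comp[OF X(1) s'(1,2) ic(1) s'(4)]
      cls_eq_iff[OF X(1) s'(2) cyc_mul[OF ic(2) abc(1)] cyc_mul[OF s'(4) ic(1)]] .
  moreover have "hr Y Z' (\<gamma> ** b - I2 ** \<beta>)"
    using e(2) unfolding u p u' Kb_Comp[OF X(2,3) s'(3) abc(2) ic(3)] Kb_Comp[OF X(2) s'(2,3) ic(2) s'(5)]
      cls_eq_iff[OF X(2) s'(3) cyc_mul[OF ic(3) abc(2)] cyc_mul[OF s'(5) ic(2)]] .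
  moreover have "hr Z (S X') (shm X X' \<alpha> ** c - P1 ** \<gamma>)"
    using e(3) unfolding u p u' Kb_shift_arr_cls[OF X(1) s'(1) ic(1)] Kb_Comp[OF X(3) S1 S2 abc(3) sc]
      Kb_Comp[OF X(3) s'(3) S2 ic(3) s'(6)]
      cls_eq_iff[OF X(3) S2 cyc_mul[OF sc abc(3)] cyc_mul[OF s'(6) ic(3)]] .
  ultimately have "rdist X Y Z a b c" unfolding rdist_def using X abc s by blast
  then show ?thesis using that u by blast
qed

lemma shm_mul:
  assumes Y: "Y \<in> bc" and a: "a \<in> H 0 (oc X) (oc Y)"
  shows "shm Y Z b ** shm X Y a = shm X Z (b ** a)"
  using sg_inv(1)[OF bcD(1)[OF Y]] one_l[OF a] by (simp add: shm_def mul_assoc mul_cong[of "sg' Y" "sg Y"] mul_cong[of "one _" a])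

lemma rdist_iso:
  assumes d: "rdist X Y Z a b c" and X1: "X1 \<in> bc" "Y1 \<in> bc" "Z1 \<in> bc"
    and abc: "a1 \<in> cyc X1 Y1" "b1 \<in> cyc Y1 Z1" "c1 \<in> cyc Z1 (S X1)"
    and i: "riso X1 X \<alpha>" "riso Y1 Y \<beta>" "riso Z1 Z \<gamma>"
    and h: "hr X1 Y (\<beta> ** a1 - a ** \<alpha>)" "hr Y1 Z (\<gamma> ** b1 - b ** \<beta>)" "hr Z1 (S X) (shm X1 X \<alpha> ** c1 - c ** \<gamma>)"
  shows "rdist X1 Y1 Z1 a1 b1 c1"
proof -
  obtain X' Y' Z' a' I1 I2 P1 P2 \<alpha>' \<beta>' \<gamma>' where s: "scone X' Y' Z' a' I1 I2 P1 P2"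
    and i': "riso X X' \<alpha>'" "riso Y Y' \<beta>'" "riso Z Z' \<gamma>'"
    and h': "hr X Y' (\<beta>' ** a - a' ** \<alpha>')" "hr Y Z' (\<gamma>' ** b - I2 ** \<beta>')" "hr Z (S X') (shm X X' \<alpha>' ** c - P1 ** \<gamma>')"
    using d unfolding rdist_def by blast
  have X: "X \<in> bc" "Y \<in> bc" "Z \<in> bc" using d by (auto simp: rdist_def)
  note s' = scone_cyc[OF s]
  note ic = riso_cyc[OF i(1)] riso_cyc[OF i(2)] riso_cyc[OF i(3)]
  note ic' = riso_cyc[OF i'(1)] riso_cyc[OF i'(2)] riso_cyc[OF i'(3)]
  have sq: "hr A D ((q' ** q) ** f - g' ** (p' ** p))"
    if "hr A E (q ** f - g ** p)" "hr B D (q' ** g - g' ** p')" "p \<in> cyc A B" "q' \<in> cyc E D" for A B D E f g g' p q p' q'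
  proof -
    have "hr A D (q' ** (q ** f - g ** p) + (q' ** g - g' ** p') ** p)"
      using hrel_add[OF hrel_mul_l[OF that(1) cycD[OF that(4)]] hrel_mul_r[OF that(2) cycD[OF that(3)]]] .
    then show ?thesis by (simp add: mul_simps)
  qed
  have "riso X1 X' (\<alpha>' ** \<alpha>)" "riso Y1 Y' (\<beta>' ** \<beta>)" "riso Z1 Z' (\<gamma>' ** \<gamma>)"
    using riso_comp[OF X1(1) X(1) s'(1) i(1) i'(1)] riso_comp[OF X1(2) X(2) s'(2) i(2) i'(2)]
      riso_comp[OF X1(3) X(3) s'(3) i(3) i'(3)] by auto
  moreover note sq[OF h(1) h'(1) ic(1) ic'(2)] sq[OF h(2) h'(2) ic(2) ic'(3)]
  moreover have "hr Z1 (S X') (shm X1 X' (\<alpha>' ** \<alpha>) ** c1 - P1 ** (\<gamma>' ** \<gamma>))"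
    using sq[OF h(3) h'(3) ic(3) shm_cyc[OF X(1) s'(1) ic'(1)]] shm_mul[OF X(1) cycD(1)[OF ic(1)]] by simp
  ultimately show ?thesis unfolding rdist_def using X1 abc s by blast
qed

text \<open>Biproducts are chosen separately in each degree and then assembled. The differential
  squares to zero because \<open>a ** sg' X\<close> anticommutes with the differentials, the
  suspension having negated that of \<open>X\<close>.\<close>

lemma cone_ex:
  assumes bip: "\<And>A B. \<lbrakk>A \<in> Obj C; B \<in> Obj C\<rbrakk> \<Longrightarrow> \<exists>D\<in>Obj C. \<exists>i1 i2 p1 p2. is_biproduct C A B D i1 i2 p1 p2"
    and X: "X \<in> bc" and Y: "Y \<in> bc" and a: "a \<in> cyc X Y"
  shows "\<exists>Z I1 I2 P1 P2. scone X Y Z a I1 I2 P1 P2"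
proof -
  note g = bcD(1)[OF S_bc[OF X]] bcD(1)[OF Y]
  have "\<forall>n. \<exists>D i1 i2 p1 p2. D \<in> Obj C \<and> is_biproduct C (Ob (S X) n) (Ob Y n) D i1 i2 p1 p2"
    using bip gobjD[OF g(1)] gobjD[OF g(2)] by blast
  then obtain D i1 i2 p1 p2 where D: "\<And>n. D n \<in> Obj C"
    and bi: "\<And>n. is_biproduct C (Ob (S X) n) (Ob Y n) (D n) (i1 n) (i2 n) (p1 n) (p2 n)" by metis
  have gD: "D \<in> gobj C" using D by (simp add: gobj_def)
  have i: "i1 \<in> gmap C 0 (Ob (S X)) D" "i2 \<in> gmap C 0 (Ob Y) D"
      "p1 \<in> gmap C 0 D (Ob (S X))" "p2 \<in> gmap C 0 D (Ob Y)"
    using bi by (auto simp: is_biproduct_def gmap_def)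
  define I1 I2 P1 P2 where I: "I1 = \<rho> 0 (Ob (S X)) D i1" "I2 = \<rho> 0 (Ob Y) D i2" "P1 = \<rho> 0 D (Ob (S X)) p1" "P2 = \<rho> 0 D (Ob Y) p2"
  have B: "biprod (oc (S X)) (oc Y) (ob D) I1 I2 P1 P2"
    using biprod_iff[OF g gD i] bi I by simp
  have Beq: "P1 ** I1 = one (oc (S X))" "P2 ** I2 = one (oc Y)" "P2 ** I1 = 0" "P1 ** I2 = 0"
    and BH: "I1 \<in> H 0 (oc (S X)) (ob D)" "I2 \<in> H 0 (oc Y) (ob D)" "P1 \<in> H 0 (ob D) (oc (S X))" "P2 \<in> H 0 (ob D) (oc Y)"
    using B by (auto simp: biprod_def)
  define d where "d = I1 ** dl (S X) ** P1 + I2 ** dl Y ** P2 + I2 ** (a ** sg' X) ** P1"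
  note dS = bcD(5,6)[OF S_bc[OF X]] and dY = bcD(5,6)[OF Y]
  have u: "a ** sg' X \<in> H 1 (oc (S X)) (oc Y)"
    using H_mul'[OF cycD(1)[OF a] sg_in(2)[OF bcD(1)[OF X]]] by simp
  have dH: "d \<in> H 1 (ob D) (ob D)"
    using H_mul'[OF H_mul'[OF BH(1) dS(1) refl] BH(3), of 1] H_mul'[OF H_mul'[OF BH(2) dY(1) refl] BH(4), of 1]
      H_mul'[OF H_mul'[OF BH(2) u refl] BH(3), of 1] unfolding d_def by (intro H_add) auto
  have sgd: "dl Y ** (a ** (sg' X ** f)) = - (a ** (sg' X ** (dl (S X) ** f)))" for f
    using one_l[OF bcD(5)[OF X]]
    by (simp add: shift_dl[OF bcD(1,2)[OF X]] mul_simps mul_cong[OF sg_inv(1)[OF bcD(1)[OF X]]]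
      mul_cong[OF cycD(2)[OF a]] mul_cong[of "one _" "dl X"])
  have dd: "d ** d = 0"
    unfolding d_def using one_l[OF dS(1)] one_l[OF dY(1)] one_l[OF u]
    by (simp add: mul_simps mul_cong[OF Beq(1)] mul_cong[OF Beq(2)] mul_cong[OF Beq(3)] mul_cong[OF Beq(4)]
      mul_cong[OF dS(2)] mul_cong[OF dY(2)] mul_cong[of "one _" "dl (S X)"] mul_cong[of "one _" "dl Y"]
      mul_cong[of "one _" a] one_l[OF cycD(1)[OF a]] sgd)
  obtain df where df: "df \<in> gmap C 1 D D" "d = \<rho> 1 D D df" using \<rho>_surj[OF gD gD dH] .
  define Z where "Z = \<lparr>Ob = D, Df = df\<rparr>"
  have Z: "Ob Z = D" "dl Z = d" using df by (auto simp: Z_def dl_def)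
  have "bdd (ob D)"
  proof -
    have 1: "pr n (ob D) = pr n (ob D) ** I1 ** P1 + pr n (ob D) ** I2 ** P2" for n
      using B one_r[OF H_pr, of n "ob D"] by (simp add: biprod_def mul_assoc mul_add[symmetric])
    have 2: "pr n (ob D) ** I1 = I1 ** pr n (oc (S X))" "pr n (ob D) ** I2 = I2 ** pr n (oc Y)" for n
      using pr_comm[OF BH(1)] pr_comm[OF BH(2)] by simp_all
    have "pr n (ob D) = 0" if "pr n (oc (S X)) = 0" "pr n (oc Y) = 0" for n
      by (subst 1) (simp add: 2 that)
    then have "{n. pr n (ob D) \<noteq> 0} \<subseteq> {n. pr n (oc (S X)) \<noteq> 0} \<union> {n. pr n (oc Y) \<noteq> 0}" by auto
    then show ?thesis
      using bcD(4)[OF S_bc[OF X]] bcD(4)[OF Y] unfolding bdd_def by (meson finite_UnI finite_subset)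
  qed
  then have "Z \<in> bc" using gD df dH dd Z by (intro bcI) (auto simp: Z_def cx_def)
  then have "scone X Y Z a I1 I2 P1 P2" unfolding scone_def using X Y a B Z by (simp add: d_def)
  then show ?thesis by blast
qed

text \<open>
  If \<open>N \<rightarrow>g K \<rightarrow> Z\<close> is a standard triangle and \<open>S W = Z\<close>, then \<open>W \<rightarrow> N \<rightarrow>g K \<rightarrow> Z\<close> is distinguished,
  its first arrow being minus the shift of \<open>Z \<rightarrow> S N\<close>.
\<close>

lemma rotation:
  assumes bip: "\<And>A B. \<lbrakk>A \<in> Obj C; B \<in> Obj C\<rbrakk> \<Longrightarrow> \<exists>D\<in>Obj C. \<exists>i1 i2 p1 p2. is_biproduct C A B D i1 i2 p1 p2"
    and s: "scone N K (S W) g I1 I2 P1 P2" and W: "W \<in> bc"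
  shows "rdist W N K (- (sg' N ** P1 ** sg W)) g I2"
proof -
  define Z where "Z = S W"
  note s' = scone_cyc[OF s, folded Z_def]
  have sN: "sg' N ** sg N = one (oc N)" "sg N ** sg' N = one (oc (S N))" 
    and hN: "sg N \<in> H (-1) (oc N) (oc (S N))" "sg' N \<in> H 1 (oc (S N)) (oc N)"
    using sg_inv[OF bcD(1)[OF s'(1)]] sg_in[OF bcD(1)[OF s'(1)]] by auto
  have sW: "sg' W ** sg W = one (oc W)" "sg W ** sg' W = one (oc Z)"
    and hW: "sg W \<in> H (-1) (oc W) (oc Z)" "sg' W \<in> H 1 (oc Z) (oc W)"
    using sg_inv[OF bcD(1)[OF W]] sg_in[OF bcD(1)[OF W]] by (auto simp: Z_def)
  have dZ0: "dl Z = I1 ** dl (S N) ** P1 + I2 ** dl K ** P2 + I2 ** (g ** sg' N) ** P1"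
    and B: "P1 ** I1 = one (oc (S N))" "P2 ** I2 = one (oc K)" "P2 ** I1 = 0" "P1 ** I2 = 0"
      "I1 ** P1 + I2 ** P2 = one (oc Z)" "I1 \<in> H 0 (oc (S N)) (oc Z)" "I2 \<in> H 0 (oc K) (oc Z)"
      "P1 \<in> H 0 (oc Z) (oc (S N))" "P2 \<in> H 0 (oc Z) (oc K)"
    using s unfolding scone_def biprod_def Z_def by auto
  have dZH: "dl Z \<in> H 1 (oc Z) (oc Z)" "dl K \<in> H 1 (oc K) (oc K)" "dl N \<in> H 1 (oc N) (oc N)"
    using bcD s' by auto
  \<comment> \<open>\<open>i\<close> and \<open>p\<close> split off \<open>N\<close> itself instead
    of \<open>S N\<close>, at the cost of having degrees -1 and 1. The suspension of
    \<open>N\<close> then disappears from the formulas.\<close>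
  define i p where "i = I1 ** sg N" and "p = sg' N ** P1"
  have iH: "i \<in> H (-1) (oc N) (oc Z)" and pH: "p \<in> H 1 (oc Z) (oc N)"
    using H_mul'[OF B(6) hN(1)] H_mul'[OF hN(2) B(8)] by (auto simp: i_def p_def)
  have pi: "p ** i = one (oc N)" "P2 ** i = 0" "p ** I2 = 0" "i ** p + I2 ** P2 = one (oc Z)"
    using B one_l[OF hN(1)] one_l[OF B(8)] sN
    by (simp_all add: i_def p_def mul_assoc mul_cong[of P1 I1] mul_cong[of P2 I1] mul_cong[of "sg N" "sg' N"])
  have dZ: "dl Z = - (i ** (dl N ** p)) + I2 ** (dl K ** P2) + I2 ** (g ** p)"
    unfolding dZ0 shift_dl(2)[OF bcD(1,2)[OF s'(1)]] by (simp add: i_def p_def mul_simps)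
  have g: "g \<in> H 0 (oc N) (oc K)" "dl K ** g = g ** dl N" using cycD[OF s'(4)] by auto
  define h where "h = - (p ** sg W)"
  have hH: "h \<in> H 0 (oc W) (oc N)" using H_uminus[OF H_mul'[OF pH hW(1), of 0]] by (simp add: h_def)
  have dW: "dl W = - (sg' W ** (dl Z ** sg W))"
    using one_l[OF bcD(5)[OF W]] one_r[OF bcD(5)[OF W]]
    by (simp add: Z_def shift_dl[OF bcD(1,2)[OF W]] mul_simps sW mul_cong[OF sW(1)])
  note ps = pi(1-3) B(2) mul_cong[OF pi(1)] mul_cong[OF pi(2)] mul_cong[OF pi(3)] mul_cong[OF B(2)]
    mul_cong[of "one (oc N)", OF one_l[OF dZH(3)]] mul_cong[of "one (oc N)", OF one_l[OF pH]]
    mul_cong[of "one (oc K)", OF one_l[OF dZH(2)]] mul_cong[of "one (oc K)", OF one_l[OF g(1)]]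
    mul_cong[of "one (oc K)", OF one_l[OF B(9)]]
    one_l[OF dZH(3)] one_l[OF pH] one_l[OF dZH(2)] one_l[OF g(1)] one_l[OF B(9)]
    one_r[OF iH] one_r[OF B(7)] one_r[OF g(1)] one_r[OF dZH(3)] one_r[OF dZH(2)]
  have hc: "h \<in> cyc W N"
  proof -
    have "sg W ** (sg' W ** (dl Z ** f)) = dl Z ** f" for f
      using mul_cong[OF sW(2)] mul_cong[OF one_l[OF dZH(1)]] by simp
    then have "dl N ** h = h ** dl W"
      unfolding h_def dW by (simp add: mul_simps) (simp add: dZ mul_simps ps)
    then show ?thesis using hH by (simp add: cyc_def)
  qed
  obtain D J1 J2 Q1 Q2 where sD: "scone W N D h J1 J2 Q1 Q2" using cone_ex[OF bip W s'(1) hc] by blast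
  note sD' = scone_cyc[OF sD]
  have dD0: "dl D = J1 ** dl Z ** Q1 + J2 ** dl N ** Q2 + J2 ** (h ** sg' W) ** Q1"
    and E: "Q1 ** J1 = one (oc Z)" "Q2 ** J2 = one (oc N)" "Q2 ** J1 = 0" "Q1 ** J2 = 0"
      "J1 ** Q1 + J2 ** Q2 = one (oc D)" "J1 \<in> H 0 (oc Z) (oc D)" "J2 \<in> H 0 (oc N) (oc D)"
      "Q1 \<in> H 0 (oc D) (oc Z)" "Q2 \<in> H 0 (oc D) (oc N)"
    using sD unfolding scone_def biprod_def Z_def by auto
  have "h ** sg' W = - p" using one_r[OF pH] by (simp add: h_def mul_simps sW)
  then have dD: "dl D = J1 ** (dl Z ** Q1) + J2 ** (dl N ** Q2) - J2 ** (p ** Q1)"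
    unfolding dD0 by (simp add: mul_simps)
  note es = E(1-4) mul_cong[OF E(1)] mul_cong[OF E(2)] mul_cong[OF E(3)] mul_cong[OF E(4)]
    mul_cong[of "one (oc Z)", OF one_l[OF iH]] mul_cong[of "one (oc Z)", OF one_l[OF B(7)]]
    mul_cong[of "one (oc Z)", OF one_l[OF dZH(1)]] one_l[OF iH] one_l[OF B(7)] one_l[OF dZH(1)]
    one_r[OF B(9)] one_r[OF pH] one_r[OF E(7)] one_r[OF E(6)]
    mul_cong[of "one (oc N)", OF one_l[OF E(9)]] one_l[OF E(9)]
  \<comment> \<open>The cone \<open>D\<close> of \<open>h\<close> is built from \<open>S N\<close>,
    \<open>K\<close> and \<open>N\<close>, and the first and the third of these cancel.
    \<open>\<kappa>\<close> includes \<open>K\<close>, and \<open>l\<close> retracts onto it: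
    \<open>l ** \<kappa>\<close> is the identity, and \<open>J1 ** (i ** Q2)\<close> is a homotopy
    between \<open>\<kappa> ** l\<close> and the identity.\<close>
  define \<kappa> where "\<kappa> = J1 ** I2"
  define l where "l = P2 ** Q1 + g ** Q2"
  have \<kappa>c: "\<kappa> \<in> cyc K D"
  proof -
    have "\<kappa> \<in> H 0 (oc K) (oc D)" using H_mul'[OF E(6) B(7)] by (simp add: \<kappa>_def)
    moreover have "dl D ** \<kappa> = \<kappa> ** dl K" by (simp add: dD \<kappa>_def mul_simps es ps) (simp add: dZ mul_simps ps)
    ultimately show ?thesis by (simp add: cyc_def)
  qed
  have lc: "l \<in> cyc D K"
  proof -
    have "l \<in> H 0 (oc D) (oc K)" using H_add[OF H_mul'[OF B(9) E(8), of 0] H_mul'[OF g(1) E(9), of 0]] by (simp add: l_def)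
    moreover have "dl K ** l = l ** dl D"
      by (simp add: dD l_def mul_simps es ps) (simp add: dZ mul_simps ps mul_cong[OF g(2)])
    ultimately show ?thesis by (simp add: cyc_def)
  qed
  have lk: "l ** \<kappa> = one (oc K)" by (simp add: l_def \<kappa>_def mul_simps es ps)
  have h1: "dl D ** (J1 ** i) + (J1 ** i) ** dl N = \<kappa> ** g - J2"
    by (simp add: dD \<kappa>_def mul_simps es ps) (simp add: dZ mul_simps ps es)
  have h2: "dl D ** (J1 ** (i ** Q2)) + (J1 ** (i ** Q2)) ** dl D = \<kappa> ** l - one (oc D)"
  proof -
    have "one (oc D) = J1 ** ((i ** p + I2 ** P2) ** Q1) + J2 ** Q2"
      using E(5) one_l[OF E(8)] by (simp add: pi(4))
    then show ?thesis
      by (simp add: dD \<kappa>_def l_def mul_simps es ps) (simp add: dZ mul_simps ps es)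
  qed
  have J1i: "J1 ** i \<in> H (-1) (oc N) (oc D)" using H_mul'[OF E(6) iH] by simp
  have "J1 ** (i ** Q2) \<in> H (-1) (oc D) (oc D)" using H_mul'[OF J1i E(9)] by (simp add: mul_assoc)
  then have "hr D D (\<kappa> ** l - one (oc D))" unfolding hrel_def h2[symmetric] by blast
  then have r\<kappa>: "riso K D \<kappa>"
    unfolding riso_def using \<kappa>c lk by (auto intro!: bexI[OF _ lc])
  have k1: "hr N D (\<kappa> ** g - J2)" using J1i h1[symmetric] unfolding hrel_def by blast
  have sq1: "hr W N (one (oc N) ** h - h ** one (oc W))" by (simp add: one_l[OF hH] one_r[OF hH])
  have sq2: "hr N D (\<kappa> ** g - J2 ** one (oc N))" using k1 by (simp add: one_r[OF E(7)])
  have "shm W W (one (oc W)) = one (oc Z)"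
    using sW one_l[OF hW(2)] by (simp add: shm_def mul_assoc)
  then have sq3: "hr K (S W) (shm W W (one (oc W)) ** I2 - Q1 ** \<kappa>)" by (simp add: \<kappa>_def es)
  have "\<exists>X' Y' Z' a' I1 I2' P1 P2 \<alpha> \<beta> \<gamma>. scone X' Y' Z' a' I1 I2' P1 P2 \<and>
        riso W X' \<alpha> \<and> riso N Y' \<beta> \<and> riso K Z' \<gamma> \<and>
        hr W Y' (\<beta> ** h - a' ** \<alpha>) \<and> hr N Z' (\<gamma> ** g - I2' ** \<beta>) \<and> hr K (S X') (shm W X' \<alpha> ** I2 - P1 ** \<gamma>)"
    using sD riso_one[OF W] riso_one[OF s'(1)] r\<kappa> sq1 sq2 sq3 by blast
  then have "rdist W N K h g I2"
    unfolding rdist_def using W s'(1,2,4,5) hc by (simp add: Z_def)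
  then show ?thesis by (simp add: h_def p_def)
qed

end

section \<open>The duality in the presence of resolutions\<close>

text \<open>
  \<open>C\<^sub>1\<close> is represented covariantly with values in \<open>I\<close>, and \<open>C\<^sub>2\<close> contravariantly with values in \<open>P\<close>.
\<close>

locale dual_setting = grpair mul H one pr P I
    + U: krep C\<^sub>1 mul H one pr ob\<^sub>1 \<rho>\<^sub>1
    + V: krep C\<^sub>2 "\<lambda>f g. mul g f" "\<lambda>k a b. H k b a" one "\<lambda>n. pr (- n)" ob\<^sub>2 \<rho>\<^sub>2
  for mul :: "'r :: ab_group_add \<Rightarrow> 'r \<Rightarrow> 'r" (infixl \<open>**\<close> 70)
    and H :: "int \<Rightarrow> 'x \<Rightarrow> 'x \<Rightarrow> 'r set" and one :: "'x \<Rightarrow> 'r" and pr :: "int \<Rightarrow> 'x \<Rightarrow> 'r"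
    and P I :: "'x set"
    and C\<^sub>1 :: "('o, 'm) preadd_cat" and ob\<^sub>1 \<rho>\<^sub>1
    and C\<^sub>2 :: "('p, 'q) preadd_cat" and ob\<^sub>2 \<rho>\<^sub>2 +
  assumes ob1_I: "X \<in> gobj C\<^sub>1 \<Longrightarrow> ob\<^sub>1 X \<in> I"
    and ob2_P: "Y \<in> gobj C\<^sub>2 \<Longrightarrow> ob\<^sub>2 Y \<in> P"
    and ob1_ess: "x \<in> I \<Longrightarrow> \<exists>X\<in>gobj C\<^sub>1. \<exists>u\<in>H 0 x (ob\<^sub>1 X). \<exists>v\<in>H 0 (ob\<^sub>1 X) x. v ** u = one x \<and> u ** v = one (ob\<^sub>1 X)"
    and ob2_ess: "y \<in> P \<Longrightarrow> \<exists>Y\<in>gobj C\<^sub>2. \<exists>u\<in>H 0 y (ob\<^sub>2 Y). \<exists>v\<in>H 0 (ob\<^sub>2 Y) y. v ** u = one y \<and> u ** v = one (ob\<^sub>2 Y)"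
begin

text \<open>The biproduct is formed in \<open>P\<close> from constant families, moved to an object
  that comes from \<open>C\<^sub>2\<close>, and read off in degree 0.\<close>

lemma biproducts:
  assumes A: "A \<in> Obj C\<^sub>2" and B: "B \<in> Obj C\<^sub>2"
  shows "\<exists>D\<in>Obj C\<^sub>2. \<exists>i1 i2 p1 p2. is_biproduct C\<^sub>2 A B D i1 i2 p1 p2"
proof -
  have g: "(\<lambda>_. A) \<in> gobj C\<^sub>2" "(\<lambda>_. B) \<in> gobj C\<^sub>2" using A B by (simp_all add: gobj_def)
  let ?a = "ob\<^sub>2 (\<lambda>_. A)" and ?b = "ob\<^sub>2 (\<lambda>_. B)"
  obtain c i1 i2 p1 p2 where c: "c \<in> P" "biprod ?a ?b c i1 i2 p1 p2" using biprod_P[OF ob2_P[OF g(1)] ob2_P[OF g(2)]] by blast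
  obtain Y u v where Y: "Y \<in> gobj C\<^sub>2" and u: "u \<in> H 0 c (ob\<^sub>2 Y)" and v: "v \<in> H 0 (ob\<^sub>2 Y) c"
    and uv: "v ** u = one c" "u ** v = one (ob\<^sub>2 Y)" using ob2_ess[OF c(1)] by blast
  have h: "i1 \<in> H 0 ?a c" "i2 \<in> H 0 ?b c" "p1 \<in> H 0 c ?a" "p2 \<in> H 0 c ?b" using c(2) by (auto simp: biprod_def)
  have vu: "v ** (u ** f) = f" if "f \<in> H 0 w c" for f w using one_l[OF that] by (simp add: mul_assoc[symmetric] uv)
  have "u ** (i1 ** (p1 ** v)) + u ** (i2 ** (p2 ** v)) = u ** ((i1 ** p1 + i2 ** p2) ** v)" by (simp add: mul_simps)
  also have "\<dots> = one (ob\<^sub>2 Y)" using c(2) one_l[OF v] uv by (simp add: biprod_def)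
  finally have "V.biprod ?a ?b (ob\<^sub>2 Y) (p1 ** v) (p2 ** v) (u ** i1) (u ** i2)"
    using c(2) vu[OF h(1)] vu[OF h(2)] H_mul[OF h(1) u] H_mul[OF h(2) u] H_mul[OF v h(3)] H_mul[OF v h(4)]
    by (simp add: V.biprod_def biprod_def mul_assoc)
  moreover obtain i1' where "i1' \<in> gmap C\<^sub>2 0 (\<lambda>_. A) Y" "p1 ** v = \<rho>\<^sub>2 0 (\<lambda>_. A) Y i1'" using V.\<rho>_surj[OF g(1) Y, of "p1 ** v" 0] H_mul[OF v h(3)] by auto
  moreover obtain i2' where "i2' \<in> gmap C\<^sub>2 0 (\<lambda>_. B) Y" "p2 ** v = \<rho>\<^sub>2 0 (\<lambda>_. B) Y i2'" using V.\<rho>_surj[OF g(2) Y, of "p2 ** v" 0] H_mul[OF v h(4)] by auto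
  moreover obtain p1' where "p1' \<in> gmap C\<^sub>2 0 Y (\<lambda>_. A)" "u ** i1 = \<rho>\<^sub>2 0 Y (\<lambda>_. A) p1'" using V.\<rho>_surj[OF Y g(1), of "u ** i1" 0] H_mul[OF h(1) u] by auto
  moreover obtain p2' where "p2' \<in> gmap C\<^sub>2 0 Y (\<lambda>_. B)" "u ** i2 = \<rho>\<^sub>2 0 Y (\<lambda>_. B) p2'" using V.\<rho>_surj[OF Y g(2), of "u ** i2" 0] H_mul[OF h(2) u] by auto
  ultimately have "is_biproduct C\<^sub>2 A B (Y 0) (i1' 0) (i2' 0) (p1' 0) (p2' 0)" using V.biprod_iff[OF g Y, of i1' i2' p1' p2'] by simp
  moreover have "Y 0 \<in> Obj C\<^sub>2" using Y by (simp add: gobj_def)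
  ultimately show ?thesis by blast
qed

section \<open>Triples that join complexes over the two categories\<close>

lemma V_iff: "V.cx a d \<longleftrightarrow> cx a d" "V.bdd a \<longleftrightarrow> bdd a" "V.hrel b db a da f \<longleftrightarrow> hrel a da b db f"
  by (auto simp: dual_simps V.hrel_def hrel_def add.commute)

text \<open>A triple consists of a complex over \<open>C\<^sub>1\<close>, a complex over
  \<open>C\<^sub>2\<close> and a good map between the objects that represent them. The duality will
  take the first member to the second, and its inverse the second to the first.\<close>

definition gt :: "('o, 'm) cochain \<times> ('p, 'q) cochain \<times> 'r \<Rightarrow> bool" where
  "gt = (\<lambda>(X, Y, e). X \<in> U.bc \<and> Y \<in> V.bc \<and> good P I (V.oc Y) (V.dl Y) (U.oc X) (U.dl X) e)"

abbreviation tX :: "('o, 'm) cochain \<times> ('p, 'q) cochain \<times> 'r \<Rightarrow> ('o, 'm) cochain" where "tX \<equiv> fst"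
abbreviation tY :: "('o, 'm) cochain \<times> ('p, 'q) cochain \<times> 'r \<Rightarrow> ('p, 'q) cochain" where "tY t \<equiv> fst (snd t)"
abbreviation te :: "('o, 'm) cochain \<times> ('p, 'q) cochain \<times> 'r \<Rightarrow> 'r" where "te t \<equiv> snd (snd t)"

lemma gtD:
  assumes "gt t"
  shows "tX t \<in> U.bc" "tY t \<in> V.bc" "good P I (V.oc (tY t)) (V.dl (tY t)) (U.oc (tX t)) (U.dl (tX t)) (te t)"
  using assms by (auto simp: gt_def case_prod_beta)

lemma gtD':
  assumes "gt t"
  shows "cx (U.oc (tX t)) (U.dl (tX t))" "bdd (U.oc (tX t))" "U.oc (tX t) \<in> I"
    "cx (V.oc (tY t)) (V.dl (tY t))" "bdd (V.oc (tY t))" "V.oc (tY t) \<in> P"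
  using U.bcD(1,3,4)[OF gtD(1)[OF assms]] V.bcD(1,3,4)[OF gtD(2)[OF assms]] ob1_I ob2_P
  by (auto simp: V_iff)

text \<open>\<open>ex_good_I\<close> yields a resolution by some object of \<open>P\<close>.
  Transport along an isomorphism of degree 0 replaces it by one that represents a complex over
  \<open>C\<^sub>2\<close>.\<close>

lemma ex_gt_X:
  assumes X: "X \<in> U.bc"
  shows "\<exists>t. gt t \<and> tX t = X"
proof -
  note X' = U.bcD[OF X]
  obtain y dy e where y: "y \<in> P" "bdd y" "cx y dy" and g: "good P I y dy (U.oc X) (U.dl X) e"
    using ex_good_I[OF ob1_I[OF X'(1)] X'(3,4)] by blast
  obtain Y u v where Y: "Y \<in> gobj C\<^sub>2" and u: "u \<in> H 0 y (ob\<^sub>2 Y)" and v: "v \<in> H 0 (ob\<^sub>2 Y) y"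
    and uv: "v ** u = one y" "u ** v = one (ob\<^sub>2 Y)" using ob2_ess[OF y(1)] by blast
  have dy: "dy \<in> H 1 y y" "dy ** dy = 0" using y by (auto simp: cx_def)
  have "good P I (ob\<^sub>2 Y) (u ** dy ** v) (U.oc X) (one (U.oc X) ** U.dl X ** one (U.oc X)) (one (U.oc X) ** e ** v)"
    by (rule good_transport[OF g, of _ 0]) (use u v uv dy X'(5) one_l[OF H_one] in auto)
  then have g': "good P I (ob\<^sub>2 Y) (u ** dy ** v) (U.oc X) (U.dl X) (e ** v)"
    using one_l[OF X'(5)] one_r[OF X'(5)] one_l[OF goodD(1)[OF g]] by simp
  have d: "u ** dy ** v \<in> H 1 (ob\<^sub>2 Y) (ob\<^sub>2 Y)" using H_mul'[OF H_mul'[OF u dy(1) refl] v] by simp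
  have dd: "(u ** dy ** v) ** (u ** dy ** v) = 0"
    using mul_cong[OF one_l[OF dy(1)]] by (simp add: mul_assoc mul_cong[OF uv(1)] mul_cong[OF dy(2)])
  obtain D where D: "D \<in> gmap C\<^sub>2 1 Y Y" "u ** dy ** v = \<rho>\<^sub>2 1 Y Y D" using V.\<rho>_surj[OF Y Y d] .
  have p: "pr n (ob\<^sub>2 Y) = u ** (pr n y ** v)" for n
    using pr_comm[OF u, of n] one_r[OF H_pr, of n "ob\<^sub>2 Y"] by (simp add: uv(2)[symmetric] mul_assoc[symmetric])
  have "{n. pr n (ob\<^sub>2 Y) \<noteq> 0} \<subseteq> {n. pr n y \<noteq> 0}" by (auto simp: p)
  then have "bdd (ob\<^sub>2 Y)" using y(2) unfolding bdd_def by (rule finite_subset)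
  then have "\<lparr>Ob = Y, Df = D\<rparr> \<in> V.bc"
    by (intro V.bcI) (use Y D d dd in \<open>auto simp: V_iff V.dl_def cx_def\<close>)
  then have "gt (X, \<lparr>Ob = Y, Df = D\<rparr>, e ** v)" using X g' by (simp add: gt_def V.dl_def D(2))
  then show ?thesis by (metis fst_conv)
qed

lemma ex_gt_Y:
  assumes Y: "Y \<in> V.bc"
  shows "\<exists>t. gt t \<and> tY t = Y"
proof -
  note Y' = V.bcD[OF Y, unfolded V_iff]
  obtain x dx e where x: "x \<in> I" "bdd x" "cx x dx" and g: "good P I (V.oc Y) (V.dl Y) x dx e"
    using ex_good_P[OF ob2_P[OF Y'(1)] Y'(3,4)] by blast
  obtain X u v where X: "X \<in> gobj C\<^sub>1" and u: "u \<in> H 0 x (ob\<^sub>1 X)" and v: "v \<in> H 0 (ob\<^sub>1 X) x"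
    and uv: "v ** u = one x" "u ** v = one (ob\<^sub>1 X)" using ob1_ess[OF x(1)] by blast
  have dx: "dx \<in> H 1 x x" "dx ** dx = 0" using x by (auto simp: cx_def)
  have "good P I (V.oc Y) (one (V.oc Y) ** V.dl Y ** one (V.oc Y)) (ob\<^sub>1 X) (u ** dx ** v) (u ** e ** one (V.oc Y))"
    by (rule good_transport[OF g, of _ 0]) (use u v uv dx Y'(5) one_l[OF H_one] in auto)
  then have g': "good P I (V.oc Y) (V.dl Y) (ob\<^sub>1 X) (u ** dx ** v) (u ** e)"
    using one_l[OF Y'(5)] one_r[OF Y'(5)] one_r[OF goodD(1)[OF g]] by (simp add: mul_assoc)
  have d: "u ** dx ** v \<in> H 1 (ob\<^sub>1 X) (ob\<^sub>1 X)" using H_mul'[OF H_mul'[OF u dx(1) refl] v] by simp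
  have dd: "(u ** dx ** v) ** (u ** dx ** v) = 0"
    using mul_cong[OF one_l[OF dx(1)]] by (simp add: mul_assoc mul_cong[OF uv(1)] mul_cong[OF dx(2)])
  obtain D where D: "D \<in> gmap C\<^sub>1 1 X X" "u ** dx ** v = \<rho>\<^sub>1 1 X X D" using U.\<rho>_surj[OF X X d] .
  have p: "pr n (ob\<^sub>1 X) = u ** (pr n x ** v)" for n
    using pr_comm[OF u, of n] one_r[OF H_pr, of n "ob\<^sub>1 X"] by (simp add: uv(2)[symmetric] mul_assoc[symmetric])
  have "{n. pr n (ob\<^sub>1 X) \<noteq> 0} \<subseteq> {n. pr n x \<noteq> 0}" by (auto simp: p)
  then have "bdd (ob\<^sub>1 X)" using x(2) unfolding bdd_def by (rule finite_subset)
  then have "\<lparr>Ob = X, Df = D\<rparr> \<in> U.bc"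
    by (intro U.bcI) (use X D d dd in \<open>auto simp: U.dl_def cx_def\<close>)
  then have "gt (\<lparr>Ob = X, Df = D\<rparr>, Y, u ** e)" using Y g' by (simp add: gt_def U.dl_def D(2))
  then show ?thesis by (metis fst_conv snd_conv)
qed

definition rel ::
  "('o, 'm) cochain \<times> ('p, 'q) cochain \<times> 'r \<Rightarrow> ('o, 'm) cochain \<times> ('p, 'q) cochain \<times> 'r \<Rightarrow> 'r \<Rightarrow> 'r \<Rightarrow> bool" where
  "rel t t' a h \<longleftrightarrow> a \<in> U.cyc (tX t) (tX t') \<and> h \<in> V.cyc (tY t') (tY t) \<and>
     hrel (V.oc (tY t)) (V.dl (tY t)) (U.oc (tX t')) (U.dl (tX t')) (a ** te t - te t' ** h)"

lemma V_cyc_iff: "h \<in> V.cyc Y' Y \<longleftrightarrow> h \<in> H 0 (V.oc Y) (V.oc Y') \<and> V.dl Y' ** h = h ** V.dl Y"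
  by (auto simp: V.cyc_def)

lemma relD:
  assumes "rel t t' a h"
  shows "a \<in> U.cyc (tX t) (tX t')" "h \<in> V.cyc (tY t') (tY t)"
    "hrel (V.oc (tY t)) (V.dl (tY t)) (U.oc (tX t')) (U.dl (tX t')) (a ** te t - te t' ** h)"
  using assms by (auto simp: rel_def)

lemma rel_ex_h:
  assumes t: "gt t" "gt t'" and a: "a \<in> U.cyc (tX t) (tX t')"
  shows "\<exists>h. rel t t' a h"
  using good_forward[OF gtD(3)[OF t(1)] gtD(3)[OF t(2)] gtD'(4)[OF t(1)] gtD'(4)[OF t(2)] gtD'(1)[OF t(2)]
      gtD'(6,5)[OF t(1)] U.cycD[OF a]] a unfolding rel_def V_cyc_iff by blast

lemma rel_ex_a:
  assumes t: "gt t" "gt t'" and h: "h \<in> V.cyc (tY t') (tY t)"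
  shows "\<exists>a. rel t t' a h"
proof -
  have h': "h \<in> H 0 (V.oc (tY t)) (V.oc (tY t'))" "V.dl (tY t') ** h = h ** V.dl (tY t)" using h unfolding V_cyc_iff by auto
  show ?thesis
    using good_backward[OF gtD(3)[OF t(1)] gtD(3)[OF t(2)] gtD'(4)[OF t(1)] gtD'(1)[OF t(1)] gtD'(1)[OF t(2)]
        gtD'(3,2)[OF t(2)] h'] h unfolding rel_def U.cyc_def by blast
qed

lemma rel_diff:
  assumes r: "rel t t' a h" and r': "rel t t' a' h'"
  shows "hrel (V.oc (tY t)) (V.dl (tY t)) (U.oc (tX t')) (U.dl (tX t')) ((a - a') ** te t - te t' ** (h - h'))"
  using hrel_add[OF relD(3)[OF r] hrel_uminus[OF relD(3)[OF r']]]
  by (simp add: mul_simps algebra_simps)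

text \<open>Well-definedness and faithfulness in both directions at once. The difference of the two
  squares again commutes up to homotopy, and a good map can be cancelled from a null composite on
  either side.\<close>

lemma rel_unique:
  assumes t: "gt t" "gt t'" and r: "rel t t' a h" and r': "rel t t' a' h'"
  shows "U.hr (tX t) (tX t') (a - a') \<longleftrightarrow> V.hr (tY t') (tY t) (h - h')"
proof
  note g = gtD(3)[OF t(1)] and g' = gtD(3)[OF t(2)]
  have ad: "a - a' \<in> H 0 (U.oc (tX t)) (U.oc (tX t'))" "U.dl (tX t') ** (a - a') = (a - a') ** U.dl (tX t)"
    using relD(1)[OF r] relD(1)[OF r'] by (auto simp: U.cyc_def mul_simps H_diff)
  have hd: "h - h' \<in> H 0 (V.oc (tY t)) (V.oc (tY t'))" "V.dl (tY t') ** (h - h') = (h - h') ** V.dl (tY t)"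
    using relD(2)[OF r] relD(2)[OF r'] by (auto simp: V_cyc_iff mul_simps H_diff)
  note d = rel_diff[OF r r']
  {
    assume "U.hr (tX t) (tX t') (a - a')"
    then have "hrel (V.oc (tY t)) (V.dl (tY t)) (U.oc (tX t')) (U.dl (tX t')) ((a - a') ** te t)"
      by (rule hrel_mul_r[OF _ goodD(1,2)[OF g]])
    from hrel_add[OF this hrel_uminus[OF d]]
    have "hrel (V.oc (tY t)) (V.dl (tY t)) (U.oc (tX t')) (U.dl (tX t')) (te t' ** (h - h'))" by simp
    then show "V.hr (tY t') (tY t) (h - h')"
      using good_forward_null[OF g' gtD'(4)[OF t(1)] gtD'(4)[OF t(2)] gtD'(1)[OF t(2)] gtD'(6,5)[OF t(1)] hd]
      by (simp add: V_iff)
  next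
    assume "V.hr (tY t') (tY t) (h - h')"
    then have "hrel (V.oc (tY t)) (V.dl (tY t)) (U.oc (tX t')) (U.dl (tX t')) (te t' ** (h - h'))"
      unfolding V_iff by (rule hrel_mul_l[OF _ goodD(1,2)[OF g']])
    from hrel_add[OF d this]
    have "hrel (V.oc (tY t)) (V.dl (tY t)) (U.oc (tX t')) (U.dl (tX t')) ((a - a') ** te t)" by simp
    then show "U.hr (tX t) (tX t') (a - a')"
      by (rule good_backward_null[OF g gtD'(4)[OF t(1)] gtD'(1)[OF t(1)] gtD'(1)[OF t(2)] gtD'(3,2)[OF t(2)] ad])
  }
qed

lemma rel_comp:
  assumes t: "gt t" "gt t'" "gt t''" and r: "rel t t' a h" and r': "rel t' t'' b k"
  shows "rel t t'' (b ** a) (k ** h)"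
proof -
  have "b ** a \<in> U.cyc (tX t) (tX t'')" using U.cyc_mul[OF relD(1)[OF r'] relD(1)[OF r]] .
  moreover have "k ** h \<in> V.cyc (tY t'') (tY t)" using V.cyc_mul[OF relD(2)[OF r] relD(2)[OF r']] .
  moreover have "k \<in> H 0 (V.oc (tY t')) (V.oc (tY t''))" "h \<in> H 0 (V.oc (tY t)) (V.oc (tY t'))" 
    "V.dl (tY t') ** h = h ** V.dl (tY t)" using relD(2)[OF r'] relD(2)[OF r] by (auto simp: V_cyc_iff)
  then have "hrel (V.oc (tY t)) (V.dl (tY t)) (U.oc (tX t'')) (U.dl (tX t''))
      (b ** (a ** te t - te t' ** h) + (b ** te t' - te t'' ** k) ** h)"
    using hrel_add[OF hrel_mul_l[OF relD(3)[OF r] U.cycD[OF relD(1)[OF r']]] hrel_mul_r[OF relD(3)[OF r'], of h]] by blast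
  ultimately show ?thesis by (simp add: rel_def mul_simps)
qed

lemma rel_add:
  assumes r: "rel t t' a h" and r': "rel t t' b k"
  shows "rel t t' (a + b) (h + k)"
  using U.cyc_add[OF relD(1)[OF r] relD(1)[OF r']] V.cyc_add[OF relD(2)[OF r] relD(2)[OF r']]
    hrel_add[OF relD(3)[OF r] relD(3)[OF r']]
  by (simp add: rel_def mul_simps algebra_simps)

lemma rel_one:
  assumes t: "gt t" shows "rel t t (one (U.oc (tX t))) (one (V.oc (tY t)))"
  using U.cyc_one[OF gtD(1)[OF t]] V.cyc_one[OF gtD(2)[OF t]]
  by (simp add: rel_def one_l[OF goodD(1)[OF gtD(3)[OF t]]] one_r[OF goodD(1)[OF gtD(3)[OF t]]])

text \<open>A homotopy inverse on one side is related to some map on the other side. The composites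
  of the latter are related to identities, hence homotopic to identities.\<close>

lemma rel_riso:
  assumes t: "gt t" "gt t'" and r: "rel t t' a h"
  shows "U.riso (tX t) (tX t') a \<longleftrightarrow> V.riso (tY t') (tY t) h"
proof
  assume "U.riso (tX t) (tX t') a"
  then obtain b where b: "b \<in> U.cyc (tX t') (tX t)" "U.hr (tX t) (tX t) (b ** a - one (U.oc (tX t)))"
    "U.hr (tX t') (tX t') (a ** b - one (U.oc (tX t')))" by (auto simp: U.riso_def)
  obtain k where k: "rel t' t b k" using rel_ex_h[OF t(2,1) b(1)] by blast
  have "V.hr (tY t) (tY t) (k ** h - one (V.oc (tY t)))" "V.hr (tY t') (tY t') (h ** k - one (V.oc (tY t')))"
    using rel_unique[OF t(1,1) rel_comp[OF t t(1) r k] rel_one[OF t(1)]] rel_unique[OF t(2,2) rel_comp[OF t(2,1,2) k r] rel_one[OF t(2)]] b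
    by auto
  then show "V.riso (tY t') (tY t) h" using relD(2)[OF r] relD(2)[OF k] by (auto simp: V.riso_def)
next
  assume "V.riso (tY t') (tY t) h"
  then obtain k where k: "k \<in> V.cyc (tY t) (tY t')" "V.hr (tY t) (tY t) (k ** h - one (V.oc (tY t)))"
    "V.hr (tY t') (tY t') (h ** k - one (V.oc (tY t')))" by (auto simp: V.riso_def)
  obtain b where b: "rel t' t b k" using rel_ex_a[OF t(2,1) k(1)] by blast
  have "U.hr (tX t) (tX t) (b ** a - one (U.oc (tX t)))" "U.hr (tX t') (tX t') (a ** b - one (U.oc (tX t')))"
    using rel_unique[OF t(1,1) rel_comp[OF t t(1) r b] rel_one[OF t(1)]] rel_unique[OF t(2,2) rel_comp[OF t(2,1,2) b r] rel_one[OF t(2)]] k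
    by auto
  then show "U.riso (tX t) (tX t') a" using relD(1)[OF r] relD(1)[OF b] by (auto simp: U.riso_def)
qed

section \<open>The functors in both directions\<close>

abbreviation T1 :: "(('o, 'm) cochain, 'm gr set) tri_cat" where "T1 \<equiv> Kb C\<^sub>1"
abbreviation T2 :: "(('p, 'q) cochain, 'q gr set) tri_cat" where "T2 \<equiv> op_tri (Kb C\<^sub>2)"

text \<open>The choice is harmless: by \<open>rel_unique\<close> all admissible \<open>h\<close>
  have the same class, and \<open>Fw_eq\<close> evaluates \<open>Fw\<close> at any of them.\<close>

definition Fw where
  "Fw t t' F = V.cls (tY t') (tY t) (SOME h. \<exists>a. rel t t' a h \<and> F = U.cls (tX t) (tX t') a)"

definition Bw where
  "Bw t t' G = U.cls (tX t) (tX t') (SOME a. \<exists>h. rel t t' a h \<and> G = V.cls (tY t') (tY t) h)"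

lemma Fw_eq:
  assumes t: "gt t" "gt t'" and r: "rel t t' a h"
  shows "Fw t t' (U.cls (tX t) (tX t') a) = V.cls (tY t') (tY t) h"
proof -
  define k where "k = (SOME h. \<exists>b. rel t t' b h \<and> U.cls (tX t) (tX t') a = U.cls (tX t) (tX t') b)"
  have "\<exists>b. rel t t' b k \<and> U.cls (tX t) (tX t') a = U.cls (tX t) (tX t') b"
    unfolding k_def by (rule someI[of _ h]) (use r in blast)
  then obtain b where b: "rel t t' b k" "U.cls (tX t) (tX t') a = U.cls (tX t) (tX t') b" by blast
  have "U.hr (tX t) (tX t') (b - a)"
    using U.cls_eq_iff[OF gtD(1)[OF t(1)] gtD(1)[OF t(2)] relD(1)[OF b(1)] relD(1)[OF r]] b(2) by simp
  then have "V.hr (tY t') (tY t) (k - h)" using rel_unique[OF t b(1) r] by simp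
  then have "V.cls (tY t') (tY t) k = V.cls (tY t') (tY t) h"
    using V.cls_eq_iff[OF gtD(2)[OF t(2)] gtD(2)[OF t(1)] relD(2)[OF b(1)] relD(2)[OF r]] by simp
  then show ?thesis by (simp add: Fw_def k_def)
qed

lemma Bw_eq:
  assumes t: "gt t" "gt t'" and r: "rel t t' a h"
  shows "Bw t t' (V.cls (tY t') (tY t) h) = U.cls (tX t) (tX t') a"
proof -
  define b where "b = (SOME a. \<exists>k. rel t t' a k \<and> V.cls (tY t') (tY t) h = V.cls (tY t') (tY t) k)"
  have "\<exists>k. rel t t' b k \<and> V.cls (tY t') (tY t) h = V.cls (tY t') (tY t) k"
    unfolding b_def by (rule someI[of _ a]) (use r in blast)
  then obtain k where k: "rel t t' b k" "V.cls (tY t') (tY t) h = V.cls (tY t') (tY t) k" by blast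
  have "V.hr (tY t') (tY t) (k - h)"
    using V.cls_eq_iff[OF gtD(2)[OF t(2)] gtD(2)[OF t(1)] relD(2)[OF k(1)] relD(2)[OF r]] k(2) by simp
  then have "U.hr (tX t) (tX t') (b - a)" using rel_unique[OF t k(1) r] by simp
  then have "U.cls (tX t) (tX t') b = U.cls (tX t) (tX t') a"
    using U.cls_eq_iff[OF gtD(1)[OF t(1)] gtD(1)[OF t(2)] relD(1)[OF k(1)] relD(1)[OF r]] by simp
  then show ?thesis by (simp add: Bw_def b_def)
qed
lemma T2_simps [simp]:
  "Obj T2 = V.bc" "Arr T2 X Y = Arr (Kb C\<^sub>2) Y X" "Ident T2 = Ident (Kb C\<^sub>2)"
  "Comp T2 X Y Z g f = Comp (Kb C\<^sub>2) Z Y X f g" "Plus T2 X Y = Plus (Kb C\<^sub>2) Y X"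
  "Shift T2 = Unshift (Kb C\<^sub>2)" "ShiftArr T2 X Y = UnshiftArr (Kb C\<^sub>2) Y X"
  by (simp_all add: op_tri_def)

lemma T2_Dist: "(X, Y, Z, u, v, w) \<in> Dist T2 \<longleftrightarrow> X \<in> V.bc \<and> Y \<in> V.bc \<and> Z \<in> V.bc \<and>
    w \<in> Arr (Kb C\<^sub>2) (Unshift (Kb C\<^sub>2) X) Z \<and>
    (Z, Y, X, v, u, Kb_shift_arr w) \<in> Kb_dist C\<^sub>2"
  by (simp add: op_tri_def)

lemma T2_is_iso: "is_iso T2 X Y f \<longleftrightarrow> is_iso (Kb C\<^sub>2) Y X f"
  by (auto simp: is_iso_def)

lemma T1_arr:
  assumes t: "gt t" "gt t'" and F: "F \<in> Arr T1 (tX t) (tX t')"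
  obtains a h where "rel t t' a h" "F = U.cls (tX t) (tX t') a"
proof -
  obtain a where a: "a \<in> U.cyc (tX t) (tX t')" "F = U.cls (tX t) (tX t') a"
    using F U.Kb_Arr[OF gtD(1)[OF t(1)] gtD(1)[OF t(2)]] by auto
  then show ?thesis using rel_ex_h[OF t a(1)] that by blast
qed

lemma T2_arr:
  assumes t: "gt t" "gt t'" and F: "F \<in> Arr T2 (tY t) (tY t')"
  obtains a h where "rel t t' a h" "F = V.cls (tY t') (tY t) h"
proof -
  obtain h where h: "h \<in> V.cyc (tY t') (tY t)" "F = V.cls (tY t') (tY t) h"
    using F V.Kb_Arr[OF gtD(2)[OF t(2)] gtD(2)[OF t(1)]] by auto
  then show ?thesis using rel_ex_a[OF t h(1)] that by blast
qed

lemma T1_Comp: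
  assumes t: "gt t" "gt t'" "gt t''" and r: "rel t t' a h" "rel t' t'' b k"
  shows "Comp T1 (tX t) (tX t') (tX t'') (U.cls (tX t') (tX t'') b) (U.cls (tX t) (tX t') a) = U.cls (tX t) (tX t'') (b ** a)"
  using U.Kb_Comp[OF gtD(1)[OF t(1)] gtD(1)[OF t(2)] gtD(1)[OF t(3)] relD(1)[OF r(1)] relD(1)[OF r(2)]] .

lemma T2_Comp:
  assumes t: "gt t" "gt t'" "gt t''" and r: "rel t t' a h" "rel t' t'' b k"
  shows "Comp T2 (tY t) (tY t') (tY t'') (V.cls (tY t'') (tY t') k) (V.cls (tY t') (tY t) h) = V.cls (tY t'') (tY t) (k ** h)"
  using V.Kb_Comp[OF gtD(2)[OF t(3)] gtD(2)[OF t(2)] gtD(2)[OF t(1)] relD(2)[OF r(2)] relD(2)[OF r(1)]] by simp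

lemma rel_cls_V:
  assumes t: "gt t" "gt t'" and r: "rel t t' a h" "rel t t' a k"
  shows "V.cls (tY t') (tY t) h = V.cls (tY t') (tY t) k"
  using rel_unique[OF t r] V.cls_eq_iff[OF gtD(2)[OF t(2)] gtD(2)[OF t(1)] relD(2)[OF r(1)] relD(2)[OF r(2)]] by simp

lemma rel_V_one:
  assumes t: "gt t" "gt t'" and eq: "tY t' = tY t"
  obtains a where "rel t t' a (one (V.oc (tY t)))" "U.riso (tX t) (tX t') a"
proof -
  have "one (V.oc (tY t)) \<in> V.cyc (tY t') (tY t)" using V.cyc_one[OF gtD(2)[OF t(1)]] eq by simp
  then obtain a where a: "rel t t' a (one (V.oc (tY t)))" using rel_ex_a[OF t] by blast
  moreover have "V.riso (tY t') (tY t) (one (V.oc (tY t)))" using V.riso_one[OF gtD(2)[OF t(1)]] eq by simp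
  ultimately show ?thesis using rel_riso[OF t a] that by blast
qed

lemma rel_U_one:
  assumes t: "gt t" "gt t'" and eq: "tX t' = tX t"
  obtains h where "rel t t' (one (U.oc (tX t))) h" "V.riso (tY t') (tY t) h"
proof -
  have "one (U.oc (tX t)) \<in> U.cyc (tX t) (tX t')" using U.cyc_one[OF gtD(1)[OF t(1)]] eq by simp
  then obtain h where h: "rel t t' (one (U.oc (tX t))) h" using rel_ex_h[OF t] by blast
  moreover have "U.riso (tX t) (tX t') (one (U.oc (tX t)))" using U.riso_one[OF gtD(1)[OF t(1)]] eq by simp
  ultimately show ?thesis using rel_riso[OF t h] that by blast
qed

definition ct where "ct X = (SOME t. gt t \<and> tX t = X)"
definition dt where "dt Y = (SOME t. gt t \<and> tY t = Y)"

lemma ct: "X \<in> U.bc \<Longrightarrow> gt (ct X)" "X \<in> U.bc \<Longrightarrow> tX (ct X) = X"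
  using someI_ex[OF ex_gt_X] by (auto simp: ct_def)

lemma dt: "Y \<in> V.bc \<Longrightarrow> gt (dt Y)" "Y \<in> V.bc \<Longrightarrow> tY (dt Y) = Y"
  using someI_ex[OF ex_gt_Y] by (auto simp: dt_def)

definition \<phi> where "\<phi> = \<lparr>FObj = (\<lambda>X. tY (ct X)), FArr = (\<lambda>X X'. Fw (ct X) (ct X'))\<rparr>"
definition \<gamma> where "\<gamma> = \<lparr>FObj = (\<lambda>Y. tX (dt Y)), FArr = (\<lambda>Y Y'. Bw (dt Y) (dt Y'))\<rparr>"

lemma \<phi>_obj [simp]: "FObj \<phi> X = tY (ct X)" and \<phi>_arr: "FArr \<phi> X X' = Fw (ct X) (ct X')"
  and \<gamma>_obj [simp]: "FObj \<gamma> Y = tX (dt Y)" and \<gamma>_arr: "FArr \<gamma> Y Y' = Bw (dt Y) (dt Y')"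
  by (simp_all add: \<phi>_def \<gamma>_def)

lemma \<phi>_bc: "X \<in> U.bc \<Longrightarrow> tY (ct X) \<in> V.bc" and \<gamma>_bc: "Y \<in> V.bc \<Longrightarrow> tX (dt Y) \<in> U.bc"
  using gtD(2)[OF ct(1)] gtD(1)[OF dt(1)] by simp_all

lemma T1_arr_ct:
  assumes X: "X \<in> U.bc" "X' \<in> U.bc" and F: "F \<in> Arr T1 X X'"
  obtains a h where "rel (ct X) (ct X') a h" "F = U.cls X X' a" "FArr \<phi> X X' F = V.cls (tY (ct X')) (tY (ct X)) h"
proof -
  have "F \<in> Arr T1 (tX (ct X)) (tX (ct X'))" using F ct X by simp
  then obtain a h where "rel (ct X) (ct X') a h" "F = U.cls (tX (ct X)) (tX (ct X')) a"
    using T1_arr ct(1) X by metis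
  then show ?thesis using that Fw_eq[OF ct(1)[OF X(1)] ct(1)[OF X(2)]] ct(2) X by (simp add: \<phi>_arr)
qed

lemma T2_arr_dt:
  assumes Y: "Y \<in> V.bc" "Y' \<in> V.bc" and F: "F \<in> Arr T2 Y Y'"
  obtains a h where "rel (dt Y) (dt Y') a h" "F = V.cls Y' Y h" "FArr \<gamma> Y Y' F = U.cls (tX (dt Y)) (tX (dt Y')) a"
proof -
  have "F \<in> Arr T2 (tY (dt Y)) (tY (dt Y'))" using F dt Y by simp
  then obtain a h where "rel (dt Y) (dt Y') a h" "F = V.cls (tY (dt Y')) (tY (dt Y)) h"
    using T2_arr dt(1) Y by metis
  then show ?thesis using that Bw_eq[OF dt(1)[OF Y(1)] dt(1)[OF Y(2)]] dt(2) Y by (simp add: \<gamma>_arr)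
qed

lemma \<phi>_functor: "is_functor T1 T2 \<phi>"
  unfolding is_functor_def U.Kb_Obj T2_simps
proof (intro conjI ballI)
  fix X assume X: "X \<in> U.bc"
  show "FObj \<phi> X \<in> V.bc" using \<phi>_bc[OF X] by simp
  show "FArr \<phi> X X (Ident T1 X) = Ident (Kb C\<^sub>2) (FObj \<phi> X)"
    using Fw_eq[OF ct(1)[OF X] ct(1)[OF X] rel_one[OF ct(1)[OF X]]] ct(2)[OF X] X
    by (simp add: \<phi>_arr U.Kb_Ident V.Kb_Ident \<phi>_bc)
  fix Y assume Y: "Y \<in> U.bc"
  show "FArr \<phi> X Y f \<in> Arr (Kb C\<^sub>2) (FObj \<phi> Y) (FObj \<phi> X)" if f: "f \<in> Arr T1 X Y" for f
  proof -
    obtain a h where h: "rel (ct X) (ct Y) a h" "FArr \<phi> X Y f = V.cls (tY (ct Y)) (tY (ct X)) h"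
      using T1_arr_ct[OF X Y f] by metis
    then show ?thesis using relD(2)[OF h(1)] V.Kb_Arr[OF \<phi>_bc[OF Y] \<phi>_bc[OF X]] by simp
  qed
  fix Z f g assume Z: "Z \<in> U.bc" and f: "f \<in> Arr T1 X Y" and g: "g \<in> Arr T1 Y Z"
  obtain a h where h: "rel (ct X) (ct Y) a h" "f = U.cls X Y a" "FArr \<phi> X Y f = V.cls (tY (ct Y)) (tY (ct X)) h"
    using T1_arr_ct[OF X Y f] .
  obtain b k where k: "rel (ct Y) (ct Z) b k" "g = U.cls Y Z b" "FArr \<phi> Y Z g = V.cls (tY (ct Z)) (tY (ct Y)) k"
    using T1_arr_ct[OF Y Z g] .
  note t = ct(1)[OF X] ct(1)[OF Y] ct(1)[OF Z]
  have "Comp T1 X Y Z g f = U.cls X Z (b ** a)" using T1_Comp[OF t h(1) k(1)] ct(2) X Y Z h k by simp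
  then have "FArr \<phi> X Z (Comp T1 X Y Z g f) = V.cls (tY (ct Z)) (tY (ct X)) (k ** h)"
    using Fw_eq[OF t(1,3) rel_comp[OF t h(1) k(1)]] ct(2) X Z by (simp add: \<phi>_arr)
  then show "FArr \<phi> X Z (Comp T1 X Y Z g f) = Comp (Kb C\<^sub>2) (FObj \<phi> Z) (FObj \<phi> Y) (FObj \<phi> X) (FArr \<phi> X Y f) (FArr \<phi> Y Z g)"
    using T2_Comp[OF t h(1) k(1)] h k by simp
qed

lemma \<gamma>_functor: "is_functor T2 T1 \<gamma>"
  unfolding is_functor_def U.Kb_Obj T2_simps
proof (intro conjI ballI)
  fix X assume X: "X \<in> V.bc"
  show "FObj \<gamma> X \<in> U.bc" using \<gamma>_bc[OF X] by simp
  show "FArr \<gamma> X X (Ident (Kb C\<^sub>2) X) = Ident T1 (FObj \<gamma> X)"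
    using Bw_eq[OF dt(1)[OF X] dt(1)[OF X] rel_one[OF dt(1)[OF X]]] dt(2)[OF X] X
    by (simp add: \<gamma>_arr U.Kb_Ident V.Kb_Ident \<gamma>_bc)
  fix Y assume Y: "Y \<in> V.bc"
  show "FArr \<gamma> X Y f \<in> Arr T1 (FObj \<gamma> X) (FObj \<gamma> Y)" if f: "f \<in> Arr (Kb C\<^sub>2) Y X" for f
  proof -
    have f': "f \<in> Arr T2 X Y" using f by simp
    obtain a h where h: "rel (dt X) (dt Y) a h" "FArr \<gamma> X Y f = U.cls (tX (dt X)) (tX (dt Y)) a"
      using T2_arr_dt[OF X Y f'] by metis
    then show ?thesis using relD(1)[OF h(1)] U.Kb_Arr[OF \<gamma>_bc[OF X] \<gamma>_bc[OF Y]] by simp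
  qed
  fix Z f g assume Z: "Z \<in> V.bc" and f: "f \<in> Arr (Kb C\<^sub>2) Y X" and g: "g \<in> Arr (Kb C\<^sub>2) Z Y"
  have f': "f \<in> Arr T2 X Y" and g': "g \<in> Arr T2 Y Z" using f g by simp_all
  obtain a h where h: "rel (dt X) (dt Y) a h" "f = V.cls Y X h" "FArr \<gamma> X Y f = U.cls (tX (dt X)) (tX (dt Y)) a"
    using T2_arr_dt[OF X Y f'] .
  obtain b k where k: "rel (dt Y) (dt Z) b k" "g = V.cls Z Y k" "FArr \<gamma> Y Z g = U.cls (tX (dt Y)) (tX (dt Z)) b"
    using T2_arr_dt[OF Y Z g'] .
  note t = dt(1)[OF X] dt(1)[OF Y] dt(1)[OF Z]
  have "Comp (Kb C\<^sub>2) Z Y X f g = V.cls Z X (k ** h)" using T2_Comp[OF t h(1) k(1)] dt(2) X Y Z h k by simp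
  then have "FArr \<gamma> X Z (Comp (Kb C\<^sub>2) Z Y X f g) = U.cls (tX (dt X)) (tX (dt Z)) (b ** a)"
    using Bw_eq[OF t(1,3) rel_comp[OF t h(1) k(1)]] dt(2) X Z by (simp add: \<gamma>_arr)
  then show "FArr \<gamma> X Z (Comp (Kb C\<^sub>2) Z Y X f g) = Comp T1 (FObj \<gamma> X) (FObj \<gamma> Y) (FObj \<gamma> Z) (FArr \<gamma> Y Z g) (FArr \<gamma> X Y f)"
    using T1_Comp[OF t h(1) k(1)] h k by simp
qed

lemma \<phi>_additive: "additive_functor T1 T2 \<phi>"
  unfolding additive_functor_def U.Kb_Obj T2_simps
proof (intro conjI ballI, rule \<phi>_functor)
  fix X Y f g assume X: "X \<in> U.bc" and Y: "Y \<in> U.bc" and f: "f \<in> Arr T1 X Y" and g: "g \<in> Arr T1 X Y"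
  obtain a h where h: "rel (ct X) (ct Y) a h" "f = U.cls X Y a" "FArr \<phi> X Y f = V.cls (tY (ct Y)) (tY (ct X)) h"
    using T1_arr_ct[OF X Y f] .
  obtain b k where k: "rel (ct X) (ct Y) b k" "g = U.cls X Y b" "FArr \<phi> X Y g = V.cls (tY (ct Y)) (tY (ct X)) k"
    using T1_arr_ct[OF X Y g] .
  have ab: "a \<in> U.cyc X Y" "b \<in> U.cyc X Y" using relD(1)[OF h(1)] relD(1)[OF k(1)] ct(2) X Y by auto
  have "FArr \<phi> X Y (Plus T1 X Y f g) = V.cls (tY (ct Y)) (tY (ct X)) (h + k)"
    using Fw_eq[OF ct(1)[OF X] ct(1)[OF Y] rel_add[OF h(1) k(1)]] ct(2) X Y
    by (simp add: \<phi>_arr h k U.Kb_Plus[OF X Y ab])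
  then show "FArr \<phi> X Y (Plus T1 X Y f g) = Plus (Kb C\<^sub>2) (FObj \<phi> Y) (FObj \<phi> X) (FArr \<phi> X Y f) (FArr \<phi> X Y g)"
    using V.Kb_Plus[OF \<phi>_bc[OF Y] \<phi>_bc[OF X] relD(2)[OF h(1)] relD(2)[OF k(1)]] h k by simp
qed

text \<open>Two triples that share one complex are linked by the map related to the identity of this
  complex, an isomorphism by \<open>rel_riso\<close>. For the unit the shared complex is the second
  one, for the counit the first one. Naturality holds because the two ways round a square are
  related to homotopic maps.\<close>

lemma \<phi>_equivalence: "is_equivalence T1 T2 \<phi>"
proof -
  define \<eta> where "\<eta> X = Bw (ct X) (dt (tY (ct X))) (V.cls (tY (ct X)) (tY (ct X)) (one (V.oc (tY (ct X)))))" for X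
  have \<eta>: "\<exists>a. rel (ct X) (dt (tY (ct X))) a (one (V.oc (tY (ct X)))) \<and> U.riso X (tX (dt (tY (ct X)))) a \<and>
      \<eta> X = U.cls X (tX (dt (tY (ct X)))) a" if X: "X \<in> U.bc" for X
  proof -
    note t = ct(1)[OF X] dt(1)[OF \<phi>_bc[OF X]]
    have e: "tY (dt (tY (ct X))) = tY (ct X)" using dt(2)[OF \<phi>_bc[OF X]] .
    obtain a where a: "rel (ct X) (dt (tY (ct X))) a (one (V.oc (tY (ct X))))" "U.riso (tX (ct X)) (tX (dt (tY (ct X)))) a"
      using rel_V_one[OF t e] .
    then show ?thesis using Bw_eq[OF t a(1)] e ct(2)[OF X] by (auto simp: \<eta>_def)
  qed
  have n1: "natural_iso T1 T1 id_functor (comp_functor \<gamma> \<phi>) \<eta>"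
    unfolding natural_iso_def U.Kb_Obj
  proof (intro conjI ballI)
    fix X assume X: "X \<in> U.bc"
    obtain a where a: "rel (ct X) (dt (tY (ct X))) a (one (V.oc (tY (ct X))))" "U.riso X (tX (dt (tY (ct X)))) a"
      "\<eta> X = U.cls X (tX (dt (tY (ct X)))) a" using \<eta>[OF X] by blast
    show "is_iso T1 (FObj id_functor X) (FObj (comp_functor \<gamma> \<phi>) X) (\<eta> X)"
      using U.is_iso_iff[OF X \<gamma>_bc[OF \<phi>_bc[OF X]] U.riso_cyc[OF a(2)]] a(2,3)
      by (simp add: id_functor_def comp_functor_def)
    fix Y f assume Y: "Y \<in> U.bc" and f: "f \<in> Arr T1 X Y"
    obtain b where b: "rel (ct Y) (dt (tY (ct Y))) b (one (V.oc (tY (ct Y))))"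
      "\<eta> Y = U.cls Y (tX (dt (tY (ct Y)))) b" using \<eta>[OF Y] by blast
    obtain u h where h: "rel (ct X) (ct Y) u h" "f = U.cls X Y u" "FArr \<phi> X Y f = V.cls (tY (ct Y)) (tY (ct X)) h"
      using T1_arr_ct[OF X Y f] .
    have "FArr \<phi> X Y f \<in> Arr T2 (tY (ct X)) (tY (ct Y))"
      using h relD(2)[OF h(1)] V.Kb_Arr[OF \<phi>_bc[OF Y] \<phi>_bc[OF X]] by simp
    then obtain u' h' where k: "rel (dt (tY (ct X))) (dt (tY (ct Y))) u' h'" "FArr \<phi> X Y f = V.cls (tY (ct Y)) (tY (ct X)) h'"
       "FArr \<gamma> (tY (ct X)) (tY (ct Y)) (FArr \<phi> X Y f) = U.cls (tX (dt (tY (ct X)))) (tX (dt (tY (ct Y)))) u'"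
      using T2_arr_dt[OF \<phi>_bc[OF X] \<phi>_bc[OF Y]] by metis
    note tX = ct(1)[OF X] dt(1)[OF \<phi>_bc[OF X]] and tY = ct(1)[OF Y] dt(1)[OF \<phi>_bc[OF Y]]
    have e: "tY (dt (tY (ct X))) = tY (ct X)" "tY (dt (tY (ct Y))) = tY (ct Y)" using dt(2) \<phi>_bc X Y by auto
    have hc: "h \<in> V.cyc (tY (ct Y)) (tY (ct X))" "h' \<in> V.cyc (tY (ct Y)) (tY (ct X))"
      using relD(2)[OF h(1)] relD(2)[OF k(1)] e by auto
    have "V.hr (tY (ct Y)) (tY (ct X)) (h - h')"
      using h(3) k(2) V.cls_eq_iff[OF \<phi>_bc[OF Y] \<phi>_bc[OF X] hc] by simp
    moreover have "rel (ct X) (dt (tY (ct Y))) (b ** u) h" 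
      using rel_comp[OF tX(1) tY h(1) b(1)] one_l[OF V.cycD(1)[OF hc(1)]] by simp
    moreover have "rel (ct X) (dt (tY (ct Y))) (u' ** a) h'"
      using rel_comp[OF tX tY(2) a(1) k(1)] one_r[OF V.cycD(1)[OF hc(2)]] by simp
    ultimately have "U.hr X (tX (dt (tY (ct Y)))) (b ** u - u' ** a)"
      using rel_unique[OF tX(1) tY(2), of "b ** u" h "u' ** a" h'] e ct(2)[OF X] by simp
    then have "U.cls X (tX (dt (tY (ct Y)))) (b ** u) = U.cls X (tX (dt (tY (ct Y)))) (u' ** a)"
      using U.cls_eq_iff[OF X \<gamma>_bc[OF \<phi>_bc[OF Y]] U.cyc_mul U.cyc_mul] relD(1)[OF h(1)] relD(1)[OF b(1)] relD(1)[OF k(1)] relD(1)[OF a(1)]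
        ct(2) X Y by fastforce
    then show "Comp T1 (FObj id_functor X) (FObj id_functor Y) (FObj (comp_functor \<gamma> \<phi>) Y) (\<eta> Y) (FArr id_functor X Y f) =
        Comp T1 (FObj id_functor X) (FObj (comp_functor \<gamma> \<phi>) X) (FObj (comp_functor \<gamma> \<phi>) Y) (FArr (comp_functor \<gamma> \<phi>) X Y f) (\<eta> X)"
      using T1_Comp[OF tX(1) tY h(1) b(1)] T1_Comp[OF tX tY(2) a(1) k(1)] h(2) b(2) a(3) k(3) ct(2) X Y
      by (simp add: id_functor_def comp_functor_def)
  qed
  define \<epsilon> where "\<epsilon> Y = Fw (ct (tX (dt Y))) (dt Y) (U.cls (tX (dt Y)) (tX (dt Y)) (one (U.oc (tX (dt Y)))))" for Y
  have \<epsilon>: "\<exists>h. rel (ct (tX (dt Y))) (dt Y) (one (U.oc (tX (dt Y)))) h \<and> V.riso Y (tY (ct (tX (dt Y)))) h \<and>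
      \<epsilon> Y = V.cls Y (tY (ct (tX (dt Y)))) h" if Y: "Y \<in> V.bc" for Y
  proof -
    note t = ct(1)[OF \<gamma>_bc[OF Y]] dt(1)[OF Y]
    have e: "tX (dt Y) = tX (ct (tX (dt Y)))" using ct(2)[OF \<gamma>_bc[OF Y]] by simp
    obtain h where h: "rel (ct (tX (dt Y))) (dt Y) (one (U.oc (tX (ct (tX (dt Y)))))) h" "V.riso (tY (dt Y)) (tY (ct (tX (dt Y)))) h"
      using rel_U_one[OF t e] .
    then show ?thesis using Fw_eq[OF t h(1)] e[symmetric] dt(2)[OF Y] by (auto simp: \<epsilon>_def)
  qed
  have n2: "natural_iso T2 T2 (comp_functor \<phi> \<gamma>) id_functor \<epsilon>"
    unfolding natural_iso_def T2_simps(1)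
  proof (intro conjI ballI)
    fix X assume X: "X \<in> V.bc"
    obtain h where a: "rel (ct (tX (dt X))) (dt X) (one (U.oc (tX (dt X)))) h" "V.riso X (tY (ct (tX (dt X)))) h"
      "\<epsilon> X = V.cls X (tY (ct (tX (dt X)))) h" using \<epsilon>[OF X] by blast
    show "is_iso T2 (FObj (comp_functor \<phi> \<gamma>) X) (FObj id_functor X) (\<epsilon> X)"
      unfolding T2_is_iso using V.is_iso_iff[OF X \<phi>_bc[OF \<gamma>_bc[OF X]] V.riso_cyc[OF a(2)]] a(2,3)
      by (simp add: id_functor_def comp_functor_def)
    fix Y f assume Y: "Y \<in> V.bc" and f: "f \<in> Arr T2 X Y"
    obtain k where b: "rel (ct (tX (dt Y))) (dt Y) (one (U.oc (tX (dt Y)))) k" "\<epsilon> Y = V.cls Y (tY (ct (tX (dt Y)))) k"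
      using \<epsilon>[OF Y] by blast
    obtain u g where g: "rel (dt X) (dt Y) u g" "f = V.cls Y X g" "FArr \<gamma> X Y f = U.cls (tX (dt X)) (tX (dt Y)) u"
      using T2_arr_dt[OF X Y f] .
    have "FArr \<gamma> X Y f \<in> Arr T1 (tX (dt X)) (tX (dt Y))"
      using g relD(1)[OF g(1)] U.Kb_Arr[OF \<gamma>_bc[OF X] \<gamma>_bc[OF Y]] by simp
    then obtain u' g' where k: "rel (ct (tX (dt X))) (ct (tX (dt Y))) u' g'" "FArr \<gamma> X Y f = U.cls (tX (dt X)) (tX (dt Y)) u'"
       "FArr \<phi> (tX (dt X)) (tX (dt Y)) (FArr \<gamma> X Y f) = V.cls (tY (ct (tX (dt Y)))) (tY (ct (tX (dt X)))) g'"
      using T1_arr_ct[OF \<gamma>_bc[OF X] \<gamma>_bc[OF Y]] by metis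
    note tX = ct(1)[OF \<gamma>_bc[OF X]] dt(1)[OF X] and tY = ct(1)[OF \<gamma>_bc[OF Y]] dt(1)[OF Y]
    have e: "tX (ct (tX (dt X))) = tX (dt X)" "tX (ct (tX (dt Y))) = tX (dt Y)" using ct(2) \<gamma>_bc X Y by auto
    have uc: "u \<in> U.cyc (tX (dt X)) (tX (dt Y))" "u' \<in> U.cyc (tX (dt X)) (tX (dt Y))"
      using relD(1)[OF g(1)] relD(1)[OF k(1)] e by auto
    have "U.hr (tX (dt X)) (tX (dt Y)) (u' - u)"
      using g(3) k(2) U.cls_eq_iff[OF \<gamma>_bc[OF X] \<gamma>_bc[OF Y] uc(2,1)] by simp
    moreover have r1: "rel (ct (tX (dt X))) (dt Y) u' (k ** g')"
      using rel_comp[OF tX(1) tY k(1) b(1)] one_l[OF U.cycD(1)[OF uc(2)]] by simp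
    moreover have r2: "rel (ct (tX (dt X))) (dt Y) u (g ** h)"
      using rel_comp[OF tX tY(2) a(1) g(1)] one_r[OF U.cycD(1)[OF uc(1)]] by simp
    ultimately have "V.hr Y (tY (ct (tX (dt X)))) (k ** g' - g ** h)"
      using rel_unique[OF tX(1) tY(2) r1 r2] e dt(2)[OF Y] by simp
    then have "V.cls Y (tY (ct (tX (dt X)))) (k ** g') = V.cls Y (tY (ct (tX (dt X)))) (g ** h)"
      using V.cls_eq_iff[OF Y \<phi>_bc[OF \<gamma>_bc[OF X]]] relD(2)[OF r1] relD(2)[OF r2] dt(2)[OF Y] by simp
    then show "Comp T2 (FObj (comp_functor \<phi> \<gamma>) X) (FObj (comp_functor \<phi> \<gamma>) Y) (FObj id_functor Y) (\<epsilon> Y) (FArr (comp_functor \<phi> \<gamma>) X Y f) =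
        Comp T2 (FObj (comp_functor \<phi> \<gamma>) X) (FObj id_functor X) (FObj id_functor Y) (FArr id_functor X Y f) (\<epsilon> X)"
      using T2_Comp[OF tX(1) tY k(1) b(1)] T2_Comp[OF tX tY(2) a(1) g(1)] g(2) b(2) a(3) k(3) dt(2) X Y
      by (simp add: id_functor_def comp_functor_def)
  qed
  show ?thesis unfolding is_equivalence_def using \<phi>_functor \<gamma>_functor n1 n2 by blast
qed

end

section \<open>Compatibility with the suspension and with triangles\<close>

context krep
begin

text \<open>The square with the isomorphisms on its sides inverted. With it an isomorphism from a
  given triangle to a standard one is read backwards, because the duality reverses all
  arrows.\<close>

lemma square_flip:
  assumes p: "p \<in> cyc A A'" "p' \<in> cyc A' A" "hr A' A' (p ** p' - one (oc A'))"
    and q: "q \<in> cyc B B'" "q' \<in> cyc B' B" "hr B B (q' ** q - one (oc B))"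
    and f: "f \<in> cyc A B" "f' \<in> cyc A' B'" and h: "hr A B' (q ** f - f' ** p)"
  shows "hr A' B (f ** p' - q' ** f')"
proof -
  have 1: "hr A' B ((q' ** q - one (oc B)) ** (f ** p'))" using hrel_mul_r[OF q(3) cycD[OF cyc_mul[OF f(1) p(2)]]] .
  have 2: "hr A' B (q' ** (q ** f - f' ** p) ** p')" using hrel_mul_r[OF hrel_mul_l[OF h cycD[OF q(2)]] cycD[OF p(2)]] .
  have 3: "hr A' B ((q' ** f') ** (p ** p' - one (oc A')))" using hrel_mul_l[OF p(3) cycD[OF cyc_mul[OF q(2) f(2)]]] .
  have o: "one (oc B) ** (f ** p') = f ** p'" "f' ** one (oc A') = f'"
    using mul_cong[OF one_l[OF cycD(1)[OF f(1)]]] one_r[OF cycD(1)[OF f(2)]] by auto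
  from hrel_add[OF hrel_add[OF hrel_uminus[OF 1] 2] 3] show ?thesis
    by (simp add: mul_simps o)
qed

lemma risoE:
  assumes "riso X Y a"
  obtains b where "a \<in> cyc X Y" "b \<in> cyc Y X" "riso Y X b" "hr X X (b ** a - one (oc X))" "hr Y Y (a ** b - one (oc Y))"
  using assms unfolding riso_def by blast

lemma shm_one: "X \<in> bc \<Longrightarrow> shm X X (one (oc X)) = one (oc (S X))"
  using sg_inv(2)[OF bcD(1)] one_r[OF sg_in(1)[OF bcD(1)]] by (simp add: shm_def)

lemma unshift_lift:
  assumes X: "X \<in> bc" and Y: "Y \<in> bc" and h: "h \<in> cyc X Y"
  obtains h' where "h' \<in> cyc (unshift X) (unshift Y)" "shm (unshift X) (unshift Y) h' = h"
  using shm_surj[OF S_unshift(2)[OF X] S_unshift(2)[OF Y], of h] h S_unshift(1)[OF X] S_unshift(1)[OF Y] by auto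

end

context dual_setting
begin

text \<open>The suspension of a triple. The opposite category suspends by the inverse of the
  suspension of \<open>Kb C\<^sub>2\<close>, so the second complex is unshifted; the degrees -1 and
  1 of the two conjugating maps cancel.\<close>

definition sh where
  "sh t = (U.S (tX t), V.unshift (tY t), U.sg (tX t) ** te t ** V.sg' (V.unshift (tY t)))"

lemma sh_sel [simp]: "tX (sh t) = U.S (tX t)" "tY (sh t) = V.unshift (tY t)"
    "te (sh t) = U.sg (tX t) ** te t ** V.sg' (V.unshift (tY t))"
  by (simp_all add: sh_def)

lemma V_sg:
  assumes "Y \<in> V.bc"
  shows "V.sg (V.unshift Y) \<in> H (- 1) (V.oc Y) (V.oc (V.unshift Y))" "V.sg' (V.unshift Y) \<in> H 1 (V.oc (V.unshift Y)) (V.oc Y)"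
    "V.sg (V.unshift Y) ** V.sg' (V.unshift Y) = one (V.oc (V.unshift Y))"
    "V.sg' (V.unshift Y) ** V.sg (V.unshift Y) = one (V.oc Y)"
    "V.dl (V.unshift Y) = - (V.sg (V.unshift Y) ** V.dl Y ** V.sg' (V.unshift Y))"
    "V.dl Y = - (V.sg' (V.unshift Y) ** V.dl (V.unshift Y) ** V.sg (V.unshift Y))"
proof -
  note u = V.S_unshift[OF assms]
  note b = V.bcD[OF u(2)]
  show 1: "V.sg (V.unshift Y) \<in> H (- 1) (V.oc Y) (V.oc (V.unshift Y))" "V.sg' (V.unshift Y) \<in> H 1 (V.oc (V.unshift Y)) (V.oc Y)"
    "V.sg (V.unshift Y) ** V.sg' (V.unshift Y) = one (V.oc (V.unshift Y))"
    "V.sg' (V.unshift Y) ** V.sg (V.unshift Y) = one (V.oc Y)"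
    using V.sg_in[OF b(1)] V.sg_inv[OF b(1)] u(1) by auto
  show d: "V.dl Y = - (V.sg' (V.unshift Y) ** V.dl (V.unshift Y) ** V.sg (V.unshift Y))"
    using V.shift_dl(2)[OF b(1,2)] u(1) by (simp add: mul_assoc)
  show "V.dl (V.unshift Y) = - (V.sg (V.unshift Y) ** V.dl Y ** V.sg' (V.unshift Y))"
    unfolding d using one_l[OF b(5)] one_r[OF b(5)] mul_cong[OF 1(3)]
    by (simp add: mul_simps 1(3))
qed

lemma gt_sh:
  assumes t: "gt t" shows "gt (sh t)"
proof -
  note X = gtD(1)[OF t] and Y = gtD(2)[OF t]
  note v = V_sg[OF Y] and u = U.sg_in[OF U.bcD(1)[OF X]] U.sg_inv[OF U.bcD(1)[OF X]]
  have "good P I (V.oc (V.unshift (tY t))) (V.sg (V.unshift (tY t)) ** V.dl (tY t) ** V.sg' (V.unshift (tY t)))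
      (U.oc (U.S (tX t))) (U.sg (tX t) ** U.dl (tX t) ** U.sg' (tX t)) (te (sh t))"
    unfolding sh_sel by (rule good_transport[OF gtD(3)[OF t], of _ "-1"])
      (use v u V.bcD(5)[OF Y] U.bcD(5)[OF X] in auto)
  from good_uminus[OF this] have "good P I (V.oc (V.unshift (tY t))) (V.dl (V.unshift (tY t)))
      (U.oc (U.S (tX t))) (U.dl (U.S (tX t))) (te (sh t))"
    using v(5) U.shift_dl(2)[OF U.bcD(1,2)[OF X]] by simp
  then show ?thesis using U.S_bc[OF X] V.S_unshift(2)[OF Y] by (simp add: gt_def case_prod_beta)
qed

lemma rel_sh:
  assumes t: "gt t" "gt t'" and r: "rel t t' a h"
    and h': "h' \<in> V.cyc (V.unshift (tY t')) (V.unshift (tY t))" "V.shm (V.unshift (tY t')) (V.unshift (tY t)) h' = h"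
  shows "rel (sh t) (sh t') (U.shm (tX t) (tX t') a) h'"
proof -
  note X = gtD(1)[OF t(1)] and Y = gtD(2)[OF t(1)] and X' = gtD(1)[OF t(2)] and Y' = gtD(2)[OF t(2)]
  note v = V_sg[OF Y] and u = U.sg_in[OF U.bcD(1)[OF X]] U.sg_inv[OF U.bcD(1)[OF X]]
  note v' = V_sg[OF Y'] and u' = U.sg_in[OF U.bcD(1)[OF X']] U.sg_inv[OF U.bcD(1)[OF X']]
  let ?\<sigma> = "U.sg (tX t')" and ?\<tau> = "V.sg' (V.unshift (tY t))"
  have "h' = V.sg (V.unshift (tY t')) ** (h ** V.sg' (V.unshift (tY t)))"
    using V.shm_inv[OF V.S_unshift(2)[OF Y'] V.S_unshift(2)[OF Y] V.cycD(1)[OF h'(1)]] h'(2) by simp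
  then have "te (sh t') ** h' = ?\<sigma> ** (te t' ** h) ** ?\<tau>"
    using one_l[OF V.cycD(1)[OF relD(2)[OF r]]] by (simp add: mul_assoc mul_cong[OF v'(4)] mul_cong[of "one _" h])
  moreover have "U.shm (tX t) (tX t') a ** te (sh t) = ?\<sigma> ** (a ** te t) ** ?\<tau>"
    using one_r[OF U.cycD(1)[OF relD(1)[OF r]]] one_l[OF goodD(1)[OF gtD(3)[OF t(1)]]]
    by (simp add: mul_assoc U.shm_def mul_cong[OF u(3)] mul_cong[of "one _" "te t"])
  ultimately have eq: "U.shm (tX t) (tX t') a ** te (sh t) - te (sh t') ** h' = ?\<sigma> ** (a ** te t - te t' ** h) ** ?\<tau>"
    by (simp add: mul_simps)
  obtain s where s: "s \<in> H (- 1) (V.oc (tY t)) (U.oc (tX t'))"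
    "a ** te t - te t' ** h = U.dl (tX t') ** s + s ** V.dl (tY t)" using relD(3)[OF r] by (auto simp: hrel_def)
  let ?s = "- (?\<sigma> ** s ** ?\<tau>)"
  have "?s \<in> H (-1) (V.oc (tY (sh t))) (U.oc (tX (sh t')))"
    using H_uminus[OF H_mul'[OF H_mul'[OF u'(1) s(1) refl] v(2), of "-1"]] by simp
  moreover have "?\<sigma> ** (a ** te t - te t' ** h) ** ?\<tau> = U.dl (tX (sh t')) ** ?s + ?s ** V.dl (tY (sh t))"
    unfolding s(2) sh_sel v(5) U.shift_dl(2)[OF U.bcD(1,2)[OF X']]
    using one_l[OF s(1)] one_l[OF V.bcD(5)[OF Y]] 
    by (simp add: mul_simps mul_cong[OF u'(3)] mul_cong[OF v(4)] mul_cong[of "one _" s] mul_cong[of "one (V.oc (tY t))" "V.dl (tY t)"]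
        one_l[OF V.bcD(5)[OF Y, simplified]] mul_cong[OF one_r[OF s(1)]])
  ultimately have "hrel (V.oc (tY (sh t))) (V.dl (tY (sh t))) (U.oc (tX (sh t'))) (U.dl (tX (sh t')))
      (U.shm (tX t) (tX t') a ** te (sh t) - te (sh t') ** h')" unfolding eq hrel_def by blast
  then show ?thesis using U.shm_cyc[OF X X' relD(1)[OF r]] h'(1) by (simp add: rel_def)
qed

text \<open>The triples \<open>ct (U.S X)\<close> and \<open>sh (ct X)\<close> both have
  \<open>U.S X\<close> as their first complex. The comparison with the suspension is the class of
  the map related to the identity of that complex.\<close>

definition \<xi> where "\<xi> X = Fw (ct (U.S X)) (sh (ct X)) (U.cls (U.S X) (U.S X) (one (U.oc (U.S X))))"

lemma \<xi>:
  assumes X: "X \<in> U.bc"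
  obtains h where "rel (ct (U.S X)) (sh (ct X)) (one (U.oc (U.S X))) h"
    "V.riso (V.unshift (tY (ct X))) (tY (ct (U.S X))) h" "\<xi> X = V.cls (V.unshift (tY (ct X))) (tY (ct (U.S X))) h"
proof -
  note t = ct(1)[OF U.S_bc[OF X]] gt_sh[OF ct(1)[OF X]]
  have e: "tX (sh (ct X)) = tX (ct (U.S X))" "tX (ct (U.S X)) = U.S X" using ct(2) X U.S_bc[OF X] by auto
  obtain h where h: "rel (ct (U.S X)) (sh (ct X)) (one (U.oc (U.S X))) h" "V.riso (tY (sh (ct X))) (tY (ct (U.S X))) h"
    using rel_U_one[OF t e(1)] e(2) by metis
  then show ?thesis using that Fw_eq[OF t h(1)] e by (simp add: \<xi>_def)
qed

lemma \<xi>_natural: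
  "natural_iso T1 T2 (comp_functor \<phi> (shift_functor T1)) (comp_functor (shift_functor T2) \<phi>) \<xi>"
  unfolding natural_iso_def U.Kb_Obj
proof (intro conjI ballI)
  fix X assume X: "X \<in> U.bc"
  note uX = V.Unshift_Kb[OF \<phi>_bc[OF X]] V.S_unshift[OF \<phi>_bc[OF X]]
  obtain h where h: "rel (ct (U.S X)) (sh (ct X)) (one (U.oc (U.S X))) h"
    "V.riso (V.unshift (tY (ct X))) (tY (ct (U.S X))) h" "\<xi> X = V.cls (V.unshift (tY (ct X))) (tY (ct (U.S X))) h"
    using \<xi>[OF X] .
  show "is_iso T2 (FObj (comp_functor \<phi> (shift_functor T1)) X) (FObj (comp_functor (shift_functor T2) \<phi>) X) (\<xi> X)"
    unfolding T2_is_iso using V.is_iso_iff[OF uX(3) \<phi>_bc[OF U.S_bc[OF X]] V.riso_cyc[OF h(2)]] h(2,3) uX(1)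
    by (simp add: comp_functor_def shift_functor_def)
  fix Y f assume Y: "Y \<in> U.bc" and f: "f \<in> Arr T1 X Y"
  note uY = V.Unshift_Kb[OF \<phi>_bc[OF Y]] V.S_unshift[OF \<phi>_bc[OF Y]]
  obtain k where k: "rel (ct (U.S Y)) (sh (ct Y)) (one (U.oc (U.S Y))) k"
    "\<xi> Y = V.cls (V.unshift (tY (ct Y))) (tY (ct (U.S Y))) k"
    using \<xi>[OF Y] by metis
  obtain a g where g: "rel (ct X) (ct Y) a g" "f = U.cls X Y a" "FArr \<phi> X Y f = V.cls (tY (ct Y)) (tY (ct X)) g"
    using T1_arr_ct[OF X Y f] .
  have a: "a \<in> U.cyc X Y" using relD(1)[OF g(1)] ct(2) X Y by simp
  note sX = U.S_bc[OF X] and sY = U.S_bc[OF Y]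
  have Sf: "Kb_shift_arr f = U.cls (U.S X) (U.S Y) (U.shm X Y a)" using U.Kb_shift_arr_cls[OF X Y a] g(2) by simp
  have "U.shm X Y a \<in> U.cyc (tX (ct (U.S X))) (tX (ct (U.S Y)))" using U.shm_cyc[OF X Y a] ct(2) sX sY by simp
  then obtain l where l: "rel (ct (U.S X)) (ct (U.S Y)) (U.shm X Y a) l" using rel_ex_h ct(1) sX sY by blast
  have \<phi>S: "FArr \<phi> (U.S X) (U.S Y) (Kb_shift_arr f) = V.cls (tY (ct (U.S Y))) (tY (ct (U.S X))) l"
    using Fw_eq[OF ct(1)[OF sX] ct(1)[OF sY] l] ct(2) sX sY by (simp add: \<phi>_arr Sf)
  obtain g' where g': "g' \<in> V.cyc (V.unshift (tY (ct Y))) (V.unshift (tY (ct X)))"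
    "V.shm (V.unshift (tY (ct Y))) (V.unshift (tY (ct X))) g' = g"
    using V.unshift_lift[OF \<phi>_bc[OF Y] \<phi>_bc[OF X] relD(2)[OF g(1)]] .
  have S\<phi>: "UnshiftArr (Kb C\<^sub>2) (tY (ct Y)) (tY (ct X)) (FArr \<phi> X Y f) = V.cls (V.unshift (tY (ct Y))) (V.unshift (tY (ct X))) g'"
    using V.Kb_UnshiftArr[OF \<phi>_bc[OF Y] \<phi>_bc[OF X] g'(1)] g' g by simp
  have r: "rel (sh (ct X)) (sh (ct Y)) (U.shm X Y a) g'"
    using rel_sh[OF ct(1)[OF X] ct(1)[OF Y] g(1) g'] ct(2) X Y by simp
  note t = ct(1)[OF sX] gt_sh[OF ct(1)[OF X]] ct(1)[OF sY] gt_sh[OF ct(1)[OF Y]]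
  have s: "U.shm X Y a \<in> H 0 (U.oc (U.S X)) (U.oc (U.S Y))" using U.cycD(1)[OF U.shm_cyc[OF X Y a]] .
  \<comment> \<open>Both ways round the naturality square are related to \<open>U.shm X Y a\<close>,
    so they agree as classes.\<close>
  have r1: "rel (ct (U.S X)) (sh (ct Y)) (U.shm X Y a) (k ** l)" using rel_comp[OF t(1,3,4) l k(1)] one_l[OF s] by simp
  have r2: "rel (ct (U.S X)) (sh (ct Y)) (U.shm X Y a) (g' ** h)" using rel_comp[OF t(1,2,4) h(1) r] one_r[OF s] by simp
  have "V.cls (V.unshift (tY (ct Y))) (tY (ct (U.S X))) (k ** l) = V.cls (V.unshift (tY (ct Y))) (tY (ct (U.S X))) (g' ** h)"
    using rel_cls_V[OF t(1,4) r1 r2] by simp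
  then show "Comp T2 (FObj (comp_functor \<phi> (shift_functor T1)) X) (FObj (comp_functor \<phi> (shift_functor T1)) Y)
        (FObj (comp_functor (shift_functor T2) \<phi>) Y) (\<xi> Y) (FArr (comp_functor \<phi> (shift_functor T1)) X Y f) =
      Comp T2 (FObj (comp_functor \<phi> (shift_functor T1)) X) (FObj (comp_functor (shift_functor T2) \<phi>) X)
        (FObj (comp_functor (shift_functor T2) \<phi>) Y) (FArr (comp_functor (shift_functor T2) \<phi>) X Y f) (\<xi> X)"
    using T2_Comp[OF t(1,3,4) l k(1)] T2_Comp[OF t(1,2,4) h(1) r] h(3) k(2) \<phi>S S\<phi> uX(1) uY(1)
    by (simp add: comp_functor_def shift_functor_def)
qed
text \<open>The complex corresponding to the cone of \<open>a\<close> is the unshifted cone of the map \<open>g\<close> corresponding to \<open>a\<close>.\<close>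

lemma cone_partner:
  assumes t0: "gt t0" and t2: "gt t2" and r: "rel t0 t2 a g"
    and s: "U.scone (tX t0) (tX t2) Z a I1 I2 P1 P2"
    and c: "V.scone (tY t2) (tY t0) (V.S W) g J1 J2 Q1 Q2" and W: "W \<in> V.bc"
  obtains t3 q where "gt t3" "tX t3 = Z" "tY t3 = W"
    "rel t2 t3 I2 (- (V.sg W ** (Q1 ** V.sg' (tY t2))))" "rel t3 (sh t0) P1 q"
    "V.shm (V.unshift (tY t0)) W q = J2"
proof -
  define K where "K = tY t0"
  define N where "N = tY t2"
  define L where "L = V.unshift K"
  define D where "D = V.S W"
  note X0 = gtD(1)[OF t0] and X2 = gtD(1)[OF t2] and K = gtD(2)[OF t0, folded K_def] and N = gtD(2)[OF t2, folded N_def]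
  note s' = U.scone_cyc[OF s] and c' = V.scone_cyc[OF c[folded K_def N_def D_def]]
  note vK = V_sg[OF K, folded L_def]
  have L: "L \<in> V.bc" using V.S_unshift(2)[OF K] by (simp add: L_def)
  have SN: "V.sg N \<in> H (-1) (V.oc (V.S N)) (V.oc N)" "V.sg' N \<in> H 1 (V.oc N) (V.oc (V.S N))"
    "V.sg N ** V.sg' N = one (V.oc N)" "V.sg' N ** V.sg N = one (V.oc (V.S N))"
    "V.dl (V.S N) = - (V.sg' N ** (V.dl N ** V.sg N))"
    using V.sg_in[OF V.bcD(1)[OF N]] V.sg_inv[OF V.bcD(1)[OF N]] V.shift_dl(2)[OF V.bcD(1,2)[OF N]] by (auto simp: mul_assoc)
  have SW: "V.sg W \<in> H (-1) (V.oc D) (V.oc W)" "V.sg' W \<in> H 1 (V.oc W) (V.oc D)"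
    "V.sg W ** V.sg' W = one (V.oc W)" "V.sg' W ** V.sg W = one (V.oc D)"
    using V.sg_in[OF V.bcD(1)[OF W]] V.sg_inv[OF V.bcD(1)[OF W]] by (auto simp: D_def)
  have dD: "V.dl D = Q1 ** (V.dl (V.S N) ** J1) + Q2 ** (V.dl K ** J2) + Q1 ** (V.sg' N ** (g ** J2))"
    and B: "J1 ** Q1 = one (V.oc (V.S N))" "J2 ** Q2 = one (V.oc K)" "J1 ** Q2 = 0" "J2 ** Q1 = 0"
      "Q1 ** J1 + Q2 ** J2 = one (V.oc D)"
      "J1 \<in> H 0 (V.oc D) (V.oc (V.S N))" "J2 \<in> H 0 (V.oc D) (V.oc K)"
      "Q1 \<in> H 0 (V.oc (V.S N)) (V.oc D)" "Q2 \<in> H 0 (V.oc K) (V.oc D)"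
    using c unfolding V.scone_def V.biprod_def K_def N_def D_def by (auto simp: mul_assoc)
  have g: "g \<in> H 0 (V.oc K) (V.oc N)" "V.dl N ** g = g ** V.dl K"
    using relD(2)[OF r] by (auto simp: V_cyc_iff K_def N_def)
  have dH: "V.dl K \<in> H 1 (V.oc K) (V.oc K)" "V.dl N \<in> H 1 (V.oc N) (V.oc N)" "V.dl D \<in> H 1 (V.oc D) (V.oc D)"
    using V.bcD(5) K N c'(3) by auto
  have dW: "V.dl W = - (V.sg W ** (V.dl D ** V.sg' W))"
  proof -
    have "V.dl D = - (V.sg' W ** (V.dl W ** V.sg W))"
      using V.shift_dl(2)[OF V.bcD(1,2)[OF W]] by (simp add: D_def mul_assoc)
    then show ?thesis using one_l[OF V.bcD(5)[OF W]] one_r[OF V.bcD(5)[OF W]]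
      by (simp add: mul_simps SW(3) mul_cong[OF SW(3)])
  qed
  let ?\<Omega> = "V.sg W" and ?\<Omega>' = "V.sg' W" and ?n = "V.sg N" and ?n' = "V.sg' N" and ?l = "V.sg L" and ?l' = "V.sg' L"
  \<comment> \<open>These maps present \<open>W\<close> as a biproduct of \<open>L\<close>, the
    unshifted \<open>K\<close>, and \<open>N\<close>. The signs in \<open>j2\<close> and
    \<open>q2\<close> cancel the minus that unshifting puts before the off-diagonal entry, so that
    the differential of \<open>W\<close> has the form required by \<open>good_ext\<close>.\<close>
  define j1 where "j1 = ?\<Omega> ** (Q2 ** ?l')"
  define q1 where "q1 = ?l ** (J2 ** ?\<Omega>')"
  define j2 where "j2 = - (?\<Omega> ** (Q1 ** ?n'))"
  define q2 where "q2 = - (?n ** (J1 ** ?\<Omega>'))"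
  have jH: "j1 \<in> H 0 (V.oc L) (V.oc W)" "q1 \<in> H 0 (V.oc W) (V.oc L)" "j2 \<in> H 0 (V.oc N) (V.oc W)" "q2 \<in> H 0 (V.oc W) (V.oc N)"
    unfolding j1_def q1_def j2_def q2_def
    using H_mul'[OF SW(1) H_mul'[OF B(9) vK(2) refl], of 0] H_mul'[OF vK(1) H_mul'[OF B(7) SW(2) refl], of 0]
      H_uminus[OF H_mul'[OF SW(1) H_mul'[OF B(8) SN(2) refl], of 0]] H_uminus[OF H_mul'[OF SN(1) H_mul'[OF B(6) SW(2) refl], of 0]]
    by auto
  note oneN = one_l[OF g(1)] one_l[OF SN(1)] one_l[OF dH(2)] mul_cong[OF one_l[OF SN(1)]] mul_cong[OF one_l[OF g(1)]] mul_cong[OF one_l[OF dH(2)]]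
  note oneD = one_l[OF SW(2)] one_l[OF B(8)] one_l[OF B(9)] mul_cong[OF one_l[OF SW(2)]] mul_cong[OF one_l[OF B(8)]] mul_cong[OF one_l[OF B(9)]]
  note oneK = one_l[OF vK(2)] one_l[OF B(7)] one_l[OF dH(1)] mul_cong[OF one_l[OF vK(2)]] mul_cong[OF one_l[OF B(7)]] mul_cong[OF one_l[OF dH(1)]]
  note oneS = one_l[OF SN(2)] one_l[OF B(6)] mul_cong[OF one_l[OF SN(2)]] mul_cong[OF one_l[OF B(6)]]
  note canc = SW(3,4) SN(3,4) vK(3,4) B(1-4) mul_cong[OF SW(3)] mul_cong[OF SW(4)] mul_cong[OF SN(3)] mul_cong[OF SN(4)]
    mul_cong[OF vK(3)] mul_cong[OF vK(4)] mul_cong[OF B(1)] mul_cong[OF B(2)] mul_cong[OF B(3)] mul_cong[OF B(4)]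
  have bp: "biprod (V.oc L) (V.oc N) (V.oc W) j1 j2 q1 q2"
  proof -
    have "j1 ** q1 + j2 ** q2 = ?\<Omega> ** ((Q1 ** J1 + Q2 ** J2) ** ?\<Omega>')"
      unfolding j1_def j2_def q1_def q2_def by (simp add: mul_simps canc oneK oneS add.commute)
    also have "\<dots> = one (V.oc W)" by (simp add: B(5) oneD SW)
    finally show ?thesis unfolding biprod_def using jH
      by (simp add: j1_def j2_def q1_def q2_def mul_simps canc oneD oneK oneS)
  qed
  have dWe: "V.dl W = j1 ** V.dl L ** q1 + j2 ** V.dl N ** q2 + j2 ** (g ** ?l') ** q1"
    unfolding dW dD SN(5) vK(5) j1_def j2_def q1_def q2_def
    by (simp add: mul_simps canc oneK oneS oneN oneD algebra_simps)
  define tx where "tx = a ** U.sg' (tX t0)"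
  note u = U.sg_in[OF U.bcD(1)[OF X0]] U.sg_inv[OF U.bcD(1)[OF X0]]
  note X0' = U.bcD[OF X0] and SX0 = U.S_bc[OF X0]
  have dZ: "U.dl Z = I1 ** U.dl (U.S (tX t0)) ** P1 + I2 ** U.dl (tX t2) ** P2 + I2 ** tx ** P1"
    and BX: "biprod (U.oc (U.S (tX t0))) (U.oc (tX t2)) (U.oc Z) I1 I2 P1 P2"
    using s by (auto simp: U.scone_def tx_def)
  note ac = U.cycD[OF relD(1)[OF r]]
  have txH: "tx \<in> H 1 (U.oc (U.S (tX t0))) (U.oc (tX t2))" using H_mul'[OF ac(1) u(2)] by (simp add: tx_def)
  have txc: "U.dl (tX t2) ** tx + tx ** U.dl (U.S (tX t0)) = 0"
    using one_l[OF X0'(5)]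
    by (simp add: tx_def U.shift_dl(2)[OF X0'(1,2)] mul_simps mul_cong[OF u(3)] mul_cong[OF ac(2)] mul_cong[of "one _" "U.dl (tX t0)"])
  define ty where "ty = g ** ?l'"
  have tyH: "ty \<in> H 1 (V.oc L) (V.oc N)" using H_mul'[OF g(1) vK(2)] by (simp add: ty_def)
  have tyc: "V.dl N ** ty + ty ** V.dl L = 0"
    by (simp add: ty_def vK(5) mul_simps canc oneK mul_cong[OF g(2)])
  obtain s where s: "s \<in> H (- 1) (V.oc K) (U.oc (tX t2))" "a ** te t0 - te t2 ** g = U.dl (tX t2) ** s + s ** V.dl K"
    using relD(3)[OF r] by (auto simp: hrel_def K_def)
  \<comment> \<open>The homotopy of the given square, moved to the unshifted complex. It becomes the
    off-diagonal entry of the good map between the two cones.\<close>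
  define s1 where "s1 = - (s ** ?l')"
  have s1H: "s1 \<in> H 0 (V.oc L) (U.oc (tX t2))" using H_uminus[OF H_mul'[OF s(1) vK(2), of 0]] by (simp add: s1_def)
  note g0 = gtD(3)[OF t0, folded K_def] and g2 = gtD(3)[OF t2, folded N_def]
  have gsh: "good P I (V.oc L) (V.dl L) (U.oc (U.S (tX t0))) (U.dl (U.S (tX t0))) (te (sh t0))"
    using gtD(3)[OF gt_sh[OF t0]] by (simp add: L_def K_def)
  have txe: "tx ** te (sh t0) - te t2 ** ty = s1 ** V.dl L - U.dl (tX t2) ** s1"
  proof -
    have "tx ** te (sh t0) - te t2 ** ty = (a ** te t0 - te t2 ** g) ** ?l'"
      using one_l[OF goodD(1)[OF g0]]
      by (simp add: tx_def ty_def mul_simps mul_cong[OF u(3)] mul_cong[of "one _" "te t0"] L_def K_def)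
    also have "\<dots> = s1 ** V.dl L - U.dl (tX t2) ** s1"
      unfolding s(2) s1_def vK(5) by (simp add: mul_simps canc oneK)
    finally show ?thesis .
  qed
  define e3 where "e3 = I1 ** te (sh t0) ** q1 + I2 ** te t2 ** q2 + I2 ** s1 ** q1"
  have cxs: "cx (U.oc (U.S (tX t0))) (U.dl (U.S (tX t0)))" "cx (U.oc (tX t2)) (U.dl (tX t2))" "cx (V.oc L) (V.dl L)" "cx (V.oc N) (V.dl N)"
    using U.bcD(3)[OF SX0] U.bcD(3)[OF X2] V.bcD(3)[OF L] V.bcD(3)[OF N] by (auto simp: V_iff)
  have "good P I (V.oc W) (V.dl W) (U.oc Z) (U.dl Z) e3"
    unfolding dZ dWe e3_def ty_def[symmetric]
    by (rule good_ext[OF gsh g2 BX bp cxs txH txc tyH tyc s1H txe])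
  then have t3: "gt (Z, W, e3)" using s'(3) W by (simp add: gt_def)
  have bpe: "q1 ** j1 = one (V.oc L)" "q2 ** j2 = one (V.oc N)" "q2 ** j1 = 0" "q1 ** j2 = 0" using bp by (auto simp: biprod_def)
  have bpX: "P1 ** I1 = one (U.oc (U.S (tX t0)))" "P2 ** I2 = one (U.oc (tX t2))" "P2 ** I1 = 0" "P1 ** I2 = 0" using BX by (auto simp: biprod_def)
  have "j2 \<in> V.cyc W N"
  proof -
    have "V.dl W ** j2 = j2 ** V.dl N" unfolding dWe by (simp add: mul_simps bpe one_r[OF dH(2)])
    then show ?thesis using jH by (simp add: V_cyc_iff)
  qed
  moreover have "I2 ** te t2 - e3 ** j2 = 0" unfolding e3_def by (simp add: mul_simps bpe one_r[OF goodD(1)[OF g2]])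
  ultimately have r2: "rel t2 (Z, W, e3) I2 j2" using s'(5) by (simp add: rel_def N_def)
  have "q1 \<in> V.cyc L W"
  proof -
    have "V.dl L ** q1 = q1 ** V.dl W" unfolding dWe using one_l[OF V.bcD(5)[OF L]]
      by (simp add: mul_simps mul_cong[OF bpe(1)] mul_cong[OF bpe(4)] mul_cong[of "one _" "V.dl L"])
    then show ?thesis using jH by (simp add: V_cyc_iff)
  qed
  moreover have "P1 ** e3 - te (sh t0) ** q1 = 0" unfolding e3_def using one_l[OF goodD(1)[OF gsh]]
    by (simp add: mul_simps mul_cong[OF bpX(1)] mul_cong[OF bpX(4)] mul_cong[of "one _" "te (sh t0)"] del: sh_sel(3))
  ultimately have r3: "rel (Z, W, e3) (sh t0) P1 q1" using s'(6) by (simp add: rel_def L_def K_def del: sh_sel(3))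
  have "V.shm L W q1 = J2"
    unfolding V.shm_def q1_def by (simp add: mul_assoc canc oneK one_r[OF B(7)])
  then show ?thesis using that[OF t3 _ _ _ r3] r2 by (simp add: j2_def N_def L_def K_def)
qed

text \<open>The given triangle is isomorphic to a standard one. By \<open>cone_partner\<close> the
  cone of the latter is joined to an unshifted cone \<open>W\<close>, so its image runs from
  \<open>W\<close> through \<open>N\<close> to \<open>K\<close>; this is a rotation of the standard
  triangle over \<open>g\<close> and hence distinguished. The isomorphism of triangles is carried
  over by \<open>rel\<close>, with its direction reversed.\<close>

lemma \<phi>_triangle:
  assumes d: "(X, Y, Z, u, v, w) \<in> Kb_dist C\<^sub>1"
  shows "(FObj \<phi> X, FObj \<phi> Y, FObj \<phi> Z, FArr \<phi> X Y u, FArr \<phi> Y Z v,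
     Comp T2 (FObj \<phi> Z) (FObj \<phi> (Shift T1 X)) (Shift T2 (FObj \<phi> X)) (\<xi> X) (FArr \<phi> Z (Shift T1 X) w)) \<in> Dist T2"
proof -
  obtain a b c where r: "U.rdist X Y Z a b c" and uvw: "u = U.cls X Y a" "v = U.cls Y Z b" "w = U.cls Z (U.S X) c"
    using U.rdistD[OF d] .
  have X: "X \<in> U.bc" and Y: "Y \<in> U.bc" and Z: "Z \<in> U.bc" and abc: "a \<in> U.cyc X Y" "b \<in> U.cyc Y Z" "c \<in> U.cyc Z (U.S X)"
    using r by (auto simp: U.rdist_def)
  obtain X' Y' Z' a' I1 I2 P1 P2 \<alpha> \<beta> \<gamma> where s: "U.scone X' Y' Z' a' I1 I2 P1 P2"
    and i: "U.riso X X' \<alpha>" "U.riso Y Y' \<beta>" "U.riso Z Z' \<gamma>"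
    and h: "U.hr X Y' (\<beta> ** a - a' ** \<alpha>)" "U.hr Y Z' (\<gamma> ** b - I2 ** \<beta>)" "U.hr Z (U.S X') (U.shm X X' \<alpha> ** c - P1 ** \<gamma>)"
    using r unfolding U.rdist_def by blast
  note s' = U.scone_cyc[OF s]
  note SX = U.S_bc[OF X] and SX' = U.S_bc[OF s'(1)]
  obtain \<alpha>' where \<alpha>: "\<alpha> \<in> U.cyc X X'" "\<alpha>' \<in> U.cyc X' X" "U.riso X' X \<alpha>'" "U.hr X X (\<alpha>' ** \<alpha> - one (U.oc X))" "U.hr X' X' (\<alpha> ** \<alpha>' - one (U.oc X'))"
    using U.risoE[OF i(1)] .
  obtain \<beta>' where \<beta>: "\<beta> \<in> U.cyc Y Y'" "\<beta>' \<in> U.cyc Y' Y" "U.riso Y' Y \<beta>'" "U.hr Y Y (\<beta>' ** \<beta> - one (U.oc Y))" "U.hr Y' Y' (\<beta> ** \<beta>' - one (U.oc Y'))"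
    using U.risoE[OF i(2)] .
  obtain \<gamma>' where \<gamma>: "\<gamma> \<in> U.cyc Z Z'" "\<gamma>' \<in> U.cyc Z' Z" "U.riso Z' Z \<gamma>'" "U.hr Z Z (\<gamma>' ** \<gamma> - one (U.oc Z))" "U.hr Z' Z' (\<gamma> ** \<gamma>' - one (U.oc Z'))"
    using U.risoE[OF i(3)] .
  note cX = ct(1)[OF X] and cY = ct(1)[OF Y] and cZ = ct(1)[OF Z] and cSX = ct(1)[OF SX]
    and c0 = ct(1)[OF s'(1)] and c2 = ct(1)[OF s'(2)]
  note cXe = ct(2)[OF X] ct(2)[OF Y] ct(2)[OF Z] ct(2)[OF SX] ct(2)[OF s'(1)] ct(2)[OF s'(2)]
  have "a' \<in> U.cyc (tX (ct X')) (tX (ct Y'))" using s'(4) cXe by simp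
  then obtain g where g: "rel (ct X') (ct Y') a' g" using rel_ex_h[OF c0 c2] by blast
  define K where "K = tY (ct X')"
  define N where "N = tY (ct Y')"
  have K: "K \<in> V.bc" and N: "N \<in> V.bc" using \<phi>_bc s' by (auto simp: K_def N_def)
  obtain D J1 J2 Q1 Q2 where sD: "V.scone N K D g J1 J2 Q1 Q2"
    using V.cone_ex[OF biproducts N K] relD(2)[OF g] unfolding K_def N_def by blast
  define W where "W = V.unshift D"
  have W: "W \<in> V.bc" "V.S W = D" using V.S_unshift[OF V.scone_cyc(3)[OF sD]] by (auto simp: W_def)
  obtain oW \<iota> where oW: "gt oW" "tX oW = Z'" "tY oW = W"
    and rI: "rel (ct Y') oW I2 (- (V.sg W ** (Q1 ** V.sg' N)))" and rP: "rel oW (sh (ct X')) P1 \<iota>"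
    and \<iota>: "V.shm (V.unshift K) W \<iota> = J2"
    using cone_partner[OF c0 c2 g, of Z' I1 I2 P1 P2 W J1 J2 Q1 Q2] s sD W cXe unfolding K_def N_def by metis
  define j where "j = - (V.sg W ** (Q1 ** V.sg' N))"
  have rot: "V.rdist W N K j g J2"
    using V.rotation[OF biproducts, of N K W g J1 J2 Q1 Q2] sD W by (simp add: j_def)
  have "b \<in> U.cyc (tX (ct Y)) (tX (ct Z))" "a \<in> U.cyc (tX (ct X)) (tX (ct Y))" "c \<in> U.cyc (tX (ct Z)) (tX (ct (U.S X)))"
    using abc cXe by auto
  then obtain ha hb hc where ha: "rel (ct X) (ct Y) a ha" and hb: "rel (ct Y) (ct Z) b hb" and hc: "rel (ct Z) (ct (U.S X)) c hc"
    using rel_ex_h[OF cX cY] rel_ex_h[OF cY cZ] rel_ex_h[OF cZ cSX] by blast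
  obtain hx where hx: "rel (ct (U.S X)) (sh (ct X)) (one (U.oc (U.S X))) hx" "\<xi> X = V.cls (V.unshift (tY (ct X))) (tY (ct (U.S X))) hx"
    using \<xi>[OF X] by metis
  define FX where "FX = tY (ct X)"
  define FY where "FY = tY (ct Y)"
  define FZ where "FZ = tY (ct Z)"
  have F: "FX \<in> V.bc" "FY \<in> V.bc" "FZ \<in> V.bc" using \<phi>_bc X Y Z by (auto simp: FX_def FY_def FZ_def)
  note uFX = V.S_unshift[OF F(1)]
  \<comment> \<open>\<open>k\<close> starts at the unshifted complex, as the last arrow of a
    triangle of \<open>op_tri\<close> does. Only its shift enters the triangle of
    \<open>Kb C\<^sub>2\<close>.\<close>
  define k where "k = hx ** hc"
  note shX = gt_sh[OF cX] and sh0 = gt_sh[OF c0]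
  have rk: "rel (ct Z) (sh (ct X)) c k"
    using rel_comp[OF cZ cSX shX hc hx(1)] one_l[OF U.cycD(1)[OF abc(3)]] by (simp add: k_def)
  have kc: "k \<in> V.cyc (V.unshift FX) FZ" using relD(2)[OF rk] by (simp add: FX_def FZ_def)
  have third: "Comp T2 (FObj \<phi> Z) (FObj \<phi> (Shift T1 X)) (Shift T2 (FObj \<phi> X)) (\<xi> X) (FArr \<phi> Z (Shift T1 X) w)
      = V.cls (V.unshift FX) FZ k"
    using T2_Comp[OF cZ cSX shX hc hx(1)] Fw_eq[OF cZ cSX hc] cXe hx(2) V.Unshift_Kb[OF F(1)] uvw(3)
    by (simp add: \<phi>_arr FX_def FZ_def k_def)
  have vu: "FArr \<phi> X Y u = V.cls FY FX ha" "FArr \<phi> Y Z v = V.cls FZ FY hb"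
    using Fw_eq[OF cX cY ha] Fw_eq[OF cY cZ hb] cXe uvw by (auto simp: \<phi>_arr FX_def FY_def FZ_def)
  have "V.rdist FZ FY FX hb ha (V.shm (V.unshift FX) FZ k)"
  proof -
    have "\<gamma>' \<in> U.cyc (tX oW) (tX (ct Z))" "\<beta>' \<in> U.cyc (tX (ct Y')) (tX (ct Y))" "\<alpha>' \<in> U.cyc (tX (ct X')) (tX (ct X))"
      using \<alpha> \<beta> \<gamma> oW cXe by auto
    then obtain \<theta>Z \<theta>Y \<theta>X where \<theta>: "rel oW (ct Z) \<gamma>' \<theta>Z" "rel (ct Y') (ct Y) \<beta>' \<theta>Y" "rel (ct X') (ct X) \<alpha>' \<theta>X"
      using rel_ex_h[OF oW(1) cZ] rel_ex_h[OF c2 cY] rel_ex_h[OF c0 cX] by blast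
    have iso: "V.riso FZ W \<theta>Z" "V.riso FY N \<theta>Y" "V.riso FX K \<theta>X"
      using rel_riso[OF oW(1) cZ \<theta>(1)] rel_riso[OF c2 cY \<theta>(2)] rel_riso[OF c0 cX \<theta>(3)] \<alpha> \<beta> \<gamma> oW cXe
      by (auto simp: FX_def FY_def FZ_def N_def K_def)
    have abc': "hb \<in> V.cyc FZ FY" "ha \<in> V.cyc FY FX" "V.shm (V.unshift FX) FZ k \<in> V.cyc FX (V.S FZ)"
      using relD(2)[OF hb] relD(2)[OF ha] V.shm_cyc[OF uFX(2) F(3) kc] uFX(1) by (auto simp: FX_def FY_def FZ_def)
    have sq1: "V.hr FZ N (hb ** \<theta>Y - \<theta>Z ** j)"
    proof -
      have "U.hr Y' Z (b ** \<beta>' - \<gamma>' ** I2)"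
        by (rule U.square_flip[OF \<beta>(1,2,5) \<gamma>(1,2,4) abc(2) s'(5) h(2)])
      then show ?thesis
        using rel_unique[OF c2 cZ rel_comp[OF c2 cY cZ \<theta>(2) hb] rel_comp[OF c2 oW(1) cZ rI[folded j_def] \<theta>(1)]] cXe
        by (simp add: FZ_def N_def)
    qed
    have sq2: "V.hr FY K (ha ** \<theta>X - \<theta>Y ** g)"
    proof -
      have "U.hr X' Y (a ** \<alpha>' - \<beta>' ** a')"
        by (rule U.square_flip[OF \<alpha>(1,2,5) \<beta>(1,2,4) abc(1) s'(4) h(1)])
      then show ?thesis
        using rel_unique[OF c0 cY rel_comp[OF c0 cX cY \<theta>(3) ha] rel_comp[OF c0 c2 cY g \<theta>(2)]] cXe
        by (simp add: FY_def K_def)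
    qed
    have "\<theta>X \<in> V.cyc FX K" using V.riso_cyc[OF iso(3)] .
    then obtain \<theta>' where \<theta>': "\<theta>' \<in> V.cyc (V.unshift FX) (V.unshift K)" "V.shm (V.unshift FX) (V.unshift K) \<theta>' = \<theta>X"
      using V.unshift_lift[OF F(1) K] by blast
    have r\<theta>': "rel (sh (ct X')) (sh (ct X)) (U.shm X' X \<alpha>') \<theta>'"
      using rel_sh[OF c0 cX \<theta>(3), of \<theta>'] \<theta>' cXe by (simp add: FX_def K_def)
    \<comment> \<open>The third square is obtained before the shift, where both composites are
      related to maps over \<open>C\<^sub>1\<close>; shifting it gives the square that
      \<open>rdist_iso\<close> requires.\<close>
    have "V.hr (V.unshift FX) W (k ** \<theta>Z - \<theta>' ** \<iota>)"
    proof -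
      note sa = U.shm_cyc[OF X s'(1) \<alpha>(1)] and sa' = U.shm_cyc[OF s'(1) X \<alpha>(2)]
      have e: "U.hr (U.S X') (U.S X') (U.shm X X' \<alpha> ** U.shm X' X \<alpha>' - one (U.oc (U.S X')))"
        "U.hr (U.S X) (U.S X) (U.shm X' X \<alpha>' ** U.shm X X' \<alpha> - one (U.oc (U.S X)))"
        using U.shm_hr[OF s'(1,1) \<alpha>(5)] U.shm_hr[OF X X \<alpha>(4)] U.shm_mul[OF X U.cycD(1)[OF \<alpha>(2)]] U.shm_mul[OF s'(1) U.cycD(1)[OF \<alpha>(1)]]
          U.shm_one[OF X] U.shm_one[OF s'(1)] by (auto simp: U.shm_def mul_simps)
      have "U.hr Z' (U.S X) (c ** \<gamma>' - U.shm X' X \<alpha>' ** P1)"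
        by (rule U.square_flip[OF \<gamma>(1,2,5) sa sa' e(2) abc(3) s'(6) h(3)])
      then show ?thesis
        using rel_unique[OF oW(1) shX rel_comp[OF oW(1) cZ shX \<theta>(1) rk] rel_comp[OF oW(1) sh0 shX rP r\<theta>']] cXe oW
        by (simp add: FX_def)
    qed
    moreover have "V.shm (V.unshift FX) W (k ** \<theta>Z - \<theta>' ** \<iota>) =
        V.shm (V.unshift FX) FZ k ** V.shm FZ W \<theta>Z - \<theta>X ** J2"
      using V.shm_mul[OF F(3) V.cycD(1)[OF kc], of W \<theta>Z] V.shm_mul[OF V.S_unshift(2)[OF K] V.cycD(1)[OF \<theta>'(1)], of W \<iota>]
      unfolding \<theta>'(2) \<iota> by (simp only:) (simp add: V.shm_def mul_simps)
    ultimately have sq3: "V.hr FX (V.S W) (V.shm (V.unshift FX) FZ k ** V.shm FZ W \<theta>Z - \<theta>X ** J2)"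
      using V.shm_hr[OF uFX(2) W(1)] uFX(1) by metis
    show ?thesis
      using V.rdist_iso[OF rot F(3,2,1) abc' iso(1-3)] sq1 sq2 sq3 by simp
  qed
  from V.rdistI[OF this] have "(FZ, FY, FX, V.cls FZ FY hb, V.cls FY FX ha, Kb_shift_arr (V.cls (V.unshift FX) FZ k)) \<in> Kb_dist C\<^sub>2"
    using V.Kb_shift_arr_cls[OF uFX(2) F(3) kc] uFX(1) by simp
  then show ?thesis
    unfolding T2_Dist third vu using F kc V.Kb_Arr[OF uFX(2) F(3)] V.Unshift_Kb[OF F(1)]
    by (simp add: FX_def FY_def FZ_def)
qed

theorem duality: "triangulated_duality (Kb C\<^sub>1) (Kb C\<^sub>2) \<phi>"
  unfolding triangulated_duality_def triangle_equivalence_def triangle_functor_def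
  using \<phi>_additive \<xi>_natural \<phi>_triangle \<phi>_equivalence by (intro exI[of _ \<xi>]) simp

end

section \<open>Graded objects over a preadditive category as a graded category\<close>

context precat
begin

lemma Plus_Null_r: "\<lbrakk>X \<in> Obj C; Y \<in> Obj C; f \<in> Arr C X Y\<rbrakk> \<Longrightarrow> Plus C X Y f (Null C X Y) = f"
  using Plus_comm[of X Y f "Null C X Y"] Plus_Null[of X Y f] Null_in[of X Y] by simp

text \<open>The axioms of \<open>grcat\<close> range over the whole type of families. A family that
  is not a graded object of \<open>C\<close> gets zero maps only, and a zero identity, so the axioms
  hold for it as well.\<close>

definition ghom :: "int \<Rightarrow> 'o gr \<Rightarrow> 'o gr \<Rightarrow> ('o, 'm) fam endo set" where
  "ghom k X Y = (if X \<in> gobj C \<and> Y \<in> gobj C then gop C k X Y ` gmap C k X Y else {0})"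

definition gone :: "'o gr \<Rightarrow> ('o, 'm) fam endo" where
  "gone X = (if X \<in> gobj C then gop C 0 X X (gid C X) else 0)"

definition gpr :: "int \<Rightarrow> 'o gr \<Rightarrow> ('o, 'm) fam endo" where
  "gpr n X = (if X \<in> gobj C then gop C 0 X X (gproj C n X) else 0)"

lemma ghomE:
  assumes "a \<in> ghom k X Y" "X \<in> gobj C" "Y \<in> gobj C"
  obtains f where "f \<in> gmap C k X Y" "a = gop C k X Y f"
  using assms by (auto simp: ghom_def)

lemma ghom_cases:
  assumes "a \<in> ghom k X Y"
  obtains "a = 0" | f where "X \<in> gobj C" "Y \<in> gobj C" "f \<in> gmap C k X Y" "a = gop C k X Y f"
  using assms by (auto simp: ghom_def split: if_splits)

lemma gop_ghom: "\<lbrakk>X \<in> gobj C; Y \<in> gobj C; f \<in> gmap C k X Y\<rbrakk> \<Longrightarrow> gop C k X Y f \<in> ghom k X Y"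
  by (simp add: ghom_def)

lemma zero_ghom: "0 \<in> ghom k X Y"
  using gop_gnull[of X Y k] gmap_closed(1)[of X Y k] by (auto simp: ghom_def intro: rev_image_eqI)

sublocale gr: grcat "(*)" ghom gone gpr
proof
  fix f g h :: "('o, 'm) fam endo"
  show "f * g * h = f * (g * h)" "(f + g) * h = f * h + g * h" "f * (g + h) = f * g + f * h"
    by (simp_all add: algebra_simps)
  fix k X Y
  show "0 \<in> ghom k X Y" by (rule zero_ghom)
  show "f + g \<in> ghom k X Y" if fg: "f \<in> ghom k X Y" "g \<in> ghom k X Y"
  proof (cases "X \<in> gobj C \<and> Y \<in> gobj C")
    case True
    then obtain u v where "u \<in> gmap C k X Y" "f = gop C k X Y u" "v \<in> gmap C k X Y" "g = gop C k X Y v"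
      using fg by (auto simp: ghom_def)
    then show ?thesis using True gop_gplus[of X Y u k v] gop_ghom[OF _ _ gmap_closed(5), of X Y u k v] by simp
  qed (use fg in \<open>auto simp: ghom_def\<close>)
  show "- f \<in> ghom k X Y" if f: "f \<in> ghom k X Y"
  proof (cases "X \<in> gobj C \<and> Y \<in> gobj C")
    case True
    then obtain u where "u \<in> gmap C k X Y" "f = gop C k X Y u" using f by (auto simp: ghom_def)
    then show ?thesis using True gop_gneg[of X Y u k] gop_ghom[OF _ _ gmap_closed(4), of X Y u k] by simp
  qed (use f in \<open>auto simp: ghom_def\<close>)
  show "g * f \<in> ghom (k + l) X Z" if fg: "f \<in> ghom k X Y" "g \<in> ghom l Y Z" for l Z
  proof (cases "X \<in> gobj C \<and> Y \<in> gobj C \<and> Z \<in> gobj C")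
    case True
    then obtain u v where uv: "u \<in> gmap C k X Y" "f = gop C k X Y u" "v \<in> gmap C l Y Z" "g = gop C l Y Z v"
      using fg by (auto simp: ghom_def)
    then show ?thesis using True gop_gcomp[of X Y Z u k v l] gop_ghom[OF _ _ gcomp_closed, of X Z Y u k v l] by simp
  next
    case False
    then have "g * f = 0" using fg by (auto simp: ghom_def)
    then show ?thesis using zero_ghom by simp
  qed
  show "gone X \<in> ghom 0 X X" "gpr n X \<in> ghom 0 X X" for n
    using gmap_closed[of X X] by (auto simp: gone_def gpr_def ghom_def)
  show "gone Y * f = f" if "f \<in> ghom k X Y" using that
  proof (cases rule: ghom_cases)
    case (2 u)
    have "gcomp C k 0 X Y Y (gid C Y) u = u"
      using 2(1,2) gmapD[OF 2(3)] by (auto simp: gcomp_def gid_def Ident_l gobjD)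
    then show ?thesis using 2 gop_gcomp[OF 2(1,2,2,3) gmap_closed(2)[OF 2(2,2)]] by (simp add: gone_def)
  qed simp
  show "f * gone X = f" if "f \<in> ghom k X Y" using that
  proof (cases rule: ghom_cases)
    case (2 u)
    have "gcomp C 0 k X X Y u (gid C X) = u"
      using 2(1,2) gmapD[OF 2(3)] by (auto simp: gcomp_def gid_def Ident_r gobjD)
    then show ?thesis using 2 gop_gcomp[OF 2(1,1,2) gmap_closed(2)[OF 2(1,1)] 2(3)] by (simp add: gone_def)
  qed simp
  show "f * gpr n X = gpr (n + k) Y * f" if "f \<in> ghom k X Y" for n using that
  proof (cases rule: ghom_cases)
    case (2 u)
    have "gcomp C 0 k X X Y u (gproj C n X) = gcomp C k 0 X Y Y (gproj C (n + k) Y) u"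
      using 2(1,2) gmapD[OF 2(3)]
      by (auto simp: gcomp_def gproj_def Ident_r Ident_l Comp_Null_l Comp_Null_r gobjD fun_eq_iff)
    then show ?thesis
      using 2 gop_gcomp[OF 2(1,1,2) gmap_closed(3)[OF 2(1,1), of n] 2(3)]
        gop_gcomp[OF 2(1,2,2,3) gmap_closed(3)[OF 2(2,2), of "n + k"]]
      by (simp add: gpr_def)
  qed simp
  show "gpr m X * gpr n X = (if m = n then gpr n X else 0)" for m n
  proof (cases "X \<in> gobj C")
    case True
    have "gcomp C 0 0 X X X (gproj C m X) (gproj C n X) = (if m = n then gproj C n X else gnull C 0 X X)"
      using True by (auto simp: gcomp_def gproj_def gnull_def Ident_r Ident_in Null_in Comp_Null_l Comp_Null_r gobjD fun_eq_iff)
    then show ?thesis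
      using True gop_gcomp[OF True True True gmap_closed(3)[OF True True, of n] gmap_closed(3)[OF True True, of m]]
      by (auto simp: gpr_def gop_gnull)
  qed (simp add: gpr_def)
  show "f = 0" if "f \<in> ghom k X Y" and 0: "\<And>n. f * gpr n X = 0" using that(1)
  proof (cases rule: ghom_cases)
    case (2 u)
    have "gop C k X Y (gcomp C 0 k X X Y u (gproj C n X)) = gop C k X Y (gnull C k X Y)" for n
      using 0[of n] 2 gop_gcomp[OF 2(1,1,2) gmap_closed(3)[OF 2(1,1)] 2(3), of n] by (simp add: gpr_def gop_gnull)
    then have e: "gcomp C 0 k X X Y u (gproj C n X) = gnull C k X Y" for n
      using gop_inject[OF 2(1,2)] gcomp_closed[OF 2(1,1,2) gmap_closed(3)[OF 2(1,1)] 2(3), of n]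
        gmap_closed(1)[OF 2(1,2), of k] by simp
    have "u n = gnull C k X Y n" for n
      using fun_cong[OF e[of n], of n] gmapD[OF 2(3), of n] 2(1,2) by (simp add: gcomp_def gproj_def Ident_r gobjD)
    then have "u = gnull C k X Y" by auto
    then show ?thesis using 2 gop_gnull by simp
  qed
qed

end

text \<open>A representation restricts along a fully faithful additive functor. In this way the
  module categories are represented through Adelman's category and its opposite.\<close>

lemma (in krep) krep_functor:
  assumes D: "precat D" and F: "additive_functor D C F"
    and ff: "\<And>X Y. \<lbrakk>X \<in> Obj D; Y \<in> Obj D\<rbrakk> \<Longrightarrow> bij_betw (FArr F X Y) (Arr D X Y) (Arr C (FObj F X) (FObj F Y))"
  shows "krep D mul H one pr (\<lambda>X. ob (\<lambda>n. FObj F (X n)))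
    (\<lambda>k X Y f. \<rho> k (\<lambda>n. FObj F (X n)) (\<lambda>n. FObj F (Y n)) (\<lambda>n. FArr F (X n) (Y (n + k)) (f n)))"
proof -
  interpret D: precat D by (rule D)
  have fn: "is_functor D C F" using F by (simp add: additive_functor_def)
  have FO: "X \<in> Obj D \<Longrightarrow> FObj F X \<in> Obj C" for X using fn by (simp add: is_functor_def)
  have FA: "\<lbrakk>X \<in> Obj D; Y \<in> Obj D; f \<in> Arr D X Y\<rbrakk> \<Longrightarrow> FArr F X Y f \<in> Arr C (FObj F X) (FObj F Y)" for X Y f
    using fn by (simp add: is_functor_def)
  let ?o = "\<lambda>X n. FObj F (X n)"
  let ?F = "\<lambda>k X Y f n. FArr F (X n) (Y (n + k)) (f n)"
  have go: "X \<in> gobj D \<Longrightarrow> ?o X \<in> gobj C" for X using FO by (simp add: gobj_def)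
  have gm: "?F k X Y f \<in> gmap C k (?o X) (?o Y)" if "X \<in> gobj D" "Y \<in> gobj D" "f \<in> gmap D k X Y" for k X Y f
    using that FA by (simp add: gobj_def gmap_def)
  have bij: "bij_betw (?F k X Y) (gmap D k X Y) (gmap C k (?o X) (?o Y))" if X: "X \<in> gobj D" and Y: "Y \<in> gobj D" for k X Y
  proof (rule bij_betwI')
    fix f g assume f: "f \<in> gmap D k X Y" and g: "g \<in> gmap D k X Y"
    have "f n = g n" if "?F k X Y f n = ?F k X Y g n" for n
      using ff[of "X n" "Y (n + k)", THEN bij_betw_imp_inj_on] that X Y D.gmapD[OF f] D.gmapD[OF g] D.gobjD
      by (meson inj_onD)
    then show "?F k X Y f = ?F k X Y g \<longleftrightarrow> f = g" by (auto simp: fun_eq_iff)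
  next
    fix f assume "f \<in> gmap D k X Y" then show "?F k X Y f \<in> gmap C k (?o X) (?o Y)" using gm X Y by blast
  next
    fix h assume h: "h \<in> gmap C k (?o X) (?o Y)"
    have "\<exists>f. f \<in> Arr D (X n) (Y (n + k)) \<and> h n = FArr F (X n) (Y (n + k)) f" for n
      using ff[of "X n" "Y (n + k)", THEN bij_betw_imp_surj_on] gmapD[OF h, of n] X Y D.gobjD by blast
    then obtain f where "\<And>n. f n \<in> Arr D (X n) (Y (n + k)) \<and> h n = FArr F (X n) (Y (n + k)) (f n)" by metis
    then show "\<exists>f\<in>gmap D k X Y. h = ?F k X Y f" by (intro bexI[of _ f]) (auto simp: gmap_def)
  qed
  have null: "FArr F X Y (Null D X Y) = Null C (FObj F X) (FObj F Y)" if "X \<in> Obj D" "Y \<in> Obj D" for X Y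
  proof (rule Plus_cancel[of "FObj F X" "FObj F Y"])
    let ?n = "FArr F X Y (Null D X Y)"
    have n: "?n \<in> Arr C (FObj F X) (FObj F Y)" using FA that D.Null_in by simp
    have "Plus C (FObj F X) (FObj F Y) ?n ?n = FArr F X Y (Plus D X Y (Null D X Y) (Null D X Y))"
      using F that D.Null_in by (simp add: additive_functor_def)
    then show "Plus C (FObj F X) (FObj F Y) ?n ?n = Plus C (FObj F X) (FObj F Y) ?n (Null C (FObj F X) (FObj F Y))"
      using that n FO by (simp add: D.Plus_Null D.Null_in Plus_Null_r)
  qed (use that FO FA D.Null_in Null_in in auto)
  show ?thesis
  proof (intro krep.intro krep_axioms.intro D grcat_axioms)
    fix X Y k assume X: "X \<in> gobj D" and Y: "Y \<in> gobj D"
    show "bij_betw (\<lambda>f. \<rho> k (?o X) (?o Y) (?F k X Y f)) (gmap D k X Y) (H k (ob (?o X)) (ob (?o Y)))"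
      using bij_betw_trans[OF bij[OF X Y] \<rho>_bij[OF go[OF X] go[OF Y]]] by (simp add: comp_def)
    fix f g assume f: "f \<in> gmap D k X Y" and g: "g \<in> gmap D k X Y"
    have "?F k X Y (gplus D k X Y f g) = gplus C k (?o X) (?o Y) (?F k X Y f) (?F k X Y g)"
      using F X Y f g D.gmapD D.gobjD by (simp add: gplus_def additive_functor_def)
    then show "\<rho> k (?o X) (?o Y) (?F k X Y (gplus D k X Y f g)) = \<rho> k (?o X) (?o Y) (?F k X Y f) + \<rho> k (?o X) (?o Y) (?F k X Y g)"
      using \<rho>_plus[OF go[OF X] go[OF Y] gm[OF X Y f] gm[OF X Y g]] by simp
  next
    fix X Y Z f g k l assume X: "X \<in> gobj D" and Y: "Y \<in> gobj D" and Z: "Z \<in> gobj D"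
      and f: "f \<in> gmap D k X Y" and g: "g \<in> gmap D l Y Z"
    have "g (n + k) \<in> Arr D (Y (n + k)) (Z (n + k + l))" for n using D.gmapD[OF g] by simp
    then have "?F (k + l) X Z (gcomp D k l X Y Z g f) = gcomp C k l (?o X) (?o Y) (?o Z) (?F l Y Z g) (?F k X Y f)"
      using fn X Y Z D.gmapD[OF f] D.gobjD by (simp add: gcomp_def is_functor_def add.assoc[symmetric])
    then show "\<rho> (k + l) (?o X) (?o Z) (?F (k + l) X Z (gcomp D k l X Y Z g f)) =
        \<rho> l (?o Y) (?o Z) (?F l Y Z g) ** \<rho> k (?o X) (?o Y) (?F k X Y f)"
      using \<rho>_comp[OF go[OF X] go[OF Y] go[OF Z] gm[OF X Y f] gm[OF Y Z g]] by simp
  next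
    fix X n assume X: "X \<in> gobj D"
    have "?F 0 X X (gid D X) = gid C (?o X)" using fn X D.gobjD by (simp add: gid_def is_functor_def)
    then show "\<rho> 0 (?o X) (?o X) (?F 0 X X (gid D X)) = one (ob (?o X))" using \<rho>_id[OF go[OF X]] by simp
    have "?F 0 X X (gproj D n X) = gproj C n (?o X)"
      using fn X D.gobjD null by (auto simp: gproj_def is_functor_def fun_eq_iff)
    then show "\<rho> 0 (?o X) (?o X) (?F 0 X X (gproj D n X)) = pr n (ob (?o X))" using \<rho>_proj[OF go[OF X]] by simp
  qed
qed

definition op_cat :: "('o, 'm) preadd_cat \<Rightarrow> ('o, 'm) preadd_cat" where
  "op_cat G = \<lparr>Obj = Obj G, Arr = (\<lambda>X Y. Arr G Y X), Ident = Ident G,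
     Comp = (\<lambda>X Y Z g f. Comp G Z Y X f g), Plus = (\<lambda>X Y. Plus G Y X), Null = (\<lambda>X Y. Null G Y X)\<rparr>"

lemma op_cat_simps [simp]:
  "Obj (op_cat G) = Obj G" "Arr (op_cat G) X Y = Arr G Y X" "Ident (op_cat G) = Ident G"
  "Comp (op_cat G) X Y Z g f = Comp G Z Y X f g" "Plus (op_cat G) X Y = Plus G Y X" "Null (op_cat G) X Y = Null G Y X"
  by (simp_all add: op_cat_def)

context precat
begin

lemma bij_gop: "\<lbrakk>X \<in> gobj C; Y \<in> gobj C\<rbrakk> \<Longrightarrow> bij_betw (gop C k X Y) (gmap C k X Y) (ghom k X Y)"
  using gop_inject by (auto simp: bij_betw_def inj_on_def ghom_def)

lemma krep_self: "krep C (*) ghom gone gpr (\<lambda>X. X) (gop C)"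
  by (intro krep.intro krep_axioms.intro precat_axioms gr.grcat_axioms)
    (simp_all add: bij_gop gop_gplus gop_gcomp gone_def gpr_def)

lemma precat_op_cat: "precat (op_cat C)"
  by unfold_locales (simp_all add: Ident_in Comp_in Comp_assoc Ident_l Ident_r Plus_in Null_in Plus_assoc Plus_Null
      inverse_ex Comp_Plus_l Comp_Plus_r, rule Plus_comm)

text \<open>The degrees of the objects are reversed, so that those of the maps are preserved.\<close>

lemma krep_op:
  "krep (op_cat C) (\<lambda>f g. g * f) (\<lambda>k a b. ghom k b a) gone (\<lambda>n. gpr (- n)) (\<lambda>X n. X (- n))
    (\<lambda>k X Y f. gop C k (\<lambda>n. Y (- n)) (\<lambda>n. X (- n)) (\<lambda>n. f (- n - k)))"
proof -
  \<comment> \<open>An arrow of the opposite category from \<open>X m\<close> to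
    \<open>Y (m + k)\<close>, seen in \<open>C\<close> with reversed degrees, starts in degree
    \<open>n = - m - k\<close>. Hence the index \<open>- n - k\<close>.\<close>
  let ?o = "\<lambda>(X :: int \<Rightarrow> 'o) n. X (- n)" and ?F = "\<lambda>k (f :: int \<Rightarrow> 'm) n. f (- n - k)"
  have go: "X \<in> gobj (op_cat C) \<Longrightarrow> ?o X \<in> gobj C" for X by (simp add: gobj_def)
  have gm: "?F k f \<in> gmap C k (?o Y) (?o X)" if f: "f \<in> gmap (op_cat C) k X Y" for k X Y f
  proof -
    have "f (- n - k) \<in> Arr C (Y (- n)) (X (- (n + k)))" for n using f[unfolded gmap_def, simplified, rule_format, of "- n - k"] by simp
    then show ?thesis by (simp add: gmap_def)
  qed
  have bij: "bij_betw (?F k) (gmap (op_cat C) k X Y) (gmap C k (?o Y) (?o X))" for k X Y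
  proof (rule bij_betwI[where g = "?F k"])
    show "?F k \<in> gmap (op_cat C) k X Y \<rightarrow> gmap C k (?o Y) (?o X)" using gm by blast
    have "g (- n - k) \<in> Arr C (Y (n + k)) (X n)" if g: "g \<in> gmap C k (?o Y) (?o X)" for g n
      using gmapD[OF g, of "- n - k"] by (simp add: add.commute)
    then show "?F k \<in> gmap C k (?o Y) (?o X) \<rightarrow> gmap (op_cat C) k X Y" by (simp add: gmap_def)
  qed simp_all
  show ?thesis
  proof (intro krep.intro krep_axioms.intro precat_op_cat gr.dual)
    fix X Y k assume X: "X \<in> gobj (op_cat C)" and Y: "Y \<in> gobj (op_cat C)"
    show "bij_betw (\<lambda>f. gop C k (?o Y) (?o X) (?F k f)) (gmap (op_cat C) k X Y) (ghom k (?o Y) (?o X))"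
      using bij_betw_trans[OF bij bij_gop[OF go[OF Y] go[OF X]]] by (simp add: comp_def)
    fix f g assume f: "f \<in> gmap (op_cat C) k X Y" and g: "g \<in> gmap (op_cat C) k X Y"
    have "?F k (gplus (op_cat C) k X Y f g) = gplus C k (?o Y) (?o X) (?F k f) (?F k g)" by (simp add: gplus_def add.commute)
    then show "gop C k (?o Y) (?o X) (?F k (gplus (op_cat C) k X Y f g)) = gop C k (?o Y) (?o X) (?F k f) + gop C k (?o Y) (?o X) (?F k g)"
      using gop_gplus[OF go[OF Y] go[OF X] gm[OF f] gm[OF g]] by simp
  next
    fix X Y Z f g k l assume X: "X \<in> gobj (op_cat C)" and Y: "Y \<in> gobj (op_cat C)" and Z: "Z \<in> gobj (op_cat C)"
      and f: "f \<in> gmap (op_cat C) k X Y" and g: "g \<in> gmap (op_cat C) l Y Z"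
    have "?F (k + l) (gcomp (op_cat C) k l X Y Z g f) n = gcomp C l k (?o Z) (?o Y) (?o X) (?F k f) (?F l g) n" for n
    proof -
      have e: "- n - (k + l) = - n - l - k" "- n - l - k + k = - n - l" "- n - l - k + k + l = - n" "- (n + l) = - n - l"
        "- (n + l + k) = - n - l - k" "- n - l + l = - n" by simp_all
      show ?thesis unfolding gcomp_def op_cat_simps e ..
    qed
    then have "?F (k + l) (gcomp (op_cat C) k l X Y Z g f) = gcomp C l k (?o Z) (?o Y) (?o X) (?F k f) (?F l g)" by blast
    then show "gop C (k + l) (?o Z) (?o X) (?F (k + l) (gcomp (op_cat C) k l X Y Z g f)) =
        gop C k (?o Y) (?o X) (?F k f) * gop C l (?o Z) (?o Y) (?F l g)"
      using gop_gcomp[OF go[OF Z] go[OF Y] go[OF X] gm[OF g] gm[OF f]] by (simp add: add.commute)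
  next
    fix X n assume X: "X \<in> gobj (op_cat C)"
    have "?F 0 (gid (op_cat C) X) = gid C (?o X)" "?F 0 (gproj (op_cat C) n X) = gproj C (- n) (?o X)"
      by (auto simp: gid_def gproj_def fun_eq_iff)
    then show "gop C 0 (?o X) (?o X) (?F 0 (gid (op_cat C) X)) = gone (?o X)"
      "gop C 0 (?o X) (?o X) (?F 0 (gproj (op_cat C) n X)) = gpr (- n) (?o X)" using go[OF X] by (simp_all add: gone_def gpr_def)
  qed
qed

end

section \<open>Adelman's free abelian category\<close>

text \<open>All arrow sets lie in one ring, so that identities between composites of arrows become
  ring identities. The sets may overlap, zero being in each of them, which is why memberships are
  carried along.\<close>

locale ringcat =
  fixes Hm :: "'p \<Rightarrow> 'p \<Rightarrow> 'r :: ring set" and idm :: "'p \<Rightarrow> 'r"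
  assumes Hm_zero: "0 \<in> Hm X Y"
    and Hm_add: "\<lbrakk>f \<in> Hm X Y; g \<in> Hm X Y\<rbrakk> \<Longrightarrow> f + g \<in> Hm X Y"
    and Hm_uminus: "f \<in> Hm X Y \<Longrightarrow> - f \<in> Hm X Y"
    and Hm_mul: "\<lbrakk>g \<in> Hm Y Z; f \<in> Hm X Y\<rbrakk> \<Longrightarrow> g * f \<in> Hm X Z"
    and Hm_id: "idm X \<in> Hm X X"
    and Hm_id_l: "f \<in> Hm X Y \<Longrightarrow> idm Y * f = f"
    and Hm_id_r: "f \<in> Hm X Y \<Longrightarrow> f * idm X = f"
begin

text \<open>
  Adelman's free abelian category: its objects are diagrams \<open>X\<^sub>1 \<rightarrow> X\<^sub>0 \<rightarrow> X\<^sub>2\<close>, to be thought of as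
  subquotients of \<open>X\<^sub>0\<close>.
\<close>

definition hom :: "'p \<times> 'p \<times> 'p \<times> 'r \<times> 'r \<Rightarrow> 'p \<times> 'p \<times> 'p \<times> 'r \<times> 'r \<Rightarrow> 'r set" where
  "hom = (\<lambda>(X1, X0, X2, f, g) (Y1, Y0, Y2, f', g').
     {F \<in> Hm X0 Y0. (\<exists>u\<in>Hm X1 Y1. F * f = f' * u) \<and> (\<exists>v\<in>Hm X2 Y2. g' * F = v * g)})"

text \<open>Adelman's ideal: \<open>f' * K\<close> lands in the image that is divided out, and
  \<open>L * g\<close> vanishes on the kernel that is taken, so that \<open>F\<close> induces zero
  on the subquotients.\<close>

definition nul :: "'p \<times> 'p \<times> 'p \<times> 'r \<times> 'r \<Rightarrow> 'p \<times> 'p \<times> 'p \<times> 'r \<times> 'r \<Rightarrow> 'r set" where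
  "nul a b = {F \<in> hom a b. case a of (X1, X0, X2, f, g) \<Rightarrow> case b of (Y1, Y0, Y2, f', g') \<Rightarrow>
     (\<exists>K\<in>Hm X0 Y1. \<exists>L\<in>Hm X2 Y0. F = f' * K + L * g)}"

definition coset where "coset a b F = {F' \<in> hom a b. F' - F \<in> nul a b}"

text \<open>Composition and sum act on chosen representatives. \<open>adel_Comp\<close> and
  \<open>adel_Plus\<close> remove the choice, \<open>nul\<close> being an ideal on both
  sides.\<close>

definition adel :: "('p \<times> 'p \<times> 'p \<times> 'r \<times> 'r, 'r set) preadd_cat" where
  "adel = \<lparr>Obj = {(X1, X0, X2, f, g). f \<in> Hm X1 X0 \<and> g \<in> Hm X0 X2},
     Arr = (\<lambda>a b. coset a b ` hom a b),
     Ident = (\<lambda>a. coset a a (idm (fst (snd a)))),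
     Comp = (\<lambda>a b c G F. coset a c ((SOME g. g \<in> G) * (SOME f. f \<in> F))),
     Plus = (\<lambda>a b F G. coset a b ((SOME f. f \<in> F) + (SOME g. g \<in> G))),
     Null = (\<lambda>a b. coset a b 0)\<rparr>"

lemma homI:
  "\<lbrakk>F \<in> Hm X0 Y0; u \<in> Hm X1 Y1; F * f = f' * u; v \<in> Hm X2 Y2; g' * F = v * g\<rbrakk>
    \<Longrightarrow> F \<in> hom (X1, X0, X2, f, g) (Y1, Y0, Y2, f', g')"
  unfolding hom_def by auto

lemma homE:
  assumes "F \<in> hom (X1, X0, X2, f, g) (Y1, Y0, Y2, f', g')"
  obtains u v where "F \<in> Hm X0 Y0" "u \<in> Hm X1 Y1" "F * f = f' * u" "v \<in> Hm X2 Y2" "g' * F = v * g"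
  using assms unfolding hom_def by auto

lemma nulI:
  "\<lbrakk>F \<in> hom (X1, X0, X2, f, g) (Y1, Y0, Y2, f', g'); K \<in> Hm X0 Y1; L \<in> Hm X2 Y0; F = f' * K + L * g\<rbrakk>
    \<Longrightarrow> F \<in> nul (X1, X0, X2, f, g) (Y1, Y0, Y2, f', g')"
  unfolding nul_def by auto

lemma nulE:
  assumes "F \<in> nul (X1, X0, X2, f, g) (Y1, Y0, Y2, f', g')"
  obtains K L where "F \<in> hom (X1, X0, X2, f, g) (Y1, Y0, Y2, f', g')" "K \<in> Hm X0 Y1" "L \<in> Hm X2 Y0" "F = f' * K + L * g"
  using assms unfolding nul_def by auto

lemma hom_nul_closed:
  shows hom_zero: "0 \<in> hom a b" and hom_add: "\<lbrakk>F \<in> hom a b; G \<in> hom a b\<rbrakk> \<Longrightarrow> F + G \<in> hom a b"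
    and hom_uminus: "F \<in> hom a b \<Longrightarrow> - F \<in> hom a b"
    and hom_mul: "\<lbrakk>G \<in> hom b c; F \<in> hom a b\<rbrakk> \<Longrightarrow> G * F \<in> hom a c"
    and nul_zero: "0 \<in> nul a b" and nul_add: "\<lbrakk>F \<in> nul a b; G \<in> nul a b\<rbrakk> \<Longrightarrow> F + G \<in> nul a b"
    and nul_uminus: "F \<in> nul a b \<Longrightarrow> - F \<in> nul a b"
    and nul_mul_l: "\<lbrakk>G \<in> hom b c; F \<in> nul a b\<rbrakk> \<Longrightarrow> G * F \<in> nul a c"
    and nul_mul_r: "\<lbrakk>G \<in> nul b c; F \<in> hom a b\<rbrakk> \<Longrightarrow> G * F \<in> nul a c"
proof -
  obtain X1 X0 X2 f g where a: "a = (X1, X0, X2, f, g)" by (cases a)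
  obtain Y1 Y0 Y2 f' g' where b: "b = (Y1, Y0, Y2, f', g')" by (cases b)
  obtain Z1 Z0 Z2 f'' g'' where c: "c = (Z1, Z0, Z2, f'', g'')" by (cases c)
  show h0: "0 \<in> hom a b" unfolding a b by (rule homI[OF Hm_zero Hm_zero _ Hm_zero]) simp_all
  show ha: "F + G \<in> hom a b" if F: "F \<in> hom a b" and G: "G \<in> hom a b" for F G
  proof -
    obtain u v where 1: "F \<in> Hm X0 Y0" "u \<in> Hm X1 Y1" "F * f = f' * u" "v \<in> Hm X2 Y2" "g' * F = v * g"
      using homE[OF F[unfolded a b]] .
    obtain u' v' where 2: "G \<in> Hm X0 Y0" "u' \<in> Hm X1 Y1" "G * f = f' * u'" "v' \<in> Hm X2 Y2" "g' * G = v' * g"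
      using homE[OF G[unfolded a b]] .
    show ?thesis unfolding a b
      by (rule homI[OF Hm_add[OF 1(1) 2(1)] Hm_add[OF 1(2) 2(2)] _ Hm_add[OF 1(4) 2(4)]])
        (simp_all add: 1 2 distrib_left distrib_right)
  qed
  show hu: "- F \<in> hom a b" if F: "F \<in> hom a b" for F
  proof -
    obtain u v where 1: "F \<in> Hm X0 Y0" "u \<in> Hm X1 Y1" "F * f = f' * u" "v \<in> Hm X2 Y2" "g' * F = v * g"
      using homE[OF F[unfolded a b]] .
    show ?thesis unfolding a b
      by (rule homI[OF Hm_uminus[OF 1(1)] Hm_uminus[OF 1(2)] _ Hm_uminus[OF 1(4)]]) (simp_all add: 1)
  qed
  show hm: "G * F \<in> hom a c" if G: "G \<in> hom b c" and F: "F \<in> hom a b" for F G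
  proof -
    obtain u v where 1: "F \<in> Hm X0 Y0" "u \<in> Hm X1 Y1" "F * f = f' * u" "v \<in> Hm X2 Y2" "g' * F = v * g"
      using homE[OF F[unfolded a b]] .
    obtain u' v' where 2: "G \<in> Hm Y0 Z0" "u' \<in> Hm Y1 Z1" "G * f' = f'' * u'" "v' \<in> Hm Y2 Z2" "g'' * G = v' * g'"
      using homE[OF G[unfolded b c]] .
    have "G * F * f = f'' * (u' * u)" by (simp add: mult.assoc 1) (simp add: mult.assoc[symmetric] 2)
    moreover have "g'' * (G * F) = v' * v * g" by (simp add: mult.assoc[symmetric] 2) (simp add: mult.assoc 1)
    ultimately show ?thesis unfolding a c
      by (rule homI[OF Hm_mul[OF 2(1) 1(1)] Hm_mul[OF 2(2) 1(2)] _ Hm_mul[OF 2(4) 1(4)]])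
  qed
  show "0 \<in> nul a b" unfolding a b by (rule nulI[OF h0[unfolded a b] Hm_zero Hm_zero]) simp
  show "F + G \<in> nul a b" if F: "F \<in> nul a b" and G: "G \<in> nul a b" for F G
  proof -
    obtain K L where 1: "F \<in> hom a b" "K \<in> Hm X0 Y1" "L \<in> Hm X2 Y0" "F = f' * K + L * g"
      using nulE[OF F[unfolded a b]] unfolding a b .
    obtain K' L' where 2: "G \<in> hom a b" "K' \<in> Hm X0 Y1" "L' \<in> Hm X2 Y0" "G = f' * K' + L' * g"
      using nulE[OF G[unfolded a b]] unfolding a b .
    show ?thesis using ha[OF 1(1) 2(1)] unfolding a b
      by (rule nulI[OF _ Hm_add[OF 1(2) 2(2)] Hm_add[OF 1(3) 2(3)]]) (simp add: 1 2 algebra_simps)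
  qed
  show "- F \<in> nul a b" if F: "F \<in> nul a b" for F
  proof -
    obtain K L where 1: "F \<in> hom a b" "K \<in> Hm X0 Y1" "L \<in> Hm X2 Y0" "F = f' * K + L * g"
      using nulE[OF F[unfolded a b]] unfolding a b .
    show ?thesis using hu[OF 1(1)] unfolding a b
      by (rule nulI[OF _ Hm_uminus[OF 1(2)] Hm_uminus[OF 1(3)]]) (simp add: 1)
  qed
  show "G * F \<in> nul a c" if G: "G \<in> hom b c" and F: "F \<in> nul a b" for F G
  proof -
    obtain K L where 1: "F \<in> hom a b" "K \<in> Hm X0 Y1" "L \<in> Hm X2 Y0" "F = f' * K + L * g"
      using nulE[OF F[unfolded a b]] unfolding a b .
    obtain u v where 2: "G \<in> Hm Y0 Z0" "u \<in> Hm Y1 Z1" "G * f' = f'' * u" "v \<in> Hm Y2 Z2" "g'' * G = v * g'"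
      using homE[OF G[unfolded b c]] .
    have "G * F = f'' * (u * K) + (G * L) * g"
      by (simp add: 1 distrib_left mult.assoc[symmetric] 2)
    then show ?thesis using hm[OF G 1(1)] unfolding a c by (intro nulI[OF _ Hm_mul[OF 2(2) 1(2)] Hm_mul[OF 2(1) 1(3)]])
  qed
  show "G * F \<in> nul a c" if G: "G \<in> nul b c" and F: "F \<in> hom a b" for F G
  proof -
    obtain K L where 1: "G \<in> hom b c" "K \<in> Hm Y0 Z1" "L \<in> Hm Y2 Z0" "G = f'' * K + L * g'"
      using nulE[OF G[unfolded b c]] unfolding b c .
    obtain u v where 2: "F \<in> Hm X0 Y0" "u \<in> Hm X1 Y1" "F * f = f' * u" "v \<in> Hm X2 Y2" "g' * F = v * g"
      using homE[OF F[unfolded a b]] .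
    have "G * F = f'' * (K * F) + (L * v) * g"
      by (simp add: 1 distrib_right mult.assoc 2)
    then show ?thesis using hm[OF 1(1) F] unfolding a c by (intro nulI[OF _ Hm_mul[OF 1(2) 2(1)] Hm_mul[OF 1(3) 2(4)]])
  qed
qed

lemma nul_diff: "\<lbrakk>F \<in> nul a b; G \<in> nul a b\<rbrakk> \<Longrightarrow> F - G \<in> nul a b"
  using nul_add[OF _ nul_uminus, of F a b G] by simp

lemma coset_self: "F \<in> hom a b \<Longrightarrow> F \<in> coset a b F"
  using nul_zero by (simp add: coset_def)

lemma coset_eq: "\<lbrakk>F \<in> hom a b; G \<in> hom a b\<rbrakk> \<Longrightarrow> coset a b F = coset a b G \<longleftrightarrow> F - G \<in> nul a b"
proof
  assume F: "F \<in> hom a b"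
  assume "coset a b F = coset a b G"
  then have "F \<in> coset a b G" using coset_self[OF F] by simp
  then show "F - G \<in> nul a b" by (simp add: coset_def)
next
  assume n: "F - G \<in> nul a b"
  have "F' - F \<in> nul a b \<longleftrightarrow> F' - G \<in> nul a b" for F'
    using nul_add[OF _ n, of "F' - F"] nul_diff[OF _ n, of "F' - G"] by auto
  then show "coset a b F = coset a b G" by (simp add: coset_def)
qed

lemma coset_some:
  assumes "F \<in> hom a b"
  shows "(SOME f. f \<in> coset a b F) \<in> hom a b" "(SOME f. f \<in> coset a b F) - F \<in> nul a b"
  using someI[of "\<lambda>f. f \<in> coset a b F", OF coset_self[OF assms]] by (auto simp: coset_def)

lemma idm_hom: "(X1, X0, X2, f, g) \<in> Obj adel \<Longrightarrow> idm X0 \<in> hom (X1, X0, X2, f, g) (X1, X0, X2, f, g)"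
  using Hm_id Hm_id_l Hm_id_r by (force simp: adel_def hom_def)

lemma idm_hom': "a \<in> Obj adel \<Longrightarrow> idm (fst (snd a)) \<in> hom a a"
  using idm_hom by (cases a) simp

lemma adel_Arr: "Arr adel a b = coset a b ` hom a b"
  and adel_Ident: "Ident adel a = coset a a (idm (fst (snd a)))"
  and adel_Null: "Null adel a b = coset a b 0"
  by (simp_all add: adel_def)

lemma adel_Comp:
  assumes "F \<in> hom a b" "G \<in> hom b c"
  shows "Comp adel a b c (coset b c G) (coset a b F) = coset a c (G * F)"
proof -
  let ?f = "SOME f. f \<in> coset a b F" and ?g = "SOME g. g \<in> coset b c G"
  note f = coset_some[OF assms(1)] and g = coset_some[OF assms(2)]
  have "?g * ?f - G * F = (?g - G) * ?f + G * (?f - F)" by (simp add: algebra_simps)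
  also have "\<dots> \<in> nul a c" using nul_add nul_mul_r[OF g(2) f(1)] nul_mul_l[OF assms(2) f(2)] by blast
  finally show ?thesis using coset_eq[OF hom_mul[OF g(1) f(1)] hom_mul[OF assms(2,1)]] by (simp add: adel_def)
qed

lemma adel_Plus:
  assumes "F \<in> hom a b" "G \<in> hom a b"
  shows "Plus adel a b (coset a b F) (coset a b G) = coset a b (F + G)"
proof -
  let ?f = "SOME f. f \<in> coset a b F" and ?g = "SOME g. g \<in> coset a b G"
  note f = coset_some[OF assms(1)] and g = coset_some[OF assms(2)]
  have "?f + ?g - (F + G) = (?f - F) + (?g - G)" by simp
  also have "\<dots> \<in> nul a b" using nul_add f(2) g(2) by blast
  finally show ?thesis using coset_eq[OF hom_add[OF f(1) g(1)] hom_add[OF assms]] by (simp add: adel_def)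
qed

lemma hom_Hm: "F \<in> hom a b \<Longrightarrow> F \<in> Hm (fst (snd a)) (fst (snd b))"
  by (auto simp: hom_def split: prod.splits)

lemma precat_adel: "precat adel"
proof
  fix a assume "a \<in> Obj adel"
  then show "Ident adel a \<in> Arr adel a a" using idm_hom' by (simp add: adel_Arr adel_Ident)
next
  fix a b c f g assume "f \<in> Arr adel a b" "g \<in> Arr adel b c"
  then show "Comp adel a b c g f \<in> Arr adel a c" by (auto simp: adel_Arr adel_Comp hom_mul)
next
  fix a b c d f g h assume "f \<in> Arr adel a b" "g \<in> Arr adel b c" "h \<in> Arr adel c d"
  then show "Comp adel a c d h (Comp adel a b c g f) = Comp adel a b d (Comp adel b c d h g) f"
    by (auto simp: adel_Arr adel_Comp hom_mul mult.assoc)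
next
  fix a b f assume a: "a \<in> Obj adel" and b: "b \<in> Obj adel" and "f \<in> Arr adel a b"
  then obtain F where F: "F \<in> hom a b" "f = coset a b F" by (auto simp: adel_Arr)
  show "Comp adel a b b (Ident adel b) f = f"
    unfolding F(2) adel_Ident adel_Comp[OF F(1) idm_hom'[OF b]] Hm_id_l[OF hom_Hm[OF F(1)]] ..
  show "Comp adel a a b f (Ident adel a) = f"
    unfolding F(2) adel_Ident adel_Comp[OF idm_hom'[OF a] F(1)] Hm_id_r[OF hom_Hm[OF F(1)]] ..
next
  fix a b f g assume "f \<in> Arr adel a b" "g \<in> Arr adel a b"
  then show "Plus adel a b f g \<in> Arr adel a b" "Plus adel a b f g = Plus adel a b g f"
    by (auto simp: adel_Arr adel_Plus hom_add add.commute)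
next
  fix a b show "Null adel a b \<in> Arr adel a b" using hom_zero by (simp add: adel_Arr adel_Null)
next
  fix a b f g h assume "f \<in> Arr adel a b" "g \<in> Arr adel a b" "h \<in> Arr adel a b"
  then show "Plus adel a b (Plus adel a b f g) h = Plus adel a b f (Plus adel a b g h)"
    by (auto simp: adel_Arr adel_Plus hom_add add.assoc)
next
  fix a b f assume "f \<in> Arr adel a b"
  then obtain F where F: "F \<in> hom a b" "f = coset a b F" by (auto simp: adel_Arr)
  then show "Plus adel a b (Null adel a b) f = f" using hom_zero by (simp add: adel_Null adel_Plus)
  show "\<exists>g\<in>Arr adel a b. Plus adel a b f g = Null adel a b"
    using F hom_uminus by (intro bexI[of _ "coset a b (- F)"]) (auto simp: adel_Null adel_Plus adel_Arr)
next
  fix a b c f g h assume "f \<in> Arr adel a b" "g \<in> Arr adel b c" "h \<in> Arr adel b c"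
  then show "Comp adel a b c (Plus adel b c g h) f = Plus adel a c (Comp adel a b c g f) (Comp adel a b c h f)"
    by (auto simp: adel_Arr adel_Plus adel_Comp hom_add hom_mul distrib_right)
next
  fix a b c f g h assume "f \<in> Arr adel a b" "h \<in> Arr adel a b" "g \<in> Arr adel b c"
  then show "Comp adel a b c g (Plus adel a b f h) = Plus adel a c (Comp adel a b c g f) (Comp adel a b c g h)"
    by (auto simp: adel_Arr adel_Plus adel_Comp hom_add hom_mul distrib_left)
qed

end

section \<open>Exactness tested by objects, and truncation\<close>

context precat
begin

text \<open>Exactness of \<open>E\<close> as seen by Hom from the objects of \<open>Q\<close>; with
  \<open>Q\<close> the projectives this is the half of exactness that \<open>good\<close> needs for
  \<open>P\<close>.\<close>

definition acyc_to :: "'o set \<Rightarrow> 'o gr \<Rightarrow> 'm gr \<Rightarrow> bool" where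
  "acyc_to Q E S \<longleftrightarrow> (\<forall>q\<in>Q. \<forall>j. \<forall>\<alpha>\<in>Arr C q (E (j + 1)).
     Comp C q (E (j + 1)) (E (j + 2)) (S (j + 1)) \<alpha> = Null C q (E (j + 2)) \<longrightarrow>
     (\<exists>\<alpha>'\<in>Arr C q (E j). \<alpha> = Comp C q (E j) (E (j + 1)) (S j) \<alpha>'))"

definition acyc_from :: "'o set \<Rightarrow> 'o gr \<Rightarrow> 'm gr \<Rightarrow> bool" where
  "acyc_from Q E S \<longleftrightarrow> (\<forall>q\<in>Q. \<forall>j. \<forall>\<alpha>\<in>Arr C (E (j + 1)) q.
     Comp C (E j) (E (j + 1)) q \<alpha> (S j) = Null C (E j) q \<longrightarrow>
     (\<exists>\<alpha>'\<in>Arr C (E (j + 2)) q. \<alpha> = Comp C (E (j + 1)) (E (j + 2)) q \<alpha>' (S (j + 1))))"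

lemma gr_acyc_to:
  assumes E: "E \<in> gobj C" and S: "S \<in> gmap C 1 E E" and Q: "Q \<subseteq> Obj C" "acyc_to Q E S"
    and qQ: "\<And>n. q n \<in> Q" and a: "a \<in> ghom k q E" "gop C 1 E E S * a = 0"
  shows "\<exists>a'\<in>ghom (k - 1) q E. a = gop C 1 E E S * a'"
proof -
  have q: "q \<in> gobj C" using qQ Q(1) by (auto simp: gobj_def)
  obtain f where f: "f \<in> gmap C k q E" "a = gop C k q E f" using ghomE[OF a(1) q E] .
  have e: "gcomp C k 1 q E E S f = gnull C (k + 1) q E"
    using gop_inject[OF q E gcomp_closed[OF q E E f(1) S] gmap_closed(1)[OF q E]] a(2) f(2) gop_gcomp[OF q E E f(1) S] gop_gnull[OF q E] by simp
  have "\<exists>u\<in>Arr C (q i) (E (i + k - 1)). f i = Comp C (q i) (E (i + k - 1)) (E (i + k)) (S (i + k - 1)) u" for i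
  proof -
    have n: "i + k - 1 + 1 = i + k" "i + k - 1 + 2 = i + (k + 1)" "i + k + 1 = i + (k + 1)" by simp_all
    show ?thesis
      using Q(2)[unfolded acyc_to_def, rule_format, OF qQ[of i], of "f i" "i + k - 1", unfolded n] gmapD[OF f(1), of i] fun_cong[OF e, of i]
      unfolding gcomp_def gnull_def n by blast
  qed
  then obtain u where u: "\<And>i. u i \<in> Arr C (q i) (E (i + k - 1))"
    "\<And>i. f i = Comp C (q i) (E (i + k - 1)) (E (i + k)) (S (i + k - 1)) (u i)" by metis
  have uH: "u \<in> gmap C (k - 1) q E" using u(1) by (simp add: gmap_def add_diff_eq)
  have "f i = gcomp C (k - 1) 1 q E E S u i" for i using u(2)[of i] by (simp add: gcomp_def add_diff_eq)
  then have "f = gcomp C (k - 1) 1 q E E S u" by blast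
  then show ?thesis using gop_gcomp[OF q E E uH S] gop_ghom[OF q E uH] f(2) by auto
qed

lemma gr_acyc_from:
  assumes E: "E \<in> gobj C" and S: "S \<in> gmap C 1 E E" and Q: "Q \<subseteq> Obj C" "acyc_from Q E S"
    and qQ: "\<And>n. q n \<in> Q" and a: "a \<in> ghom k E q" "a * gop C 1 E E S = 0"
  shows "\<exists>a'\<in>ghom (k - 1) E q. a = a' * gop C 1 E E S"
proof -
  have q: "q \<in> gobj C" using qQ Q(1) by (auto simp: gobj_def)
  obtain f where f: "f \<in> gmap C k E q" "a = gop C k E q f" using ghomE[OF a(1) E q] .
  have e: "gcomp C 1 k E E q f S = gnull C (1 + k) E q"
    using gop_inject[OF E q gcomp_closed[OF E E q S f(1)] gmap_closed(1)[OF E q]] a(2) f(2) gop_gcomp[OF E E q S f(1)] gop_gnull[OF E q] by simp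
  have "\<exists>u\<in>Arr C (E (i + 1)) (q (i + k)). f i = Comp C (E i) (E (i + 1)) (q (i + k)) u (S i)" for i
  proof -
    have n: "i - 1 + 1 = i" "i - 1 + 2 = i + 1" "i - 1 + (1 + k) = i + k" "i - 1 + 1 + k = i + k" by simp_all
    show ?thesis
      using Q(2)[unfolded acyc_from_def, rule_format, OF qQ[of "i + k"], of "f i" "i - 1", unfolded n] gmapD[OF f(1), of i] fun_cong[OF e, of "i - 1"]
      unfolding gcomp_def gnull_def n by blast
  qed
  then obtain u' where u': "\<And>i. u' i \<in> Arr C (E (i + 1)) (q (i + k))" "\<And>i. f i = Comp C (E i) (E (i + 1)) (q (i + k)) (u' i) (S i)" by metis
  \<comment> \<open>\<open>acyc_from\<close> yields arrows that start at \<open>E (i + 1)\<close>,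
    so the family is reindexed to start at \<open>E i\<close>, which lowers the degree to
    \<open>k - 1\<close>.\<close>
  define u where "u i = u' (i - 1)" for i
  have "u i \<in> Arr C (E i) (q (i + (k - 1)))" for i using u'(1)[of "i - 1"] by (simp add: u_def algebra_simps)
  then have uH: "u \<in> gmap C (k - 1) E q" by (simp add: gmap_def)
  have "f i = gcomp C 1 (k - 1) E E q u S i" for i using u'(2)[of i] by (simp add: gcomp_def u_def)
  then have "f = gcomp C 1 (k - 1) E E q u S" by blast
  then show ?thesis using gop_gcomp[OF E E q S uH] gop_ghom[OF E q uH] f(2) by auto
qed

end

context grcat
begin

definition hacyc :: "'x set \<Rightarrow> 'x \<Rightarrow> 'r \<Rightarrow> bool" where
  "hacyc Q E S \<longleftrightarrow> (\<forall>q\<in>Q. \<forall>k. \<forall>a\<in>H k q E. S ** a = 0 \<longrightarrow> (\<exists>a'\<in>H (k - 1) q E. a = S ** a'))"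

text \<open>\<open>E\<close> is the cone of \<open>j' S i : y \<rightarrow> x\<close>, up to a shift.\<close>

lemma cut_hgood:
  assumes i: "i \<in> H s y E" "i' \<in> H (- s) E y" "j \<in> H (s + 1) x E" "j' \<in> H (- s - 1) E x"
    and e: "i' ** i = one y" "j' ** j = one x" "i' ** j = 0" "j' ** i = 0" "i ** i' + j ** j' = one E"
    and S: "S \<in> H 1 E E" "i' ** (S ** j) = 0" and ac: "hacyc Q E S"
  shows "hgood Q y (i' ** (S ** i)) x (- (j' ** (S ** j))) (j' ** (S ** i))"
  unfolding hgood_def
proof (intro ballI allI impI)
  fix q k a b
  assume q: "q \<in> Q" and a: "a \<in> H (k + 1) q y" and b: "b \<in> H k q x"
    and da: "i' ** (S ** i) ** a = 0" and db: "- (j' ** (S ** j)) ** b = j' ** (S ** i) ** a"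
  have split: "f = i ** (i' ** f) + j ** (j' ** f)" if "f \<in> H l q E" for f l
    using one_l[OF that] by (simp add: e(5)[symmetric] add_mul mul_assoc)
  \<comment> \<open>A cocycle of the cone is the same as a map into \<open>E\<close> that
    \<open>S\<close> kills; \<open>i\<close> and \<open>j\<close> assemble it from its two
    components.\<close>
  let ?c = "i ** a + j ** b"
  have ia: "i ** a \<in> H (k + (s + 1)) q E" and jb: "j ** b \<in> H (k + (s + 1)) q E"
    using H_mul[OF a i(1)] H_mul[OF b i(3)] by (simp_all add: algebra_simps)
  note c = H_add[OF this]
  have "S ** ?c = i ** (i' ** (S ** ?c)) + j ** (j' ** (S ** ?c))" by (rule split[OF H_mul[OF c S(1)]])
  also have "i' ** (S ** ?c) = i' ** (S ** i) ** a + i' ** (S ** j) ** b" by (simp add: mul_simps)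
  also have "\<dots> = 0" using da S(2) by simp
  also have "j' ** (S ** ?c) = j' ** (S ** i) ** a - (- (j' ** (S ** j)) ** b)" by (simp add: mul_simps)
  finally have "S ** ?c = 0" using db by simp
  then obtain c' where c': "c' \<in> H (k + (s + 1) - 1) q E" "?c = S ** c'" using ac q c unfolding hacyc_def by blast
  have sc: "f ** (S ** c') = f ** (S ** i) ** (i' ** c') + f ** (S ** j) ** (j' ** c')" for f
    using arg_cong[OF split[OF c'(1)], of "\<lambda>u. f ** (S ** u)"] by (simp add: mul_simps)
  have "a = i' ** ?c" "b = j' ** ?c"
    using one_l[OF a] one_l[OF b] e by (simp_all add: mul_add mul_assoc[symmetric])
  moreover have "i' ** (S ** c') = i' ** (S ** i) ** (i' ** c')" "j' ** (S ** c') = j' ** (S ** i) ** (i' ** c') - (- (j' ** (S ** j)) ** (j' ** c'))"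
    using sc[of i'] sc[of j'] S(2) by (simp_all add: mul_uminus)
  moreover have "i' ** c' \<in> H k q y" "j' ** c' \<in> H (k - 1) q x" using H_mul[OF c'(1) i(2)] H_mul[OF c'(1) i(4)] by simp_all
  ultimately show "\<exists>a'\<in>H k q y. \<exists>b'\<in>H (k - 1) q x. a = i' ** (S ** i) ** a' \<and> b = j' ** (S ** i) ** a' - (- (j' ** (S ** j)) ** b')"
    unfolding c'(2) by blast
qed

lemma cut_good:
  assumes i: "i \<in> H s y E" "i' \<in> H (- s) E y" "j \<in> H (s + 1) x E" "j' \<in> H (- s - 1) E x"
    and e: "i' ** i = one y" "j' ** j = one x" "i' ** j = 0" "j' ** i = 0" "i ** i' + j ** j' = one E"
    and S: "S \<in> H 1 E E" "i' ** (S ** j) = 0" "S ** S = 0"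
    and ac: "hacyc P E S" "grcat.hacyc (\<lambda>f g. g ** f) (\<lambda>k a b. H k b a) I E S"
  shows "cx y (i' ** (S ** i)) \<and> cx x (- (j' ** (S ** j))) \<and> good P I y (i' ** (S ** i)) x (- (j' ** (S ** j))) (j' ** (S ** i))"
proof -
  interpret D: grcat "\<lambda>f g. g ** f" "\<lambda>k a b. H k b a" one "\<lambda>n. pr (- n)" by (rule dual)
  have SS: "S ** (i ** (i' ** (S ** u))) + S ** (j ** (j' ** (S ** u))) = 0" for u
  proof -
    have "S ** (i ** i' + j ** j') ** (S ** u) = 0"
      unfolding e(5) one_r[OF S(1)] using S(3) by (simp add: mul_assoc[symmetric])
    then show ?thesis by (simp add: mul_simps)
  qed
  have j0: "i' ** (S ** (j ** u)) = 0" for u using S(2) by (metis mul_assoc mul_zero(2))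
  have ii: "i' ** (S ** (i ** (i' ** (S ** u)))) = 0" for u
    using arg_cong[OF SS[of u], of "\<lambda>f. i' ** f"] by (simp add: mul_add j0)
  have jj: "j' ** (S ** (i ** (i' ** (S ** u)))) = - (j' ** (S ** (j ** (j' ** (S ** u)))))" for u
    using arg_cong[OF SS[of u], of "\<lambda>f. j' ** f"] by (simp add: mul_add eq_neg_iff_add_eq_0)
  have ac': "D.hacyc I E (- S)" unfolding D.hacyc_def
  proof (intro ballI allI impI)
    fix q k a assume q: "q \<in> I" and a: "a \<in> H k E q" "a ** - S = 0"
    then obtain a' where "a' \<in> H (k - 1) E q" "a = a' ** S" using ac(2)[unfolded D.hacyc_def, rule_format, OF q a(1)] by (auto simp: mul_uminus)
    then show "\<exists>a'\<in>H (k - 1) E q. a = a' ** - S" by (intro bexI[of _ "- a'"]) (simp_all add: mul_uminus H_uminus)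
  qed
  \<comment> \<open>Reversing arrows exchanges the two halves: \<open>j'\<close> and
    \<open>j\<close> take the places of \<open>i\<close> and \<open>i'\<close>. The signs given to
    \<open>i\<close>, \<open>i'\<close> and \<open>S\<close> restore the formulas of the
    claim.\<close>
  have "D.hgood I x (- (j' ** (S ** j))) y (i' ** (S ** i)) (j' ** (S ** i))"
    using D.cut_hgood[where i = j' and s = "- s - 1" and y = x and E = E and i' = j and j = "- i'" and x = y and j' = "- i" and S = "- S" and Q = I]
      i e S ac' by (simp add: mul_uminus mul_assoc add.commute H_uminus)
  moreover have "hgood P y (i' ** (S ** i)) x (- (j' ** (S ** j))) (j' ** (S ** i))" by (rule cut_hgood[OF i e S(1,2) ac(1)])
  moreover have "i' ** (S ** i) \<in> H 1 y y" "j' ** (S ** j) \<in> H 1 x x" "j' ** (S ** i) \<in> H 0 y x"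
    using H_mul[OF H_mul[OF i(1) S(1)] i(2)] H_mul[OF H_mul[OF i(3) S(1)] i(4)] H_mul[OF H_mul[OF i(1) S(1)] i(4)] by simp_all
  ultimately show ?thesis
    using jj[of i] jj[of j] ii[of i] j0 S(2) unfolding cx_def good_def by (simp add: mul_simps H_uminus)
qed

end

context precat
begin

text \<open>\<open>y\<close> and \<open>x\<close> are the two halves of the acyclic complex \<open>E\<close>, cut at \<open>S c\<close>.\<close>

lemma truncation_good:
  assumes E: "E \<in> gobj C" and S: "S \<in> gmap C 1 E E"
    and SS: "\<And>j. Comp C (E j) (E (j + 1)) (E (j + 2)) (S (j + 1)) (S j) = Null C (E j) (E (j + 2))"
    and yE: "\<And>n. n \<le> c \<Longrightarrow> y n = E n" and y0: "\<And>n. c < n \<Longrightarrow> zero_object C (y n)"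
    and xE: "\<And>n. c \<le> n \<Longrightarrow> x n = E (n + 1)" and x0: "\<And>n. n < c \<Longrightarrow> zero_object C (x n)"
    and P: "P \<subseteq> Obj C" "acyc_to P E S" and I: "I \<subseteq> Obj C" "acyc_from I E S"
  shows "\<exists>dy dx e. gr.cx y dy \<and> gr.cx x dx \<and> gr.good {q. \<forall>n. q n \<in> P} {q. \<forall>n. q n \<in> I} y dy x dx e"
proof -
  interpret D: grcat "\<lambda>f g. g * f" "\<lambda>k a b. ghom k b a" gone "\<lambda>n. gpr (- n)" by (rule gr.dual)
  have Eo: "E n \<in> Obj C" for n using E by (simp add: gobj_def)
  have yo: "y n \<in> Obj C" for n using yE[of n] y0[of n] Eo[of n] by (cases "n \<le> c") (auto simp: zero_object_def)
  have xo: "x n \<in> Obj C" for n using xE[of n] x0[of n] Eo[of "n + 1"] by (cases "c \<le> n") (auto simp: zero_object_def)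
  have xE': "x (n - 1) = E n" if "c < n" for n using xE[of "n - 1"] that by simp
  have y: "y \<in> gobj C" and x: "x \<in> gobj C" using yo xo by (auto simp: gobj_def)
  have m1: "n + - 1 = n - 1" "n + 1 + - 1 = n" "n - 1 + 1 = n" for n :: int by simp_all
  \<comment> \<open>Inclusions and projections of the two halves. \<open>j\<close> and
    \<open>j'\<close> have degrees 1 and -1 because \<open>x\<close> is the upper half of
    \<open>E\<close> moved down by one, so that both halves have a component in degree
    \<open>c\<close>.\<close>
  define i where "i n = (if n \<le> c then Ident C (E n) else Null C (y n) (E n))" for n
  define i' where "i' n = (if n \<le> c then Ident C (E n) else Null C (E n) (y n))" for n
  define j where "j n = (if c \<le> n then Ident C (x n) else Null C (x n) (E (n + 1)))" for n
  define j' where "j' n = (if c < n then Ident C (E n) else Null C (E n) (x (n - 1)))" for n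
  have iA: "i n \<in> Arr C (y n) (E n)" "i' n \<in> Arr C (E n) (y n)" "j n \<in> Arr C (x n) (E (n + 1))" "j' n \<in> Arr C (E n) (x (n - 1))" for n
    using Ident_in[OF Eo] Ident_in[OF xo] Null_in[OF yo Eo] Null_in[OF Eo yo] Null_in[OF xo Eo] Null_in[OF Eo xo] yE[of n] xE[of n] xE'[of n]
    by (auto simp: i_def i'_def j_def j'_def)
  have i: "i \<in> gmap C 0 y E" "i' \<in> gmap C 0 E y" "j \<in> gmap C 1 x E" "j' \<in> gmap C (- 1) E x"
    using iA by (simp_all add: gmap_def)
  note nul = Comp_Null_l[OF Eo Eo yo] Comp_Null_l[OF xo Eo yo iA(3)] Comp_Null_l[OF yo Eo xo iA(1)] Comp_Null_l[OF Eo yo Eo iA(2)]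
  have 1: "gcomp C 0 0 y E y i' i = gid C y"
  proof
    fix n show "gcomp C 0 0 y E y i' i n = gid C y n"
      using yE[of n] y0[of n] Ident_l[OF Eo Eo Ident_in[OF Eo]] Comp_Null_l[OF yo Eo yo iA(1)[of n]]
      by (cases "n \<le> c") (auto simp: gcomp_def gid_def i_def i'_def zero_object_def)
  qed
  have 2: "gcomp C 1 (- 1) x E x j' j = gid C x"
  proof
    fix n show "gcomp C 1 (- 1) x E x j' j n = gid C x n"
      using xE[of n] x0[of n] Ident_l[OF Eo Eo Ident_in[OF Eo], of "n + 1"] Comp_Null_l[OF xo Eo xo iA(3)[of n], of n]
      unfolding gcomp_def gid_def m1 by (cases "c \<le> n") (auto simp: j_def j'_def zero_object_def)
  qed
  have 3: "gcomp C 1 0 x E y i' j = gnull C 1 x y"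
  proof
    fix n show "gcomp C 1 0 x E y i' j n = gnull C 1 x y n"
      using Comp_Null_l[OF xo Eo yo iA(3)[of n], of "n + 1"] Comp_Null_r[OF xo Eo yo iA(2), of n "n + 1"]
      by (cases "c \<le> n") (auto simp: gcomp_def gnull_def i'_def j_def)
  qed
  have 4: "gcomp C 0 (- 1) y E x j' i = gnull C (- 1) y x"
  proof
    fix n show "gcomp C 0 (- 1) y E x j' i n = gnull C (- 1) y x n"
      using Comp_Null_l[OF yo Eo xo iA(1)[of n], of "n - 1"] Comp_Null_r[OF yo Eo xo iA(4), of n n]
      by (cases "n \<le> c") (auto simp: gcomp_def gnull_def i_def j'_def)
  qed
  have 5: "gplus C 0 E E (gcomp C 0 0 E y E i i') (gcomp C (- 1) 1 E x E j j') = gid C E"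
  proof
    fix n show "gplus C 0 E E (gcomp C 0 0 E y E i i') (gcomp C (- 1) 1 E x E j j') n = gid C E n"
    proof (cases "n \<le> c")
      case True
      then show ?thesis
        using yE[of n] Ident_l[OF Eo Eo Ident_in[OF Eo], of n] Comp_Null_r[OF Eo xo Eo iA(3), of n "n - 1"] Plus_Null_r[OF Eo Eo Ident_in[OF Eo], of n]
        unfolding gcomp_def gplus_def gid_def m1 by (simp add: i_def i'_def j'_def)
    next
      case False
      then show ?thesis
        using xE'[of n] Ident_l[OF Eo Eo Ident_in[OF Eo], of n] Comp_Null_r[OF Eo yo Eo iA(1), of n n] Plus_Null[OF Eo Eo Ident_in[OF Eo], of n]
        unfolding gcomp_def gplus_def gid_def m1 by (simp add: i'_def j_def j'_def)
    qed
  qed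
  have Sj: "gcomp C 1 1 x E E S j \<in> gmap C (1 + 1) x E" by (rule gcomp_closed[OF x E E i(3) S])
  have 6: "gcomp C (1 + 1) 0 x E y i' (gcomp C 1 1 x E E S j) = gnull C (1 + 1) x y"
  proof
    fix n
    note Sn = gmapD[OF Sj, of n]
    show "gcomp C (1 + 1) 0 x E y i' (gcomp C 1 1 x E E S j) n = gnull C (1 + 1) x y n"
    proof (cases "c \<le> n")
      case True
      then show ?thesis using Comp_Null_l[OF xo Eo yo Sn, of "n + (1 + 1)"] by (simp add: gcomp_def[of C 2 0] gnull_def i'_def)
    next
      case False
      then have "gcomp C 1 1 x E E S j n = Null C (x n) (E (n + (1 + 1)))"
        using Comp_Null_r[OF xo Eo Eo gmapD[OF S], of n "n + 1"] by (simp add: gcomp_def j_def add.assoc)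
      then show ?thesis using Comp_Null_r[OF xo Eo yo iA(2), of n "n + (1 + 1)"] by (simp add: gcomp_def[of C 2 0] gnull_def)
    qed
  qed
  have 7: "gcomp C 1 1 E E E S S = gnull C (1 + 1) E E" using SS by (simp add: gcomp_def gnull_def fun_eq_iff add.assoc)
  let ?i = "gop C 0 y E i" and ?i' = "gop C 0 E y i'" and ?j = "gop C 1 x E j" and ?j' = "gop C (- 1) E x j'" and ?S = "gop C 1 E E S"
  have "gr.hacyc {q. \<forall>n. q n \<in> P} E ?S" unfolding gr.hacyc_def using gr_acyc_to[OF E S P] by blast
  moreover have "D.hacyc {q. \<forall>n. q n \<in> I} E ?S" unfolding D.hacyc_def using gr_acyc_from[OF E S I] by blast
  moreover have "?i' * ?i = gone y" "?j' * ?j = gone x" "?i' * ?j = 0" "?j' * ?i = 0"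
    using gop_gcomp[OF y E y i(1,2)] gop_gcomp[OF x E x i(3,4)] gop_gcomp[OF x E y i(3,2)] gop_gcomp[OF y E x i(1,4)] 1 2 3 4
    by (simp_all add: gone_def x y gop_gnull)
  moreover have "?i * ?i' + ?j * ?j' = gone E"
    using gop_gcomp[OF E y E i(2,1)] gop_gcomp[OF E x E i(4,3)] gop_gplus[OF E E, of "gcomp C 0 0 E y E i i'" 0 "gcomp C (- 1) 1 E x E j j'"]
      gcomp_closed[OF E y E i(2,1)] gcomp_closed[OF E x E i(4,3)] 5 by (simp add: gone_def E)
  moreover have "?i' * (?S * ?j) = 0" "?S * ?S = 0"
    using gop_gcomp[OF x E E i(3) S] gop_gcomp[OF x E y Sj i(2)] gop_gcomp[OF E E E S S] 6 7 gop_gnull[OF x y, of "1 + 1"] gop_gnull[OF E E, of "1 + 1"]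
    by simp_all
  moreover have "?i \<in> ghom 0 y E" "?i' \<in> ghom (- 0) E y" "?j \<in> ghom (0 + 1) x E" "?j' \<in> ghom (- 0 - 1) E x" "?S \<in> ghom 1 E E"
    using gop_ghom[OF y E i(1)] gop_ghom[OF E y i(2)] gop_ghom[OF x E i(3)] gop_ghom[OF E x i(4)] gop_ghom[OF E E S] by simp_all
  ultimately show ?thesis using gr.cut_good[of ?i 0 y E ?i' ?j x ?j' ?S] by blast
qed

section \<open>From objectwise data to graded data\<close>

lemma gr_biprod:
  assumes Q: "Q \<subseteq> Obj C" and bp: "\<And>X Y. \<lbrakk>X \<in> Q; Y \<in> Q\<rbrakk> \<Longrightarrow> \<exists>Z\<in>Q. \<exists>i1 i2 p1 p2. is_biproduct C X Y Z i1 i2 p1 p2"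
    and a: "\<And>n. a n \<in> Q" and b: "\<And>n. b n \<in> Q"
  shows "\<exists>c. (\<forall>n. c n \<in> Q) \<and> (\<exists>i1 i2 p1 p2. gr.biprod a b c i1 i2 p1 p2)"
proof -
  interpret K: krep C "(*)" ghom gone gpr "\<lambda>X. X" "gop C" by (rule krep_self)
  have "\<exists>Z i1 i2 p1 p2. Z \<in> Q \<and> is_biproduct C (a n) (b n) Z i1 i2 p1 p2" for n using bp[OF a b] by blast
  then obtain c i1 i2 p1 p2 where c: "\<And>n. c n \<in> Q" and B: "\<And>n. is_biproduct C (a n) (b n) (c n) (i1 n) (i2 n) (p1 n) (p2 n)"
    by metis
  have g: "a \<in> gobj C" "b \<in> gobj C" "c \<in> gobj C" using a b c Q by (auto simp: gobj_def)
  have i: "i1 \<in> gmap C 0 a c" "i2 \<in> gmap C 0 b c" "p1 \<in> gmap C 0 c a" "p2 \<in> gmap C 0 c b"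
    using B by (auto simp: gmap_def is_biproduct_def)
  show ?thesis using K.biprod_iff[OF g i] B c by blast
qed

lemma gr_split:
  assumes Q: "Q \<subseteq> Obj C" and Z: "Z \<in> Q" "zero_object C Z" and a: "\<And>n. a n \<in> Q"
  shows "\<exists>b c. (\<forall>n. b n \<in> Q) \<and> (\<forall>n. c n \<in> Q) \<and> (\<exists>i1 i2 p1 p2. gr.biprod b c a i1 i2 p1 p2 \<and> i1 * p1 = gpr n a)"
proof -
  interpret K: krep C "(*)" ghom gone gpr "\<lambda>X. X" "gop C" by (rule krep_self)
  define b where "b m = (if m = n then a m else Z)" for m
  define c where "c m = (if m = n then Z else a m)" for m
  define i1 where "i1 m = (if m = n then Ident C (a m) else Null C Z (a m))" for m
  define p1 where "p1 m = (if m = n then Ident C (a m) else Null C (a m) Z)" for m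
  define i2 where "i2 m = (if m = n then Null C Z (a m) else Ident C (a m))" for m
  define p2 where "p2 m = (if m = n then Null C (a m) Z else Ident C (a m))" for m
  have ao: "\<And>m. a m \<in> Obj C" and Zo: "Z \<in> Obj C" using a Q Z by auto
  have bQ: "\<And>m. b m \<in> Q" and cQ: "\<And>m. c m \<in> Q" using a Z by (auto simp: b_def c_def)
  have g: "b \<in> gobj C" "c \<in> gobj C" "a \<in> gobj C" using a bQ cQ Q by (auto simp: gobj_def)
  have i: "i1 \<in> gmap C 0 b a" "i2 \<in> gmap C 0 c a" "p1 \<in> gmap C 0 a b" "p2 \<in> gmap C 0 a c"
    using ao Zo by (auto simp: gmap_def i1_def i2_def p1_def p2_def b_def c_def Ident_in Null_in)
  have iZ: "Ident C Z = Null C Z Z" using Z by (simp add: zero_object_def)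
  have "is_biproduct C (b m) (c m) (a m) (i1 m) (i2 m) (p1 m) (p2 m)" for m
    using ao Zo iZ by (auto simp: is_biproduct_def i1_def i2_def p1_def p2_def b_def c_def Ident_in Null_in Ident_l Ident_r
        Comp_Null_l Comp_Null_r Plus_Null Plus_Null_r)
  then have B: "gr.biprod b c a (gop C 0 b a i1) (gop C 0 c a i2) (gop C 0 a b p1) (gop C 0 a c p2)"
    using K.biprod_iff[OF g i] by blast
  have "gcomp C 0 0 a b a i1 p1 m = gproj C n a m" for m
    using ao Zo by (auto simp: gcomp_def gproj_def i1_def p1_def b_def Ident_in Ident_l Null_in Comp_Null_r)
  then have "gcomp C 0 0 a b a i1 p1 = gproj C n a" by blast
  then have "gop C 0 b a i1 * gop C 0 a b p1 = gpr n a"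
    using gop_gcomp[OF g(3,1,3) i(3,1)] g(3) by (simp add: gpr_def)
  then show ?thesis using B bQ cQ by blast
qed

lemma gone_zero: assumes "\<And>n. zero_object C (x n)" shows "gone x = 0"
proof -
  have x: "x \<in> gobj C" using assms by (simp add: gobj_def zero_object_def)
  have "gid C x = gnull C 0 x x" using assms by (simp add: gid_def gnull_def zero_object_def)
  then show ?thesis using x gop_gnull[OF x x] by (simp add: gone_def)
qed

lemma gpr_zero: assumes "x \<in> gobj C" "zero_object C (x n)" shows "gpr n x = 0"
proof -
  have "gproj C n x = gnull C 0 x x" using assms by (auto simp: gproj_def gnull_def zero_object_def)
  then show ?thesis using assms gop_gnull[of x x 0] by (simp add: gpr_def)
qed

lemma concentrated: assumes x: "x \<in> gobj C" and n: "gone x = gpr n x" and "i \<noteq> n" shows "zero_object C (x i)"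
proof -
  have "gid C x = gproj C n x"
    using gop_inject[OF x x gmap_closed(2,3)[OF x x]] n x by (simp add: gone_def gpr_def)
  then have "gid C x i = gproj C n x i" by simp
  then show ?thesis using \<open>i \<noteq> n\<close> x by (simp add: gid_def gproj_def zero_object_def gobj_def)
qed

lemma concentrated_null: assumes "gone x = gpr n x" "d \<in> ghom 1 x x" shows "d = 0"
proof -
  have "d = d * gpr n x" using gr.one_r[OF assms(2)] assms(1) by simp
  also have "\<dots> = gpr (n + 1) x * (gpr n x * d)" using gr.pr_comm[OF assms(2)] gr.one_l[OF assms(2)] assms(1) by simp
  also have "\<dots> = 0" using gr.pr_pr[of "n + 1" x n] by (simp add: mult.assoc[symmetric])
  finally show ?thesis .
qed

lemma gr_bdd: assumes "x \<in> gobj C" "\<And>n. \<not> (l \<le> n \<and> n \<le> u) \<Longrightarrow> zero_object C (x n)" shows "gr.bdd x"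
proof -
  have "gpr n x = 0" if "n \<notin> {l..u}" for n using gpr_zero[OF assms(1) assms(2)] that by simp
  then have "{n. gpr n x \<noteq> 0} \<subseteq> {l..u}" by blast
  then show ?thesis unfolding gr.bdd_def using finite_subset by blast
qed

text \<open>In \<open>rI\<close> the complex \<open>E\<close> agrees beyond degree \<open>n\<close>
  with \<open>x\<close> moved up by one, and up to \<open>n\<close> it has members of
  \<open>P\<close>; cutting it between the two resolves \<open>x\<close>. \<open>rP\<close> is the
  mirror image. The cut also yields some differential on the resolved object, which
  \<open>concentrated_null\<close> shows to be zero.\<close>

lemma grpair_pointwise:
  assumes P: "P \<subseteq> Obj C" and I: "I \<subseteq> Obj C" and Z: "Z \<in> P" "Z \<in> I" "zero_object C Z"
    and bP: "\<And>X Y. \<lbrakk>X \<in> P; Y \<in> P\<rbrakk> \<Longrightarrow> \<exists>Z\<in>P. \<exists>i1 i2 p1 p2. is_biproduct C X Y Z i1 i2 p1 p2"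
    and bI: "\<And>X Y. \<lbrakk>X \<in> I; Y \<in> I\<rbrakk> \<Longrightarrow> \<exists>Z\<in>I. \<exists>i1 i2 p1 p2. is_biproduct C X Y Z i1 i2 p1 p2"
    and rI: "\<And>x n. \<lbrakk>\<And>i. x i \<in> I; \<And>i. i \<noteq> n \<Longrightarrow> zero_object C (x i)\<rbrakk> \<Longrightarrow>
      \<exists>E S l. E \<in> gobj C \<and> S \<in> gmap C 1 E E \<and>
        (\<forall>j. Comp C (E j) (E (j + 1)) (E (j + 2)) (S (j + 1)) (S j) = Null C (E j) (E (j + 2))) \<and>
        (\<forall>i\<le>n. E i \<in> P) \<and> (\<forall>i\<ge>n. x i = E (i + 1)) \<and> (\<forall>i<l. zero_object C (E i)) \<and> acyc_to P E S \<and> acyc_from I E S"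
    and rP: "\<And>y n. \<lbrakk>\<And>i. y i \<in> P; \<And>i. i \<noteq> n \<Longrightarrow> zero_object C (y i)\<rbrakk> \<Longrightarrow>
      \<exists>E S u. E \<in> gobj C \<and> S \<in> gmap C 1 E E \<and>
        (\<forall>j. Comp C (E j) (E (j + 1)) (E (j + 2)) (S (j + 1)) (S j) = Null C (E j) (E (j + 2))) \<and>
        (\<forall>i\<ge>n. E (i + 1) \<in> I) \<and> (\<forall>i\<le>n. y i = E i) \<and> (\<forall>i>u. zero_object C (E i)) \<and> acyc_to P E S \<and> acyc_from I E S"
  shows "grpair (*) ghom gone gpr {q. \<forall>n. q n \<in> P} {q. \<forall>n. q n \<in> I}"
proof
  let ?P = "{q. \<forall>n::int. q n \<in> P}" and ?I = "{q. \<forall>n::int. q n \<in> I}"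
  show "\<exists>c\<in>?P. \<exists>i1 i2 p1 p2. gr.biprod a b c i1 i2 p1 p2" if "a \<in> ?P" "b \<in> ?P" for a b
    using gr_biprod[OF P bP, of a b] that by blast
  show "\<exists>c\<in>?I. \<exists>i1 i2 p1 p2. gr.biprod a b c i1 i2 p1 p2" if "a \<in> ?I" "b \<in> ?I" for a b
    using gr_biprod[OF I bI, of a b] that by blast
  show "\<exists>b\<in>?P. \<exists>c\<in>?P. \<exists>i1 i2 p1 p2. gr.biprod b c a i1 i2 p1 p2 \<and> i1 * p1 = gpr n a" if "a \<in> ?P" for a n
    using gr_split[OF P Z(1,3), of a n] that by blast
  show "\<exists>b\<in>?I. \<exists>c\<in>?I. \<exists>i1 i2 p1 p2. gr.biprod b c a i1 i2 p1 p2 \<and> i1 * p1 = gpr n a" if "a \<in> ?I" for a n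
    using gr_split[OF I Z(2,3), of a n] that by blast
  show "\<exists>z\<in>?P. gone z = 0" "\<exists>z\<in>?I. gone z = 0" using gone_zero[of "\<lambda>n. Z"] Z by auto
  show "\<exists>y\<in>?P. \<exists>dy e. gr.bdd y \<and> gr.cx y dy \<and> gr.good ?P ?I y dy x 0 e" if x: "x \<in> ?I" and n: "gone x = gpr n x" for x n
  proof -
    have xg: "x \<in> gobj C" using x I by (auto simp: gobj_def)
    have x0: "i \<noteq> n \<Longrightarrow> zero_object C (x i)" for i using concentrated[OF xg n] .
    obtain E S l where E: "E \<in> gobj C" "S \<in> gmap C 1 E E"
        "\<And>j. Comp C (E j) (E (j + 1)) (E (j + 2)) (S (j + 1)) (S j) = Null C (E j) (E (j + 2))"
      and EP: "\<And>i. i \<le> n \<Longrightarrow> E i \<in> P" and Ex: "\<And>i. n \<le> i \<Longrightarrow> x i = E (i + 1)" and l: "\<And>i. i < l \<Longrightarrow> zero_object C (E i)"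
      and ac: "acyc_to P E S" "acyc_from I E S"
      using rI[of x n] x x0 by blast
    define y where "y i = (if i \<le> n then E i else Z)" for i
    have yP: "y \<in> ?P" using EP Z by (simp add: y_def)
    have yg: "y \<in> gobj C" using yP P by (auto simp: gobj_def)
    have "\<exists>dy dx e. gr.cx y dy \<and> gr.cx x dx \<and> gr.good ?P ?I y dy x dx e"
      by (rule truncation_good[OF E _ _ Ex _ P ac(1) I ac(2)]) (use Z x0 in \<open>auto simp: y_def\<close>)
    then obtain dy dx e where "gr.cx y dy" "gr.cx x dx" "gr.good ?P ?I y dy x dx e" by blast
    moreover from this have "dx = 0" using concentrated_null[OF n] by (simp add: gr.cx_def)
    moreover have "gr.bdd y" using l Z by (intro gr_bdd[OF yg, of l n]) (auto simp: y_def)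
    ultimately show ?thesis using yP by blast
  qed
  show "\<exists>x\<in>?I. \<exists>dx e. gr.bdd x \<and> gr.cx x dx \<and> gr.good ?P ?I y 0 x dx e" if y: "y \<in> ?P" and n: "gone y = gpr n y" for y n
  proof -
    have yg: "y \<in> gobj C" using y P by (auto simp: gobj_def)
    have y0: "i \<noteq> n \<Longrightarrow> zero_object C (y i)" for i using concentrated[OF yg n] .
    obtain E S u where E: "E \<in> gobj C" "S \<in> gmap C 1 E E"
        "\<And>j. Comp C (E j) (E (j + 1)) (E (j + 2)) (S (j + 1)) (S j) = Null C (E j) (E (j + 2))"
      and EI: "\<And>i. n \<le> i \<Longrightarrow> E (i + 1) \<in> I" and Ey: "\<And>i. i \<le> n \<Longrightarrow> y i = E i" and u: "\<And>i. u < i \<Longrightarrow> zero_object C (E i)"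
      and ac: "acyc_to P E S" "acyc_from I E S"
      using rP[of y n] y y0 by blast
    define x where "x i = (if n \<le> i then E (i + 1) else Z)" for i
    have xI: "x \<in> ?I" using EI Z by (simp add: x_def)
    have xg: "x \<in> gobj C" using xI I by (auto simp: gobj_def)
    have "\<exists>dy dx e. gr.cx y dy \<and> gr.cx x dx \<and> gr.good ?P ?I y dy x dx e"
      by (rule truncation_good[OF E Ey _ _ _ P ac(1) I ac(2)]) (use Z y0 in \<open>auto simp: x_def\<close>)
    then obtain dy dx e where "gr.cx y dy" "gr.cx x dx" "gr.good ?P ?I y dy x dx e" by blast
    moreover from this have "dy = 0" using concentrated_null[OF n] by (simp add: gr.cx_def)
    moreover have "gr.bdd x" using u Z by (intro gr_bdd[OF xg, of n u]) (auto simp: x_def)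
    ultimately show ?thesis using xI by blast
  qed
qed

end

section \<open>Resolutions in Adelman's category\<close>

locale addcat = ringcat Hm idm
  for Hm :: "'p \<Rightarrow> 'p \<Rightarrow> 'r :: ring set" and idm :: "'p \<Rightarrow> 'r" +
  fixes z :: 'p
  assumes idm_z: "idm z = 0"
    and ex_biprod: "\<exists>S i j p q. i \<in> Hm X S \<and> j \<in> Hm Y S \<and> p \<in> Hm S X \<and> q \<in> Hm S Y \<and>
      p * i = idm X \<and> q * j = idm Y \<and> q * i = 0 \<and> p * j = 0 \<and> i * p + j * q = idm S"
begin

definition rbp where
  "rbp X Y S i j p q \<longleftrightarrow> i \<in> Hm X S \<and> j \<in> Hm Y S \<and> p \<in> Hm S X \<and> q \<in> Hm S Y \<and>
      p * i = idm X \<and> q * j = idm Y \<and> q * i = 0 \<and> p * j = 0 \<and> i * p + j * q = idm S"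

lemma rbp_z: "rbp z z z 0 0 0 0"
  by (simp add: rbp_def Hm_zero idm_z)

lemma rbp_mul:
  assumes "rbp X Y S i j p q"
  shows "p * (i * f) = idm X * f" "q * (j * f) = idm Y * f" "q * (i * f) = 0" "p * (j * f) = 0"
  using assms by (simp_all add: rbp_def mult.assoc[symmetric])

lemma adel_biproduct:
  assumes 1: "rbp X1 Y1 S1 i1 j1 p1 q1" and 0: "rbp X0 Y0 S0 i0 j0 p0 q0" and 2: "rbp X2 Y2 S2 i2 j2 p2 q2"
    and f: "f \<in> Hm X1 X0" and g: "g \<in> Hm X0 X2" and f': "f' \<in> Hm Y1 Y0" and g': "g' \<in> Hm Y0 Y2"
  shows "\<exists>I J P Q. is_biproduct adel (X1, X0, X2, f, g) (Y1, Y0, Y2, f', g')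
    (S1, S0, S2, i0 * f * p1 + j0 * f' * q1, i2 * g * p0 + j2 * g' * q0) I J P Q"
    "(S1, S0, S2, i0 * f * p1 + j0 * f' * q1, i2 * g * p0 + j2 * g' * q0) \<in> Obj adel"
proof -
  let ?a = "(X1, X0, X2, f, g)" and ?b = "(Y1, Y0, Y2, f', g')"
  let ?c = "(S1, S0, S2, i0 * f * p1 + j0 * f' * q1, i2 * g * p0 + j2 * g' * q0)"
  note d1 = 1[unfolded rbp_def] and d0 = 0[unfolded rbp_def] and d2 = 2[unfolded rbp_def]
  note simps = distrib_left distrib_right mult.assoc rbp_mul[OF 1] rbp_mul[OF 0] rbp_mul[OF 2] d1 d0 d2
    Hm_id_l[OF f] Hm_id_r[OF f] Hm_id_l[OF g] Hm_id_r[OF g] Hm_id_l[OF f'] Hm_id_r[OF f'] Hm_id_l[OF g'] Hm_id_r[OF g']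
  have i: "i0 \<in> hom ?a ?c" by (rule homI[where u = i1 and v = i2]) (simp_all add: simps)
  have j: "j0 \<in> hom ?b ?c" by (rule homI[where u = j1 and v = j2]) (simp_all add: simps)
  have p: "p0 \<in> hom ?c ?a" by (rule homI[where u = p1 and v = p2]) (simp_all add: simps flip: mult.assoc)
  have q: "q0 \<in> hom ?c ?b" by (rule homI[where u = q1 and v = q2]) (simp_all add: simps flip: mult.assoc)
  have "is_biproduct adel ?a ?b ?c (coset ?a ?c i0) (coset ?b ?c j0) (coset ?c ?a p0) (coset ?c ?b q0)"
    unfolding is_biproduct_def adel_Comp[OF i p] adel_Comp[OF j q] adel_Comp[OF i q] adel_Comp[OF j p]
      adel_Comp[OF p i] adel_Comp[OF q j] adel_Plus[OF hom_mul[OF i p] hom_mul[OF j q]]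
    by (simp add: adel_Arr adel_Ident adel_Null i j p q d0)
  then show "\<exists>I J P Q. is_biproduct adel ?a ?b ?c I J P Q" by blast
  show "?c \<in> Obj adel" using d1 d0 d2 f g f' g' by (auto simp: adel_def intro!: Hm_add intro: Hm_mul)
qed

text \<open>Projective and injective objects of \<^term>\<open>adel\<close>.\<close>

definition projs where "projs = {(z, p, q, 0, f) | p q f. f \<in> Hm p q}"
definition injs where "injs = {(p, q, z, f, 0) | p q f. f \<in> Hm p q}"

lemma projs_injs_Obj: "projs \<subseteq> Obj adel" "injs \<subseteq> Obj adel"
  by (auto simp: projs_def injs_def adel_def Hm_zero)

lemma biprod_projs:
  assumes "a \<in> projs" "b \<in> projs"
  shows "\<exists>c\<in>projs. \<exists>I J P Q. is_biproduct adel a b c I J P Q"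
proof -
  obtain p q f p' q' f' where a: "a = (z, p, q, 0, f)" "f \<in> Hm p q" and b: "b = (z, p', q', 0, f')" "f' \<in> Hm p' q'"
    using assms by (auto simp: projs_def)
  obtain S0 i0 j0 p0 q0 where 0: "rbp p p' S0 i0 j0 p0 q0" using ex_biprod[of p p'] unfolding rbp_def by blast
  obtain S2 i2 j2 p2 q2 where 2: "rbp q q' S2 i2 j2 p2 q2" using ex_biprod[of q q'] unfolding rbp_def by blast
  have "i2 * f * p0 + j2 * f' * q0 \<in> Hm S0 S2" using 0 2 a(2) b(2) by (auto simp: rbp_def intro!: Hm_add intro: Hm_mul)
  then have "(z, S0, S2, 0, i2 * f * p0 + j2 * f' * q0) \<in> projs" by (auto simp: projs_def)
  then show ?thesis
    using adel_biproduct(1)[OF rbp_z 0 2 Hm_zero a(2) Hm_zero b(2)] a b by (intro bexI) simp_all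
qed

lemma biprod_injs:
  assumes "a \<in> injs" "b \<in> injs"
  shows "\<exists>c\<in>injs. \<exists>I J P Q. is_biproduct adel a b c I J P Q"
proof -
  obtain p q f p' q' f' where a: "a = (p, q, z, f, 0)" "f \<in> Hm p q" and b: "b = (p', q', z, f', 0)" "f' \<in> Hm p' q'"
    using assms by (auto simp: injs_def)
  obtain S1 i1 j1 p1 q1 where 1: "rbp p p' S1 i1 j1 p1 q1" using ex_biprod[of p p'] unfolding rbp_def by blast
  obtain S0 i0 j0 p0 q0 where 0: "rbp q q' S0 i0 j0 p0 q0" using ex_biprod[of q q'] unfolding rbp_def by blast
  have "i0 * f * p1 + j0 * f' * q1 \<in> Hm S1 S0" using 0 1 a(2) b(2) by (auto simp: rbp_def intro!: Hm_add intro: Hm_mul)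
  then have "(S1, S0, z, i0 * f * p1 + j0 * f' * q1, 0) \<in> injs" by (auto simp: injs_def)
  then show ?thesis
    using adel_biproduct(1)[OF 1 0 rbp_z a(2) Hm_zero b(2) Hm_zero] a b by (intro bexI) simp_all
qed

definition zer where "zer = (z, z, z, 0 :: 'r, 0 :: 'r)"

lemma zer: "zer \<in> projs" "zer \<in> injs" "zero_object adel zer"
proof -
  show P: "zer \<in> projs" and "zer \<in> injs" using Hm_zero by (auto simp: projs_def injs_def zer_def)
  show "zero_object adel zer"
    using P projs_injs_Obj unfolding zero_object_def adel_Ident adel_Null by (auto simp: zer_def idm_z)
qed

text \<open>The complex \<open>0 \<rightarrow> (0 \<rightarrow> m \<rightarrow> k) \<rightarrow> (0 \<rightarrow> m \<rightarrow> 0) \<rightarrow> (0 \<rightarrow> k \<rightarrow> 0) \<rightarrow> (m \<rightarrow> k \<rightarrow> 0) \<rightarrow> 0\<close>.\<close>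

definition four where
  "four m k f c j = (if j = c then (z, m, k, 0, f) else if j = c + 1 then (z, m, z, 0, 0)
     else if j = c + 2 then (z, k, z, 0, 0) else if j = c + 3 then (m, k, z, f, 0) else zer)"

lemma zero_nul:
  assumes "zero_object adel b"
  shows "F \<in> hom a b \<Longrightarrow> F \<in> nul a b" "F \<in> hom b a \<Longrightarrow> F \<in> nul b a"
proof -
  have b: "b \<in> Obj adel" and "coset b b (idm (fst (snd b))) = coset b b 0"
    using assms by (auto simp: zero_object_def adel_Ident adel_Null)
  then have n: "idm (fst (snd b)) \<in> nul b b" using coset_eq[OF idm_hom'[OF b] hom_zero] by simp
  show "F \<in> nul a b" if F: "F \<in> hom a b" using nul_mul_r[OF n F] Hm_id_l[OF hom_Hm[OF F]] by simp
  show "F \<in> nul b a" if F: "F \<in> hom b a" using nul_mul_l[OF F n] Hm_id_r[OF hom_Hm[OF F]] by simp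
qed

text \<open>Exactness at each of the four terms, tested by \<open>projs\<close> and
  \<open>injs\<close>. Outside these degrees \<open>E\<close> is only known to consist of zero
  objects: it will be continued by a given family \<open>x\<close> or \<open>y\<close>, whose zero
  objects may differ from \<open>zer\<close>.\<close>

lemma four_term:
  fixes c :: int
  assumes f: "f \<in> Hm m k"
    and E: "E c = (z, m, k, 0, f)" "E (c + 1) = (z, m, z, 0, 0)" "E (c + 2) = (z, k, z, 0, 0)" "E (c + 3) = (m, k, z, f, 0)"
    and E0: "\<And>j. \<not> (c \<le> j \<and> j \<le> c + 3) \<Longrightarrow> zero_object adel (E j)"
  shows "\<exists>S. E \<in> gobj adel \<and> S \<in> gmap adel 1 E E \<and>
        (\<forall>j. Comp adel (E j) (E (j + 1)) (E (j + 2)) (S (j + 1)) (S j) = Null adel (E j) (E (j + 2))) \<and>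
        precat.acyc_to adel projs E S \<and> precat.acyc_from adel injs E S"
proof -
  interpret A: precat adel by (rule precat_adel)
  let ?e0 = "(z, m, k, 0, f)" and ?e1 = "(z, m, z, 0, 0)" and ?e2 = "(z, k, z, 0, 0)" and ?e3 = "(m, k, z, f, 0)"
  \<comment> \<open>The map in the middle is \<open>f\<close>. The outer maps are given by the
    identities of \<open>m\<close> and \<open>k\<close>; on the subquotients they are the inclusion
    of the kernel of \<open>f\<close> and the projection onto its cokernel.\<close>
  define s where "s j = (if j = c then idm m else if j = c + 1 then f else if j = c + 2 then idm k else 0)" for j
  define S where "S j = coset (E j) (E (j + 1)) (s j)" for j
  note ff = Hm_id_l[OF f] Hm_id_r[OF f]
  have e: "c - 1 + 1 = c" "c - 1 + 2 = c + 1" "c + 1 + 1 = c + 2" "c + 1 + 2 = c + 3" "c + 2 + 1 = c + 3" by simp_all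
  have pos: "j + 1 = c \<or> j + 1 = c + 1 \<or> j + 1 = c + 2 \<or> j + 1 = c + 3 \<or> zero_object adel (E (j + 1))" for j
    using E0[of "j + 1"] by linarith
  have Eo: "E j \<in> Obj adel" for j
    using pos[of "j - 1"] by (auto simp: E adel_def Hm_zero f zero_object_def)
  have sh: "s j \<in> hom (E j) (E (j + 1))" for j
  proof -
    have "idm m \<in> hom ?e0 ?e1" "f \<in> hom ?e1 ?e2" "idm k \<in> hom ?e2 ?e3"
      by (rule homI[where u = 0 and v = 0], simp_all add: Hm_id Hm_zero f)+
    note h = this
    consider "j = c" | "j = c + 1" | "j = c + 2" | "s j = 0" unfolding s_def by argo
    then show ?thesis
    proof cases
      case 1 then show ?thesis using h E by (simp add: s_def)
    next
      case 2 show ?thesis unfolding 2 e E using h by (simp add: s_def)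
    next
      case 3 show ?thesis unfolding 3 e E using h by (simp add: s_def)
    qed (simp add: hom_zero)
  qed
  have sh1: "s (j + 1) \<in> hom (E (j + 1)) (E (j + 2))" for j using sh[of "j + 1"] by (simp add: add.assoc)
  have ss: "s (j + 1) * s j \<in> nul (E j) (E (j + 2))" for j
  proof -
    have h: "f \<in> nul ?e0 ?e2"
      by (rule nulI[where K = 0 and L = "idm k"], rule homI[where u = 0 and v = 0]) (simp_all add: f ff Hm_id Hm_zero)
    have h': "f \<in> nul ?e1 ?e3"
      by (rule nulI[where K = "idm m" and L = 0], rule homI[where u = 0 and v = 0]) (simp_all add: f ff Hm_id Hm_zero)
    consider "j = c" | "j = c + 1" | "s (j + 1) * s j = 0" by (cases "j = c \<or> j = c + 1") (auto simp: s_def)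
    then show ?thesis
    proof cases
      case 1 then show ?thesis using h E by (simp add: s_def ff)
    next
      case 2 show ?thesis unfolding 2 e E using h' by (simp add: s_def ff)
    qed (simp add: nul_zero)
  qed
  have to: "\<exists>F'\<in>hom a (E j). F - s j * F' \<in> nul a (E (j + 1))"
    if a: "a \<in> projs" and F: "F \<in> hom a (E (j + 1))" and k: "s (j + 1) * F \<in> nul a (E (j + 2))" for a j F
  proof -
    obtain p r h where a: "a = (z, p, r, 0, h)" "h \<in> Hm p r" using a by (auto simp: projs_def)
    have any: "F \<in> hom a ?e1 \<longleftrightarrow> F \<in> Hm p m" "F \<in> hom a ?e2 \<longleftrightarrow> F \<in> Hm p k" for F
      using Hm_zero unfolding hom_def a by force+
    have trivial: ?thesis if "F \<in> nul a (E (j + 1))" using that hom_zero by (intro bexI[of _ 0]) auto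
    have FH: "F \<in> Hm p (fst (snd (E (j + 1))))" using hom_Hm[OF F] by (simp add: a)
    \<comment> \<open>One case for each position of \<open>E (j + 1)\<close> among the four terms,
      and one where it is a zero object. In the first case nothing can precede it, so
      \<open>F\<close> itself has to be null.\<close>
    consider "j = c - 1" | "j = c" | "j = c + 1" | "j = c + 2" | "zero_object adel (E (j + 1))" using pos[of j] by linarith
    then show ?thesis
    proof cases
      case j: 1
      obtain K L where L: "L \<in> Hm r m" "F = 0 * K + L * h" using k FH Hm_id_l[of F p m] unfolding j e a by (auto simp: E s_def elim: nulE)
      have "F \<in> nul a ?e0" using F unfolding j e a by (intro nulI[OF _ Hm_zero L(1)]) (use L in \<open>auto simp: E\<close>)
      then show ?thesis using trivial unfolding j e by (simp add: E)
    next
      case j: 2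
      obtain K L where L: "L \<in> Hm r k" "f * F = 0 * K + L * h" using k unfolding j e a by (auto simp: E s_def elim: nulE)
      have "F \<in> hom a ?e0" unfolding a by (rule homI[OF _ Hm_zero _ L(1)]) (use L FH[unfolded j e] in \<open>simp_all add: E\<close>)
      then show ?thesis using FH Hm_id_l[of F p m] nul_zero unfolding j e by (intro bexI[of _ F]) (simp_all add: E s_def)
    next
      case j: 3
      \<comment> \<open>A null map into the last term has the form \<open>f * K + L * h\<close>. The
        first summand factors through the middle map, and the second is already null as a map into
        the term before.\<close>
      obtain K L where L: "K \<in> Hm p m" "L \<in> Hm r k" "F = f * K + L * h"
        using k FH Hm_id_l[of F p k] unfolding j e a by (auto simp: E s_def elim: nulE)
      have "F - f * K \<in> hom a ?e2" using L Hm_mul[OF L(2) a(2)] by (simp add: any)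
      then have "F - f * K \<in> nul a ?e2" unfolding a by (rule nulI[OF _ Hm_zero L(2)]) (use L in simp)
      then show ?thesis using any L unfolding j e by (intro bexI[of _ K]) (simp_all add: E s_def)
    next
      case j: 4
      show ?thesis using FH any Hm_id_l[of F p k] nul_zero unfolding j e by (intro bexI[of _ F]) (simp_all add: E s_def)
    next
      case 5
      then show ?thesis using trivial zero_nul(1)[OF _ F] by blast
    qed
  qed
  have fr: "\<exists>F'\<in>hom (E (j + 2)) a. F - F' * s (j + 1) \<in> nul (E (j + 1)) a"
    if a: "a \<in> injs" and F: "F \<in> hom (E (j + 1)) a" and k: "F * s j \<in> nul (E j) a" for a j F
  proof -
    obtain p r h where a: "a = (p, r, z, h, 0)" "h \<in> Hm p r" using a by (auto simp: injs_def)
    have any: "F \<in> hom ?e1 a \<longleftrightarrow> F \<in> Hm m r" "F \<in> hom ?e2 a \<longleftrightarrow> F \<in> Hm k r" for F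
      using Hm_zero unfolding hom_def a by force+
    have trivial: ?thesis if "F \<in> nul (E (j + 1)) a" using that hom_zero by (intro bexI[of _ 0]) auto
    have FH: "F \<in> Hm (fst (snd (E (j + 1)))) r" using hom_Hm[OF F] by (simp add: a)
    consider "j = c - 1" | "j = c" | "j = c + 1" | "j = c + 2" | "zero_object adel (E (j + 1))" using pos[of j] by linarith
    then show ?thesis
    proof cases
      case j: 1
      show ?thesis using FH any Hm_id_r[of F m r] nul_zero unfolding j e by (intro bexI[of _ F]) (simp_all add: E s_def)
    next
      case j: 2
      obtain K L where L: "K \<in> Hm m p" "L \<in> Hm k r" "F = h * K + L * f"
        using k FH Hm_id_r[of F m r] unfolding j e a by (auto simp: E s_def elim: nulE)
      have "F - L * f \<in> hom ?e1 a" using L Hm_mul[OF a(2) L(1)] by (simp add: any)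
      then have "F - L * f \<in> nul ?e1 a" unfolding a by (rule nulI[OF _ L(1) Hm_zero]) (use L in simp)
      then show ?thesis using any L unfolding j e by (intro bexI[of _ L]) (simp_all add: E s_def)
    next
      case j: 3
      obtain K L where L: "K \<in> Hm m p" "F * f = h * K + L * 0" using k unfolding j e a by (auto simp: E s_def elim: nulE)
      have "F \<in> Hm k r" using FH unfolding j e by (simp add: E)
      then have "F \<in> hom ?e3 a" unfolding a by (rule homI[OF _ L(1) _ Hm_zero]) (use L in simp_all)
      then show ?thesis using \<open>F \<in> Hm k r\<close> Hm_id_r[of F k r] nul_zero unfolding j e by (intro bexI[of _ F]) (simp_all add: E s_def)
    next
      case j: 4
      have "F \<in> Hm k r" using FH unfolding j e by (simp add: E)
      then obtain K L where L: "K \<in> Hm k p" "F = h * K + L * 0" using k Hm_id_r[of F k r] unfolding j e a by (auto simp: E s_def elim: nulE)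
      have "F \<in> nul ?e3 a" using F unfolding j e a E by (rule nulI[OF _ L(1) Hm_zero]) (use L in simp)
      then show ?thesis using trivial unfolding j e by (simp add: E)
    next
      case 5
      then show ?thesis using trivial zero_nul(2)[OF _ F] by blast
    qed
  qed
  have "S \<in> gmap adel 1 E E" using sh by (simp add: gmap_def S_def adel_Arr)
  moreover have S1: "S (j + 1) = coset (E (j + 1)) (E (j + 2)) (s (j + 1))" for j by (simp add: S_def add.assoc)
  have "Comp adel (E j) (E (j + 1)) (E (j + 2)) (S (j + 1)) (S j) = Null adel (E j) (E (j + 2))" for j
    unfolding S1 unfolding S_def adel_Comp[OF sh sh1] adel_Null using ss[of j] coset_eq[OF hom_mul[OF sh1 sh] hom_zero, of j] by simp
  moreover have "A.acyc_to projs E S" unfolding A.acyc_to_def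
  proof (intro ballI allI impI)
    fix a j \<alpha> assume a: "a \<in> projs" and "\<alpha> \<in> Arr adel a (E (j + 1))"
      and k: "Comp adel a (E (j + 1)) (E (j + 2)) (S (j + 1)) \<alpha> = Null adel a (E (j + 2))"
    then obtain F where F: "F \<in> hom a (E (j + 1))" "\<alpha> = coset a (E (j + 1)) F" by (auto simp: adel_Arr)
    have "s (j + 1) * F \<in> nul a (E (j + 2))"
      using k adel_Comp[OF F(1) sh1] coset_eq[OF hom_mul[OF sh1 F(1)] hom_zero] by (simp add: S1 F(2) adel_Null)
    from to[OF a F(1) this] obtain F' where F': "F' \<in> hom a (E j)" "F - s j * F' \<in> nul a (E (j + 1))" by blast
    then show "\<exists>\<alpha>'\<in>Arr adel a (E j). \<alpha> = Comp adel a (E j) (E (j + 1)) (S j) \<alpha>'"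
      using adel_Comp[OF F'(1) sh] coset_eq[OF F(1) hom_mul[OF sh F'(1)]] by (auto simp: S_def F(2) adel_Arr)
  qed
  moreover have "A.acyc_from injs E S" unfolding A.acyc_from_def
  proof (intro ballI allI impI)
    fix a j \<alpha> assume a: "a \<in> injs" and "\<alpha> \<in> Arr adel (E (j + 1)) a"
      and k: "Comp adel (E j) (E (j + 1)) a \<alpha> (S j) = Null adel (E j) a"
    then obtain F where F: "F \<in> hom (E (j + 1)) a" "\<alpha> = coset (E (j + 1)) a F" by (auto simp: adel_Arr)
    have "F * s j \<in> nul (E j) a"
      using k adel_Comp[OF sh F(1)] coset_eq[OF hom_mul[OF F(1) sh] hom_zero] by (simp add: S_def F(2) adel_Null)
    from fr[OF a F(1) this] obtain F' where F': "F' \<in> hom (E (j + 2)) a" "F - F' * s (j + 1) \<in> nul (E (j + 1)) a" by blast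
    then show "\<exists>\<alpha>'\<in>Arr adel (E (j + 2)) a. \<alpha> = Comp adel (E (j + 1)) (E (j + 2)) a \<alpha>' (S (j + 1))"
      using adel_Comp[OF sh1 F'(1)] coset_eq[OF F(1) hom_mul[OF F'(1) sh1]] by (auto simp: S1 F(2) adel_Arr)
  qed
  ultimately show ?thesis using Eo by (intro exI[of _ S]) (simp add: gobj_def)
qed

theorem grpair_adel:
  "grpair (*) (precat.ghom adel) (precat.gone adel) (precat.gpr adel) {q. \<forall>n. q n \<in> projs} {q. \<forall>n. q n \<in> injs}"
proof -
  interpret A: precat adel by (rule precat_adel)
  have base: "(z, m, z, 0, 0) \<in> projs" "(z, m, z, 0, 0) \<in> injs" for m using Hm_zero by (auto simp: projs_def injs_def)
  show ?thesis
  proof (rule A.grpair_pointwise[OF projs_injs_Obj zer biprod_projs biprod_injs])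
    fix x :: "int \<Rightarrow> _" and n
    assume x: "\<And>i. x i \<in> injs" and x0: "\<And>i. i \<noteq> n \<Longrightarrow> zero_object adel (x i)"
    obtain m k f where xn: "x n = (m, k, z, f, 0)" and f: "f \<in> Hm m k" using x[of n] by (auto simp: injs_def)
    \<comment> \<open>The four terms begin in degree \<open>n - 2\<close>, so that the last of them,
      in degree \<open>n + 1\<close>, is \<open>x n\<close>.\<close>
    define E where "E i = (if n + 1 \<le> i then x (i - 1) else four m k f (n - 2) i)" for i
    have Ev: "E (n - 2) = (z, m, k, 0, f)" "E (n - 2 + 1) = (z, m, z, 0, 0)" "E (n - 2 + 2) = (z, k, z, 0, 0)" "E (n - 2 + 3) = (m, k, z, f, 0)"
      by (simp_all add: E_def four_def xn)
    have E0: "zero_object adel (E j)" if "\<not> (n - 2 \<le> j \<and> j \<le> n - 2 + 3)" for j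
      using that zer(3) x0 by (auto simp: E_def four_def)
    have EP: "E i \<in> projs" if "i \<le> n" for i using that f zer base unfolding E_def four_def by (auto simp: projs_def)
    obtain S where S: "E \<in> gobj adel" "S \<in> gmap adel 1 E E"
        "\<And>j. Comp adel (E j) (E (j + 1)) (E (j + 2)) (S (j + 1)) (S j) = Null adel (E j) (E (j + 2))"
        "A.acyc_to projs E S" "A.acyc_from injs E S"
      using four_term[where E = E, OF f Ev] E0 by blast
    show "\<exists>E S l. E \<in> gobj adel \<and> S \<in> gmap adel 1 E E \<and>
        (\<forall>j. Comp adel (E j) (E (j + 1)) (E (j + 2)) (S (j + 1)) (S j) = Null adel (E j) (E (j + 2))) \<and>
        (\<forall>i\<le>n. E i \<in> projs) \<and> (\<forall>i\<ge>n. x i = E (i + 1)) \<and> (\<forall>i<l. zero_object adel (E i)) \<and> A.acyc_to projs E S \<and> A.acyc_from injs E S"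
    proof (intro exI conjI)
      show "\<forall>i\<ge>n. x i = E (i + 1)" by (simp add: E_def)
      show "\<forall>i<n - 2. zero_object adel (E i)" using E0 by simp
    qed (use S EP in auto)
  next
    fix y :: "int \<Rightarrow> _" and n
    assume y: "\<And>i. y i \<in> projs" and y0: "\<And>i. i \<noteq> n \<Longrightarrow> zero_object adel (y i)"
    obtain m k f where yn: "y n = (z, m, k, 0, f)" and f: "f \<in> Hm m k" using y[of n] by (auto simp: projs_def)
    define E where "E i = (if i \<le> n then y i else four m k f n i)" for i
    have Ev: "E n = (z, m, k, 0, f)" "E (n + 1) = (z, m, z, 0, 0)" "E (n + 2) = (z, k, z, 0, 0)" "E (n + 3) = (m, k, z, f, 0)"
      by (simp_all add: E_def four_def yn)
    have E0: "zero_object adel (E j)" if "\<not> (n \<le> j \<and> j \<le> n + 3)" for j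
      using that zer(3) y0 by (auto simp: E_def four_def)
    have EI: "E (i + 1) \<in> injs" if "n \<le> i" for i using that f zer base unfolding E_def four_def by (auto simp: injs_def)
    obtain S where S: "E \<in> gobj adel" "S \<in> gmap adel 1 E E"
        "\<And>j. Comp adel (E j) (E (j + 1)) (E (j + 2)) (S (j + 1)) (S j) = Null adel (E j) (E (j + 2))"
        "A.acyc_to projs E S" "A.acyc_from injs E S"
      using four_term[where E = E, OF f Ev] E0 by blast
    show "\<exists>E S u. E \<in> gobj adel \<and> S \<in> gmap adel 1 E E \<and>
        (\<forall>j. Comp adel (E j) (E (j + 1)) (E (j + 2)) (S (j + 1)) (S j) = Null adel (E j) (E (j + 2))) \<and>
        (\<forall>i\<ge>n. E (i + 1) \<in> injs) \<and> (\<forall>i\<le>n. y i = E i) \<and> (\<forall>i>u. zero_object adel (E i)) \<and> A.acyc_to projs E S \<and> A.acyc_from injs E S"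
    proof (intro exI conjI)
      show "\<forall>i\<le>n. y i = E i" by (simp add: E_def)
      show "\<forall>i>n + 3. zero_object adel (E i)" using E0 by simp
    qed (use S EI in auto)
  qed
qed

end

section \<open>Free modules and transposition\<close>

primrec lincomb :: "('a, 'u, 'x) module_scheme \<Rightarrow> (nat \<Rightarrow> 'u) \<Rightarrow> nat \<Rightarrow> (nat \<Rightarrow> 'a) \<Rightarrow> 'u" where
  "lincomb M v 0 x = \<zero>\<^bsub>M\<^esub>"
| "lincomb M v (Suc k) x = lincomb M v k x \<oplus>\<^bsub>M\<^esub> x k \<odot>\<^bsub>M\<^esub> v k"

abbreviation fcar :: "('a, 'r) ring_scheme \<Rightarrow> nat \<Rightarrow> (nat \<Rightarrow> 'a) set" where
  "fcar R n \<equiv> carrier (free_rmod R n)"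

context right_module
begin

lemma smult_zero: "a \<in> carrier R \<Longrightarrow> a \<odot>\<^bsub>M\<^esub> \<zero>\<^bsub>M\<^esub> = \<zero>\<^bsub>M\<^esub>"
  using rsmult_r_distr[of a "\<zero>\<^bsub>M\<^esub>" "\<zero>\<^bsub>M\<^esub>"] rsmult_closed[of a "\<zero>\<^bsub>M\<^esub>"] by simp

lemma zero_smult: "x \<in> carrier M \<Longrightarrow> \<zero> \<odot>\<^bsub>M\<^esub> x = \<zero>\<^bsub>M\<^esub>"
  using rsmult_l_distr[of \<zero> \<zero> x] rsmult_closed[of \<zero> x] by simp

lemma lincomb_closed: "\<lbrakk>\<And>i. i < k \<Longrightarrow> v i \<in> carrier M; \<And>i. i < k \<Longrightarrow> x i \<in> carrier R\<rbrakk> \<Longrightarrow> lincomb M v k x \<in> carrier M"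
  by (induction k) (auto simp: rsmult_closed)

lemma lincomb_add:
  "\<lbrakk>\<And>i. i < k \<Longrightarrow> v i \<in> carrier M; \<And>i. i < k \<Longrightarrow> x i \<in> carrier R; \<And>i. i < k \<Longrightarrow> y i \<in> carrier R;
    \<And>i. i < k \<Longrightarrow> w i = x i \<oplus>\<^bsub>R\<^esub> y i\<rbrakk> \<Longrightarrow> lincomb M v k w = lincomb M v k x \<oplus>\<^bsub>M\<^esub> lincomb M v k y"
proof (induction k)
  case (Suc k)
  have "lincomb M v k x \<in> carrier M" "lincomb M v k y \<in> carrier M" using Suc.prems by (auto intro!: lincomb_closed)
  then show ?case using Suc by (simp add: rsmult_l_distr rsmult_closed M.add.m_ac)
qed simp

lemma lincomb_smult:
  "\<lbrakk>\<And>i. i < k \<Longrightarrow> v i \<in> carrier M; \<And>i. i < k \<Longrightarrow> x i \<in> carrier R; a \<in> carrier R;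
    \<And>i. i < k \<Longrightarrow> w i = x i \<otimes>\<^bsub>R\<^esub> a\<rbrakk> \<Longrightarrow> lincomb M v k w = a \<odot>\<^bsub>M\<^esub> lincomb M v k x"
proof (induction k)
  case (Suc k)
  have "lincomb M v k x \<in> carrier M" using Suc.prems by (auto intro!: lincomb_closed)
  then show ?case using Suc by (simp add: rsmult_r_distr rsmult_closed rsmult_assoc)
qed (simp add: smult_zero)

lemma lincomb_unit:
  "\<lbrakk>\<And>i. i < k \<Longrightarrow> v i \<in> carrier M; \<And>i. i < k \<Longrightarrow> x i = (if i = j then \<one> else \<zero>)\<rbrakk>
    \<Longrightarrow> lincomb M v k x = (if j < k then v j else \<zero>\<^bsub>M\<^esub>)"
proof (induction k)
  case (Suc k)
  then show ?case by (cases "j < k") (auto simp: rsmult_one zero_smult less_Suc_eq)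
qed simp

end

lemma rmod_hom_zero:
  assumes "right_module A M" "right_module A N" "f \<in> rmod_hom A M N"
  shows "f \<zero>\<^bsub>M\<^esub> = \<zero>\<^bsub>N\<^esub>"
proof -
  interpret M: right_module A M by fact
  interpret N: right_module A N by fact
  show ?thesis
    using rmod_homD(3)[OF assms(3) M.M.zero_closed M.M.zero_closed] rmod_homD(1)[OF assms(3) M.M.zero_closed] by simp
qed

lemma rmod_hom_eqI:
  assumes "f \<in> rmod_hom A M N" "g \<in> rmod_hom A M N'" "\<And>x. x \<in> carrier M \<Longrightarrow> f x = g x"
  shows "f = g"
  by (rule extensionalityI[OF rmod_homD(2)[OF assms(1)] rmod_homD(2)[OF assms(2)] assms(3)])

section \<open>The pairing of free modules, and transposition\<close>

definition unit_vec :: "('a, 'r) ring_scheme \<Rightarrow> nat \<Rightarrow> nat \<Rightarrow> nat \<Rightarrow> 'a" where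
  "unit_vec R n j = (\<lambda>i\<in>{..<n}. if i = j then \<one>\<^bsub>R\<^esub> else \<zero>\<^bsub>R\<^esub>)"

text \<open>The sum of the products \<open>y k \<otimes> x k\<close> in this order, hence linear
  over \<open>R\<close> in \<open>x\<close> and over \<open>op_ring R\<close> in \<open>y\<close>.
  This pairing makes the free left and the free right module dual to each other.\<close>

definition dot :: "('a, 'r) ring_scheme \<Rightarrow> nat \<Rightarrow> (nat \<Rightarrow> 'a) \<Rightarrow> (nat \<Rightarrow> 'a) \<Rightarrow> 'a" where
  "dot R n y x = lincomb (regular_rmod R) y n x"

definition transp ::
  "('a, 'r) ring_scheme \<Rightarrow> nat \<Rightarrow> nat \<Rightarrow> ((nat \<Rightarrow> 'a) \<Rightarrow> nat \<Rightarrow> 'a) \<Rightarrow> (nat \<Rightarrow> 'a) \<Rightarrow> nat \<Rightarrow> 'a" where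
  "transp R m n f = (\<lambda>y\<in>fcar R n. \<lambda>j\<in>{..<m}. dot R n y (f (unit_vec R m j)))"

lemma op_ring_simps [simp]:
  "carrier (op_ring A) = carrier A" "\<one>\<^bsub>op_ring A\<^esub> = \<one>\<^bsub>A\<^esub>" "\<zero>\<^bsub>op_ring A\<^esub> = \<zero>\<^bsub>A\<^esub>" "add (op_ring A) = add A"
  "x \<otimes>\<^bsub>op_ring A\<^esub> y = y \<otimes>\<^bsub>A\<^esub> x" "op_ring (op_ring A) = A"
  by (simp_all add: op_ring_def)

lemma carrier_free_op [simp]: "fcar (op_ring A) n = fcar A n"
  by (simp add: free_rmod_def)

lemma unit_vec_op [simp]: "unit_vec (op_ring A) n = unit_vec A n"
  by (simp add: unit_vec_def fun_eq_iff)

context ring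
begin

lemma ring_op: "ring (op_ring R)"
proof (rule ringI)
  show "abelian_group (op_ring R)"
  proof (rule abelian_groupI)
    show "\<exists>y\<in>carrier (op_ring R). y \<oplus>\<^bsub>op_ring R\<^esub> x = \<zero>\<^bsub>op_ring R\<^esub>" if "x \<in> carrier (op_ring R)" for x
      using that l_neg[of x] by (intro bexI[of _ "\<ominus> x"]) auto
  qed (auto simp: add.m_ac)
  show "Group.monoid (op_ring R)" by unfold_locales (auto simp: m_assoc)
qed (auto simp: l_distr r_distr)

lemma right_module_regular: "right_module R (regular_rmod R)"
proof (intro right_module.intro right_module_axioms.intro abelian_groupI)
  show "ring R" by (rule ring_axioms)
  show "\<exists>y\<in>carrier (regular_rmod R). y \<oplus>\<^bsub>regular_rmod R\<^esub> x = \<zero>\<^bsub>regular_rmod R\<^esub>" if "x \<in> carrier (regular_rmod R)" for x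
    using that l_neg[of x] by (intro bexI[of _ "\<ominus> x"]) (auto simp: regular_rmod_def)
qed (auto simp: regular_rmod_def add.m_ac l_distr r_distr m_assoc)

lemma right_module_free: "right_module R (free_rmod R n)"
proof (intro right_module.intro right_module_axioms.intro abelian_groupI)
  show "ring R" by (rule ring_axioms)
  show "\<exists>y\<in>fcar R n. y \<oplus>\<^bsub>free_rmod R n\<^esub> x = \<zero>\<^bsub>free_rmod R n\<^esub>" if "x \<in> fcar R n" for x
    using that by (intro bexI[of _ "\<lambda>i\<in>{..<n}. \<ominus> x i"]) (auto simp: free_rmod_def PiE_iff l_neg fun_eq_iff)
qed (auto simp: free_rmod_def PiE_iff add.m_ac l_distr r_distr m_assoc fun_eq_iff extensional_def)

lemma free_simps:
  "\<lbrakk>x \<in> fcar R n; i < n\<rbrakk> \<Longrightarrow> x i \<in> carrier R"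
  "(\<zero>\<^bsub>free_rmod R n\<^esub>) = (\<lambda>i\<in>{..<n}. \<zero>)"
  "i < n \<Longrightarrow> (x \<oplus>\<^bsub>free_rmod R n\<^esub> y) i = x i \<oplus> y i"
  "i < n \<Longrightarrow> (a \<odot>\<^bsub>free_rmod R n\<^esub> x) i = x i \<otimes> a"
  by (auto simp: free_rmod_def)

lemma free_eqI:
  assumes "x \<in> fcar R n" "y \<in> fcar R n" "\<And>i. i < n \<Longrightarrow> x i = y i"
  shows "x = y"
  by (rule PiE_ext) (use assms in \<open>auto simp: free_rmod_def\<close>)

lemma unit_vec_closed: "unit_vec R n j \<in> fcar R n"
  by (auto simp: free_rmod_def unit_vec_def)

lemma free_lift:
  assumes M: "right_module R M" and v: "\<And>i. i < n \<Longrightarrow> v i \<in> carrier M"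
  obtains \<phi> where "\<phi> \<in> rmod_hom R (free_rmod R n) M" "\<And>j. j < n \<Longrightarrow> \<phi> (unit_vec R n j) = v j"
proof
  interpret M: right_module R M by (rule M)
  interpret F: right_module R "free_rmod R n" by (rule right_module_free)
  let ?\<phi> = "\<lambda>x\<in>fcar R n. lincomb M v n x"
  show "?\<phi> \<in> rmod_hom R (free_rmod R n) M"
  proof (rule rmod_homI)
    fix x assume x: "x \<in> fcar R n"
    show "?\<phi> x \<in> carrier M" using x M.lincomb_closed[OF v free_simps(1)[OF x]] by simp
    show "?\<phi> (x \<oplus>\<^bsub>free_rmod R n\<^esub> y) = ?\<phi> x \<oplus>\<^bsub>M\<^esub> ?\<phi> y" if y: "y \<in> fcar R n" for y
      using x y M.lincomb_add[OF v free_simps(1)[OF x] free_simps(1)[OF y] free_simps(3)] by simp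
    show "?\<phi> (a \<odot>\<^bsub>free_rmod R n\<^esub> x) = a \<odot>\<^bsub>M\<^esub> ?\<phi> x" if a: "a \<in> carrier R" for a
      using x F.rsmult_closed[OF a x] M.lincomb_smult[OF v free_simps(1)[OF x] a free_simps(4)] by simp
  qed simp
  show "?\<phi> (unit_vec R n j) = v j" if "j < n" for j
    using unit_vec_closed that M.lincomb_unit[where k = n and v = v and x = "unit_vec R n j" and j = j] v by (simp add: unit_vec_def)
qed

lemma free_hom_eqI:
  assumes M: "right_module R M" and f: "f \<in> rmod_hom R (free_rmod R n) M" and g: "g \<in> rmod_hom R (free_rmod R n) M"
    and eq: "\<And>j. j < n \<Longrightarrow> f (unit_vec R n j) = g (unit_vec R n j)"
  shows "f = g"
proof -
  interpret F: right_module R "free_rmod R n" by (rule right_module_free)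
  \<comment> \<open>\<open>k\<close> bounds the support of \<open>x\<close>: from index
    \<open>k\<close> on the coordinates vanish. The induction step splits off the coordinate of
    index \<open>k\<close>.\<close>
  have "f x = g x" if "x \<in> fcar R n" "\<And>i. \<lbrakk>k \<le> i; i < n\<rbrakk> \<Longrightarrow> x i = \<zero>" for x k
    using that
  proof (induction k arbitrary: x)
    case 0
    then have "x = \<zero>\<^bsub>free_rmod R n\<^esub>" using F.M.zero_closed by (intro free_eqI) (auto simp: free_simps(2))
    then show ?case using rmod_hom_zero[OF F.right_module_axioms M] f g by metis
  next
    case (Suc k)
    show ?case
    proof (cases "k < n")
      case True
      let ?x = "\<lambda>i\<in>{..<n}. if i = k then \<zero> else x i"
      have x': "?x \<in> fcar R n" using Suc.prems(1) by (auto simp: free_rmod_def PiE_iff)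
      have xk: "x k \<in> carrier R" using free_simps(1)[OF Suc.prems(1) True] .
      note b = F.rsmult_closed[OF xk unit_vec_closed, of k]
      have x: "x = ?x \<oplus>\<^bsub>free_rmod R n\<^esub> x k \<odot>\<^bsub>free_rmod R n\<^esub> unit_vec R n k"
        by (rule free_eqI[OF Suc.prems(1)])
          (use x' b xk free_simps(1)[OF Suc.prems(1)] in \<open>auto simp: free_simps(3,4) unit_vec_def\<close>)
      have "f ?x = g ?x" using Suc.prems(2) by (intro Suc.IH[OF x']) (auto simp: Suc_le_eq)
      then have "f (?x \<oplus>\<^bsub>free_rmod R n\<^esub> x k \<odot>\<^bsub>free_rmod R n\<^esub> unit_vec R n k)
          = g (?x \<oplus>\<^bsub>free_rmod R n\<^esub> x k \<odot>\<^bsub>free_rmod R n\<^esub> unit_vec R n k)"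
        using rmod_homD(3)[OF f x' b] rmod_homD(3)[OF g x' b] rmod_homD(4)[OF f xk unit_vec_closed] rmod_homD(4)[OF g xk unit_vec_closed] eq[OF True]
        by simp
      then show ?thesis using x by simp
    next
      case False
      then show ?thesis using Suc by (metis Suc_leI le_less_trans not_less)
    qed
  qed
  from this[of _ n] show ?thesis by (intro rmod_hom_eqI[OF f g]) simp
qed

lemma dot_closed: "\<lbrakk>y \<in> fcar R n; x \<in> fcar R n\<rbrakk> \<Longrightarrow> dot R n y x \<in> carrier R"
  using right_module.lincomb_closed[OF right_module_regular, of n y x] free_simps(1)
  by (simp add: dot_def regular_rmod_def)

lemma dot_hom:
  assumes y: "y \<in> fcar R n"
  shows "(\<lambda>x\<in>fcar R n. dot R n y x) \<in> rmod_hom R (free_rmod R n) (regular_rmod R)"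
proof -
  interpret M: right_module R "regular_rmod R" by (rule right_module_regular)
  interpret F: right_module R "free_rmod R n" by (rule right_module_free)
  have v: "y i \<in> carrier (regular_rmod R)" if "i < n" for i using free_simps(1)[OF y that] by (simp add: regular_rmod_def)
  show ?thesis unfolding dot_def
  proof (rule rmod_homI)
    let ?\<phi> = "\<lambda>x\<in>fcar R n. lincomb (regular_rmod R) y n x"
    fix x assume x: "x \<in> fcar R n"
    show "?\<phi> x \<in> carrier (regular_rmod R)" using x M.lincomb_closed[OF v free_simps(1)[OF x]] by simp
    show "?\<phi> (x \<oplus>\<^bsub>free_rmod R n\<^esub> x') = ?\<phi> x \<oplus>\<^bsub>regular_rmod R\<^esub> ?\<phi> x'" if x': "x' \<in> fcar R n" for x'
      using x x' M.lincomb_add[OF v free_simps(1)[OF x] free_simps(1)[OF x'] free_simps(3)] by simp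
    show "?\<phi> (a \<odot>\<^bsub>free_rmod R n\<^esub> x) = a \<odot>\<^bsub>regular_rmod R\<^esub> ?\<phi> x" if a: "a \<in> carrier R" for a
      using x F.rsmult_closed[OF a x] M.lincomb_smult[OF v free_simps(1)[OF x] a free_simps(4)] by simp
  qed simp
qed

lemma dot_bas:
  assumes "y \<in> fcar R n" "j < n" shows "dot R n y (unit_vec R n j) = y j"
  using right_module.lincomb_unit[OF right_module_regular, of n y "unit_vec R n j" j] free_simps(1)[OF assms(1)] assms(2)
  by (simp add: dot_def unit_vec_def regular_rmod_def)

end

text \<open>Linearity has to be proved in one argument only; the opposite ring gives it in the
  other.\<close>

lemma dot_op: "dot (op_ring R) n x y = dot R n y x"
  unfolding dot_def by (induction n) (simp_all add: regular_rmod_def)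

context ring
begin

lemma dot_hom_l:
  assumes "x \<in> fcar R n"
  shows "(\<lambda>y\<in>fcar R n. dot R n y x) \<in> rmod_hom (op_ring R) (free_rmod (op_ring R) n) (regular_rmod (op_ring R))"
  using ring.dot_hom[OF ring_op, of x n] assms by (simp add: dot_op)

lemma transp_closed:
  assumes "f \<in> rmod_hom R (free_rmod R m) (free_rmod R n)" "y \<in> fcar R n"
  shows "transp R m n f y \<in> fcar R m"
  using assms dot_closed[OF assms(2)] rmod_homD(1)[OF assms(1) unit_vec_closed] by (auto simp: transp_def free_rmod_def)

text \<open>Adjointness characterises the transpose, by \<open>dot_eqI\<close>. That transposition
  reverses composites and is an involution both follow from it.\<close>

lemma transp_dot:
  assumes f: "f \<in> rmod_hom R (free_rmod R m) (free_rmod R n)" and y: "y \<in> fcar R n" and x: "x \<in> fcar R m"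
  shows "dot R m (transp R m n f y) x = dot R n y (f x)"
proof -
  have "compose (fcar R m) (\<lambda>x\<in>fcar R n. dot R n y x) f
      = (\<lambda>x\<in>fcar R m. dot R m (transp R m n f y) x)"
  proof (rule free_hom_eqI[OF right_module_regular])
    show "compose (fcar R m) (\<lambda>x\<in>fcar R n. dot R n y x) f \<in> rmod_hom R (free_rmod R m) (regular_rmod R)"
      by (rule rmod_hom_compose[OF right_module_free f dot_hom[OF y]])
    show "(\<lambda>x\<in>fcar R m. dot R m (transp R m n f y) x) \<in> rmod_hom R (free_rmod R m) (regular_rmod R)"
      by (rule dot_hom[OF transp_closed[OF f y]])
    fix j assume j: "j < m"
    show "compose (fcar R m) (\<lambda>x\<in>fcar R n. dot R n y x) f (unit_vec R m j) =
       (\<lambda>x\<in>fcar R m. dot R m (transp R m n f y) x) (unit_vec R m j)"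
      using j unit_vec_closed[of m j] rmod_homD(1)[OF f unit_vec_closed] dot_bas[OF transp_closed[OF f y] j] y
      by (simp add: compose_def transp_def)
  qed
  from fun_cong[OF this, of x] show ?thesis using x rmod_homD(1)[OF f x] by (simp add: compose_def)
qed

lemma dot_eqI:
  assumes "y \<in> fcar R n" "y' \<in> fcar R n"
    and "\<And>x. x \<in> fcar R n \<Longrightarrow> dot R n y x = dot R n y' x"
  shows "y = y'"
  using assms(3)[OF unit_vec_closed] dot_bas[OF assms(1)] dot_bas[OF assms(2)] by (intro free_eqI[OF assms(1,2)]) metis

lemma transp_hom:
  assumes f: "f \<in> rmod_hom R (free_rmod R m) (free_rmod R n)"
  shows "transp R m n f \<in> rmod_hom (op_ring R) (free_rmod (op_ring R) n) (free_rmod (op_ring R) m)"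
proof (rule rmod_homI)
  interpret O: ring "op_ring R" by (rule ring_op)
  interpret N: right_module "op_ring R" "free_rmod (op_ring R) n" by (rule O.right_module_free)
  let ?F = "free_rmod (op_ring R) n"
  fix y assume y: "y \<in> carrier ?F"
  have fb: "f (unit_vec R m j) \<in> fcar R n" for j using rmod_homD(1)[OF f unit_vec_closed] .
  show "transp R m n f y \<in> fcar (op_ring R) m" using transp_closed[OF f] y by simp
  show "transp R m n f (y \<oplus>\<^bsub>?F\<^esub> y') = transp R m n f y \<oplus>\<^bsub>free_rmod (op_ring R) m\<^esub> transp R m n f y'" if y': "y' \<in> carrier ?F" for y'
  proof -
    have "dot R n (y \<oplus>\<^bsub>?F\<^esub> y') (f (unit_vec R m j)) = dot R n y (f (unit_vec R m j)) \<oplus> dot R n y' (f (unit_vec R m j))" for j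
      using rmod_homD(3)[OF dot_hom_l[OF fb] y y'] y y' N.M.add.m_closed[OF y y'] by (simp add: regular_rmod_def)
    then show ?thesis using y y' N.M.add.m_closed[OF y y']
      by (simp add: transp_def free_rmod_def fun_eq_iff)
  qed
  show "transp R m n f (a \<odot>\<^bsub>?F\<^esub> y) = a \<odot>\<^bsub>free_rmod (op_ring R) m\<^esub> transp R m n f y" if a: "a \<in> carrier (op_ring R)" for a
  proof -
    have "dot R n (a \<odot>\<^bsub>?F\<^esub> y) (f (unit_vec R m j)) = a \<otimes> dot R n y (f (unit_vec R m j))" for j
      using rmod_homD(4)[OF dot_hom_l[OF fb] a y] y N.rsmult_closed[OF a y] by (simp add: regular_rmod_def)
    then show ?thesis using y N.rsmult_closed[OF a y] by (simp add: transp_def free_rmod_def fun_eq_iff)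
  qed
qed (simp add: transp_def)

lemma transp_comp:
  assumes f: "f \<in> rmod_hom R (free_rmod R l) (free_rmod R m)" and g: "g \<in> rmod_hom R (free_rmod R m) (free_rmod R n)"
  shows "transp R l n (compose (fcar R l) g f) = compose (fcar R n) (transp R l m f) (transp R m n g)"
proof (rule ext)
  fix y
  note gf = rmod_hom_compose[OF right_module_free f g]
  show "transp R l n (compose (fcar R l) g f) y = compose (fcar R n) (transp R l m f) (transp R m n g) y"
  proof (cases "y \<in> fcar R n")
    case True
    show ?thesis
    proof (rule dot_eqI[OF transp_closed[OF gf True]])
      show "compose (fcar R n) (transp R l m f) (transp R m n g) y \<in> fcar R l"
        using True transp_closed[OF f transp_closed[OF g True]] by (simp add: compose_def)
      fix x assume x: "x \<in> fcar R l"
      show "dot R l (transp R l n (compose (fcar R l) g f) y) x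
         = dot R l (compose (fcar R n) (transp R l m f) (transp R m n g) y) x"
        using transp_dot[OF gf True x] transp_dot[OF f transp_closed[OF g True] x] transp_dot[OF g True rmod_homD(1)[OF f x]] True x
        by (simp add: compose_def)
    qed
  qed (simp add: transp_def compose_def)
qed

lemma transp_id: "transp R n n (\<lambda>x\<in>fcar R n. x) = (\<lambda>x\<in>fcar R n. x)"
proof (rule ext)
  fix y show "transp R n n (\<lambda>x\<in>fcar R n. x) y = (\<lambda>x\<in>fcar R n. x) y"
    using dot_bas[of y n] unit_vec_closed[of n] free_eqI[of "\<lambda>j\<in>{..<n}. y j" n y]
    by (auto simp: transp_def free_rmod_def PiE_iff extensional_def fun_eq_iff)
qed

lemma transp_add:
  assumes f: "f \<in> rmod_hom R (free_rmod R m) (free_rmod R n)" and g: "g \<in> rmod_hom R (free_rmod R m) (free_rmod R n)"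
  shows "transp R m n (\<lambda>x\<in>fcar R m. f x \<oplus>\<^bsub>free_rmod R n\<^esub> g x)
    = (\<lambda>y\<in>fcar R n. transp R m n f y \<oplus>\<^bsub>free_rmod R m\<^esub> transp R m n g y)"
proof (rule ext)
  interpret N: right_module R "free_rmod R n" by (rule right_module_free)
  fix y
  have fb: "f (unit_vec R m j) \<in> fcar R n" "g (unit_vec R m j) \<in> fcar R n" for j
    using rmod_homD(1)[OF f unit_vec_closed] rmod_homD(1)[OF g unit_vec_closed] by auto
  have "dot R n y (f (unit_vec R m j) \<oplus>\<^bsub>free_rmod R n\<^esub> g (unit_vec R m j)) = dot R n y (f (unit_vec R m j)) \<oplus> dot R n y (g (unit_vec R m j))"
    if "y \<in> fcar R n" for j
    using rmod_homD(3)[OF dot_hom[OF that] fb] fb N.M.add.m_closed[OF fb] by (simp add: regular_rmod_def)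
  then show "transp R m n (\<lambda>x\<in>fcar R m. f x \<oplus>\<^bsub>free_rmod R n\<^esub> g x) y
    = (\<lambda>y\<in>fcar R n. transp R m n f y \<oplus>\<^bsub>free_rmod R m\<^esub> transp R m n g y) y"
    using unit_vec_closed by (simp add: transp_def free_rmod_def fun_eq_iff)
qed

lemma transp_transp:
  assumes f: "f \<in> rmod_hom R (free_rmod R m) (free_rmod R n)"
  shows "transp (op_ring R) n m (transp R m n f) = f"
proof (rule ext)
  interpret O: ring "op_ring R" by (rule ring_op)
  fix x
  show "transp (op_ring R) n m (transp R m n f) x = f x"
  proof (cases "x \<in> fcar R m")
    case True
    have c: "transp (op_ring R) n m (transp R m n f) x \<in> fcar R n"
      using O.transp_closed[OF transp_hom[OF f]] True by simp
    show ?thesis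
    proof (rule free_eqI[OF c rmod_homD(1)[OF f True]])
      fix i assume i: "i < n"
      note b = unit_vec_closed[of n i]
      have "transp (op_ring R) n m (transp R m n f) x i = dot (op_ring R) n (transp (op_ring R) n m (transp R m n f) x) (unit_vec (op_ring R) n i)"
        using O.dot_bas[of _ n i] c i by simp
      also have "\<dots> = dot R n (unit_vec R n i) (f x)"
        using O.transp_dot[OF transp_hom[OF f], of x "unit_vec R n i"] True b transp_dot[OF f b True] by (simp add: dot_op)
      also have "\<dots> = dot (op_ring R) n (f x) (unit_vec (op_ring R) n i)" by (simp add: dot_op)
      also have "\<dots> = f x i" using O.dot_bas[of "f x" n i] rmod_homD(1)[OF f True] i by simp
      finally show "transp (op_ring R) n m (transp R m n f) x i = f x i" .
    qed
  qed (use rmod_homD(2)[OF f] in \<open>simp add: transp_def extensional_def\<close>)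
qed

end

text \<open>A single arrow as a constant family. Maps between free modules thereby become elements
  of a type of class \<open>ring\<close>, as \<open>ringcat\<close> demands.\<close>

definition em :: "('o, 'm) preadd_cat \<Rightarrow> 'o \<Rightarrow> 'o \<Rightarrow> 'm \<Rightarrow> ('o, 'm) fam endo" where
  "em C X Y f = gop C 0 (\<lambda>_. X) (\<lambda>_. Y) (\<lambda>_. f)"

context precat
begin

lemma em_aux: "X \<in> Obj C \<Longrightarrow> (\<lambda>_. X) \<in> gobj C" "f \<in> Arr C X Y \<Longrightarrow> (\<lambda>_. f) \<in> gmap C 0 (\<lambda>_. X) (\<lambda>_. Y)"
  by (simp_all add: gobj_def gmap_def)

lemma em_inject:
  assumes "X \<in> Obj C" "Y \<in> Obj C" "f \<in> Arr C X Y" "g \<in> Arr C X Y" "em C X Y f = em C X Y g"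
  shows "f = g"
  using gop_inject[OF em_aux(1)[OF assms(1)] em_aux(1)[OF assms(2)] em_aux(2)[OF assms(3)] em_aux(2)[OF assms(4)]] assms(5)
  by (simp add: em_def fun_eq_iff)

lemma em_Comp:
  assumes "X \<in> Obj C" "Y \<in> Obj C" "Z \<in> Obj C" "f \<in> Arr C X Y" "g \<in> Arr C Y Z"
  shows "em C X Z (Comp C X Y Z g f) = em C Y Z g * em C X Y f"
  using gop_gcomp[OF em_aux(1)[OF assms(1)] em_aux(1)[OF assms(2)] em_aux(1)[OF assms(3)] em_aux(2)[OF assms(4)] em_aux(2)[OF assms(5)]]
  by (simp add: em_def gcomp_def)

lemma em_Plus:
  assumes "X \<in> Obj C" "Y \<in> Obj C" "f \<in> Arr C X Y" "g \<in> Arr C X Y"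
  shows "em C X Y (Plus C X Y f g) = em C X Y f + em C X Y g"
  using gop_gplus[OF em_aux(1)[OF assms(1)] em_aux(1)[OF assms(2)] em_aux(2)[OF assms(3)] em_aux(2)[OF assms(4)]]
  by (simp add: em_def gplus_def)

lemma em_Null: "\<lbrakk>X \<in> Obj C; Y \<in> Obj C\<rbrakk> \<Longrightarrow> em C X Y (Null C X Y) = 0"
  using gop_gnull[OF em_aux(1)[of X] em_aux(1)[of Y], of 0] by (simp add: em_def gnull_def)

lemma em_Neg:
  assumes "X \<in> Obj C" "Y \<in> Obj C" "f \<in> Arr C X Y"
  shows "em C X Y (Neg C X Y f) = - em C X Y f"
  using gop_gneg[OF em_aux(1)[OF assms(1)] em_aux(1)[OF assms(2)] em_aux(2)[OF assms(3)]]
  by (simp add: em_def gneg_def)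

end

definition free_cat :: "('a, 'r) ring_scheme \<Rightarrow> (('a, nat \<Rightarrow> 'a) module, (nat \<Rightarrow> 'a) \<Rightarrow> nat \<Rightarrow> 'a) preadd_cat" where
  "free_cat R = rmod_cat R (range (free_rmod R))"

abbreviation fhom where "fhom R m n \<equiv> rmod_hom R (free_rmod R m) (free_rmod R n)"
abbreviation fid where "fid R n \<equiv> (\<lambda>x\<in>fcar R n. x)"
abbreviation fcomp where "fcomp R l g f \<equiv> compose (fcar R l) g f"
abbreviation fplus where "fplus R m n f g \<equiv> (\<lambda>x\<in>fcar R m. f x \<oplus>\<^bsub>free_rmod R n\<^esub> g x)"
abbreviation fnull where "fnull R m n \<equiv> (\<lambda>x\<in>fcar R m. \<zero>\<^bsub>free_rmod R n\<^esub>)"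

definition fem where "fem R m n f = em (free_cat R) (free_rmod R m) (free_rmod R n) f"

definition FH where "FH R m n = fem R m n ` fhom R m n"

definition FI where "FI R n = fem R n n (fid R n)"

context ring
begin

lemma precat_free: "precat (free_cat R)"
  unfolding free_cat_def by (rule precat_rmod_cat) (auto simp: right_module_free)

lemma free_cat_simps:
  "free_rmod R n \<in> Obj (free_cat R)" "Arr (free_cat R) = rmod_hom R"
  "Comp (free_cat R) (free_rmod R l) M N g f = fcomp R l g f"
  "Plus (free_cat R) (free_rmod R m) (free_rmod R n) f g = fplus R m n f g"
  "Null (free_cat R) (free_rmod R m) (free_rmod R n) = fnull R m n"
  "Ident (free_cat R) (free_rmod R n) = fid R n"
  by (simp_all add: free_cat_def)

lemma fhom_closed:
  shows fhom_id: "fid R n \<in> fhom R n n"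
    and fhom_comp: "\<lbrakk>f \<in> fhom R l m; g \<in> fhom R m n\<rbrakk> \<Longrightarrow> fcomp R l g f \<in> fhom R l n"
    and fhom_plus: "\<lbrakk>f \<in> fhom R m n; g \<in> fhom R m n\<rbrakk> \<Longrightarrow> fplus R m n f g \<in> fhom R m n"
    and fhom_null: "fnull R m n \<in> fhom R m n"
  using precat.Ident_in[OF precat_free free_cat_simps(1), of n]
    precat.Comp_in[OF precat_free free_cat_simps(1,1,1), of f l m g n]
    precat.Plus_in[OF precat_free free_cat_simps(1,1), of f m n g]
    precat.Null_in[OF precat_free free_cat_simps(1,1), of m n]
  by (simp_all add: free_cat_simps)

lemma fem_inject: "\<lbrakk>f \<in> fhom R m n; g \<in> fhom R m n; fem R m n f = fem R m n g\<rbrakk> \<Longrightarrow> f = g"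
  using precat.em_inject[OF precat_free free_cat_simps(1,1), of f m n g] by (simp add: free_cat_simps fem_def)

lemma fem_comp: "\<lbrakk>f \<in> fhom R l m; g \<in> fhom R m n\<rbrakk> \<Longrightarrow> fem R l n (fcomp R l g f) = fem R m n g * fem R l m f"
  using precat.em_Comp[OF precat_free free_cat_simps(1,1,1), of f l m g n] by (simp add: free_cat_simps fem_def)

lemma fem_plus: "\<lbrakk>f \<in> fhom R m n; g \<in> fhom R m n\<rbrakk> \<Longrightarrow> fem R m n (fplus R m n f g) = fem R m n f + fem R m n g"
  using precat.em_Plus[OF precat_free free_cat_simps(1,1), of f m n g] by (simp add: free_cat_simps fem_def)

lemma fem_null: "fem R m n (fnull R m n) = 0"
  using precat.em_Null[OF precat_free free_cat_simps(1,1), of m n] by (simp add: free_cat_simps fem_def)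

lemma fem_FH: "f \<in> fhom R m n \<Longrightarrow> fem R m n f \<in> FH R m n"
  by (simp add: FH_def)

lemma ringcat_free: "ringcat (FH R) (FI R)"
proof
  fix l m n and f g :: "(('a, nat \<Rightarrow> 'a) module, (nat \<Rightarrow> 'a) \<Rightarrow> nat \<Rightarrow> 'a) fam endo"
  show "0 \<in> FH R m n" using fem_null fem_FH[OF fhom_null] by metis
  show "f + g \<in> FH R m n" if "f \<in> FH R m n" "g \<in> FH R m n"
    using that unfolding FH_def by (auto simp: fem_plus[symmetric] fhom_plus)
  show "- f \<in> FH R m n" if f: "f \<in> FH R m n"
  proof -
    obtain u where u: "u \<in> fhom R m n" "f = fem R m n u" using f by (auto simp: FH_def)
    show ?thesis
      using precat.em_Neg[OF precat_free free_cat_simps(1,1), of u m n] precat.Neg_in[OF precat_free free_cat_simps(1,1), of u m n] u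
        fem_FH[of "Neg (free_cat R) (free_rmod R m) (free_rmod R n) u" m n]
      by (simp add: free_cat_simps fem_def)
  qed
  show "g * f \<in> FH R l n" if "g \<in> FH R m n" "f \<in> FH R l m"
    using that unfolding FH_def by (auto simp: fem_comp[symmetric] fhom_comp)
  show "FI R n \<in> FH R n n" by (simp add: FI_def fem_FH fhom_id)
  show "FI R n * f = f" if f: "f \<in> FH R m n"
  proof -
    obtain u where u: "u \<in> fhom R m n" "f = fem R m n u" using f by (auto simp: FH_def)
    show ?thesis using fem_comp[OF u(1) fhom_id] u precat.Ident_l[OF precat_free free_cat_simps(1,1), of u m n]
      by (simp add: FI_def free_cat_simps)
  qed
  show "f * FI R m = f" if f: "f \<in> FH R m n"
  proof -
    obtain u where u: "u \<in> fhom R m n" "f = fem R m n u" using f by (auto simp: FH_def)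
    show ?thesis using fem_comp[OF fhom_id u(1)] u precat.Ident_r[OF precat_free free_cat_simps(1,1), of u m n]
      by (simp add: FI_def free_cat_simps)
  qed
qed

lemma free_biproduct:
  "\<exists>i\<in>fhom R m (m + n). \<exists>j\<in>fhom R n (m + n). \<exists>p\<in>fhom R (m + n) m. \<exists>q\<in>fhom R (m + n) n.
    fcomp R m p i = fid R m \<and> fcomp R n q j = fid R n \<and> fcomp R m q i = fnull R m n \<and> fcomp R n p j = fnull R n m \<and>
    fplus R (m + n) (m + n) (fcomp R (m + n) i p) (fcomp R (m + n) j q) = fid R (m + n)"
proof -
  define i where "i = (\<lambda>x\<in>fcar R m. \<lambda>k\<in>{..<m + n}. if k < m then x k else \<zero>)"
  define j where "j = (\<lambda>x\<in>fcar R n. \<lambda>k\<in>{..<m + n}. if k < m then \<zero> else x (k - m))"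
  define p where "p = (\<lambda>x\<in>fcar R (m + n). \<lambda>k\<in>{..<m}. x k)"
  define q where "q = (\<lambda>x\<in>fcar R (m + n). \<lambda>k\<in>{..<n}. x (m + k))"
  interpret M: right_module R "free_rmod R m" by (rule right_module_free)
  interpret N: right_module R "free_rmod R n" by (rule right_module_free)
  interpret MN: right_module R "free_rmod R (m + n)" by (rule right_module_free)
  have ic: "x \<in> fcar R m \<Longrightarrow> i x \<in> fcar R (m + n)" for x
    by (auto simp: i_def free_rmod_def PiE_iff)
  have jc: "x \<in> fcar R n \<Longrightarrow> j x \<in> fcar R (m + n)" for x
    by (auto simp: j_def free_rmod_def PiE_iff)
  have pc: "x \<in> fcar R (m + n) \<Longrightarrow> p x \<in> fcar R m" for x
    by (auto simp: p_def free_rmod_def PiE_iff)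
  have qc: "x \<in> fcar R (m + n) \<Longrightarrow> q x \<in> fcar R n" for x
    by (auto simp: q_def free_rmod_def PiE_iff)
  have i: "i \<in> fhom R m (m + n)"
  proof (rule rmod_homI[OF ic])
    show "i \<in> extensional (fcar R m)" by (simp add: i_def)
  qed (auto simp: i_def free_rmod_def PiE_iff fun_eq_iff)
  have j: "j \<in> fhom R n (m + n)"
  proof (rule rmod_homI[OF jc])
    show "j \<in> extensional (fcar R n)" by (simp add: j_def)
  qed (auto simp: j_def free_rmod_def PiE_iff fun_eq_iff)
  have p: "p \<in> fhom R (m + n) m"
  proof (rule rmod_homI[OF pc])
    show "p \<in> extensional (fcar R (m + n))" by (simp add: p_def)
  qed (auto simp: p_def free_rmod_def PiE_iff fun_eq_iff)
  have q: "q \<in> fhom R (m + n) n"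
  proof (rule rmod_homI[OF qc])
    show "q \<in> extensional (fcar R (m + n))" by (simp add: q_def)
  qed (auto simp: q_def free_rmod_def PiE_iff fun_eq_iff)
  have pi: "p (i x) = x" if x: "x \<in> fcar R m" for x
    by (rule free_eqI[OF pc[OF ic[OF x]] x]) (use x ic[OF x] in \<open>auto simp: i_def p_def\<close>)
  have qj: "q (j x) = x" if x: "x \<in> fcar R n" for x
    by (rule free_eqI[OF qc[OF jc[OF x]] x]) (use x jc[OF x] in \<open>auto simp: j_def q_def\<close>)
  have "fcomp R m p i = fid R m"
    by (rule rmod_hom_eqI[OF fhom_comp[OF i p] fhom_id])
      (use pi in \<open>simp add: compose_def\<close>)
  moreover have "fcomp R n q j = fid R n"
    by (rule rmod_hom_eqI[OF fhom_comp[OF j q] fhom_id])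
      (use qj in \<open>simp add: compose_def\<close>)
  moreover have "fcomp R m q i = fnull R m n"
    by (rule rmod_hom_eqI[OF fhom_comp[OF i q] fhom_null])
      (use ic in \<open>auto simp: compose_def i_def q_def free_simps(2)\<close>)
  moreover have "fcomp R n p j = fnull R n m"
    by (rule rmod_hom_eqI[OF fhom_comp[OF j p] fhom_null])
      (use jc in \<open>auto simp: compose_def j_def p_def free_simps(2)\<close>)
  moreover have "fplus R (m + n) (m + n) (fcomp R (m + n) i p) (fcomp R (m + n) j q) = fid R (m + n)"
  proof (rule rmod_hom_eqI[OF fhom_plus[OF fhom_comp[OF p i] fhom_comp[OF q j]] fhom_id])
    fix x assume x: "x \<in> fcar R (m + n)"
    have "i (p x) \<oplus>\<^bsub>free_rmod R (m + n)\<^esub> j (q x) = x"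
    proof (rule free_eqI[OF MN.M.add.m_closed[OF ic[OF pc[OF x]] jc[OF qc[OF x]]] x])
      fix k assume k: "k < m + n"
      then show "(i (p x) \<oplus>\<^bsub>free_rmod R (m + n)\<^esub> j (q x)) k = x k"
        using free_simps(1)[OF x k] pc[OF x] qc[OF x] x by (auto simp: free_simps(3) i_def j_def) (auto simp: p_def q_def)
    qed
    then show "fplus R (m + n) (m + n) (fcomp R (m + n) i p) (fcomp R (m + n) j q) x = fid R (m + n) x"
      using x by (simp add: compose_def)
  qed
  ultimately show ?thesis using i j p q by blast
qed

lemma addcat_free: "addcat (FH R) (FI R) 0"
proof (intro addcat.intro addcat_axioms.intro)
  show "ringcat (FH R) (FI R)" by (rule ringcat_free)
  have "fid R 0 = fnull R 0 0"
    by (rule rmod_hom_eqI[OF fhom_id fhom_null]) (auto simp: free_rmod_def)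
  then show "FI R 0 = 0" using fem_null[of 0 0] by (simp add: FI_def)
  fix m n
  obtain i j p q where h: "i \<in> fhom R m (m + n)" "j \<in> fhom R n (m + n)" "p \<in> fhom R (m + n) m" "q \<in> fhom R (m + n) n"
    and e: "fcomp R m p i = fid R m" "fcomp R n q j = fid R n" "fcomp R m q i = fnull R m n" "fcomp R n p j = fnull R n m"
      "fplus R (m + n) (m + n) (fcomp R (m + n) i p) (fcomp R (m + n) j q) = fid R (m + n)"
    using free_biproduct[of m n] by blast
  let ?S = "m + n"
  show "\<exists>S i j p q. i \<in> FH R m S \<and> j \<in> FH R n S \<and> p \<in> FH R S m \<and> q \<in> FH R S n \<and>
      p * i = FI R m \<and> q * j = FI R n \<and> q * i = 0 \<and> p * j = 0 \<and> i * p + j * q = FI R S"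
    using fem_FH[OF h(1)] fem_FH[OF h(2)] fem_FH[OF h(3)] fem_FH[OF h(4)] fem_comp[OF h(1,3)] fem_comp[OF h(2,4)] fem_comp[OF h(1,4)] fem_comp[OF h(2,3)]
      fem_comp[OF h(3,1)] fem_comp[OF h(4,2)] fem_plus[OF fhom_comp[OF h(3,1)] fhom_comp[OF h(4,2)]]
    unfolding e FI_def fem_null
    by (intro exI[of _ ?S] exI[of _ "fem R m ?S i"] exI[of _ "fem R n ?S j"] exI[of _ "fem R ?S m p"] exI[of _ "fem R ?S n q"]) simp
qed

end

section \<open>Presentations\<close>

definition is_pres :: "('a, 'r) ring_scheme \<Rightarrow> ('a, 'u, 'x) module_scheme \<Rightarrow>
    nat \<times> nat \<times> ((nat \<Rightarrow> 'a) \<Rightarrow> nat \<Rightarrow> 'a) \<Rightarrow> ((nat \<Rightarrow> 'a) \<Rightarrow> 'u) \<Rightarrow> bool" where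
  "is_pres R M = (\<lambda>(m, n, f) p. right_module R M \<and> f \<in> fhom R m n \<and> p \<in> rmod_hom R (free_rmod R n) M \<and>
     f ` fcar R m = {x \<in> fcar R n. p x = \<zero>\<^bsub>M\<^esub>} \<and>
     p ` fcar R n = carrier M)"

lemma is_presD:
  assumes "is_pres R M (m, n, f) p"
  shows "right_module R M" "f \<in> fhom R m n" "p \<in> rmod_hom R (free_rmod R n) M"
    and "w \<in> fcar R m \<Longrightarrow> p (f w) = \<zero>\<^bsub>M\<^esub>"
    and "\<lbrakk>x \<in> fcar R n; p x = \<zero>\<^bsub>M\<^esub>\<rbrakk> \<Longrightarrow> \<exists>w\<in>fcar R m. x = f w"
    and "y \<in> carrier M \<Longrightarrow> \<exists>x\<in>fcar R n. y = p x"
proof -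
  have P: "right_module R M \<and> f \<in> fhom R m n \<and> p \<in> rmod_hom R (free_rmod R n) M \<and>
     f ` fcar R m = {x \<in> fcar R n. p x = \<zero>\<^bsub>M\<^esub>} \<and>
     p ` fcar R n = carrier M" using assms by (simp add: is_pres_def)
  then show "right_module R M" "f \<in> fhom R m n" "p \<in> rmod_hom R (free_rmod R n) M" by blast+
  show "p (f w) = \<zero>\<^bsub>M\<^esub>" if "w \<in> fcar R m" using P that by blast
  show "\<exists>w\<in>fcar R m. x = f w" if "x \<in> fcar R n" "p x = \<zero>\<^bsub>M\<^esub>" using P that by blast
  show "\<exists>x\<in>fcar R n. y = p x" if "y \<in> carrier M" using P that by blast
qed

lemma fin_pres_is_pres: "fin_pres_rmod R M \<longleftrightarrow> (\<exists>Q p. is_pres R M Q p)"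
  by (auto simp: fin_pres_rmod_def is_pres_def)

text \<open>Maps of generators that extend to maps of presentations. The map \<open>u\<close> of
  relations is not recorded, since the induced map of cokernels depends on \<open>F\<close>
  alone.\<close>

definition lifts :: "('a, 'r) ring_scheme \<Rightarrow> nat \<times> nat \<times> ((nat \<Rightarrow> 'a) \<Rightarrow> nat \<Rightarrow> 'a) \<Rightarrow>
    nat \<times> nat \<times> ((nat \<Rightarrow> 'a) \<Rightarrow> nat \<Rightarrow> 'a) \<Rightarrow> ((nat \<Rightarrow> 'a) \<Rightarrow> nat \<Rightarrow> 'a) set" where
  "lifts R = (\<lambda>(m, n, f) (m', n', f'). {F \<in> fhom R n n'. \<exists>u\<in>fhom R m m'. fcomp R m F f = fcomp R m f' u})"

lemma lifts_iff:
  "F \<in> lifts R (m, n, f) (m', n', f') \<longleftrightarrow> F \<in> fhom R n n' \<and> (\<exists>u\<in>fhom R m m'. fcomp R m F f = fcomp R m f' u)"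
  by (simp add: lifts_def)

context ring
begin

lemma pres_factor:
  assumes Q: "is_pres R M (m, n, f) p" and G: "G \<in> fhom R k n" and 0: "\<And>x. x \<in> fcar R k \<Longrightarrow> p (G x) = \<zero>\<^bsub>M\<^esub>"
  shows "\<exists>u\<in>fhom R k m. G = fcomp R k f u"
proof -
  note q = is_presD[OF Q]
  have "\<exists>w. w \<in> fcar R m \<and> G (unit_vec R k j) = f w" for j
    using q(5)[OF rmod_homD(1)[OF G unit_vec_closed] 0[OF unit_vec_closed]] by blast
  then obtain v where v: "\<And>j. v j \<in> fcar R m" "\<And>j. G (unit_vec R k j) = f (v j)" by metis
  obtain u where u: "u \<in> fhom R k m" "\<And>j. j < k \<Longrightarrow> u (unit_vec R k j) = v j"
    using free_lift[OF right_module_free, of k v m] v(1) by metis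
  have "G = fcomp R k f u"
    by (rule free_hom_eqI[OF right_module_free G fhom_comp[OF u(1) q(2)]]) (use u v unit_vec_closed in \<open>simp add: compose_def\<close>)
  then show ?thesis using u by blast
qed

lemma pres_lift:
  assumes Q: "is_pres R M (m, n, f) p" and Q': "is_pres R M' (m', n', f') p'" and \<phi>: "\<phi> \<in> rmod_hom R M M'"
  shows "\<exists>F\<in>lifts R (m, n, f) (m', n', f'). \<forall>x\<in>fcar R n. p' (F x) = \<phi> (p x)"
proof -
  note q = is_presD[OF Q] and q' = is_presD[OF Q']
  have "\<exists>w. w \<in> fcar R n' \<and> \<phi> (p (unit_vec R n j)) = p' w" for j
    using q'(6)[OF rmod_homD(1)[OF \<phi> rmod_homD(1)[OF q(3) unit_vec_closed]]] by blast
  then obtain v where v: "\<And>j. v j \<in> fcar R n'" "\<And>j. \<phi> (p (unit_vec R n j)) = p' (v j)" by metis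
  obtain F where F: "F \<in> fhom R n n'" "\<And>j. j < n \<Longrightarrow> F (unit_vec R n j) = v j"
    using free_lift[OF right_module_free, of n v n'] v(1) by metis
  have c: "fcomp R n \<phi> p = fcomp R n p' F"
    by (rule free_hom_eqI[OF q'(1) rmod_hom_compose[OF right_module_free q(3) \<phi>] rmod_hom_compose[OF right_module_free F(1) q'(3)]])
      (use F v unit_vec_closed in \<open>simp add: compose_def\<close>)
  have e: "p' (F x) = \<phi> (p x)" if "x \<in> fcar R n" for x
    using fun_cong[OF c, of x] that by (simp add: compose_def)
  have "p' (fcomp R m F f x) = \<zero>\<^bsub>M'\<^esub>" if x: "x \<in> fcar R m" for x
    using x e[OF rmod_homD(1)[OF q(2) x]] q(4)[OF x] rmod_hom_zero[OF q(1) q'(1) \<phi>] by (simp add: compose_def)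
  then have "\<exists>u\<in>fhom R m m'. fcomp R m F f = fcomp R m f' u" using pres_factor[OF Q' fhom_comp[OF q(2) F(1)]] by blast
  then have "F \<in> lifts R (m, n, f) (m', n', f')" using F(1) lifts_iff by blast
  then show ?thesis using e by blast
qed

text \<open>The universal property of the cokernel. If \<open>p x = p y\<close>, then
  \<open>x\<close> and \<open>y\<close> differ by an element of the image of \<open>f\<close>, on
  which \<open>g\<close> vanishes.\<close>

lemma pres_desc:
  assumes Q: "is_pres R M (m, n, f) p" and N: "right_module R N" and g: "g \<in> rmod_hom R (free_rmod R n) N"
    and 0: "\<And>w. w \<in> fcar R m \<Longrightarrow> g (f w) = \<zero>\<^bsub>N\<^esub>"
  shows "\<exists>\<phi>\<in>rmod_hom R M N. \<forall>x\<in>fcar R n. g x = \<phi> (p x)"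
proof -
  note q = is_presD[OF Q]
  interpret M: right_module R M by (rule q(1))
  interpret N: right_module R N by (rule N)
  interpret F: right_module R "free_rmod R n" by (rule right_module_free)
  note gc = rmod_homD(1)[OF g] and pc = rmod_homD(1)[OF q(3)]
  have wd: "g x = g y" if x: "x \<in> fcar R n" and y: "y \<in> fcar R n" and e: "p x = p y" for x y
  proof -
    let ?d = "x \<oplus>\<^bsub>free_rmod R n\<^esub> (\<ominus>\<^bsub>free_rmod R n\<^esub> y)"
    have d: "?d \<in> fcar R n" and dy: "?d \<oplus>\<^bsub>free_rmod R n\<^esub> y = x"
      using x y by (simp_all add: F.M.a_assoc F.M.l_neg)
    have "p ?d \<oplus>\<^bsub>M\<^esub> p y = p y" using rmod_homD(3)[OF q(3) d y] dy e by simp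
    then have "p ?d = \<zero>\<^bsub>M\<^esub>" using M.M.add.r_cancel_one'[OF pc[OF y] pc[OF d]] M.M.add.r_cancel_one[OF pc[OF y] pc[OF d]] by metis
    then have "g ?d = \<zero>\<^bsub>N\<^esub>" using q(5)[OF d] 0 by metis
    then show ?thesis using rmod_homD(3)[OF g d y] dy gc[OF y] by simp
  qed
  have "\<forall>y\<in>carrier M. \<exists>x. x \<in> fcar R n \<and> y = p x" using q(6) by blast
  then obtain s where s: "\<And>y. y \<in> carrier M \<Longrightarrow> s y \<in> fcar R n" "\<And>y. y \<in> carrier M \<Longrightarrow> y = p (s y)" by metis
  let ?\<phi> = "\<lambda>y\<in>carrier M. g (s y)"
  have gs: "g (s (p x)) = g x" if "x \<in> fcar R n" for x
    using wd[OF s(1) that] s(2) pc[OF that] by metis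
  have "?\<phi> \<in> rmod_hom R M N"
  proof (rule rmod_homI)
    fix y assume y: "y \<in> carrier M"
    show "?\<phi> y \<in> carrier N" using y s gc by simp
    show "?\<phi> (y \<oplus>\<^bsub>M\<^esub> z) = ?\<phi> y \<oplus>\<^bsub>N\<^esub> ?\<phi> z" if z: "z \<in> carrier M" for z
    proof -
      have "y \<oplus>\<^bsub>M\<^esub> z = p (s y \<oplus>\<^bsub>free_rmod R n\<^esub> s z)" using rmod_homD(3)[OF q(3) s(1)[OF y] s(1)[OF z]] s(2)[OF y] s(2)[OF z] by simp
      then show ?thesis using gs[OF F.M.add.m_closed[OF s(1)[OF y] s(1)[OF z]]] rmod_homD(3)[OF g s(1)[OF y] s(1)[OF z]] y z M.M.add.m_closed[OF y z] by simp
    qed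
    show "?\<phi> (a \<odot>\<^bsub>M\<^esub> y) = a \<odot>\<^bsub>N\<^esub> ?\<phi> y" if a: "a \<in> carrier R" for a
    proof -
      have "a \<odot>\<^bsub>M\<^esub> y = p (a \<odot>\<^bsub>free_rmod R n\<^esub> s y)" using rmod_homD(4)[OF q(3) a s(1)[OF y]] s(2)[OF y] by simp
      then show ?thesis using gs[OF F.rsmult_closed[OF a s(1)[OF y]]] rmod_homD(4)[OF g a s(1)[OF y]] y M.rsmult_closed[OF a y] by simp
    qed
  qed simp
  moreover have "g x = ?\<phi> (p x)" if "x \<in> fcar R n" for x using gs[OF that] pc[OF that] by simp
  ultimately show ?thesis by blast
qed

lemma pres_uniq:
  assumes Q: "is_pres R M (m, n, f) p" and \<phi>: "\<phi> \<in> rmod_hom R M N" "\<psi> \<in> rmod_hom R M N"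
    and e: "\<And>x. x \<in> fcar R n \<Longrightarrow> \<phi> (p x) = \<psi> (p x)"
  shows "\<phi> = \<psi>"
  by (rule rmod_hom_eqI[OF \<phi>]) (use is_presD(6)[OF Q] e in metis)

lemma lifts_desc:
  assumes Q: "is_pres R M (m, n, f) p" and Q': "is_pres R M' (m', n', f') p'" and F: "F \<in> lifts R (m, n, f) (m', n', f')"
  shows "\<exists>\<phi>\<in>rmod_hom R M M'. \<forall>x\<in>fcar R n. p' (F x) = \<phi> (p x)"
proof -
  note q = is_presD[OF Q] and q' = is_presD[OF Q']
  obtain u where Fh: "F \<in> fhom R n n'" and u: "u \<in> fhom R m m'" "fcomp R m F f = fcomp R m f' u" using F lifts_iff by blast
  have "fcomp R n p' F (f w) = \<zero>\<^bsub>M'\<^esub>" if w: "w \<in> fcar R m" for w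
    using fun_cong[OF u(2), of w] q'(4)[OF rmod_homD(1)[OF u(1) w]] w rmod_homD(1)[OF q(2) w] by (simp add: compose_def)
  from pres_desc[OF Q q'(1) rmod_hom_compose[OF right_module_free Fh q'(3)] this]
  show ?thesis by (auto simp: compose_def)
qed

text \<open>The congruence under which two lifts induce the same map into the cokernel of
  \<open>f\<close>. It is stated as a sum because \<open>fplus\<close> is the operation on module
  maps; negatives enter the proof through \<open>Neg\<close> of \<open>free_cat\<close>.\<close>

lemma fplus_factor:
  assumes Q: "is_pres R M (m, n, f) p" and F: "F \<in> fhom R k n" "G \<in> fhom R k n"
  shows "(\<exists>K\<in>fhom R k m. F = fplus R k n G (fcomp R k f K)) \<longleftrightarrow> (\<forall>x\<in>fcar R k. p (F x) = p (G x))"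
proof
  note q = is_presD[OF Q]
  interpret M: right_module R M by (rule q(1))
  interpret N: right_module R "free_rmod R n" by (rule right_module_free)
  note pc = rmod_homD(1)[OF q(3)]
  {
    assume "\<exists>K\<in>fhom R k m. F = fplus R k n G (fcomp R k f K)"
    then obtain K where K: "K \<in> fhom R k m" "F = fplus R k n G (fcomp R k f K)" by blast
    show "\<forall>x\<in>fcar R k. p (F x) = p (G x)"
    proof
      fix x assume x: "x \<in> fcar R k"
      note Kx = rmod_homD(1)[OF K(1) x]
      show "p (F x) = p (G x)" unfolding K(2)
        using x rmod_homD(3)[OF q(3) rmod_homD(1)[OF F(2) x] rmod_homD(1)[OF q(2) Kx]] q(4)[OF Kx] pc[OF rmod_homD(1)[OF F(2) x]]
        by (simp add: compose_def)
    qed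
  }
  assume e: "\<forall>x\<in>fcar R k. p (F x) = p (G x)"
  let ?N = "Neg (free_cat R) (free_rmod R k) (free_rmod R n) G"
  have N: "?N \<in> fhom R k n" "fplus R k n G ?N = fnull R k n"
    using precat.Neg_in[OF precat_free free_cat_simps(1,1), of G k n] precat.Plus_Neg[OF precat_free free_cat_simps(1,1), of G k n] F(2)
    by (simp_all add: free_cat_simps)
  let ?D = "fplus R k n ?N F"
  have D: "?D \<in> fhom R k n" by (rule fhom_plus[OF N(1) F(1)])
  have GN: "G x \<oplus>\<^bsub>free_rmod R n\<^esub> ?N x = \<zero>\<^bsub>free_rmod R n\<^esub>" if "x \<in> fcar R k" for x
    using fun_cong[OF N(2), of x] that by simp
  have GD: "G x \<oplus>\<^bsub>free_rmod R n\<^esub> ?D x = F x" if x: "x \<in> fcar R k" for x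
    using GN[OF x] x rmod_homD(1)[OF N(1) x] rmod_homD(1)[OF F(1) x] rmod_homD(1)[OF F(2) x]
    by (simp add: N.M.a_assoc[symmetric])
  have "p (?D x) = \<zero>\<^bsub>M\<^esub>" if x: "x \<in> fcar R k" for x
  proof -
    note c = rmod_homD(1)[OF D x] rmod_homD(1)[OF F(2) x]
    have "p (G x) \<oplus>\<^bsub>M\<^esub> p (?D x) = p (G x)" using rmod_homD(3)[OF q(3) c(2,1)] GD[OF x] e x by simp
    then show ?thesis using M.M.add.l_cancel_one[OF pc[OF c(2)] pc[OF c(1)]] by simp
  qed
  from pres_factor[OF Q D this] obtain K where K: "K \<in> fhom R k m" "?D = fcomp R k f K" by blast
  have "F = fplus R k n G (fcomp R k f K)"
  proof (rule rmod_hom_eqI[OF F(1) fhom_plus[OF F(2) fhom_comp[OF K(1) q(2)]]])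
    fix x assume x: "x \<in> fcar R k"
    show "F x = fplus R k n G (fcomp R k f K) x" using fun_cong[OF K(2), of x] GD[OF x] x by simp
  qed
  then show "\<exists>K\<in>fhom R k m. F = fplus R k n G (fcomp R k f K)" using K(1) by (intro bexI)
qed

end

text \<open>A module map has many lifts to presentations, so a functor is best given by the relation
  between a map and the arrows that its lifts define. Totality is \<open>ex\<close>, fullness is
  \<open>surj\<close>, and \<open>eq\<close> is single-valuedness and faithfulness together.\<close>

lemma functor_of_relation:
  assumes ob: "\<And>X. X \<in> Obj C \<Longrightarrow> ob X \<in> Obj G"
    and ex: "\<And>X Y \<phi>. \<lbrakk>X \<in> Obj C; Y \<in> Obj C; \<phi> \<in> Arr C X Y\<rbrakk> \<Longrightarrow> \<exists>a. T X Y \<phi> a"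
    and dom: "\<And>X Y \<phi> a. \<lbrakk>X \<in> Obj C; Y \<in> Obj C; T X Y \<phi> a\<rbrakk> \<Longrightarrow> \<phi> \<in> Arr C X Y \<and> a \<in> Arr G (ob X) (ob Y)"
    and eq: "\<And>X Y \<phi> a \<psi> b. \<lbrakk>X \<in> Obj C; Y \<in> Obj C; T X Y \<phi> a; T X Y \<psi> b\<rbrakk> \<Longrightarrow> a = b \<longleftrightarrow> \<phi> = \<psi>"
    and surj: "\<And>X Y a. \<lbrakk>X \<in> Obj C; Y \<in> Obj C; a \<in> Arr G (ob X) (ob Y)\<rbrakk> \<Longrightarrow> \<exists>\<phi>. T X Y \<phi> a"
    and id: "\<And>X. X \<in> Obj C \<Longrightarrow> T X X (Ident C X) (Ident G (ob X))"
    and comp: "\<And>X Y Z \<phi> a \<psi> b. \<lbrakk>X \<in> Obj C; Y \<in> Obj C; Z \<in> Obj C; T X Y \<phi> a; T Y Z \<psi> b\<rbrakk> \<Longrightarrow>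
      T X Z (Comp C X Y Z \<psi> \<phi>) (Comp G (ob X) (ob Y) (ob Z) b a)"
    and plus: "\<And>X Y \<phi> a \<psi> b. \<lbrakk>X \<in> Obj C; Y \<in> Obj C; T X Y \<phi> a; T X Y \<psi> b\<rbrakk> \<Longrightarrow>
      T X Y (Plus C X Y \<phi> \<psi>) (Plus G (ob X) (ob Y) a b)"
  shows "\<exists>F. FObj F = ob \<and> additive_functor C G F \<and>
    (\<forall>X\<in>Obj C. \<forall>Y\<in>Obj C. bij_betw (FArr F X Y) (Arr C X Y) (Arr G (ob X) (ob Y)))"
proof -
  define F where "F = \<lparr>FObj = ob, FArr = (\<lambda>X Y \<phi>. SOME a. T X Y \<phi> a)\<rparr>"
  have FO: "FObj F = ob" by (simp add: F_def)
  have TF: "T X Y \<phi> (FArr F X Y \<phi>)" if "X \<in> Obj C" "Y \<in> Obj C" "\<phi> \<in> Arr C X Y" for X Y \<phi>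
    using someI_ex[OF ex[OF that]] by (simp add: F_def)
  have TE: "a = FArr F X Y \<phi>" if "X \<in> Obj C" "Y \<in> Obj C" "T X Y \<phi> a" for X Y \<phi> a
    using eq[OF that TF[OF that(1,2)]] dom[OF that] by simp
  have "additive_functor C G F"
    unfolding additive_functor_def is_functor_def FO
  proof (intro conjI ballI)
    fix X assume X: "X \<in> Obj C"
    show "ob X \<in> Obj G" using ob X .
    show "FArr F X X (Ident C X) = Ident G (ob X)" using TE[OF X X id[OF X]] by simp
    fix Y \<phi> assume Y: "Y \<in> Obj C" and \<phi>: "\<phi> \<in> Arr C X Y"
    show "FArr F X Y \<phi> \<in> Arr G (ob X) (ob Y)" using dom[OF X Y TF[OF X Y \<phi>]] by blast
    show "FArr F X Y (Plus C X Y \<phi> \<psi>) = Plus G (ob X) (ob Y) (FArr F X Y \<phi>) (FArr F X Y \<psi>)" if "\<psi> \<in> Arr C X Y" for \<psi>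
      using TE[OF X Y plus[OF X Y TF[OF X Y \<phi>] TF[OF X Y that]]] by simp
    show "FArr F X Z (Comp C X Y Z \<psi> \<phi>) = Comp G (ob X) (ob Y) (ob Z) (FArr F Y Z \<psi>) (FArr F X Y \<phi>)"
      if Z: "Z \<in> Obj C" and "\<psi> \<in> Arr C Y Z" for Z \<psi>
      using TE[OF X Z comp[OF X Y Z TF[OF X Y \<phi>] TF[OF Y that]]] by simp
  qed
  moreover have "bij_betw (FArr F X Y) (Arr C X Y) (Arr G (ob X) (ob Y))" if X: "X \<in> Obj C" and Y: "Y \<in> Obj C" for X Y
  proof (rule bij_betwI')
    show "FArr F X Y \<phi> = FArr F X Y \<psi> \<longleftrightarrow> \<phi> = \<psi>" if "\<phi> \<in> Arr C X Y" "\<psi> \<in> Arr C X Y" for \<phi> \<psi>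
      using eq[OF X Y TF[OF X Y that(1)] TF[OF X Y that(2)]] .
    show "FArr F X Y \<phi> \<in> Arr G (ob X) (ob Y)" if "\<phi> \<in> Arr C X Y" for \<phi>
      using dom[OF X Y TF[OF X Y that]] by blast
    show "\<exists>\<phi>\<in>Arr C X Y. a = FArr F X Y \<phi>" if a: "a \<in> Arr G (ob X) (ob Y)" for a
      using surj[OF X Y a] dom[OF X Y] TE[OF X Y] by blast
  qed
  ultimately show ?thesis using FO by blast
qed

text \<open>What \<open>G\<close> must offer to contain the finitely presented modules through their
  presentations: its arrows are lifts modulo the congruence of \<open>fplus_factor\<close>.
  Adelman's category and its opposite are the two instances.\<close>

locale pres_embedding = ring R for R :: "('a, 'r) ring_scheme" (structure) +
  fixes G :: "('g, 'h) preadd_cat"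
    and ob :: "nat \<times> nat \<times> ((nat \<Rightarrow> 'a) \<Rightarrow> nat \<Rightarrow> 'a) \<Rightarrow> 'g"
    and ar :: "nat \<times> nat \<times> ((nat \<Rightarrow> 'a) \<Rightarrow> nat \<Rightarrow> 'a) \<Rightarrow> nat \<times> nat \<times> ((nat \<Rightarrow> 'a) \<Rightarrow> nat \<Rightarrow> 'a) \<Rightarrow> ((nat \<Rightarrow> 'a) \<Rightarrow> nat \<Rightarrow> 'a) \<Rightarrow> 'h"
  assumes ob_Obj: "f \<in> fhom R m n \<Longrightarrow> ob (m, n, f) \<in> Obj G"
    and ar_image: "\<lbrakk>f \<in> fhom R m n; f' \<in> fhom R m' n'\<rbrakk> \<Longrightarrow>
      Arr G (ob (m, n, f)) (ob (m', n', f')) = ar (m, n, f) (m', n', f') ` lifts R (m, n, f) (m', n', f')"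
    and ar_eq: "\<lbrakk>f \<in> fhom R m n; f' \<in> fhom R m' n'; F \<in> lifts R (m, n, f) (m', n', f'); F' \<in> lifts R (m, n, f) (m', n', f')\<rbrakk> \<Longrightarrow>
      ar (m, n, f) (m', n', f') F = ar (m, n, f) (m', n', f') F' \<longleftrightarrow> (\<exists>K\<in>fhom R n m'. F = fplus R n n' F' (fcomp R n f' K))"
    and ar_id: "f \<in> fhom R m n \<Longrightarrow> ar (m, n, f) (m, n, f) (fid R n) = Ident G (ob (m, n, f))"
    and ar_comp: "\<lbrakk>f \<in> fhom R m n; f' \<in> fhom R m' n'; f'' \<in> fhom R m'' n'';
        F \<in> lifts R (m, n, f) (m', n', f'); F' \<in> lifts R (m', n', f') (m'', n'', f'')\<rbrakk> \<Longrightarrow>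
      ar (m, n, f) (m'', n'', f'') (fcomp R n F' F) =
        Comp G (ob (m, n, f)) (ob (m', n', f')) (ob (m'', n'', f'')) (ar (m', n', f') (m'', n'', f'') F') (ar (m, n, f) (m', n', f') F)"
    and ar_plus: "\<lbrakk>f \<in> fhom R m n; f' \<in> fhom R m' n'; F \<in> lifts R (m, n, f) (m', n', f'); F' \<in> lifts R (m, n, f) (m', n', f')\<rbrakk> \<Longrightarrow>
      ar (m, n, f) (m', n', f') (fplus R n n' F F') =
        Plus G (ob (m, n, f)) (ob (m', n', f')) (ar (m, n, f) (m', n', f') F) (ar (m, n, f) (m', n', f') F')"
begin

definition rl :: "('a, 'u) module \<times> (nat \<times> nat \<times> ((nat \<Rightarrow> 'a) \<Rightarrow> nat \<Rightarrow> 'a)) \<times> ((nat \<Rightarrow> 'a) \<Rightarrow> 'u) \<Rightarrow>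
    ('a, 'u) module \<times> (nat \<times> nat \<times> ((nat \<Rightarrow> 'a) \<Rightarrow> nat \<Rightarrow> 'a)) \<times> ((nat \<Rightarrow> 'a) \<Rightarrow> 'u) \<Rightarrow> ('u \<Rightarrow> 'u) \<Rightarrow> 'h \<Rightarrow> bool" where
  "rl = (\<lambda>(M, Q, p) (M', Q', p') \<phi> a. \<phi> \<in> rmod_hom R M M' \<and>
     (\<exists>F\<in>lifts R Q Q'. (\<forall>x\<in>carrier (free_rmod R (fst (snd Q))). p' (F x) = \<phi> (p x)) \<and> a = ar Q Q' F))"

lemma rlI:
  "\<lbrakk>\<phi> \<in> rmod_hom R M M'; F \<in> lifts R (m, n, f) (m', n', f'); \<And>x. x \<in> fcar R n \<Longrightarrow> p' (F x) = \<phi> (p x);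
    a = ar (m, n, f) (m', n', f') F\<rbrakk> \<Longrightarrow> rl (M, (m, n, f), p) (M', (m', n', f'), p') \<phi> a"
  unfolding rl_def by auto

lemma rlE:
  assumes "rl (M, (m, n, f), p) (M', (m', n', f'), p') \<phi> a"
  obtains F where "\<phi> \<in> rmod_hom R M M'" "F \<in> lifts R (m, n, f) (m', n', f')"
    "\<forall>x\<in>fcar R n. p' (F x) = \<phi> (p x)" "a = ar (m, n, f) (m', n', f') F"
  using assms unfolding rl_def by auto

context
  fixes M :: "('a, 'u) module" and m n f p
  assumes Q: "is_pres R M (m, n, f) p"
begin

lemma rl_id: "rl (M, (m, n, f), p) (M, (m, n, f), p) (\<lambda>x\<in>carrier M. x) (Ident G (ob (m, n, f)))"
proof (rule rlI[OF _ _ _ ar_id[symmetric]])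
  note q = is_presD[OF Q]
  interpret M: right_module R M by (rule q(1))
  show "(\<lambda>x\<in>carrier M. x) \<in> rmod_hom R M M" by (rule rmod_homI) (auto simp: M.rsmult_closed)
  have "fcomp R m (fid R n) f = fcomp R m f (fid R m)"
    using rmod_homD(1)[OF q(2)] by (auto simp: compose_def)
  then show "fid R n \<in> lifts R (m, n, f) (m, n, f)" using fhom_id by (auto simp: lifts_iff)
  show "p (fid R n x) = (\<lambda>x\<in>carrier M. x) (p x)" if "x \<in> fcar R n" for x
    using that rmod_homD(1)[OF q(3) that] by simp
  show "f \<in> fhom R m n" by (rule q(2))
qed

context
  fixes M' :: "('a, 'u) module" and m' n' f' p'
  assumes Q': "is_pres R M' (m', n', f') p'"
begin

lemma rl_ex: "\<phi> \<in> rmod_hom R M M' \<Longrightarrow> \<exists>a. rl (M, (m, n, f), p) (M', (m', n', f'), p') \<phi> a"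
  by (rule bexE[OF pres_lift[OF Q Q']], assumption, rule exI, rule rlI) (auto intro: refl)

lemma rl_dom:
  assumes "rl (M, (m, n, f), p) (M', (m', n', f'), p') \<phi> a"
  shows "\<phi> \<in> rmod_hom R M M'" "a \<in> Arr G (ob (m, n, f)) (ob (m', n', f'))"
proof -
  obtain F where F: "\<phi> \<in> rmod_hom R M M'" "F \<in> lifts R (m, n, f) (m', n', f')"
    "\<forall>x\<in>fcar R n. p' (F x) = \<phi> (p x)" "a = ar (m, n, f) (m', n', f') F" using rlE[OF assms] .
  show "\<phi> \<in> rmod_hom R M M'" by (rule F(1))
  show "a \<in> Arr G (ob (m, n, f)) (ob (m', n', f'))"
    unfolding F(4) ar_image[OF is_presD(2)[OF Q] is_presD(2)[OF Q']] using F(2) by (rule imageI)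
qed

lemma rl_eq:
  assumes a: "rl (M, (m, n, f), p) (M', (m', n', f'), p') \<phi> a" and b: "rl (M, (m, n, f), p) (M', (m', n', f'), p') \<psi> b"
  shows "a = b \<longleftrightarrow> \<phi> = \<psi>"
proof -
  obtain F where F: "\<phi> \<in> rmod_hom R M M'" "F \<in> lifts R (m, n, f) (m', n', f')"
    "\<forall>x\<in>fcar R n. p' (F x) = \<phi> (p x)" "a = ar (m, n, f) (m', n', f') F" using rlE[OF a] .
  obtain F' where F': "\<psi> \<in> rmod_hom R M M'" "F' \<in> lifts R (m, n, f) (m', n', f')"
    "\<forall>x\<in>fcar R n. p' (F' x) = \<psi> (p x)" "b = ar (m, n, f) (m', n', f') F'" using rlE[OF b] .
  have h: "F \<in> fhom R n n'" "F' \<in> fhom R n n'" using F(2) F'(2) by (simp_all add: lifts_iff)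
  have "a = b \<longleftrightarrow> (\<exists>K\<in>fhom R n m'. F = fplus R n n' F' (fcomp R n f' K))"
    unfolding F(4) F'(4) by (rule ar_eq[OF is_presD(2)[OF Q] is_presD(2)[OF Q'] F(2) F'(2)])
  also have "\<dots> \<longleftrightarrow> (\<forall>x\<in>fcar R n. p' (F x) = p' (F' x))"
    by (rule fplus_factor[OF Q' h])
  also have "\<dots> \<longleftrightarrow> \<phi> = \<psi>" using pres_uniq[OF Q F(1) F'(1)] F(3) F'(3) by auto
  finally show ?thesis .
qed

lemma rl_surj: assumes "a \<in> Arr G (ob (m, n, f)) (ob (m', n', f'))"
  shows "\<exists>\<phi>. rl (M, (m, n, f), p) (M', (m', n', f'), p') \<phi> a"
proof -
  obtain F where F: "F \<in> lifts R (m, n, f) (m', n', f')" "a = ar (m, n, f) (m', n', f') F"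
    using assms ar_image[OF is_presD(2)[OF Q] is_presD(2)[OF Q']] by blast
  obtain \<phi> where \<phi>: "\<phi> \<in> rmod_hom R M M'" "\<forall>x\<in>fcar R n. p' (F x) = \<phi> (p x)"
    using lifts_desc[OF Q Q' F(1)] by (rule bexE)
  show ?thesis by (rule exI, rule rlI[OF \<phi>(1) F(1) _ F(2)]) (rule bspec[OF \<phi>(2)])
qed

lemma rl_plus:
  assumes a: "rl (M, (m, n, f), p) (M', (m', n', f'), p') \<phi> a" and b: "rl (M, (m, n, f), p) (M', (m', n', f'), p') \<psi> b"
  shows "rl (M, (m, n, f), p) (M', (m', n', f'), p') (\<lambda>x\<in>carrier M. \<phi> x \<oplus>\<^bsub>M'\<^esub> \<psi> x) (Plus G (ob (m, n, f)) (ob (m', n', f')) a b)"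
proof -
  note q = is_presD[OF Q] and q' = is_presD[OF Q']
  interpret M: right_module R M by (rule q(1))
  interpret M': right_module R M' by (rule q'(1))
  interpret N': right_module R "free_rmod R n'" by (rule right_module_free)
  obtain F where F: "\<phi> \<in> rmod_hom R M M'" "F \<in> lifts R (m, n, f) (m', n', f')"
    "\<forall>x\<in>fcar R n. p' (F x) = \<phi> (p x)" "a = ar (m, n, f) (m', n', f') F" using rlE[OF a] .
  obtain F' where F': "\<psi> \<in> rmod_hom R M M'" "F' \<in> lifts R (m, n, f) (m', n', f')"
    "\<forall>x\<in>fcar R n. p' (F' x) = \<psi> (p x)" "b = ar (m, n, f) (m', n', f') F'" using rlE[OF b] .
  obtain u u' where h: "F \<in> fhom R n n'" "F' \<in> fhom R n n'" and u: "u \<in> fhom R m m'" "fcomp R m F f = fcomp R m f' u"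
    and u': "u' \<in> fhom R m m'" "fcomp R m F' f = fcomp R m f' u'" using F(2) F'(2) by (auto simp: lifts_iff)
  show ?thesis
  proof (rule rlI)
    show "(\<lambda>x\<in>carrier M. \<phi> x \<oplus>\<^bsub>M'\<^esub> \<psi> x) \<in> rmod_hom R M M'"
    proof -
      have "precat (rmod_cat R {M, M'})" by (rule precat_rmod_cat) (use q(1) q'(1) in auto)
      from precat.Plus_in[OF this, of M M' \<phi> \<psi>] show ?thesis using F(1) F'(1) by simp
    qed
    have "fcomp R m (fplus R n n' F F') f = fcomp R m f' (fplus R m m' u u')"
    proof (rule rmod_hom_eqI[OF fhom_comp[OF q(2) fhom_plus[OF h]] fhom_comp[OF fhom_plus[OF u(1) u'(1)] q'(2)]])
      fix x assume x: "x \<in> fcar R m"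
      show "fcomp R m (fplus R n n' F F') f x = fcomp R m f' (fplus R m m' u u') x"
        using fun_cong[OF u(2), of x] fun_cong[OF u'(2), of x] x rmod_homD(1)[OF q(2) x]
          rmod_homD(3)[OF q'(2) rmod_homD(1)[OF u(1) x] rmod_homD(1)[OF u'(1) x]] by (simp add: compose_def)
    qed
    then show "fplus R n n' F F' \<in> lifts R (m, n, f) (m', n', f')"
      using fhom_plus[OF h] fhom_plus[OF u(1) u'(1)] lifts_iff by blast
    show "p' (fplus R n n' F F' x) = (\<lambda>x\<in>carrier M. \<phi> x \<oplus>\<^bsub>M'\<^esub> \<psi> x) (p x)" if x: "x \<in> fcar R n" for x
      using x rmod_homD(1)[OF q(3) x] rmod_homD(3)[OF q'(3) rmod_homD(1)[OF h(1) x] rmod_homD(1)[OF h(2) x]] bspec[OF F(3) x] bspec[OF F'(3) x] by simp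
    show "Plus G (ob (m, n, f)) (ob (m', n', f')) a b = ar (m, n, f) (m', n', f') (fplus R n n' F F')"
      unfolding F(4) F'(4) using ar_plus[OF q(2) q'(2) F(2) F'(2)] by simp
  qed
qed

lemma rl_comp:
  fixes M'' :: "('a, 'u) module"
  assumes Q'': "is_pres R M'' (m'', n'', f'') p''"
    and a: "rl (M, (m, n, f), p) (M', (m', n', f'), p') \<phi> a" and b: "rl (M', (m', n', f'), p') (M'', (m'', n'', f''), p'') \<psi> b"
  shows "rl (M, (m, n, f), p) (M'', (m'', n'', f''), p'') (compose (carrier M) \<psi> \<phi>) (Comp G (ob (m, n, f)) (ob (m', n', f')) (ob (m'', n'', f'')) b a)"
proof -
  note q = is_presD[OF Q] and q' = is_presD[OF Q'] and q'' = is_presD[OF Q'']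
  obtain F where F: "\<phi> \<in> rmod_hom R M M'" "F \<in> lifts R (m, n, f) (m', n', f')"
    "\<forall>x\<in>fcar R n. p' (F x) = \<phi> (p x)" "a = ar (m, n, f) (m', n', f') F" using rlE[OF a] .
  obtain F' where F': "\<psi> \<in> rmod_hom R M' M''" "F' \<in> lifts R (m', n', f') (m'', n'', f'')"
    "\<forall>x\<in>fcar R n'. p'' (F' x) = \<psi> (p' x)" "b = ar (m', n', f') (m'', n'', f'') F'" using rlE[OF b] .
  obtain u u' where h: "F \<in> fhom R n n'" "F' \<in> fhom R n' n''" and u: "u \<in> fhom R m m'" "fcomp R m F f = fcomp R m f' u"
    and u': "u' \<in> fhom R m' m''" "fcomp R m' F' f' = fcomp R m' f'' u'" using F(2) F'(2) by (auto simp: lifts_iff)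
  show ?thesis
  proof (rule rlI)
    show "compose (carrier M) \<psi> \<phi> \<in> rmod_hom R M M''" by (rule rmod_hom_compose[OF q(1) F(1) F'(1)])
    have "fcomp R m (fcomp R n F' F) f = fcomp R m f'' (fcomp R m u' u)"
    proof (rule rmod_hom_eqI[OF fhom_comp[OF q(2) fhom_comp[OF h]] fhom_comp[OF fhom_comp[OF u(1) u'(1)] q''(2)]])
      fix x assume x: "x \<in> fcar R m"
      show "fcomp R m (fcomp R n F' F) f x = fcomp R m f'' (fcomp R m u' u) x"
        using fun_cong[OF u(2), of x] fun_cong[OF u'(2), of "u x"] x rmod_homD(1)[OF q(2) x] rmod_homD(1)[OF u(1) x] by (simp add: compose_def)
    qed
    then show "fcomp R n F' F \<in> lifts R (m, n, f) (m'', n'', f'')"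
      using fhom_comp[OF h] fhom_comp[OF u(1) u'(1)] lifts_iff by blast
    show "p'' (fcomp R n F' F x) = compose (carrier M) \<psi> \<phi> (p x)" if x: "x \<in> fcar R n" for x
      using x rmod_homD(1)[OF q(3) x] bspec[OF F(3) x] bspec[OF F'(3) rmod_homD(1)[OF h(1) x]] by (simp add: compose_def)
    show "Comp G (ob (m, n, f)) (ob (m', n', f')) (ob (m'', n'', f'')) b a = ar (m, n, f) (m'', n'', f'') (fcomp R n F' F)"
      unfolding F(4) F'(4) using ar_comp[OF q(2) q'(2) q''(2) F(2) F'(2)] by simp
  qed
qed

end

end

text \<open>A diagram that comes from an arbitrary presentation of \<open>M\<close> will have to be
  compared with the one from the chosen presentation \<open>pres_of M\<close>. Arrows related to the
  identity of \<open>M\<close> in the two directions are inverse to each other.\<close>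

lemma rl_iso:
  fixes M :: "('a, 'u) module"
  assumes Q: "is_pres R M (m, n, f) p" and Q': "is_pres R M (m', n', f') p'"
  shows "\<exists>a. is_iso G (ob (m, n, f)) (ob (m', n', f')) a"
proof -
  let ?u = "\<lambda>x\<in>carrier M. x"
  let ?X = "ob (m, n, f)" and ?Y = "ob (m', n', f')"
  have i: "?u \<in> rmod_hom R M M" using rl_dom(1)[OF Q Q rl_id[OF Q]] .
  have ii: "compose (carrier M) ?u ?u = ?u" by (auto simp: compose_def)
  obtain a b where a: "rl (M, (m, n, f), p) (M, (m', n', f'), p') ?u a" and b: "rl (M, (m', n', f'), p') (M, (m, n, f), p) ?u b"
    using rl_ex[OF Q Q' i] rl_ex[OF Q' Q i] by blast
  have "Comp G ?X ?Y ?X b a = Ident G ?X"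
    using rl_eq[OF Q Q rl_comp[OF Q Q' Q a b] rl_id[OF Q]] ii by simp
  moreover have "Comp G ?Y ?X ?Y a b = Ident G ?Y"
    using rl_eq[OF Q' Q' rl_comp[OF Q' Q Q' b a] rl_id[OF Q']] ii by simp
  ultimately show ?thesis unfolding is_iso_def
    using rl_dom(2)[OF Q Q' a] rl_dom(2)[OF Q' Q b] by blast
qed

definition "pres_of M = (SOME z. is_pres R M (fst z) (snd z))"

lemma pres_of: assumes "fin_pres_rmod R M" shows "is_pres R M (fst (pres_of M)) (snd (pres_of M))"
  unfolding pres_of_def by (rule someI_ex) (use assms in \<open>simp add: fin_pres_is_pres\<close>)

theorem pres_functor:
  "\<exists>F. FObj F = (\<lambda>M. ob (fst (pres_of M))) \<and> additive_functor (mod_cat R :: (('a, 'u) module, 'u \<Rightarrow> 'u) preadd_cat) G F \<and>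
    (\<forall>M\<in>Obj (mod_cat R :: (('a, 'u) module, 'u \<Rightarrow> 'u) preadd_cat). \<forall>M'\<in>Obj (mod_cat R).
      bij_betw (FArr F M M') (Arr (mod_cat R) M M') (Arr G (ob (fst (pres_of M))) (ob (fst (pres_of M')))))"
proof (rule functor_of_relation[where T = "\<lambda>M M'. rl (M, pres_of M) (M', pres_of M')"])
  have P: "is_pres R M (fst (fst (pres_of M)), fst (snd (fst (pres_of M))), snd (snd (fst (pres_of M)))) (snd (pres_of M))"
    if "M \<in> Obj (mod_cat R)" for M :: "('a, 'u) module"
    using that pres_of by (simp add: mod_cat_def)
  fix X :: "('a, 'u) module" assume X: "X \<in> Obj (mod_cat R)"
  show "ob (fst (pres_of X)) \<in> Obj G" using ob_Obj[OF is_presD(2)[OF P[OF X]]] by simp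
  show "rl (X, pres_of X) (X, pres_of X) (Ident (mod_cat R) X) (Ident G (ob (fst (pres_of X))))"
    using rl_id[OF P[OF X]] by (simp add: mod_cat_def)
  fix Y :: "('a, 'u) module" assume Y: "Y \<in> Obj (mod_cat R)"
  show "\<exists>a. rl (X, pres_of X) (Y, pres_of Y) \<phi> a" if "\<phi> \<in> Arr (mod_cat R) X Y" for \<phi>
    using rl_ex[OF P[OF X] P[OF Y]] that by (simp add: mod_cat_def)
  show "\<phi> \<in> Arr (mod_cat R) X Y \<and> a \<in> Arr G (ob (fst (pres_of X))) (ob (fst (pres_of Y)))" if "rl (X, pres_of X) (Y, pres_of Y) \<phi> a" for \<phi> a
    using rl_dom[OF P[OF X] P[OF Y]] that by (simp add: mod_cat_def)
  show "a = b \<longleftrightarrow> \<phi> = \<psi>" if "rl (X, pres_of X) (Y, pres_of Y) \<phi> a" "rl (X, pres_of X) (Y, pres_of Y) \<psi> b" for \<phi> \<psi> a b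
    using rl_eq[OF P[OF X] P[OF Y]] that by simp
  show "\<exists>\<phi>. rl (X, pres_of X) (Y, pres_of Y) \<phi> a" if "a \<in> Arr G (ob (fst (pres_of X))) (ob (fst (pres_of Y)))" for a
    using rl_surj[OF P[OF X] P[OF Y]] that by simp
  show "rl (X, pres_of X) (Y, pres_of Y) (Plus (mod_cat R) X Y \<phi> \<psi>) (Plus G (ob (fst (pres_of X))) (ob (fst (pres_of Y))) a b)"
    if "rl (X, pres_of X) (Y, pres_of Y) \<phi> a" "rl (X, pres_of X) (Y, pres_of Y) \<psi> b" for \<phi> \<psi> a b
    using rl_plus[OF P[OF X] P[OF Y]] that by (simp add: mod_cat_def)
  fix Z :: "('a, 'u) module" assume Z: "Z \<in> Obj (mod_cat R)"
  show "rl (X, pres_of X) (Z, pres_of Z) (Comp (mod_cat R) X Y Z \<psi> \<phi>) (Comp G (ob (fst (pres_of X))) (ob (fst (pres_of Y))) (ob (fst (pres_of Z))) b a)"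
    if "rl (X, pres_of X) (Y, pres_of Y) \<phi> a" "rl (Y, pres_of Y) (Z, pres_of Z) \<psi> b" for \<phi> \<psi> a b
    using rl_comp[OF P[OF X] P[OF Y] P[OF Z]] that by (simp add: mod_cat_def)
qed

end

section \<open>Finitely presented modules in Adelman's category\<close>

lemma add_free_op: "add (free_rmod (op_ring A) n) = add (free_rmod A n)"
  by (simp add: free_rmod_def)

context ring
begin

text \<open>The cokernel of \<open>f : R\<^sup>m \<rightarrow> R\<^sup>n\<close> becomes the diagram \<open>R\<^sup>m \<rightarrow> R\<^sup>n \<rightarrow> 0\<close>, which is injective.\<close>

lemma adel_embedding:
  "pres_embedding R (ringcat.adel (FH R) (FI R)) (\<lambda>(m, n, f). (m, n, 0, fem R m n f, 0))
     (\<lambda>(m, n, f) (m', n', f') F. ringcat.coset (FH R) (m, n, 0, fem R m n f, 0) (m', n', 0, fem R m' n' f', 0) (fem R n n' F))"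
proof -
  interpret fc: addcat "FH R" "FI R" 0 by (rule addcat_free)
  let ?o = "\<lambda>m n f. (m, n, 0, fem R m n f, 0)"
  have hom: "fc.hom (?o m n f) (?o m' n' f') = fem R n n' ` lifts R (m, n, f) (m', n', f')"
    if f: "f \<in> fhom R m n" and f': "f' \<in> fhom R m' n'" for m n f m' n' f'
  proof (intro equalityI subsetI)
    fix X assume "X \<in> fc.hom (?o m n f) (?o m' n' f')"
    then obtain u v where X: "X \<in> FH R n n'" "u \<in> FH R m m'" "X * fem R m n f = fem R m' n' f' * u" "v \<in> FH R 0 0" "0 * X = v * 0" by (rule fc.homE)
    obtain F where F: "F \<in> fhom R n n'" "X = fem R n n' F" using X(1) by (auto simp: FH_def)
    obtain w where w: "w \<in> fhom R m m'" "u = fem R m m' w" using X(2) by (auto simp: FH_def)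
    have "fcomp R m F f = fcomp R m f' w"
      by (rule fem_inject[OF fhom_comp[OF f F(1)] fhom_comp[OF w(1) f']])
        (use X(3) F(2) w(2) fem_comp[OF f F(1)] fem_comp[OF w(1) f'] in simp)
    then have "F \<in> lifts R (m, n, f) (m', n', f')" using F(1) w(1) lifts_iff by blast
    then show "X \<in> fem R n n' ` lifts R (m, n, f) (m', n', f')" using F(2) by blast
  next
    fix X assume "X \<in> fem R n n' ` lifts R (m, n, f) (m', n', f')"
    then obtain F w where F: "F \<in> fhom R n n'" "X = fem R n n' F" and w: "w \<in> fhom R m m'" "fcomp R m F f = fcomp R m f' w"
      by (auto simp: lifts_iff)
    show "X \<in> fc.hom (?o m n f) (?o m' n' f')"
    proof (rule fc.homI)
      show "X * fem R m n f = fem R m' n' f' * fem R m m' w"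
        using F(2) w(2) fem_comp[OF f F(1)] fem_comp[OF w(1) f'] by simp
    qed (use F fem_FH[OF F(1)] fem_FH[OF w(1)] fc.Hm_zero in auto)
  qed
  show ?thesis
  proof (intro pres_embedding.intro pres_embedding_axioms.intro, rule ring_axioms, unfold prod.case)
    fix m n f m' n' f' assume f: "f \<in> fhom R m n"
    show "?o m n f \<in> Obj fc.adel" using fem_FH[OF f] fc.Hm_zero by (simp add: fc.adel_def)
    show "fc.coset (?o m n f) (?o m n f) (fem R n n (fid R n)) = Ident fc.adel (?o m n f)"
      by (simp add: fc.adel_Ident FI_def)
    assume f': "f' \<in> fhom R m' n'"
    show "Arr fc.adel (?o m n f) (?o m' n' f') = (\<lambda>F. fc.coset (?o m n f) (?o m' n' f') (fem R n n' F)) ` lifts R (m, n, f) (m', n', f')"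
      unfolding fc.adel_Arr hom[OF f f'] by (simp add: image_image)
    show "fc.coset (?o m n f) (?o m'' n'' f'') (fem R n n'' (fcomp R n F' F)) =
        Comp fc.adel (?o m n f) (?o m' n' f') (?o m'' n'' f'') (fc.coset (?o m' n' f') (?o m'' n'' f'') (fem R n' n'' F')) (fc.coset (?o m n f) (?o m' n' f') (fem R n n' F))"
      if f'': "f'' \<in> fhom R m'' n''" and F: "F \<in> lifts R (m, n, f) (m', n', f')" and F': "F' \<in> lifts R (m', n', f') (m'', n'', f'')" for m'' n'' f'' F F'
    proof -
      have h: "F \<in> fhom R n n'" "F' \<in> fhom R n' n''" using F F' by (simp_all add: lifts_iff)
      have "fem R n n' F \<in> fc.hom (?o m n f) (?o m' n' f')" "fem R n' n'' F' \<in> fc.hom (?o m' n' f') (?o m'' n'' f'')"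
        using hom[OF f f'] hom[OF f' f''] F F' by simp_all
      then show ?thesis using fc.adel_Comp fem_comp[OF h] by simp
    qed
    fix F F' assume F: "F \<in> lifts R (m, n, f) (m', n', f')" and F': "F' \<in> lifts R (m, n, f) (m', n', f')"
    have h: "F \<in> fhom R n n'" "F' \<in> fhom R n n'" using F F' by (simp_all add: lifts_iff)
    have H: "fem R n n' F \<in> fc.hom (?o m n f) (?o m' n' f')" "fem R n n' F' \<in> fc.hom (?o m n f) (?o m' n' f')"
      using hom[OF f f'] F F' by simp_all
    show "fc.coset (?o m n f) (?o m' n' f') (fem R n n' (fplus R n n' F F')) =
       Plus fc.adel (?o m n f) (?o m' n' f') (fc.coset (?o m n f) (?o m' n' f') (fem R n n' F)) (fc.coset (?o m n f) (?o m' n' f') (fem R n n' F'))"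
      using fc.adel_Plus[OF H] fem_plus[OF h] by simp
    have *: "F = fplus R n n' F' (fcomp R n f' K) \<longleftrightarrow> fem R n n' F - fem R n n' F' = fem R m' n' f' * fem R n m' K" if K: "K \<in> fhom R n m'" for K
    proof -
      have "fem R n n' (fplus R n n' F' (fcomp R n f' K)) = fem R n n' F' + fem R m' n' f' * fem R n m' K"
        using fem_plus[OF h(2) fhom_comp[OF K f']] fem_comp[OF K f'] by simp
      then show ?thesis
        using fem_inject[OF h(1) fhom_plus[OF h(2) fhom_comp[OF K f']]] by (auto simp: algebra_simps)
    qed
    show "fc.coset (?o m n f) (?o m' n' f') (fem R n n' F) = fc.coset (?o m n f) (?o m' n' f') (fem R n n' F')
       \<longleftrightarrow> (\<exists>K\<in>fhom R n m'. F = fplus R n n' F' (fcomp R n f' K))"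
    proof (unfold fc.coset_eq[OF H], intro iffI)
      assume "fem R n n' F - fem R n n' F' \<in> fc.nul (?o m n f) (?o m' n' f')"
      then obtain K L where "K \<in> FH R n m'" "fem R n n' F - fem R n n' F' = fem R m' n' f' * K + L * 0" by (rule fc.nulE)
      then show "\<exists>K\<in>fhom R n m'. F = fplus R n n' F' (fcomp R n f' K)" using * by (auto simp: FH_def)
    next
      assume "\<exists>K\<in>fhom R n m'. F = fplus R n n' F' (fcomp R n f' K)"
      then obtain K where K: "K \<in> fhom R n m'" "F = fplus R n n' F' (fcomp R n f' K)" by blast
      have d: "fem R n n' F - fem R n n' F' \<in> fc.hom (?o m n f) (?o m' n' f')"
        using fc.hom_add[OF H(1) fc.hom_uminus[OF H(2)]] by simp
      show "fem R n n' F - fem R n n' F' \<in> fc.nul (?o m n f) (?o m' n' f')"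
        by (rule fc.nulI[OF d fem_FH[OF K(1)] fc.Hm_zero]) (use *[OF K(1)] K(2) in simp)
    qed
  qed
qed

text \<open>A map of free modules over \<open>op_ring R\<close> becomes, after transposition, a map
  of free modules over \<open>R\<close> in the opposite direction, and is then represented by
  \<open>fem\<close>. So both kinds of modules live over the same ring category.\<close>

definition tem where "tem m n f = fem R n m (transp (op_ring R) m n f)"

lemma tem_FH: "f \<in> fhom (op_ring R) m n \<Longrightarrow> tem m n f \<in> FH R n m"
  using ring.transp_hom[OF ring_op, of f m n] by (simp add: tem_def fem_FH)

lemma tem_comp:
  assumes "f \<in> fhom (op_ring R) l m" "g \<in> fhom (op_ring R) m n"
  shows "tem l n (fcomp (op_ring R) l g f) = tem l m f * tem m n g"
  using ring.transp_comp[OF ring_op assms] ring.transp_hom[OF ring_op assms(1)] ring.transp_hom[OF ring_op assms(2)]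
    fem_comp[of "transp (op_ring R) m n g" n m "transp (op_ring R) l m f" l]
  by (simp add: tem_def)

lemma tem_plus:
  assumes "f \<in> fhom (op_ring R) m n" "g \<in> fhom (op_ring R) m n"
  shows "tem m n (fplus (op_ring R) m n f g) = tem m n f + tem m n g"
  using ring.transp_add[OF ring_op assms] ring.transp_hom[OF ring_op assms(1)] ring.transp_hom[OF ring_op assms(2)]
    fem_plus[of "transp (op_ring R) m n f" n m "transp (op_ring R) m n g"]
  by (simp add: tem_def add_free_op)

lemma tem_id: "tem n n (fid (op_ring R) n) = FI R n"
  using ring.transp_id[OF ring_op, of n] by (simp add: tem_def FI_def)

lemma tem_inject:
  assumes "f \<in> fhom (op_ring R) m n" "g \<in> fhom (op_ring R) m n" "tem m n f = tem m n g"
  shows "f = g"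
proof -
  have "transp (op_ring R) m n f = transp (op_ring R) m n g"
    by (rule fem_inject[of _ n m]) (use assms ring.transp_hom[OF ring_op assms(1)] ring.transp_hom[OF ring_op assms(2)] in \<open>simp_all add: tem_def\<close>)
  then show ?thesis using ring.transp_transp[OF ring_op assms(1)] ring.transp_transp[OF ring_op assms(2)] by metis
qed

text \<open>Every map is a transpose, because transposing twice gives it back. This makes the
  contravariant embedding full.\<close>

lemma FH_tem: "FH R n m = tem m n ` fhom (op_ring R) m n"
proof (intro equalityI subsetI)
  fix X assume "X \<in> FH R n m"
  then obtain F where F: "F \<in> fhom R n m" "X = fem R n m F" by (auto simp: FH_def)
  then show "X \<in> tem m n ` fhom (op_ring R) m n"
    using transp_transp[OF F(1)] transp_hom[OF F(1)] by (intro image_eqI[of _ _ "transp R n m F"]) (simp_all add: tem_def)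
qed (auto simp: tem_FH)

text \<open>The cokernel of a map of free left modules becomes \<open>0 \<rightarrow> R\<^sup>n \<rightarrow> R\<^sup>m\<close>, which is projective.\<close>

lemma adel_coembedding:
  "pres_embedding (op_ring R) (op_cat (ringcat.adel (FH R) (FI R))) (\<lambda>(m, n, f). (0, n, m, 0, tem m n f))
     (\<lambda>(m, n, f) (m', n', f') F. ringcat.coset (FH R) (0, n', m', 0, tem m' n' f') (0, n, m, 0, tem m n f) (tem n n' F))"
proof -
  interpret fc: addcat "FH R" "FI R" 0 by (rule addcat_free)
  interpret O: ring "op_ring R" by (rule ring_op)
  let ?S = "op_ring R"
  let ?o = "\<lambda>m n f. (0, n, m, 0, tem m n f)"
  have hom: "fc.hom (?o m' n' f') (?o m n f) = tem n n' ` lifts ?S (m, n, f) (m', n', f')"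
    if f: "f \<in> fhom ?S m n" and f': "f' \<in> fhom ?S m' n'" for m n f m' n' f'
  proof (intro equalityI subsetI)
    fix X assume "X \<in> fc.hom (?o m' n' f') (?o m n f)"
    then obtain u v where X: "X \<in> FH R n' n" "u \<in> FH R 0 0" "X * 0 = 0 * u" "v \<in> FH R m' m" "tem m n f * X = v * tem m' n' f'" by (rule fc.homE)
    obtain F where F: "F \<in> fhom ?S n n'" "X = tem n n' F" using X(1) unfolding FH_tem by blast
    obtain w where w: "w \<in> fhom ?S m m'" "v = tem m m' w" using X(4) unfolding FH_tem by blast
    have "fcomp ?S m F f = fcomp ?S m f' w"
      by (rule tem_inject[OF O.fhom_comp[OF f F(1)] O.fhom_comp[OF w(1) f']])
        (use X(5) F(2) w(2) tem_comp[OF f F(1)] tem_comp[OF w(1) f'] in simp)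
    then have "F \<in> lifts ?S (m, n, f) (m', n', f')" using F(1) w(1) lifts_iff by blast
    then show "X \<in> tem n n' ` lifts ?S (m, n, f) (m', n', f')" using F(2) by blast
  next
    fix X assume "X \<in> tem n n' ` lifts ?S (m, n, f) (m', n', f')"
    then obtain F w where F: "F \<in> fhom ?S n n'" "X = tem n n' F" and w: "w \<in> fhom ?S m m'" "fcomp ?S m F f = fcomp ?S m f' w"
      using lifts_iff by blast
    show "X \<in> fc.hom (?o m' n' f') (?o m n f)"
    proof (rule fc.homI)
      show "tem m n f * X = tem m m' w * tem m' n' f'"
        unfolding F(2) tem_comp[OF f F(1), symmetric] w(2) tem_comp[OF w(1) f'] ..
    qed (use F tem_FH[OF F(1)] tem_FH[OF w(1)] fc.Hm_zero in auto)
  qed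
  show ?thesis
  proof (intro pres_embedding.intro pres_embedding_axioms.intro, rule ring_op, unfold prod.case op_cat_simps)
    fix m n f m' n' f' assume f: "f \<in> fhom ?S m n"
    show "?o m n f \<in> Obj fc.adel" using tem_FH[OF f] fc.Hm_zero by (simp add: fc.adel_def)
    show "fc.coset (?o m n f) (?o m n f) (tem n n (fid ?S n)) = Ident fc.adel (?o m n f)"
      unfolding tem_id by (simp add: fc.adel_Ident)
    assume f': "f' \<in> fhom ?S m' n'"
    show "Arr fc.adel (?o m' n' f') (?o m n f) = (\<lambda>F. fc.coset (?o m' n' f') (?o m n f) (tem n n' F)) ` lifts ?S (m, n, f) (m', n', f')"
      unfolding fc.adel_Arr hom[OF f f'] by (simp add: image_image)
    show "fc.coset (?o m'' n'' f'') (?o m n f) (tem n n'' (fcomp ?S n F' F)) =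
        Comp fc.adel (?o m'' n'' f'') (?o m' n' f') (?o m n f) (fc.coset (?o m' n' f') (?o m n f) (tem n n' F)) (fc.coset (?o m'' n'' f'') (?o m' n' f') (tem n' n'' F'))"
      if f'': "f'' \<in> fhom ?S m'' n''" and F: "F \<in> lifts ?S (m, n, f) (m', n', f')" and F': "F' \<in> lifts ?S (m', n', f') (m'', n'', f'')" for m'' n'' f'' F F'
    proof -
      have h: "F \<in> fhom ?S n n'" "F' \<in> fhom ?S n' n''" using F F' lifts_iff by blast+
      have "tem n n' F \<in> fc.hom (?o m' n' f') (?o m n f)" "tem n' n'' F' \<in> fc.hom (?o m'' n'' f'') (?o m' n' f')"
        using hom[OF f f'] hom[OF f' f''] F F' by blast+
      then show ?thesis unfolding tem_comp[OF h] by (simp add: fc.adel_Comp)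
    qed
    fix F F' assume F: "F \<in> lifts ?S (m, n, f) (m', n', f')" and F': "F' \<in> lifts ?S (m, n, f) (m', n', f')"
    have h: "F \<in> fhom ?S n n'" "F' \<in> fhom ?S n n'" using F F' lifts_iff by blast+
    have H: "tem n n' F \<in> fc.hom (?o m' n' f') (?o m n f)" "tem n n' F' \<in> fc.hom (?o m' n' f') (?o m n f)"
      using hom[OF f f'] F F' by blast+
    show "fc.coset (?o m' n' f') (?o m n f) (tem n n' (fplus ?S n n' F F')) =
       Plus fc.adel (?o m' n' f') (?o m n f) (fc.coset (?o m' n' f') (?o m n f) (tem n n' F)) (fc.coset (?o m' n' f') (?o m n f) (tem n n' F'))"
      unfolding tem_plus[OF h] using fc.adel_Plus[OF H] by simp
    have *: "F = fplus ?S n n' F' (fcomp ?S n f' K) \<longleftrightarrow> tem n n' F - tem n n' F' = tem n m' K * tem m' n' f'" if K: "K \<in> fhom ?S n m'" for K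
    proof -
      have "tem n n' (fplus ?S n n' F' (fcomp ?S n f' K)) = tem n n' F' + tem n m' K * tem m' n' f'"
        unfolding tem_plus[OF h(2) O.fhom_comp[OF K f']] tem_comp[OF K f'] ..
      then show ?thesis
        using tem_inject[OF h(1) O.fhom_plus[OF h(2) O.fhom_comp[OF K f']]] by (auto simp: algebra_simps)
    qed
    show "fc.coset (?o m' n' f') (?o m n f) (tem n n' F) = fc.coset (?o m' n' f') (?o m n f) (tem n n' F')
       \<longleftrightarrow> (\<exists>K\<in>fhom ?S n m'. F = fplus ?S n n' F' (fcomp ?S n f' K))"
    proof (unfold fc.coset_eq[OF H], intro iffI)
      assume "tem n n' F - tem n n' F' \<in> fc.nul (?o m' n' f') (?o m n f)"
      then obtain K L where L: "L \<in> FH R m' n" "tem n n' F - tem n n' F' = 0 * K + L * tem m' n' f'" by (rule fc.nulE)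
      then obtain K' where "K' \<in> fhom ?S n m'" "L = tem n m' K'" unfolding FH_tem by blast
      then show "\<exists>K\<in>fhom ?S n m'. F = fplus ?S n n' F' (fcomp ?S n f' K)" using * L(2) by auto
    next
      assume "\<exists>K\<in>fhom ?S n m'. F = fplus ?S n n' F' (fcomp ?S n f' K)"
      then obtain K where K: "K \<in> fhom ?S n m'" "F = fplus ?S n n' F' (fcomp ?S n f' K)" by blast
      have d: "tem n n' F - tem n n' F' \<in> fc.hom (?o m' n' f') (?o m n f)"
        using fc.hom_add[OF H(1) fc.hom_uminus[OF H(2)]] by simp
      show "tem n n' F - tem n n' F' \<in> fc.nul (?o m' n' f') (?o m n f)"
        by (rule fc.nulI[OF d fc.Hm_zero tem_FH[OF K(1)]]) (use *[OF K(1)] K(2) in simp)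
    qed
  qed
qed
text \<open>The quotient is built on chosen representatives \<open>rep x\<close> and not on cosets,
  so its elements are again vectors. \<open>fin_pres_rmod_in_large_universe\<close> moves it to the
  given universe afterwards.\<close>

lemma cokernel:
  assumes f: "f \<in> fhom R m n"
  shows "\<exists>M :: ('a, nat \<Rightarrow> 'a) module. \<exists>p. is_pres R M (m, n, f) p"
proof -
  let ?F = "free_rmod R n"
  interpret F: right_module R ?F by (rule right_module_free)
  interpret E: right_module R "free_rmod R m" by (rule right_module_free)
  define cg where "cg x y \<longleftrightarrow> (\<exists>w\<in>fcar R m. x = y \<oplus>\<^bsub>?F\<^esub> f w)" for x y
  note fc = rmod_homD(1)[OF f]
  have f0: "f \<zero>\<^bsub>free_rmod R m\<^esub> = \<zero>\<^bsub>?F\<^esub>" by (rule rmod_hom_zero[OF E.right_module_axioms F.right_module_axioms f])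
  have refl: "cg x x" if "x \<in> carrier ?F" for x
    unfolding cg_def using that f0 by (intro bexI[of _ "\<zero>\<^bsub>free_rmod R m\<^esub>"]) simp_all
  have sym: "cg y x" if y: "y \<in> carrier ?F" and "cg x y" for x y
  proof -
    obtain w where w: "w \<in> fcar R m" "x = y \<oplus>\<^bsub>?F\<^esub> f w" using \<open>cg x y\<close> unfolding cg_def by blast
    have "f w \<oplus>\<^bsub>?F\<^esub> f (\<ominus>\<^bsub>free_rmod R m\<^esub> w) = \<zero>\<^bsub>?F\<^esub>"
      using rmod_homD(3)[OF f w(1), of "\<ominus>\<^bsub>free_rmod R m\<^esub> w"] w(1) f0 by (simp add: E.M.r_neg)
    then have "y = x \<oplus>\<^bsub>?F\<^esub> f (\<ominus>\<^bsub>free_rmod R m\<^esub> w)"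
      using w y fc[OF w(1)] fc[OF E.M.a_inv_closed[OF w(1)]] by (simp add: F.M.a_assoc)
    then show ?thesis unfolding cg_def using w(1) by blast
  qed
  have trans: "cg x z" if z: "z \<in> carrier ?F" and "cg x y" "cg y z" for x y z
  proof -
    obtain w where w: "w \<in> fcar R m" "x = y \<oplus>\<^bsub>?F\<^esub> f w" using \<open>cg x y\<close> unfolding cg_def by blast
    obtain v where v: "v \<in> fcar R m" "y = z \<oplus>\<^bsub>?F\<^esub> f v" using \<open>cg y z\<close> unfolding cg_def by blast
    have "x = z \<oplus>\<^bsub>?F\<^esub> f (v \<oplus>\<^bsub>free_rmod R m\<^esub> w)"
      using w v z fc[OF w(1)] fc[OF v(1)] rmod_homD(3)[OF f v(1) w(1)] by (simp add: F.M.a_assoc)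
    then show ?thesis unfolding cg_def using w(1) v(1) by blast
  qed
  have cadd: "cg (x \<oplus>\<^bsub>?F\<^esub> z) (y \<oplus>\<^bsub>?F\<^esub> z)" if y: "y \<in> carrier ?F" and z: "z \<in> carrier ?F" and "cg x y" for x y z
  proof -
    obtain w where w: "w \<in> fcar R m" "x = y \<oplus>\<^bsub>?F\<^esub> f w" using \<open>cg x y\<close> unfolding cg_def by blast
    have "x \<oplus>\<^bsub>?F\<^esub> z = y \<oplus>\<^bsub>?F\<^esub> z \<oplus>\<^bsub>?F\<^esub> f w" unfolding w(2) using y z fc[OF w(1)] by (simp add: F.M.add.m_ac)
    then show ?thesis unfolding cg_def using w(1) by blast
  qed
  have csm: "cg (a \<odot>\<^bsub>?F\<^esub> x) (a \<odot>\<^bsub>?F\<^esub> y)" if y: "y \<in> carrier ?F" and a: "a \<in> carrier R" and "cg x y" for x y a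
  proof -
    obtain w where w: "w \<in> fcar R m" "x = y \<oplus>\<^bsub>?F\<^esub> f w" using \<open>cg x y\<close> unfolding cg_def by blast
    have "a \<odot>\<^bsub>?F\<^esub> x = a \<odot>\<^bsub>?F\<^esub> y \<oplus>\<^bsub>?F\<^esub> f (a \<odot>\<^bsub>free_rmod R m\<^esub> w)"
      unfolding w(2) using F.rsmult_r_distr[OF a y fc[OF w(1)]] rmod_homD(4)[OF f a w(1)] by simp
    then show ?thesis unfolding cg_def using E.rsmult_closed[OF a w(1)] by blast
  qed
  define rep where "rep x = (SOME y. y \<in> carrier ?F \<and> cg x y)" for x
  have rep: "rep x \<in> carrier ?F" "cg x (rep x)" if "x \<in> carrier ?F" for x
    using someI[of "\<lambda>y. y \<in> carrier ?F \<and> cg x y" x] refl[OF that] that by (auto simp: rep_def)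
  have rep_eq: "rep x = rep y \<longleftrightarrow> cg x y" if x: "x \<in> carrier ?F" and y: "y \<in> carrier ?F" for x y
  proof
    assume "rep x = rep y"
    then show "cg x y" using trans[OF y rep(2)[OF x]] sym[OF rep(1)[OF y] rep(2)[OF y]] by simp
  next
    assume c: "cg x y"
    have "z \<in> carrier ?F \<and> cg x z \<longleftrightarrow> z \<in> carrier ?F \<and> cg y z" for z
      using trans[of z x y] trans[of z y x] sym[OF y c] sym[of _ _] c by blast
    then show "rep x = rep y" by (simp add: rep_def)
  qed
  have rep_rep: "rep (rep x) = rep x" if "x \<in> carrier ?F" for x
    using rep_eq[OF rep(1)[OF that] that] sym[OF rep(1)[OF that] rep(2)[OF that]] by simp
  have rep_l: "rep (rep x \<oplus>\<^bsub>?F\<^esub> y) = rep (x \<oplus>\<^bsub>?F\<^esub> y)" if x: "x \<in> carrier ?F" and y: "y \<in> carrier ?F" for x y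
    using rep_eq[of "rep x \<oplus>\<^bsub>?F\<^esub> y" "x \<oplus>\<^bsub>?F\<^esub> y"] cadd[OF x y sym[OF rep(1)[OF x] rep(2)[OF x]]] x y rep(1)[OF x] by simp
  have rep_r: "rep (y \<oplus>\<^bsub>?F\<^esub> rep x) = rep (y \<oplus>\<^bsub>?F\<^esub> x)" if x: "x \<in> carrier ?F" and y: "y \<in> carrier ?F" for x y
    using rep_l[OF x y] F.M.a_comm[OF y rep(1)[OF x]] F.M.a_comm[OF y x] by simp
  have rep_s: "rep (a \<odot>\<^bsub>?F\<^esub> rep x) = rep (a \<odot>\<^bsub>?F\<^esub> x)" if x: "x \<in> carrier ?F" and a: "a \<in> carrier R" for x a
    using rep_eq[OF F.rsmult_closed[OF a rep(1)[OF x]] F.rsmult_closed[OF a x]] csm[OF x a sym[OF rep(1)[OF x] rep(2)[OF x]]] by simp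
  define M :: "('a, nat \<Rightarrow> 'a) module" where "M = \<lparr>carrier = rep ` carrier ?F, mult = undefined, one = undefined,
    zero = rep \<zero>\<^bsub>?F\<^esub>, add = (\<lambda>x y. rep (x \<oplus>\<^bsub>?F\<^esub> y)), smult = (\<lambda>a x. rep (a \<odot>\<^bsub>?F\<^esub> x))\<rparr>"
  have Ms: "carrier M = rep ` carrier ?F" "\<zero>\<^bsub>M\<^esub> = rep \<zero>\<^bsub>?F\<^esub>" "x \<oplus>\<^bsub>M\<^esub> y = rep (x \<oplus>\<^bsub>?F\<^esub> y)" "a \<odot>\<^bsub>M\<^esub> x = rep (a \<odot>\<^bsub>?F\<^esub> x)" for x y a
    by (simp_all add: M_def)
  have M: "right_module R M"
  proof (intro right_module.intro right_module_axioms.intro abelian_groupI)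
    show "ring R" by (rule ring_axioms)
    fix x assume "x \<in> carrier M"
    then obtain x' where x': "x' \<in> carrier ?F" "x = rep x'" by (auto simp: Ms)
    show "\<exists>y\<in>carrier M. y \<oplus>\<^bsub>M\<^esub> x = \<zero>\<^bsub>M\<^esub>"
      by (rule bexI[of _ "rep (\<ominus>\<^bsub>?F\<^esub> x')"]) (use x' rep in \<open>simp_all add: Ms rep_l rep_r F.M.l_neg\<close>)
    show "\<zero>\<^bsub>M\<^esub> \<oplus>\<^bsub>M\<^esub> x = x" using x' rep by (simp add: Ms rep_l rep_rep)
    show "\<one> \<odot>\<^bsub>M\<^esub> x = x" using x' rep by (simp add: Ms F.rsmult_one rep_rep)
    show "a \<odot>\<^bsub>M\<^esub> x \<in> carrier M" if "a \<in> carrier R" for a using that x' rep F.rsmult_closed by (auto simp: Ms)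
    show "(a \<oplus> b) \<odot>\<^bsub>M\<^esub> x = a \<odot>\<^bsub>M\<^esub> x \<oplus>\<^bsub>M\<^esub> b \<odot>\<^bsub>M\<^esub> x" if "a \<in> carrier R" "b \<in> carrier R" for a b
      using that x' rep by (simp add: Ms rep_s rep_l rep_r F.rsmult_closed F.rsmult_l_distr[OF that x'(1)])
    show "(a \<otimes> b) \<odot>\<^bsub>M\<^esub> x = b \<odot>\<^bsub>M\<^esub> (a \<odot>\<^bsub>M\<^esub> x)" if "a \<in> carrier R" "b \<in> carrier R" for a b
      using that x' rep by (simp add: Ms rep_s F.rsmult_closed F.rsmult_assoc[OF that x'(1)])
    fix y assume "y \<in> carrier M"
    then obtain y' where y': "y' \<in> carrier ?F" "y = rep y'" by (auto simp: Ms)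
    show "x \<oplus>\<^bsub>M\<^esub> y \<in> carrier M" using x' y' rep by (auto simp: Ms)
    show "x \<oplus>\<^bsub>M\<^esub> y = y \<oplus>\<^bsub>M\<^esub> x" using x' y' rep by (simp add: Ms F.M.a_comm)
    show "a \<odot>\<^bsub>M\<^esub> (x \<oplus>\<^bsub>M\<^esub> y) = a \<odot>\<^bsub>M\<^esub> x \<oplus>\<^bsub>M\<^esub> a \<odot>\<^bsub>M\<^esub> y" if "a \<in> carrier R" for a
      using that x' y' rep by (simp add: Ms rep_s rep_l rep_r F.rsmult_closed F.rsmult_r_distr[OF that x'(1) y'(1)])
    fix z assume "z \<in> carrier M"
    then obtain z' where z': "z' \<in> carrier ?F" "z = rep z'" by (auto simp: Ms)
    show "x \<oplus>\<^bsub>M\<^esub> y \<oplus>\<^bsub>M\<^esub> z = x \<oplus>\<^bsub>M\<^esub> (y \<oplus>\<^bsub>M\<^esub> z)"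
      using x' y' z' rep by (simp add: Ms rep_l rep_r F.M.a_assoc)
  next
    show "\<zero>\<^bsub>M\<^esub> \<in> carrier M" by (simp add: Ms)
  qed
  let ?p = "\<lambda>x\<in>carrier ?F. rep x"
  have p: "?p \<in> rmod_hom R ?F M"
  proof (rule rmod_homI)
    fix x assume x: "x \<in> carrier ?F"
    show "?p x \<in> carrier M" using x by (simp add: Ms)
    show "?p (x \<oplus>\<^bsub>?F\<^esub> y) = ?p x \<oplus>\<^bsub>M\<^esub> ?p y" if "y \<in> carrier ?F" for y using x that rep by (simp add: Ms rep_l rep_r)
    show "?p (a \<odot>\<^bsub>?F\<^esub> x) = a \<odot>\<^bsub>M\<^esub> ?p x" if "a \<in> carrier R" for a using x that rep by (simp add: Ms rep_s F.rsmult_closed)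
  qed simp
  have "?p x = \<zero>\<^bsub>M\<^esub> \<longleftrightarrow> x \<in> f ` fcar R m" if x: "x \<in> carrier ?F" for x
    using x rep_eq[OF x F.M.zero_closed] fc by (auto simp: Ms cg_def)
  then have "f ` fcar R m = {x \<in> carrier ?F. ?p x = \<zero>\<^bsub>M\<^esub>}" using fc by blast
  then have "is_pres R M (m, n, f) ?p" using M f p by (simp add: is_pres_def Ms)
  then show ?thesis by blast
qed

lemma cokernel_in_large_universe:
  assumes f: "f \<in> fhom R m n" and U: "large_universe R TYPE('u)"
  shows "\<exists>M \<in> Obj (mod_cat R :: (('a, 'u) module, 'u \<Rightarrow> 'u) preadd_cat). \<exists>p. is_pres R M (m, n, f) p"
proof -
  obtain C :: "('a, nat \<Rightarrow> 'a) module" and p where C: "is_pres R C (m, n, f) p" using cokernel[OF f] by blast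
  note q = is_presD[OF C]
  have "fin_pres_rmod R C" using C fin_pres_is_pres by blast
  from fin_pres_rmod_in_large_universe[OF this U] obtain N :: "('a, 'u) module" and h
    where N: "fin_pres_rmod R N" and h: "h \<in> rmod_hom R C N" "bij_betw h (carrier C) (carrier N)"
    by (auto simp: mod_cat_def)
  have rN: "right_module R N" using N by (simp add: fin_pres_rmod_def)
  interpret C: right_module R C by (rule q(1))
  note pc = rmod_homD(1)[OF q(3)]
  have h0: "h y = \<zero>\<^bsub>N\<^esub> \<longleftrightarrow> y = \<zero>\<^bsub>C\<^esub>" if "y \<in> carrier C" for y
    using inj_onD[OF bij_betw_imp_inj_on[OF h(2)], of y "\<zero>\<^bsub>C\<^esub>"] rmod_hom_zero[OF q(1) rN h(1)] that by auto
  have "is_pres R N (m, n, f) (fcomp R n h p)"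
    unfolding is_pres_def prod.case
  proof (intro conjI)
    show "fcomp R n h p \<in> rmod_hom R (free_rmod R n) N" by (rule rmod_hom_compose[OF right_module_free q(3) h(1)])
    show "f ` fcar R m = {x \<in> fcar R n. fcomp R n h p x = \<zero>\<^bsub>N\<^esub>}"
      using C h0 pc by (auto simp: is_pres_def compose_def)
    have "fcomp R n h p ` fcar R n = h ` p ` fcar R n"
      by (auto simp: compose_def image_image)
    then show "fcomp R n h p ` fcar R n = carrier N"
      using C bij_betw_imp_surj_on[OF h(2)] by (simp add: is_pres_def)
  qed (use rN q in auto)
  then show ?thesis using N by (auto simp: mod_cat_def)
qed

end

section \<open>Assembling the duality of module categories\<close>

lemma is_iso_op: "is_iso (op_cat G) X Y a \<Longrightarrow> \<exists>b. is_iso G X Y b"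
  unfolding is_iso_def by auto

context precat
begin

lemma gr_iso:
  assumes x: "x \<in> gobj C" and y: "y \<in> gobj C" and iso: "\<And>n. \<exists>a. is_iso C (x n) (y n) a"
  shows "\<exists>u\<in>ghom 0 x y. \<exists>v\<in>ghom 0 y x. v * u = gone x \<and> u * v = gone y"
proof -
  have "\<exists>a b. a \<in> Arr C (x n) (y n) \<and> b \<in> Arr C (y n) (x n) \<and> Comp C (x n) (y n) (x n) b a = Ident C (x n) \<and>
      Comp C (y n) (x n) (y n) a b = Ident C (y n)" for n
    using iso[of n] unfolding is_iso_def by blast
  then obtain a b where a: "\<And>n. a n \<in> Arr C (x n) (y n)" and b: "\<And>n. b n \<in> Arr C (y n) (x n)"
    and ba: "\<And>n. Comp C (x n) (y n) (x n) (b n) (a n) = Ident C (x n)"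
    and ab: "\<And>n. Comp C (y n) (x n) (y n) (a n) (b n) = Ident C (y n)" by metis
  have g: "a \<in> gmap C 0 x y" "b \<in> gmap C 0 y x" using a b by (simp_all add: gmap_def)
  have "gcomp C 0 0 x y x b a = gid C x" "gcomp C 0 0 y x y a b = gid C y" using ab ba by (simp_all add: gcomp_def gid_def)
  then have "gop C 0 y x b * gop C 0 x y a = gone x" "gop C 0 x y a * gop C 0 y x b = gone y"
    using gop_gcomp[OF x y x g] gop_gcomp[OF y x y g(2,1)] x y by (simp_all add: gone_def)
  then show ?thesis using gop_ghom[OF x y g(1)] gop_ghom[OF y x g(2)] by blast
qed

end

lemma precat_mod_cat: "precat (mod_cat R)"
  unfolding mod_cat_eq by (rule precat_rmod_cat) (simp add: fin_pres_rmod_def)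

theorem (in ring) duality_mod_cat:
  assumes U1: "large_universe R TYPE('u)" and U2: "large_universe (op_ring R) TYPE('u)"
  shows "\<exists>\<phi>. triangulated_duality (Kb (mod_cat R :: (('a, 'u) module, 'u \<Rightarrow> 'u) preadd_cat))
    (Kb (mod_cat (op_ring R) :: (('a, 'u) module, 'u \<Rightarrow> 'u) preadd_cat)) \<phi>"
proof -
  let ?C1 = "mod_cat R :: (('a, 'u) module, 'u \<Rightarrow> 'u) preadd_cat"
  let ?C2 = "mod_cat (op_ring R) :: (('a, 'u) module, 'u \<Rightarrow> 'u) preadd_cat"
  interpret O: ring "op_ring R" by (rule ring_op)
  interpret fc: addcat "FH R" "FI R" 0 by (rule addcat_free)
  interpret A: precat fc.adel by (rule fc.precat_adel)
  interpret pU: pres_embedding R fc.adel "\<lambda>(m, n, f). (m, n, 0, fem R m n f, 0)"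
     "\<lambda>(m, n, f) (m', n', f') F. fc.coset (m, n, 0, fem R m n f, 0) (m', n', 0, fem R m' n' f', 0) (fem R n n' F)"
    by (rule adel_embedding)
  interpret pV: pres_embedding "op_ring R" "op_cat fc.adel" "\<lambda>(m, n, f). (0, n, m, 0, tem m n f)"
     "\<lambda>(m, n, f) (m', n', f') F. fc.coset (0, n', m', 0, tem m' n' f') (0, n, m, 0, tem m n f) (tem n n' F)"
    by (rule adel_coembedding)
  obtain F where FO: "FObj F = (\<lambda>M. case fst (pU.pres_of M) of (m, n, f) \<Rightarrow> (m, n, 0, fem R m n f, 0))"
    and Fa: "additive_functor ?C1 fc.adel F"
    and Fb: "\<And>M M'. \<lbrakk>M \<in> Obj ?C1; M' \<in> Obj ?C1\<rbrakk> \<Longrightarrow> bij_betw (FArr F M M') (Arr ?C1 M M') (Arr fc.adel (FObj F M) (FObj F M'))"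
    using pU.pres_functor[where 'u = 'u] by auto
  obtain V where VO: "FObj V = (\<lambda>M. case fst (pV.pres_of M) of (m, n, f) \<Rightarrow> (0, n, m, 0, tem m n f))"
    and Va: "additive_functor ?C2 (op_cat fc.adel) V"
    and Vb: "\<And>M M'. \<lbrakk>M \<in> Obj ?C2; M' \<in> Obj ?C2\<rbrakk> \<Longrightarrow> bij_betw (FArr V M M') (Arr ?C2 M M') (Arr fc.adel (FObj V M') (FObj V M))"
    using pV.pres_functor[where 'u = 'u] by auto
  have FI: "FObj F M \<in> fc.injs" if M: "M \<in> Obj ?C1" for M
  proof -
    obtain m n f p where Q: "pU.pres_of M = ((m, n, f), p)" by (metis surj_pair)
    have "is_pres R M (m, n, f) p" using pU.pres_of[of M] M Q by (simp add: mod_cat_def)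
    from is_presD(2)[OF this] show ?thesis using fem_FH[of f m n] by (auto simp: FO Q fc.injs_def)
  qed
  have VP: "FObj V M \<in> fc.projs" if M: "M \<in> Obj ?C2" for M
  proof -
    obtain m n f p where Q: "pV.pres_of M = ((m, n, f), p)" by (metis surj_pair)
    have "is_pres (op_ring R) M (m, n, f) p" using pV.pres_of[of M] M Q by (simp add: mod_cat_def)
    from is_presD(2)[OF this] show ?thesis using tem_FH[of f m n] by (auto simp: VO Q fc.projs_def)
  qed
  have Fess: "\<exists>M\<in>Obj ?C1. \<exists>a. is_iso fc.adel x (FObj F M) a" if x: "x \<in> fc.injs" for x
  proof -
    obtain m n X where X: "x = (m, n, 0, X, 0)" "X \<in> FH R m n" using x by (auto simp: fc.injs_def)
    obtain f where f: "f \<in> fhom R m n" "X = fem R m n f" using X(2) by (auto simp: FH_def)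
    obtain M :: "('a, 'u) module" and p where M: "M \<in> Obj ?C1" "is_pres R M (m, n, f) p"
      using cokernel_in_large_universe[OF f(1) U1] by blast
    obtain m' n' f' p' where Q: "pU.pres_of M = ((m', n', f'), p')" by (metis surj_pair)
    have "is_pres R M (m', n', f') p'" using pU.pres_of[of M] M(1) Q by (simp add: mod_cat_def)
    from pU.rl_iso[OF M(2) this] have "\<exists>a. is_iso fc.adel x (FObj F M) a" by (simp add: FO Q X f)
    then show ?thesis using M(1) by blast
  qed
  have Vess: "\<exists>M\<in>Obj ?C2. \<exists>a. is_iso fc.adel x (FObj V M) a" if x: "x \<in> fc.projs" for x
  proof -
    obtain m n X where X: "x = (0, n, m, 0, X)" "X \<in> FH R n m" using x by (auto simp: fc.projs_def)
    obtain f where f: "f \<in> fhom (op_ring R) m n" "X = tem m n f" using X(2) unfolding FH_tem by blast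
    obtain M :: "('a, 'u) module" and p where M: "M \<in> Obj ?C2" "is_pres (op_ring R) M (m, n, f) p"
      using O.cokernel_in_large_universe[OF f(1) U2] by blast
    obtain m' n' f' p' where Q: "pV.pres_of M = ((m', n', f'), p')" by (metis surj_pair)
    have "is_pres (op_ring R) M (m', n', f') p'" using pV.pres_of[of M] M(1) Q by (simp add: mod_cat_def)
    from pV.rl_iso[OF M(2) this] obtain a where "is_iso (op_cat fc.adel) x (FObj V M) a" by (auto simp: VO Q X f)
    from is_iso_op[OF this] show ?thesis using M(1) by blast
  qed
  note PI = fc.projs_injs_Obj
  interpret G: grpair "(*)" A.ghom A.gone A.gpr "{q. \<forall>n. q n \<in> fc.projs}" "{q. \<forall>n. q n \<in> fc.injs}"
    by (rule fc.grpair_adel)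
  interpret D: dual_setting "(*)" A.ghom A.gone A.gpr "{q. \<forall>n. q n \<in> fc.projs}" "{q. \<forall>n. q n \<in> fc.injs}"
    ?C1 "\<lambda>X n. FObj F (X n)" "\<lambda>k X Y f. gop fc.adel k (\<lambda>n. FObj F (X n)) (\<lambda>n. FObj F (Y n)) (\<lambda>n. FArr F (X n) (Y (n + k)) (f n))"
    ?C2 "\<lambda>X n. FObj V (X (- n))" "\<lambda>k X Y f. gop fc.adel k (\<lambda>n. FObj V (Y (- n))) (\<lambda>n. FObj V (X (- n)))
      (\<lambda>n. FArr V (X (- n - k)) (Y (- n)) (f (- n - k)))"
  proof (intro dual_setting.intro dual_setting_axioms.intro)
    show "grpair (*) A.ghom A.gone A.gpr {q. \<forall>n. q n \<in> fc.projs} {q. \<forall>n. q n \<in> fc.injs}" by (rule fc.grpair_adel)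
    show "krep ?C1 (*) A.ghom A.gone A.gpr (\<lambda>X n. FObj F (X n))
       (\<lambda>k X Y f. gop fc.adel k (\<lambda>n. FObj F (X n)) (\<lambda>n. FObj F (Y n)) (\<lambda>n. FArr F (X n) (Y (n + k)) (f n)))"
      by (rule krep.krep_functor[OF A.krep_self precat_mod_cat Fa Fb])
    show "krep ?C2 (\<lambda>f g. g * f) (\<lambda>k a b. A.ghom k b a) A.gone (\<lambda>n. A.gpr (- n)) (\<lambda>X n. FObj V (X (- n)))
       (\<lambda>k X Y f. gop fc.adel k (\<lambda>n. FObj V (Y (- n))) (\<lambda>n. FObj V (X (- n))) (\<lambda>n. FArr V (X (- n - k)) (Y (- n)) (f (- n - k))))"
      using krep.krep_functor[OF A.krep_op precat_mod_cat Va] Vb by simp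
    show "(\<lambda>n. FObj F (X n)) \<in> {q. \<forall>n. q n \<in> fc.injs}" if "X \<in> gobj ?C1" for X using that FI by (simp add: gobj_def)
    show "(\<lambda>n. FObj V (X (- n))) \<in> {q. \<forall>n. q n \<in> fc.projs}" if "X \<in> gobj ?C2" for X using that VP by (simp add: gobj_def)
    show "\<exists>X\<in>gobj ?C1. \<exists>u\<in>A.ghom 0 x (\<lambda>n. FObj F (X n)). \<exists>v\<in>A.ghom 0 (\<lambda>n. FObj F (X n)) x.
        v * u = A.gone x \<and> u * v = A.gone (\<lambda>n. FObj F (X n))" if x: "x \<in> {q. \<forall>n. q n \<in> fc.injs}" for x
    proof -
      have "\<forall>n. \<exists>M. M \<in> Obj ?C1 \<and> (\<exists>a. is_iso fc.adel (x n) (FObj F M) a)" using Fess x by blast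
      then obtain X where X: "\<And>n. X n \<in> Obj ?C1" "\<And>n. \<exists>a. is_iso fc.adel (x n) (FObj F (X n)) a" by metis
      have "x \<in> gobj fc.adel" "(\<lambda>n. FObj F (X n)) \<in> gobj fc.adel" using x FI[OF X(1)] PI by (auto simp: gobj_def)
      from A.gr_iso[OF this X(2)] show ?thesis using X(1) by (intro bexI[of _ X]) (auto simp: gobj_def)
    qed
    show "\<exists>X\<in>gobj ?C2. \<exists>u\<in>A.ghom 0 x (\<lambda>n. FObj V (X (- n))). \<exists>v\<in>A.ghom 0 (\<lambda>n. FObj V (X (- n))) x.
        v * u = A.gone x \<and> u * v = A.gone (\<lambda>n. FObj V (X (- n)))" if x: "x \<in> {q. \<forall>n. q n \<in> fc.projs}" for x
    proof -
      have "\<forall>n. \<exists>M. M \<in> Obj ?C2 \<and> (\<exists>a. is_iso fc.adel (x n) (FObj V M) a)" using Vess x by blast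
      then obtain Y where Y: "\<And>n. Y n \<in> Obj ?C2" "\<And>n. \<exists>a. is_iso fc.adel (x n) (FObj V (Y n)) a" by metis
      have "x \<in> gobj fc.adel" "(\<lambda>n. FObj V (Y n)) \<in> gobj fc.adel" using x VP[OF Y(1)] PI by (auto simp: gobj_def)
      \<comment> \<open>The representation of the second category reverses degrees, so the witness
        is reversed as well.\<close>
      from A.gr_iso[OF this Y(2)] show ?thesis using Y(1) by (intro bexI[of _ "\<lambda>n. Y (- n)"]) (auto simp: gobj_def)
    qed
  qed
  show ?thesis using D.duality by blast
qed

theorem theorem3p6:
  fixes A :: "('a, 'r) ring_scheme"
  assumes "ring A"
    and "right_coherent A"
    and "left_coherent A"
    and "large_universe A TYPE('u)"
  shows "\<exists>\<phi>. triangulated_duality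
           (Kb (mod_cat (op_ring A) :: (('a, 'u) module, 'u \<Rightarrow> 'u) preadd_cat))
           (Kb (mod_cat A :: (('a, 'u) module, 'u \<Rightarrow> 'u) preadd_cat)) \<phi>"
proof -
  have "large_universe (op_ring A) TYPE('u)" using assms(4) by (simp add: large_universe_def)
  \<comment> \<open>The covariantly represented category has to be that of the left modules. So the
    ring \<open>R\<close> of \<open>duality_mod_cat\<close> is \<open>op_ring A\<close>, whose
    opposite is \<open>A\<close> again.\<close>
  then show ?thesis
    using ring.duality_mod_cat[OF ring.ring_op[OF assms(1)], where 'u = 'u] assms(4) by simp
qed

end
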